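(* Let $V_n\to+\infty$ and, for every $n$, let $(u_{V_n},h_{V_n})\in\mathcal{A}_{V_n}$ be a minimizer of the problem defining $F_s(V_n)$. Then the corresponding rescaled profiles $\widetilde h_{V_n}$ (possibly translated) converge, up to a subsequence, in $L^\infty(\mathbb{R})$ to some function $h$ which minimizes the functional $$G(h):=\left(\inf_{u(x,0)=x}\int_{\{h>0\}\times[0,+\infty)}|\nabla u|^2\,dx\,dy\right)+\int_{\mathbb{R}}h'^2\,dx$$ under the constraint $\int_{\mathbb{R}}h\,dx=1$.
   Context: For a nonnegative $h\in H^1(\mathbb{R})$ (identified with its continuous representative), let $\Omega_h:=\{(x,y)\in\mathbb{R}^2: 0<y<h(x)\}$. For $V>0$, let $\mathcal{A}_V$ be the set of pairs $(u,h)$ with $h\in H^1(\mathbb{R})$, $h\ge 0$, $u\in H^1(\Omega_h)$ real-valued, $\int_{\mathbb{R}}h\,dx=V$, and $u(x,0)=x$ (in the sense of traces) for $x\in\operatorname{supp}h$. Set $$E_V(u,h):=\int_{\Omega_h}|\nabla u|^2\,dx\,dy,\qquad S_V(h):=\int_{\mathbb{R}}h'^2\,dx,\qquad F_s(V):=\inf\{E_V(u,h)+S_V(h): (u,h)\in\mathcal{A}_V\}.$$ A minimizer is a pair in $\mathcal{A}_V$ attaining this infimum. The rescaled profile associated with $h_V$ is $\widetilde h_V(x):=V^{-3/5}h_V(V^{2/5}x)$, which satisfies $\int_{\mathbb{R}}\widetilde h_V\,dx=1$. The functional $G$ is considered on nonnegative $h\in H^1(\mathbb{R})$; the infimum in $G$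 is over weakly differentiable $u$ on $\{h>0\}\times(0,\infty)$ with trace $u(x,0)=x$ on $\{h>0\}$. Equivalently, $G(h)=C_W\sum_i(b_i-a_i)^2+\int_{\mathbb{R}}h'^2\,dx$, where $(a_i,b_i)$ are the connected components of $\{h>0\}$ and $C_W:=\inf\{\int_{[0,1]\times[0,+\infty)}|\nabla u|^2\,dx\,dy: u(x,0)=x\}$. *)

theory Defs
  imports "HOL-Analysis.Analysis"
begin

subsection \<open>Weak gradients and Sobolev spaces\<close>

primrec continuously_diff :: "nat \<Rightarrow> ('a::euclidean_space \<Rightarrow> real) \<Rightarrow> bool" where
  "continuously_diff 0 f \<longleftrightarrow> continuous_on UNIV f"
| "continuously_diff (Suc k) f \<longleftrightarrow>
     f differentiable_on UNIV \<and>
     (\<forall>b\<in>Basis. continuously_diff k (\<lambda>x. frechet_derivative f (at x) b))"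

definition test_function :: "'a::euclidean_space set \<Rightarrow> ('a \<Rightarrow> real) \<Rightarrow> bool" where
  "test_function \<Omega> \<phi> \<longleftrightarrow>
     (\<forall>k. continuously_diff k \<phi>) \<and>
     compact (closure {x. \<phi> x \<noteq> 0}) \<and> closure {x. \<phi> x \<noteq> 0} \<subseteq> \<Omega>"

definition locally_integrable ::
    "'a::euclidean_space set \<Rightarrow> ('a \<Rightarrow> 'b::euclidean_space) \<Rightarrow> bool" where
  "locally_integrable \<Omega> f \<longleftrightarrow> (\<forall>K. compact K \<and> K \<subseteq> \<Omega> \<longrightarrow> set_integrable lebesgue K f)"

definition has_weak_gradient ::
    "'a::euclidean_space set \<Rightarrow> ('a \<Rightarrow> real) \<Rightarrow> ('a \<Rightarrow> 'a) \<Rightarrow> bool" where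
  "has_weak_gradient \<Omega> u g \<longleftrightarrow>
     locally_integrable \<Omega> u \<and> locally_integrable \<Omega> g \<and>
     (\<forall>\<phi>. test_function \<Omega> \<phi> \<longrightarrow>
       (\<forall>b\<in>Basis.
         (LINT x:\<Omega>|lebesgue. u x * frechet_derivative \<phi> (at x) b) =
         - (LINT x:\<Omega>|lebesgue. (g x \<bullet> b) * \<phi> x)))"

definition weakly_differentiable :: "'a::euclidean_space set \<Rightarrow> ('a \<Rightarrow> real) \<Rightarrow> bool" where
  "weakly_differentiable \<Omega> u \<longleftrightarrow> (\<exists>g. has_weak_gradient \<Omega> u g)"

text \<open>On an open set the weak gradient is unique up to null sets, so every quantity below depends
  only on the class of the chosen representative. For functions on the real line it is the weak
  derivative.\<close>

definition weak_gradient :: "'a::euclidean_space set \<Rightarrow> ('a \<Rightarrow> real) \<Rightarrow> 'a \<Rightarrow> 'a" where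
  "weak_gradient \<Omega> u = (SOME g. has_weak_gradient \<Omega> u g)"

definition Lp :: "nat \<Rightarrow> 'a::euclidean_space set \<Rightarrow> ('a \<Rightarrow> 'b::euclidean_space) set" where
  "Lp p \<Omega> = {f. f \<in> borel_measurable (lebesgue_on \<Omega>) \<and>
                 (\<integral>\<^sup>+x\<in>\<Omega>. ennreal (norm (f x) ^ p) \<partial>lebesgue) < \<infinity>}"

definition sobolev :: "nat \<Rightarrow> 'a::euclidean_space set \<Rightarrow> ('a \<Rightarrow> real) set" where
  "sobolev p \<Omega> = {u. u \<in> Lp p \<Omega> \<and> weakly_differentiable \<Omega> u \<and> weak_gradient \<Omega> u \<in> Lp p \<Omega>}"

abbreviation H1 :: "'a::euclidean_space set \<Rightarrow> ('a \<Rightarrow> real) set" where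
  "H1 \<Omega> \<equiv> sobolev 2 \<Omega>"

definition W11_norm :: "'a::euclidean_space set \<Rightarrow> ('a \<Rightarrow> real) \<Rightarrow> ennreal" where
  "W11_norm \<Omega> u =
     (\<integral>\<^sup>+x\<in>\<Omega>. ennreal (norm (u x)) \<partial>lebesgue) +
     (\<integral>\<^sup>+x\<in>\<Omega>. ennreal (norm (weak_gradient \<Omega> u x)) \<partial>lebesgue)"

definition dirichlet :: "'a::euclidean_space set \<Rightarrow> ('a \<Rightarrow> real) \<Rightarrow> ennreal" where
  "dirichlet \<Omega> u = (\<integral>\<^sup>+x\<in>\<Omega>. ennreal ((norm (weak_gradient \<Omega> u x))\<^sup>2) \<partial>lebesgue)"

subsection \<open>Traces on the axis \<open>y = 0\<close>\<close>

text \<open>The trace operator on a rectangle \<open>Q\<close> is the continuous extension to \<open>W\<^sup>1\<^sup>,\<^sup>1(Q)\<close> of the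
  restriction map defined on functions of \<open>W\<^sup>1\<^sup>,\<^sup>1(Q)\<close> that are continuous up to the boundary; that
  is, its graph is the closure of the graph of the restriction map. On \<open>H\<^sup>1(Q)\<close> this is the usual
  \<open>H\<^sup>1\<close> trace, since \<open>Q\<close> is bounded.\<close>

definition has_trace_rect ::
    "real \<Rightarrow> real \<Rightarrow> real \<Rightarrow> (real \<times> real \<Rightarrow> real) \<Rightarrow> (real \<Rightarrow> real) \<Rightarrow> bool" where
  "has_trace_rect a b r u g \<longleftrightarrow>
     (let Q = {a<..<b} \<times> {0<..<r} in
       u \<in> sobolev 1 Q \<and>
       (\<exists>v::nat \<Rightarrow> real \<times> real \<Rightarrow> real.
          (\<forall>k. v k \<in> sobolev 1 Q \<and> continuous_on (closure Q) (v k)) \<and>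
          (\<lambda>k. W11_norm Q (\<lambda>z. v k z - u z)) \<longlonglongrightarrow> 0 \<and>
          (\<lambda>k. \<integral>\<^sup>+x\<in>{a<..<b}. ennreal \<bar>v k (x, 0) - g x\<bar> \<partial>lebesgue) \<longlonglongrightarrow> 0))"

text \<open>\<open>u(x,0) = g(x)\<close> in the sense of traces, for (almost) every \<open>x\<close> above which \<open>\<Omega>\<close> locally
  contains a rectangle standing on the axis. Both for the region under a continuous graph \<open>h\<close> and
  for the half-strips over \<open>{h > 0}\<close> these are exactly the points with \<open>h x > 0\<close>.\<close>

definition has_trace ::
    "(real \<times> real) set \<Rightarrow> (real \<times> real \<Rightarrow> real) \<Rightarrow> (real \<Rightarrow> real) \<Rightarrow> bool" where
  "has_trace \<Omega> u g \<longleftrightarrow>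
     (\<forall>a b r. a < b \<and> 0 < r \<and> {a..b} \<times> {0<..r} \<subseteq> \<Omega> \<longrightarrow> has_trace_rect a b r u g)"

subsection \<open>The variational problems\<close>

definition profile :: "real \<Rightarrow> (real \<Rightarrow> real) \<Rightarrow> bool" where
  "profile V h \<longleftrightarrow>
     continuous_on UNIV h \<and> h \<in> H1 UNIV \<and> (\<forall>x. 0 \<le> h x) \<and> has_bochner_integral lebesgue h V"

definition region :: "(real \<Rightarrow> real) \<Rightarrow> (real \<times> real) set" where
  "region h = {(x, y). 0 < y \<and> y < h x}"

definition admissible :: "real \<Rightarrow> ((real \<times> real \<Rightarrow> real) \<times> (real \<Rightarrow> real)) set" where
  "admissible V = {(u, h). profile V h \<and> u \<in> H1 (region h) \<and> has_trace (region h) u (\<lambda>x. x)}"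

definition elastic_energy :: "(real \<times> real \<Rightarrow> real) \<Rightarrow> (real \<Rightarrow> real) \<Rightarrow> ennreal" where
  "elastic_energy u h = dirichlet (region h) u"

definition surface_energy :: "(real \<Rightarrow> real) \<Rightarrow> ennreal" where
  "surface_energy h = dirichlet UNIV h"

definition F_s :: "real \<Rightarrow> ennreal" where
  "F_s V = (INF (u, h)\<in>admissible V. elastic_energy u h + surface_energy h)"

definition F_s_minimizer :: "real \<Rightarrow> (real \<times> real \<Rightarrow> real) \<Rightarrow> (real \<Rightarrow> real) \<Rightarrow> bool" where
  "F_s_minimizer V u h \<longleftrightarrow>
     (u, h) \<in> admissible V \<and> elastic_energy u h + surface_energy h = F_s V"

definition rescaled :: "real \<Rightarrow> (real \<Rightarrow> real) \<Rightarrow> real \<Rightarrow> real" where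
  "rescaled V h x = V powr (- 3 / 5) * h (V powr (2 / 5) * x)"

definition half_strips :: "(real \<Rightarrow> real) \<Rightarrow> (real \<times> real) set" where
  "half_strips h = {x. 0 < h x} \<times> {0<..}"

definition G :: "(real \<Rightarrow> real) \<Rightarrow> ennreal" where
  "G h = (INF u\<in>{u. weakly_differentiable (half_strips h) u \<and> has_trace (half_strips h) u (\<lambda>x. x)}.
            dirichlet (half_strips h) u) + surface_energy h"

definition G_minimizer :: "(real \<Rightarrow> real) \<Rightarrow> bool" where
  "G_minimizer h \<longleftrightarrow> profile 1 h \<and> (\<forall>k. profile 1 k \<longrightarrow> G h \<le> G k)"

end

theory Submission
  imports Defs "HOL-Real_Asymp.Real_Asymp"
begin

text \<open>A displacement equal to \<open>x\<close> on the base of a rectangle of width \<open>d\<close> and height \<open>r\<close> costs at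
  least \<open>C_W d\<^sup>2 tanh (pi r / d)\<close>: test it against the rotated gradient of the explicit solution of
  the dual problem, which vanishes on the other three sides. For an island of width \<open>l\<close> and mass
  \<open>M\<close> this competes with the surface term \<open>\<ge> 12 M\<^sup>2 / l\<^sup>3\<close>, whose optimal shape is a parabola.
  Both terms of the energy scale so that the cost of mass \<open>M\<close> is \<open>\<ge> m_opt M\<^bsup>4/5\<^esup>\<close>, which is strictly
  subadditive, so splitting the mass is not optimal. After rescaling, the ratio of height to width is of
  order \<open>V\<^bsup>1/5\<^esup> \<rightarrow> \<infinity>\<close> and \<open>tanh\<close> tends to \<open>1\<close> wherever the film is thicker than a fixed \<open>\<delta>\<close>; the part
  thinner than \<open>\<delta>\<close> carries little mass, because it also stores elastic energy on squares adapted to its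
  thickness. A competitor whose energy is asymptotically \<open>m_opt\<close> forces almost
  all the mass into one component, and the quantitative gap in
  \<open>C_W l\<^sup>2 + 12 / l\<^sup>3 \<ge> m_opt\<close> gives uniform convergence to the optimal parabola.\<close>

subsection \<open>Smooth functions\<close>

text \<open>The elastic energy of a minimizer is controlled only through the rectangles that fit
  under the graph, and none of them stands over a whole component of {h > 0}, because the height
  vanishes at its ends; there may also be infinitely many components. Hence the estimates are made
  on superlevel sets {H > \<delta>}, with mass counted from level \<delta>. No limit of
  displacements and no compactness of profiles is used: duality against a fixed divergence-free
  field eliminates the displacement and leaves an energy density on the line. Loss of compactness by
  translation does no harm, since the stability estimate itself names the centre of the heavy
  component and compares the profile with a parabola there. Optimal widths scale like
  \<open>M powr (2/5)\<close>, whence the exponent 4/5; balancing \<open>C_W * l^2\<close> against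
  \<open>12 / l^3\<close> gives \<open>C_W * L_opt^5 = 18\<close>. For a given accuracy the
  threshold concerns only the ratio of scales, so the subsequence merely pairs the k-th accuracy
  with a large enough volume.\<close>

lemma continuously_diff_imp_continuous:
  "continuously_diff k f \<Longrightarrow> continuous_on UNIV f"
  by (cases k) (auto intro: differentiable_imp_continuous_on)

lemma continuously_diff_Suc_D: "continuously_diff (Suc k) f \<Longrightarrow> continuously_diff k f"
proof (induction k arbitrary: f)
  case 0
  then show ?case by (auto intro: differentiable_imp_continuous_on)
next
  case (Suc k)
  then show ?case by (metis continuously_diff.simps(2))
qed

lemma continuously_diff_const: "continuously_diff k (\<lambda>x::'a::euclidean_space. c)"
  by (induction k arbitrary: c) (auto simp: frechet_derivative_const)

lemma frechet_derivative_eqI: "(f has_derivative f') (at x) \<Longrightarrow> frechet_derivative f (at x) b = f' b"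
  by (metis frechet_derivative_at)

lemma continuously_diff_SucI:
  assumes "\<And>x. (f has_derivative f' x) (at x)"
    and "\<And>b. b \<in> Basis \<Longrightarrow> continuously_diff k (\<lambda>x. f' x b)"
  shows "continuously_diff (Suc k) f"
proof -
  have "frechet_derivative f (at x) = f' x" for x
    using assms(1) frechet_derivative_at by metis
  then show ?thesis
    using assms by (auto simp: differentiable_on_def differentiable_def intro: has_derivative_at_withinI)
qed

lemma continuously_diff_SucE:
  assumes "continuously_diff (Suc k) f"
  obtains f' where "\<And>x. (f has_derivative f' x) (at x)"
    and "\<And>b. b \<in> Basis \<Longrightarrow> continuously_diff k (\<lambda>x. f' x b)"
proof
  show "(f has_derivative frechet_derivative f (at x)) (at x)" for x
    using assms by (auto simp: differentiable_on_def frechet_derivative_works)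
qed (use assms in auto)

lemma continuously_diff_add:
  "continuously_diff k f \<Longrightarrow> continuously_diff k g \<Longrightarrow> continuously_diff k (\<lambda>x. f x + g x)"
proof (induction k arbitrary: f g)
  case 0
  then show ?case by (simp add: continuous_on_add continuous_on_mult)
next
  case (Suc k)
  obtain f' where f: "\<And>x. (f has_derivative f' x) (at x)"
      "\<And>b. b \<in> Basis \<Longrightarrow> continuously_diff k (\<lambda>x. f' x b)"
    using continuously_diff_SucE[OF Suc.prems(1)] by blast
  obtain g' where g: "\<And>x. (g has_derivative g' x) (at x)"
      "\<And>b. b \<in> Basis \<Longrightarrow> continuously_diff k (\<lambda>x. g' x b)"
    using continuously_diff_SucE[OF Suc.prems(2)] by blast
  show ?case
    by (rule continuously_diff_SucI[OF has_derivative_add[OF f(1) g(1)]], rule Suc.IH[OF f(2) g(2)])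
qed

lemma continuously_diff_mult:
  "continuously_diff k f \<Longrightarrow> continuously_diff k g \<Longrightarrow> continuously_diff k (\<lambda>x. f x * g x)"
proof (induction k arbitrary: f g)
  case 0
  then show ?case by (simp add: continuous_on_add continuous_on_mult)
next
  case (Suc k)
  obtain f' where f: "\<And>x. (f has_derivative f' x) (at x)"
      "\<And>b. b \<in> Basis \<Longrightarrow> continuously_diff k (\<lambda>x. f' x b)"
    using continuously_diff_SucE[OF Suc.prems(1)] by blast
  obtain g' where g: "\<And>x. (g has_derivative g' x) (at x)"
      "\<And>b. b \<in> Basis \<Longrightarrow> continuously_diff k (\<lambda>x. g' x b)"
    using continuously_diff_SucE[OF Suc.prems(2)] by blast
  show ?case
    by (rule continuously_diff_SucI[OF has_derivative_mult[OF f(1) g(1)]], rule continuously_diff_add)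
       (rule Suc.IH, (rule f(2) g(2) Suc.prems[THEN continuously_diff_Suc_D], assumption?)+)+
qed

abbreviation smooth :: "('a::euclidean_space \<Rightarrow> real) \<Rightarrow> bool" where
  "smooth f \<equiv> \<forall>k. continuously_diff k f"

lemma smooth_const [simp]: "smooth (\<lambda>x::'a::euclidean_space. c)"
  by (simp add: continuously_diff_const)

lemma smooth_add: "smooth f \<Longrightarrow> smooth g \<Longrightarrow> smooth (\<lambda>x. f x + g x)"
  by (simp add: continuously_diff_add)

lemma smooth_mult: "smooth f \<Longrightarrow> smooth g \<Longrightarrow> smooth (\<lambda>x. f x * g x)"
  by (simp add: continuously_diff_mult)

lemma smooth_minus: "smooth f \<Longrightarrow> smooth (\<lambda>x. - f x)"
  using smooth_mult[of "\<lambda>_. -1" f] by simp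

lemma smooth_diff: "smooth f \<Longrightarrow> smooth g \<Longrightarrow> smooth (\<lambda>x. f x - g x)"
  using smooth_add[of f "\<lambda>x. - g x"] smooth_minus[of g] by simp

lemma smooth_divide_const: "smooth f \<Longrightarrow> smooth (\<lambda>x. f x / c)"
  using smooth_mult[of f "\<lambda>_. inverse c"] by (simp add: field_simps)

lemma smooth_prod: "(\<And>i. i \<in> I \<Longrightarrow> smooth (f i)) \<Longrightarrow> smooth (\<lambda>x::'a::euclidean_space. \<Prod>i\<in>I. f i x)"
  by (induction I rule: infinite_finite_induct) (simp_all add: continuously_diff_mult continuously_diff_const)

lemma smooth_continuous: "smooth f \<Longrightarrow> continuous_on S f"
  using continuously_diff_imp_continuous continuous_on_subset by blast

lemma smooth_frechet:
  assumes "smooth f"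
  shows "(f has_derivative frechet_derivative f (at x)) (at x)"
    and "b \<in> Basis \<Longrightarrow> smooth (\<lambda>x. frechet_derivative f (at x) b)"
proof -
  show "(f has_derivative frechet_derivative f (at x)) (at x)"
    using assms[rule_format, of "Suc 0"] by (auto simp: differentiable_on_def frechet_derivative_works)
  show "b \<in> Basis \<Longrightarrow> smooth (\<lambda>x. frechet_derivative f (at x) b)"
    using assms continuously_diff.simps(2) by blast
qed

lemma smooth_derivE:
  fixes f :: "real \<Rightarrow> real"
  assumes "smooth f"
  obtains f' where "\<And>x. (f has_real_derivative f' x) (at x)" "smooth f'"
proof
  show "smooth (\<lambda>x. frechet_derivative f (at x) 1)"
    using smooth_frechet(2)[OF assms, of 1] by simp
  show "(f has_real_derivative frechet_derivative f (at x) 1) (at x)" for x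
  proof -
    have "frechet_derivative f (at x) = (*) (frechet_derivative f (at x) 1)"
    proof
      fix y
      have "linear (frechet_derivative f (at x))"
        using smooth_frechet(1)[OF assms] has_derivative_linear by blast
      from linear_cmul[OF this, of y 1] show "frechet_derivative f (at x) y = frechet_derivative f (at x) 1 * y"
        by simp
    qed
    then show ?thesis using smooth_frechet(1)[OF assms, of x] by (simp add: has_field_derivative_def)
  qed
qed

lemma continuously_diff_of_deriv:
  fixes f :: "real \<Rightarrow> real"
  assumes "\<And>x. (f has_real_derivative f' x) (at x)" "continuously_diff k f'"
  shows "continuously_diff (Suc k) f"
  using assms by (intro continuously_diff_SucI[of f "\<lambda>x y. f' x * y"]) (auto simp: has_field_derivative_def)

lemma smooth_of_deriv:
  fixes f :: "real \<Rightarrow> real"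
  assumes "\<And>x. (f has_real_derivative f' x) (at x)" "smooth f'"
  shows "smooth f"
proof
  fix k
  show "continuously_diff k f"
    using continuously_diff_of_deriv[OF assms(1)] assms(2) continuously_diff_Suc_D by blast
qed

lemma continuously_diff_compose_inner:
  fixes f :: "real \<Rightarrow> real" and c :: "'a::euclidean_space"
  shows "continuously_diff k f \<Longrightarrow> continuously_diff k (\<lambda>x. f (x \<bullet> c + d))"
proof (induction k arbitrary: f)
  case 0
  then have "continuous_on UNIV f" by simp
  then show ?case
    by (auto intro!: continuous_on_compose2[of UNIV f] continuous_intros)
next
  case (Suc k)
  then obtain f' where f'0: "\<And>x. (f has_derivative f' x) (at x)"
    "\<And>b. b \<in> Basis \<Longrightarrow> continuously_diff k (\<lambda>x. f' x b)"
    using continuously_diff_SucE[OF Suc.prems] by blast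
  note f' = f'0(1) f'0(2)[of 1, simplified]
  have lin: "f' x y = f' x 1 * y" for x y
    using linear_cmul[OF has_derivative_linear[OF f'(1)], of x y 1] by simp
  have "((\<lambda>x. f (x \<bullet> c + d)) has_derivative (\<lambda>v. f' (x \<bullet> c + d) (v \<bullet> c))) (at x)" for x
    by (rule has_derivative_compose[OF _ f'(1)]) (auto intro!: derivative_eq_intros)
  then show ?case
  proof (rule continuously_diff_SucI)
    fix b :: 'a
    show "continuously_diff k (\<lambda>x. f' (x \<bullet> c + d) (b \<bullet> c))"
      by (subst lin) (rule continuously_diff_mult[OF Suc.IH[OF f'(2)] continuously_diff_const])
  qed
qed

lemma smooth_compose_inner:
  fixes f :: "real \<Rightarrow> real" and c :: "'a::euclidean_space"
  shows "smooth f \<Longrightarrow> smooth (\<lambda>x. f (x \<bullet> c + d))"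
  using continuously_diff_compose_inner by blast

lemma smooth_compose_affine:
  fixes f :: "real \<Rightarrow> real"
  shows "smooth f \<Longrightarrow> smooth (\<lambda>x. f (c * x + d))"
  using smooth_compose_inner[of f c d] by (simp add: mult.commute)

lemma smooth_fst:
  fixes f :: "real \<Rightarrow> real"
  shows "smooth f \<Longrightarrow> smooth (\<lambda>z::real \<times> real. f (fst z))"
  using smooth_compose_inner[of f "(1, 0)::real \<times> real" 0] by (simp add: inner_prod_def)

lemma smooth_snd:
  fixes f :: "real \<Rightarrow> real"
  shows "smooth f \<Longrightarrow> smooth (\<lambda>z::real \<times> real. f (snd z))"
  using smooth_compose_inner[of f "(0, 1)::real \<times> real" 0] by (simp add: inner_prod_def)

lemma smooth_exp: "smooth (exp :: real \<Rightarrow> real)"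
proof
  fix k
  show "continuously_diff k (exp :: real \<Rightarrow> real)"
  proof (induction k)
    case (Suc k)
    then show ?case
      using continuously_diff_of_deriv[of exp exp k] DERIV_exp by blast
  qed (simp add: continuous_on_exp)
qed

lemma smooth_sin_cos: "smooth (sin :: real \<Rightarrow> real)" "smooth (cos :: real \<Rightarrow> real)"
proof -
  have "continuously_diff k (sin :: real \<Rightarrow> real) \<and> continuously_diff k (cos :: real \<Rightarrow> real)" for k
  proof (induction k)
    case (Suc k)
    moreover have "continuously_diff k (\<lambda>x::real. - sin x)"
      using continuously_diff_mult[OF continuously_diff_const[of k "-1"], of sin] Suc by simp
    ultimately show ?case
      using continuously_diff_of_deriv[of sin cos k] continuously_diff_of_deriv[of cos "\<lambda>x. - sin x" k]
        DERIV_sin DERIV_cos by blast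
  qed (simp add: continuous_on_sin continuous_on_cos)
  then show "smooth (sin :: real \<Rightarrow> real)" "smooth (cos :: real \<Rightarrow> real)" by auto
qed

section \<open>A smooth step function and smooth plateaus\<close>

definition flat_exp :: "nat \<Rightarrow> real \<Rightarrow> real" where
  "flat_exp n x = (if x \<le> 0 then 0 else exp (- inverse x) * inverse x ^ n)"

lemma flat_exp_tendsto_0: "(flat_exp n \<longlongrightarrow> 0) (at 0)"
proof -
  have "((\<lambda>x::real. x ^ n / exp x) \<longlongrightarrow> 0) at_top" by (rule tendsto_power_div_exp_0)
  then have "((\<lambda>x::real. inverse x ^ n / exp (inverse x)) \<longlongrightarrow> 0) (at_right 0)"
    by (rule filterlim_compose[OF _ filterlim_inverse_at_top_right])
  moreover have "\<forall>\<^sub>F x in at_right (0::real). inverse x ^ n / exp (inverse x) = flat_exp n x"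
    unfolding eventually_at_filter
    by (auto simp: flat_exp_def field_simps exp_minus intro!: eventuallyI)
  ultimately have R: "(flat_exp n \<longlongrightarrow> 0) (at_right 0)" by (simp add: tendsto_cong)
  have "(flat_exp n \<longlongrightarrow> 0) (at_left 0)"
    by (rule tendsto_eventually) (auto simp: eventually_at_filter flat_exp_def)
  with R show ?thesis by (simp add: filterlim_split_at)
qed

text \<open>The powers of \<open>inverse x\<close> keep the family closed under differentiation, so
  smoothness of every member follows by one induction on the order. At 0 the difference quotient of
  index n is exactly the member of index n + 1, which tends to 0.\<close>

lemma flat_exp_deriv:
  "(flat_exp n has_real_derivative (flat_exp (n + 2) x - real n * flat_exp (n + 1) x)) (at x)"
proof (cases x "0::real" rule: linorder_cases)
  case less
  have "((\<lambda>x. 0) has_real_derivative 0) (at x)" by simp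
  then have "(flat_exp n has_real_derivative 0) (at x)"
    by (rule has_field_derivative_transform_within_open[of _ _ _ "{..<0}"])
       (use less in \<open>auto simp: flat_exp_def\<close>)
  then show ?thesis using less by (simp add: flat_exp_def)
next
  case equal
  have "\<forall>\<^sub>F h in at 0. flat_exp (n + 1) h = (flat_exp n (0 + h) - flat_exp n 0) / h"
    unfolding eventually_at_filter by (rule eventuallyI) (simp add: flat_exp_def divide_inverse)
  then have "((\<lambda>h. (flat_exp n (0 + h) - flat_exp n 0) / h) \<longlongrightarrow> 0) (at 0)"
    by (rule Lim_transform_eventually[OF flat_exp_tendsto_0[of "n + 1"]])
  then show ?thesis using equal by (simp add: DERIV_def flat_exp_def)
next
  case greater
  have "((\<lambda>x. exp (- inverse x) * inverse x ^ n) has_real_derivative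
      (exp (- inverse x) * (inverse x * inverse x)) * inverse x ^ n
       + real n * (- (inverse x * inverse x)) * inverse x ^ (n - 1) * exp (- inverse x)) (at x)"
    using greater by (auto intro!: derivative_eq_intros simp: power2_eq_square)
  also have "(exp (- inverse x) * (inverse x * inverse x)) * inverse x ^ n
       + real n * (- (inverse x * inverse x)) * inverse x ^ (n - 1) * exp (- inverse x) =
     exp (- inverse x) * inverse x ^ (n + 2) - real n * (exp (- inverse x) * inverse x ^ (n + 1))"
    by (cases n) (simp_all add: power_add algebra_simps)
  finally have "(flat_exp n has_real_derivative
      (exp (- inverse x) * inverse x ^ (n + 2) - real n * (exp (- inverse x) * inverse x ^ (n + 1)))) (at x)"
    by (rule has_field_derivative_transform_within_open[of _ _ _ "{0<..}"])
       (use greater in \<open>auto simp: flat_exp_def\<close>)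
  then show ?thesis using greater by (simp add: flat_exp_def)
qed

lemma smooth_flat_exp: "smooth (flat_exp n)"
proof
  fix k
  show "continuously_diff k (flat_exp n)"
  proof (induction k arbitrary: n)
    case 0
    show ?case
      using flat_exp_deriv[THEN DERIV_isCont] by (simp add: continuous_on_eq_continuous_at)
  next
    case (Suc k)
    have "continuously_diff k (\<lambda>x. flat_exp (n + 2) x + (- real n) * flat_exp (n + 1) x)"
      by (intro continuously_diff_add continuously_diff_mult continuously_diff_const Suc)
    then show ?case
      by (intro continuously_diff_of_deriv[OF flat_exp_deriv]) simp
  qed
qed

text \<open>The step is the normalised primitive of the bump
  \<open>exp (- 1/x) * exp (- 1/(1 - x))\<close> on the unit interval: monotone because the bump is
  nonnegative, constant on both sides because the bump vanishes there.\<close>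

lemma smooth_step_exists:
  "\<exists>f::real \<Rightarrow> real. smooth f \<and> mono f \<and> (\<forall>x\<le>0. f x = 0) \<and> (\<forall>x\<ge>1. f x = 1)"
proof -
  define b where "b x = flat_exp 0 x * flat_exp 0 (1 - x)" for x
  have b: "smooth b"
    unfolding b_def using smooth_mult[OF smooth_flat_exp smooth_compose_affine[OF smooth_flat_exp, of 0 "-1" 1]]
    by simp
  have "\<exists>F. \<forall>x. -\<infinity> < ereal x \<longrightarrow> ereal x < \<infinity> \<longrightarrow> (F has_vector_derivative b x) (at x)"
    by (rule einterval_antiderivative)
       (use smooth_continuous[OF b, of UNIV] in \<open>auto simp: continuous_on_eq_continuous_at\<close>)
  then obtain F where F: "\<And>x. (F has_real_derivative b x) (at x)"
    by (auto simp: has_real_derivative_iff_has_vector_derivative)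
  have b0: "b x \<ge> 0" for x by (simp add: b_def flat_exp_def)
  have mF: "F x \<le> F y" if "x \<le> y" for x y
    using DERIV_nonneg_imp_nondecreasing[OF that, of F] F b0 by blast
  have const: "F x = F y" if "x \<le> y" "\<And>t. x \<le> t \<Longrightarrow> t \<le> y \<Longrightarrow> b t = 0" for x y
  proof -
    have "(F has_vector_derivative 0) (at t within {x..y})" if "t \<in> {x..y}" for t
      using F[of t] that \<open>\<And>t. x \<le> t \<Longrightarrow> t \<le> y \<Longrightarrow> b t = 0\<close>
      by (auto simp: has_real_derivative_iff_has_vector_derivative intro: has_vector_derivative_at_within)
    then have "((\<lambda>_. 0::real) has_integral F y - F x) {x..y}"
      by (intro fundamental_theorem_of_calculus that)
    from has_integral_unique[OF this has_integral_0] show ?thesis by simp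
  qed
  \<comment> \<open>Makes the normalising denominator \<open>F 1 - F 0\<close> nonzero: the mean
    value point lies strictly between 1/2 and 1, where the bump is positive.\<close>
  have "F (1/2) \<noteq> F 1"
  proof
    assume "F (1/2) = F 1"
    obtain z where z: "1/2 < z" "z < 1" "F 1 - F (1/2) = (1 - 1/2) * b z"
      using MVT2[of "1/2" 1 F b] F by auto
    then have "b z = 0" using \<open>F (1/2) = F 1\<close> by simp
    with z show False by (auto simp: b_def flat_exp_def)
  qed
  then have lt: "F 0 < F 1" using mF[of 0 "1/2"] mF[of "1/2" 1] by simp
  define f where "f x = (F x - F 0) / (F 1 - F 0)" for x
  have "smooth f"
    unfolding f_def
    by (intro smooth_divide_const smooth_diff smooth_of_deriv[OF F b] smooth_const)
  moreover have "mono f"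
    using lt mF by (auto simp: f_def mono_def divide_right_mono)
  moreover have "f x = 0" if "x \<le> 0" for x
    using const[OF that] by (simp add: f_def b_def flat_exp_def)
  moreover have "f x = 1" if "x \<ge> 1" for x
    using const[OF that] lt by (simp add: f_def b_def flat_exp_def)
  ultimately show ?thesis by blast
qed

definition sstep :: "real \<Rightarrow> real" where
  "sstep = (SOME f. smooth f \<and> mono f \<and> (\<forall>x\<le>0. f x = 0) \<and> (\<forall>x\<ge>1. f x = 1))"

lemma sstep: "smooth sstep" "mono sstep" "x \<le> 0 \<Longrightarrow> sstep x = 0" "x \<ge> 1 \<Longrightarrow> sstep x = 1"
  using someI_ex[OF smooth_step_exists] unfolding sstep_def by blast+

lemma sstep_bounds: "0 \<le> sstep x" "sstep x \<le> 1"
  using monoD[OF sstep(2), of "min x 0" x] monoD[OF sstep(2), of x "max x 1"]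
    sstep(3)[of "min x 0"] sstep(4)[of "max x 1"] by auto

lemma sstep_deriv: "(sstep has_real_derivative deriv sstep x) (at x)"
  and smooth_deriv_sstep: "smooth (deriv sstep)"
proof -
  obtain f' where f': "\<And>x. (sstep has_real_derivative f' x) (at x)" "smooth f'"
    using smooth_derivE[OF sstep(1)] by blast
  then have eq: "deriv sstep = f'" by (intro ext DERIV_imp_deriv)
  show "(sstep has_real_derivative deriv sstep x) (at x)" unfolding eq by (rule f'(1))
  show "smooth (deriv sstep)" unfolding eq by (rule f'(2))
qed

text \<open>On the two open rays the step is locally constant; the end points 0 and 1 follow by
  continuity of the derivative.\<close>

lemma deriv_sstep_eq_0: "x \<le> 0 \<or> 1 \<le> x \<Longrightarrow> deriv sstep x = 0"
proof -
  have "deriv sstep y = 0" if "y < 0 \<or> 1 < y" for y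
  proof -
    have "(sstep has_real_derivative 0) (at y)"
    proof (cases "y < 0")
      case True
      show ?thesis
        by (rule has_field_derivative_transform_within_open[of "\<lambda>_. 0" _ _ "{..<0}"])
           (use True in \<open>auto simp: sstep(3)\<close>)
    next
      case False
      show ?thesis
        by (rule has_field_derivative_transform_within_open[of "\<lambda>_. 1" _ _ "{1<..}"])
           (use False that in \<open>auto simp: sstep(4)\<close>)
    qed
    then show ?thesis by (rule DERIV_imp_deriv)
  qed
  note 0 = this
  have c: "continuous_on S (deriv sstep)" for S
    by (rule smooth_continuous[OF smooth_deriv_sstep])
  assume "x \<le> 0 \<or> 1 \<le> x"
  then show "deriv sstep x = 0"
  proof
    assume "x \<le> 0"
    then have "x \<in> closure {..<0}" by simp
    from continuous_constant_on_closure[OF c _ this] 0 show ?thesis by simp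
  next
    assume "1 \<le> x"
    then have "x \<in> closure {1<..}" by simp
    from continuous_constant_on_closure[OF c _ this] 0 show ?thesis by simp
  qed
qed

lemma deriv_sstep_nonneg: "0 \<le> deriv sstep x"
proof (rule ccontr)
  assume "\<not> 0 \<le> deriv sstep x"
  then obtain d where "d > 0" "\<And>h. h > 0 \<Longrightarrow> h < d \<Longrightarrow> sstep (x + h) < sstep x"
    using DERIV_neg_dec_right[OF sstep_deriv[of x]] by auto
  from this(2)[of "d/2"] this(1) show False
    using monoD[OF sstep(2), of x "x + d/2"] by simp
qed

lemma deriv_sstep_bounded:
  obtains B where "B > 0" "\<forall>x. deriv sstep x \<le> B"
proof -
  have "bounded (deriv sstep ` {0..1})"
    by (intro compact_imp_bounded compact_continuous_image smooth_continuous smooth_deriv_sstep compact_Icc)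
  then obtain B where B: "B > 0" "\<And>x. x \<in> {0..1} \<Longrightarrow> norm (deriv sstep x) \<le> B"
    by (auto simp: bounded_pos)
  have "deriv sstep x \<le> B" for x
  proof (cases "x \<in> {0..1}")
    case True
    then show ?thesis using B(2)[of x] by simp
  next
    case False
    then have "x \<le> 0 \<or> 1 \<le> x" by auto
    from deriv_sstep_eq_0[OF this] show ?thesis using B(1) by simp
  qed
  with B show ?thesis using that by blast
qed

text \<open>The shifts by 1 make the cut-off vanish within distance 1/j of the ends, so its support
  is compact in the open interval although it converges to the indicator of that interval.\<close>

definition plateau :: "real \<Rightarrow> real \<Rightarrow> nat \<Rightarrow> real \<Rightarrow> real" where
  "plateau a b j x = sstep (real j * (x - a) - 1) * sstep (real j * (b - x) - 1)"

lemma smooth_sstep_affine: "smooth (\<lambda>x::real. sstep (c * x + d))"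
  by (rule smooth_compose_affine[OF sstep(1)])

lemma smooth_plateau: "smooth (plateau a b j)"
proof -
  have eq: "plateau a b j = (\<lambda>x. sstep (real j * x + (- real j * a - 1)) * sstep ((- real j) * x + (real j * b - 1)))"
    by (auto simp: plateau_def algebra_simps fun_eq_iff)
  show ?thesis
    unfolding eq by (rule smooth_mult[OF smooth_sstep_affine smooth_sstep_affine])
qed

lemma plateau_bounds: "0 \<le> plateau a b j x" "plateau a b j x \<le> 1"
  by (auto simp: plateau_def sstep_bounds mult_le_one)

lemma plateau_eq_0: "x \<notin> {a + 1 / Suc j .. b - 1 / Suc j} \<Longrightarrow> plateau a b (Suc j) x = 0"
  by (auto simp: plateau_def not_le field_simps intro!: sstep(3))

lemma plateau_tendsto: "(\<lambda>j. plateau a b (Suc j) x) \<longlonglongrightarrow> indicator {a<..<b} x"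
proof (cases "x \<in> {a<..<b}")
  case True
  have *: "\<forall>\<^sub>F j in sequentially. 1 \<le> real (Suc j) * d - 1" if "d > 0" for d :: real
    using that by real_asymp
  have "\<forall>\<^sub>F j in sequentially. plateau a b (Suc j) x = 1"
    using eventually_conj[OF *[of "x - a"] *[of "b - x"]] True
    by (simp add: plateau_def) (auto elim!: eventually_mono simp: sstep(4))
  then show ?thesis using True by (simp add: tendsto_eventually)
next
  case False
  have "plateau a b (Suc j) x = 0" for j
  proof (rule plateau_eq_0)
    define d where "d = 1 / real (Suc j)"
    have "d > 0" by (simp add: d_def)
    then show "x \<notin> {a + 1 / Suc j .. b - 1 / Suc j}"
      using False unfolding d_def[symmetric] by auto
  qed
  then show ?thesis using False by simp
qed

section \<open>Compactly supported test functions\<close>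

lemma test_functionI:
  assumes "smooth \<phi>" "compact K" "K \<subseteq> \<Omega>" "\<And>x. x \<notin> K \<Longrightarrow> \<phi> x = 0"
  shows "test_function \<Omega> \<phi>"
proof -
  have cl: "closure {x. \<phi> x \<noteq> 0} \<subseteq> K"
    using assms(2,4) by (intro closure_minimal) (auto intro: compact_imp_closed)
  then have "K \<inter> closure {x. \<phi> x \<noteq> 0} = closure {x. \<phi> x \<noteq> 0}" by blast
  with compact_Int_closed[OF assms(2) closed_closure, of "{x. \<phi> x \<noteq> 0}"]
  have "compact (closure {x. \<phi> x \<noteq> 0})" by simp
  with assms(1,3) cl show ?thesis unfolding test_function_def by fast
qed

lemma test_functionE:
  assumes "test_function \<Omega> \<phi>"
  obtains K where "compact K" "K \<subseteq> \<Omega>" "\<forall>x. x \<notin> K \<longrightarrow> \<phi> x = 0" "smooth \<phi>"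
    "\<forall>x v. x \<notin> K \<longrightarrow> frechet_derivative \<phi> (at x) v = 0"
proof -
  define K where "K = closure {x. \<phi> x \<noteq> 0}"
  have 0: "\<phi> x = 0" if "x \<notin> K" for x
    using that closure_subset[of "{x. \<phi> x \<noteq> 0}"] unfolding K_def by blast
  have "open (- K)" unfolding K_def by (rule open_Compl[OF closed_closure])
  have d: "frechet_derivative \<phi> (at x) v = 0" if "x \<notin> K" for x v
  proof -
    have "(\<phi> has_derivative (\<lambda>_. 0)) (at x)"
      by (rule has_derivative_transform_within_open[OF has_derivative_const \<open>open (- K)\<close>])
         (use that 0 in auto)
    then show ?thesis by (rule frechet_derivative_eqI)
  qed
  have "compact K \<and> K \<subseteq> \<Omega>" "smooth \<phi>"
    using assms unfolding test_function_def K_def[symmetric] by (rule conjunct2, rule conjunct1)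
  with 0 d show ?thesis by (intro that[of K]) fast+
qed

lemma test_function_mono: "test_function \<Omega> \<phi> \<Longrightarrow> \<Omega> \<subseteq> \<Omega>' \<Longrightarrow> test_function \<Omega>' \<phi>"
  unfolding test_function_def by blast

subsection \<open>Weak gradients\<close>

lemma borel_measurable_lebesgue_continuous:
  fixes f :: "'a::euclidean_space \<Rightarrow> 'b::euclidean_space"
  assumes "continuous_on UNIV f"
  shows "f \<in> borel_measurable lebesgue" "f \<in> borel_measurable borel"
proof -
  show "f \<in> borel_measurable borel" by (rule borel_measurable_continuous_onI[OF assms])
  then have "f \<in> borel_measurable lborel" by simp
  then show "f \<in> borel_measurable lebesgue" by (rule measurable_completion)
qed

lemma locally_integrableD:
  "locally_integrable \<Omega> f \<Longrightarrow> compact K \<Longrightarrow> K \<subseteq> \<Omega> \<Longrightarrow> integrable lebesgue (\<lambda>x. indicator K x *\<^sub>R f x)"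
  by (simp add: locally_integrable_def set_integrable_def)

lemma integrable_continuous_mult_locally_integrable:
  fixes f :: "'a::euclidean_space \<Rightarrow> 'b::euclidean_space"
  assumes f: "locally_integrable \<Omega> f" and K: "compact K" "K \<subseteq> \<Omega>"
    and \<psi>: "continuous_on UNIV \<psi>" "\<And>x. x \<notin> K \<Longrightarrow> \<psi> x = 0"
  shows "integrable lebesgue (\<lambda>x. \<psi> x *\<^sub>R f x)"
proof -
  note i = locally_integrableD[OF f K]
  have "bounded (\<psi> ` K)"
    by (intro compact_imp_bounded compact_continuous_image K continuous_on_subset[OF \<psi>(1)]) simp
  then obtain B where B: "\<And>x. x \<in> K \<Longrightarrow> norm (\<psi> x) \<le> B" "B > 0" by (auto simp: bounded_pos)
  have eq: "\<psi> x *\<^sub>R f x = \<psi> x *\<^sub>R (indicator K x *\<^sub>R f x)" for x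
    using \<psi>(2)[of x] by (auto simp: indicator_def)
  have "(\<lambda>x. \<psi> x *\<^sub>R (indicator K x *\<^sub>R f x)) \<in> borel_measurable lebesgue"
    by (intro borel_measurable_scaleR borel_measurable_lebesgue_continuous[OF \<psi>(1)]
        borel_measurable_integrable[OF i])
  moreover have "norm (\<psi> x *\<^sub>R (indicator K x *\<^sub>R f x)) \<le> norm (B *\<^sub>R (indicator K x *\<^sub>R f x))" for x
    using B \<psi>(2)[of x] by (auto simp: indicator_def intro!: mult_right_mono order_trans[OF B(1)])
  ultimately show ?thesis
    unfolding eq
    by (intro Bochner_Integration.integrable_bound[OF integrable_scaleR_right[OF i, of B]] AE_I2)
qed

lemma set_integral_eq_integral:
  fixes F :: "'a \<Rightarrow> 'b::{banach, second_countable_topology}"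
  assumes "\<And>x. x \<notin> \<Omega> \<Longrightarrow> F x = 0"
  shows "(LINT x:\<Omega>|M. F x) = (LINT x|M. F x)"
  unfolding set_lebesgue_integral_def
  by (rule Bochner_Integration.integral_cong) (use assms in \<open>auto simp: indicator_def\<close>)

lemma test_function_integrable:
  fixes f :: "'a::euclidean_space \<Rightarrow> 'b::euclidean_space"
  assumes f: "locally_integrable \<Omega> f" and \<phi>: "test_function \<Omega> \<phi>"
  shows "integrable lebesgue (\<lambda>x. \<phi> x *\<^sub>R f x)"
    and "b \<in> Basis \<Longrightarrow> integrable lebesgue (\<lambda>x. frechet_derivative \<phi> (at x) b *\<^sub>R f x)"
proof -
  obtain K where K: "compact K" "K \<subseteq> \<Omega>" "\<forall>x. x \<notin> K \<longrightarrow> \<phi> x = 0" "smooth \<phi>"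
    "\<forall>x v. x \<notin> K \<longrightarrow> frechet_derivative \<phi> (at x) v = 0"
    by (rule test_functionE[OF \<phi>])
  show "integrable lebesgue (\<lambda>x. \<phi> x *\<^sub>R f x)"
    by (rule integrable_continuous_mult_locally_integrable[OF f K(1,2) smooth_continuous[OF K(4)] K(3)[rule_format]])
  show "integrable lebesgue (\<lambda>x. frechet_derivative \<phi> (at x) b *\<^sub>R f x)" if "b \<in> Basis"
    by (rule integrable_continuous_mult_locally_integrable[OF f K(1,2)
          smooth_continuous[OF smooth_frechet(2)[OF K(4) that]] K(5)[rule_format]])
qed

text \<open>A test function and its derivatives vanish off \<Omega>, so both integrals may be taken
  over the whole space, where linearity and dominated convergence apply without an
  indicator.\<close>

lemma has_weak_gradient_iff:
  "has_weak_gradient \<Omega> u g \<longleftrightarrow>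
     locally_integrable \<Omega> u \<and> locally_integrable \<Omega> g \<and>
     (\<forall>\<phi>. test_function \<Omega> \<phi> \<longrightarrow>
       (\<forall>b\<in>Basis.
         (LINT x|lebesgue. u x * frechet_derivative \<phi> (at x) b) = - (LINT x|lebesgue. (g x \<bullet> b) * \<phi> x)))"
proof -
  have "(LINT x:\<Omega>|lebesgue. u x * frechet_derivative \<phi> (at x) b) =
      (LINT x|lebesgue. u x * frechet_derivative \<phi> (at x) b)"
    "(LINT x:\<Omega>|lebesgue. (g x \<bullet> b) * \<phi> x) = (LINT x|lebesgue. (g x \<bullet> b) * \<phi> x)"
    if tf: "test_function \<Omega> \<phi>" for \<phi> b
  proof -
    obtain K where K: "compact K" "K \<subseteq> \<Omega>" "\<forall>x. x \<notin> K \<longrightarrow> \<phi> x = 0" "smooth \<phi>"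
      "\<forall>x v. x \<notin> K \<longrightarrow> frechet_derivative \<phi> (at x) v = 0"
      by (rule test_functionE[OF tf])
    have "\<phi> x = 0" "frechet_derivative \<phi> (at x) b = 0" if "x \<notin> \<Omega>" for x
      using that K(2,3,5) by blast+
    then show "(LINT x:\<Omega>|lebesgue. u x * frechet_derivative \<phi> (at x) b) =
        (LINT x|lebesgue. u x * frechet_derivative \<phi> (at x) b)"
      "(LINT x:\<Omega>|lebesgue. (g x \<bullet> b) * \<phi> x) = (LINT x|lebesgue. (g x \<bullet> b) * \<phi> x)"
      by (simp_all add: set_integral_eq_integral)
  qed
  then show ?thesis unfolding has_weak_gradient_def by simp
qed

lemma has_weak_gradientD:
  assumes "has_weak_gradient \<Omega> u g" "test_function \<Omega> \<phi>" "b \<in> Basis"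
  shows "(LINT x|lebesgue. u x * frechet_derivative \<phi> (at x) b) = - (LINT x|lebesgue. (g x \<bullet> b) * \<phi> x)"
  using assms unfolding has_weak_gradient_iff by simp

lemma test_function_eq_0:
  assumes "test_function \<Omega> \<phi>" "x \<notin> \<Omega>" shows "\<phi> x = 0"
  using assms closure_subset[of "{x. \<phi> x \<noteq> 0}"] unfolding test_function_def by blast

section \<open>The fundamental lemma of the calculus of variations\<close>

definition box_plateau :: "'a::euclidean_space \<Rightarrow> 'a \<Rightarrow> nat \<Rightarrow> 'a \<Rightarrow> real" where
  "box_plateau a b j x = (\<Prod>i\<in>Basis. plateau (a \<bullet> i) (b \<bullet> i) (Suc j) (x \<bullet> i))"

lemma box_plateau_bounds: "0 \<le> box_plateau a b j x" "box_plateau a b j x \<le> 1"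
  unfolding box_plateau_def by (auto intro!: prod_nonneg prod_le_1 plateau_bounds)

lemma smooth_box_plateau: "smooth (box_plateau a b j)"
  unfolding box_plateau_def
proof (rule smooth_prod)
  show "smooth (\<lambda>x. plateau (a \<bullet> i) (b \<bullet> i) (Suc j) (x \<bullet> i))" for i
    using smooth_compose_inner[OF smooth_plateau, of "a \<bullet> i" "b \<bullet> i" "Suc j" i 0] by simp
qed

lemma box_plateau_eq_0:
  assumes "x \<notin> cbox a b" shows "box_plateau a b j x = 0"
proof -
  obtain i where i: "i \<in> Basis" "x \<bullet> i < a \<bullet> i \<or> b \<bullet> i < x \<bullet> i"
    using assms by (auto simp: mem_box not_le)
  have "0 \<le> 1 / real (Suc j)" by simp
  then have "x \<bullet> i \<notin> {a \<bullet> i + 1 / real (Suc j) .. b \<bullet> i - 1 / real (Suc j)}"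
    using i(2) unfolding atLeastAtMost_iff by linarith
  then have "plateau (a \<bullet> i) (b \<bullet> i) (Suc j) (x \<bullet> i) = 0" by (rule plateau_eq_0)
  with i(1) show ?thesis unfolding box_plateau_def by (auto intro: prod_zero)
qed

lemma box_plateau_tendsto: "(\<lambda>j. box_plateau a b j x) \<longlonglongrightarrow> indicator (box a b) x"
proof -
  have "indicator (box a b) x = (\<Prod>i\<in>Basis. indicator {a \<bullet> i<..<b \<bullet> i} (x \<bullet> i) :: real)"
    by (auto simp: indicator_def mem_box prod_zero_iff)
  then show ?thesis unfolding box_plateau_def by (auto intro!: tendsto_prod plateau_tendsto)
qed

text \<open>Open boxes are an intersection-stable generator of the Borel sets, so a Dynkin argument
  extends the vanishing of the integrals to all of them; the vanishing total integral is what
  handles complements.\<close>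

lemma AE_eq_0_of_box_integrals:
  fixes F :: "'a::euclidean_space \<Rightarrow> real"
  assumes F: "integrable lebesgue F" and 0: "integral\<^sup>L lebesgue F = 0"
    and box: "\<And>c d. (LINT x:box c d|lebesgue. F x) = 0"
  shows "AE x in lebesgue. F x = 0"
proof -
  \<comment> \<open>Uniqueness of densities is applied on \<open>lborel\<close>, so the integrand is
    first replaced by a Borel representative.\<close>
  obtain F' where F'[measurable]: "F' \<in> borel_measurable lborel" and ae: "AE x in lborel. F x = F' x"
    using completion_ex_borel_measurable_real[OF borel_measurable_integrable[OF F]] by auto
  have ae': "AE x in lebesgue. F x = F' x" using ae by (rule AE_completion)
  have F'm: "F' \<in> borel_measurable lebesgue" using F' by (rule measurable_completion)
  have "integrable lebesgue F'" by (rule integrable_cong_AE_imp[OF F F'm]) (use ae' in auto)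
  then have iF': "integrable lborel F'" by (simp add: integrable_completion)
  have eq: "(LINT x:A|lborel. F' x) = (LINT x:A|lebesgue. F x)" if [measurable]: "A \<in> sets borel" for A
  proof -
    have "(LINT x:A|lborel. F' x) = (LINT x:A|lebesgue. F' x)"
      unfolding set_lebesgue_integral_def by (subst integral_completion) auto
    also have "\<dots> = (LINT x:A|lebesgue. F x)"
      unfolding set_lebesgue_integral_def
    proof (rule integral_cong_AE)
      show "(\<lambda>x. indicator A x *\<^sub>R F' x) \<in> borel_measurable lebesgue"
        "(\<lambda>x. indicator A x *\<^sub>R F x) \<in> borel_measurable lebesgue"
        using that F'm borel_measurable_integrable[OF F]
        by (intro borel_measurable_scaleR borel_measurable_indicator; simp)+
    qed (use ae' in auto)
    finally show ?thesis .
  qed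
  have im: "set_integrable lborel B F'" if "B \<in> sets borel" for B
    unfolding set_integrable_def by (rule integrable_mult_indicator[OF _ iF']) (use that in simp)
  have "(LINT x:A|lborel. F' x) = 0" if "A \<in> sets borel" for A
  proof -
    have sub: "range (\<lambda>(a, b). box a b :: 'a set) \<subseteq> Pow UNIV" by simp
    have rng: "box u v \<in> range (\<lambda>(a, b). box a b)" for u v :: 'a
      by (rule range_eqI[of _ _ "(u, v)"]) simp
    have st: "Int_stable (range (\<lambda>(a, b). box a b :: 'a set))"
      unfolding Int_stable_def using rng by (clarsimp simp: box_Int_box)
    have A: "A \<in> sigma_sets UNIV (range (\<lambda>(a, b). box a b :: 'a set))"
      using that unfolding borel_eq_box by simp
    from st sub A show ?thesis
    proof (induction A rule: sigma_sets_induct_disjoint)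
      case (basic A)
      then show ?case using box by (auto simp: eq)
    next
      case empty
      show ?case by (simp add: set_lebesgue_integral_def)
    next
      case (compl A)
      then have A: "A \<in> sets borel" unfolding borel_eq_box by simp
      have "(LINT x:A \<union> (UNIV - A)|lborel. F' x) = (LINT x:A|lborel. F' x) + (LINT x:UNIV - A|lborel. F' x)"
        by (intro set_integral_Un im) (use A in auto)
      moreover have "(LINT x:UNIV|lborel. F' x) = 0"
        by (subst eq) (auto simp: set_lebesgue_integral_def 0)
      ultimately show ?case using compl by simp
    next
      case (union A)
      then have A: "A i \<in> sets borel" for i unfolding borel_eq_box by auto
      have "set_integrable lborel (\<Union>i. A i) F'" by (rule im) (use A in auto)
      then have "(LINT x:(\<Union>i. A i)|lborel. F' x) = (\<Sum>i. (LINT x:(A i)|lborel. F' x))"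
        using A union(1) by (intro lebesgue_integral_countable_add) (auto simp: disjoint_family_on_def)
      then show ?case using union by simp
    qed
  qed
  then have "AE x in lborel. F' x = 0"
    using density_unique_real[OF iF', of "\<lambda>_. 0"] by simp
  from AE_completion[OF this] ae' show ?thesis by eventually_elim simp
qed

text \<open>Products of two box cut-offs are used: the fixed box \<open>cbox a b\<close> keeps the
  support inside \<Omega>, while the second box runs through the generator. A countable cover of
  \<Omega> by closed boxes then collects the null sets.\<close>

lemma AE_eq_0_of_test_function:
  fixes f :: "'a::euclidean_space \<Rightarrow> real"
  assumes \<Omega>: "open \<Omega>" and f: "locally_integrable \<Omega> f"
    and 0: "\<And>\<phi>. test_function \<Omega> \<phi> \<Longrightarrow> (LINT x:\<Omega>|lebesgue. f x * \<phi> x) = 0"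
  shows "AE x in lebesgue. x \<in> \<Omega> \<longrightarrow> f x = 0"
proof -
  have box0: "(LINT x|lebesgue. indicator (box a b) x * indicator (box c d) x * f x) = 0"
    if ab: "cbox a b \<subseteq> \<Omega>" for a b c d
  proof -
    define \<phi> where "\<phi> j x = box_plateau a b j x * box_plateau c d j x" for j x
    have sm: "smooth (\<phi> j)" for j
      unfolding \<phi>_def by (rule smooth_mult[OF smooth_box_plateau smooth_box_plateau])
    have z: "\<phi> j x = 0" if "x \<notin> cbox a b" for j x
      using box_plateau_eq_0[OF that] by (simp add: \<phi>_def)
    have tst: "test_function \<Omega> (\<phi> j)" for j
      by (rule test_functionI[OF sm compact_cbox ab z])
    have int0: "(LINT x|lebesgue. \<phi> j x * f x) = 0" for j
    proof -
      have "(LINT x:\<Omega>|lebesgue. f x * \<phi> j x) = (LINT x|lebesgue. f x * \<phi> j x)"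
        by (rule set_integral_eq_integral) (use z ab in auto)
      then show ?thesis using 0[OF tst[of j]] by (simp add: mult.commute)
    qed
    note i = locally_integrableD[OF f compact_cbox ab]
    have mj: "(\<lambda>x. \<phi> j x * f x) \<in> borel_measurable lebesgue" for j
      by (rule borel_measurable_integrable[OF test_function_integrable(1)[OF f tst[of j], unfolded real_scaleR_def]])
    have lim: "(\<lambda>j. \<phi> j x * f x) \<longlonglongrightarrow> indicator (box a b) x * indicator (box c d) x * f x" for x
      unfolding \<phi>_def by (intro tendsto_mult box_plateau_tendsto tendsto_const)
    have "(\<lambda>j. LINT x|lebesgue. \<phi> j x * f x) \<longlonglongrightarrow>
        (LINT x|lebesgue. indicator (box a b) x * indicator (box c d) x * f x)"
    proof (rule integral_dominated_convergence[where w = "\<lambda>x. norm (indicator (cbox a b) x *\<^sub>R f x)"])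
      show "(\<lambda>x. indicator (box a b) x * indicator (box c d) x * f x) \<in> borel_measurable lebesgue"
        by (rule borel_measurable_LIMSEQ_real[OF _ mj]) (rule lim)
      show "AE x in lebesgue. norm (\<phi> j x * f x) \<le> norm (indicator (cbox a b) x *\<^sub>R f x)" for j
      proof (rule AE_I2)
        fix x
        have "\<phi> j x \<le> 1" "0 \<le> \<phi> j x"
          unfolding \<phi>_def by (intro mult_le_one mult_nonneg_nonneg box_plateau_bounds)+
        then have "\<bar>\<phi> j x\<bar> * \<bar>f x\<bar> \<le> 1 * \<bar>f x\<bar>" by (intro mult_right_mono) auto
        then show "norm (\<phi> j x * f x) \<le> norm (indicator (cbox a b) x *\<^sub>R f x)"
          using z[of x j] by (auto simp: indicator_def abs_mult)
      qed
      show "integrable lebesgue (\<lambda>x. norm (indicator (cbox a b) x *\<^sub>R f x))"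
        by (rule integrable_norm[OF i])
      show "AE x in lebesgue. (\<lambda>j. \<phi> j x * f x) \<longlonglongrightarrow> indicator (box a b) x * indicator (box c d) x * f x"
        by (rule AE_I2[OF lim])
    qed (rule mj)
    from LIMSEQ_unique[OF this] show ?thesis using int0 by simp
  qed
  have ae: "AE x in lebesgue. x \<in> box a b \<longrightarrow> f x = 0" if ab: "cbox a b \<subseteq> \<Omega>" for a b
  proof -
    define F where "F x = indicator (box a b) x * f x" for x
    have "integrable lebesgue (\<lambda>x. indicator (box a b) x *\<^sub>R (indicator (cbox a b) x *\<^sub>R f x))"
      by (rule integrable_mult_indicator[OF _ locally_integrableD[OF f compact_cbox ab]]) simp
    also have "(\<lambda>x. indicator (box a b) x *\<^sub>R (indicator (cbox a b) x *\<^sub>R f x)) = F"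
      using box_subset_cbox[of a b] by (auto simp: F_def indicator_def fun_eq_iff)
    finally have iF: "integrable lebesgue F" .
    have "AE x in lebesgue. F x = 0"
    proof (rule AE_eq_0_of_box_integrals[OF iF])
      show "integral\<^sup>L lebesgue F = 0"
        using box0[OF ab, of a b] unfolding F_def by (simp flip: indicator_inter_arith)
      show "(LINT x:box c d|lebesgue. F x) = 0" for c d
        using box0[OF ab, of c d] unfolding F_def set_lebesgue_integral_def by (simp add: mult_ac)
    qed
    then show ?thesis by (auto simp: F_def indicator_def elim!: eventually_mono split: if_splits)
  qed
  obtain \<D> where D: "countable \<D>" "\<D> \<subseteq> Pow \<Omega>" "\<And>X. X \<in> \<D> \<Longrightarrow> \<exists>a b. X = cbox a b" "\<Union>\<D> = \<Omega>"
    using open_countable_Union_open_cbox[OF \<Omega>] by blast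
  have "AE x in lebesgue. \<forall>X\<in>\<D>. x \<in> X \<longrightarrow> f x = 0"
  proof (rule AE_ball_countable[THEN iffD2, OF D(1)], rule ballI)
    fix X assume X: "X \<in> \<D>"
    then obtain a b where ab: "X = cbox a b" using D(3) by blast
    have "negligible (cbox a b - box a b)" by (rule negligible_frontier_interval)
    then have "AE x in lebesgue. x \<notin> cbox a b - box a b"
      unfolding negligible_iff_null_sets by (rule AE_not_in)
    moreover have "AE x in lebesgue. x \<in> box a b \<longrightarrow> f x = 0"
      using ae X D(2) ab by auto
    ultimately show "AE x in lebesgue. x \<in> X \<longrightarrow> f x = 0"
      unfolding ab by eventually_elim auto
  qed
  then show ?thesis using D(4) by (auto elim!: eventually_mono)
qed

text \<open>The fundamental lemma applied to each coordinate of the difference. This is what lets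
  the arbitrarily chosen \<open>weak_gradient\<close> be replaced by any explicitly computed
  gradient.\<close>

lemma weak_gradient_unique:
  assumes \<Omega>: "open \<Omega>" and g: "has_weak_gradient \<Omega> u g" and g': "has_weak_gradient \<Omega> u g'"
  shows "AE x in lebesgue. x \<in> \<Omega> \<longrightarrow> g x = g' x"
proof -
  have li: "locally_integrable \<Omega> g" "locally_integrable \<Omega> g'"
    using g g' unfolding has_weak_gradient_def by auto
  have "AE x in lebesgue. x \<in> \<Omega> \<longrightarrow> (g x - g' x) \<bullet> b = 0" if b: "b \<in> Basis" for b
  proof (rule AE_eq_0_of_test_function[OF \<Omega>])
    show "locally_integrable \<Omega> (\<lambda>x. (g x - g' x) \<bullet> b)"
      unfolding locally_integrable_def set_integrable_def
    proof (intro allI impI)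
      fix K assume "compact K \<and> K \<subseteq> \<Omega>"
      then have "integrable lebesgue (\<lambda>x. (indicator K x *\<^sub>R g x - indicator K x *\<^sub>R g' x) \<bullet> b)"
        using li unfolding locally_integrable_def set_integrable_def
        by (intro integrable_inner_left Bochner_Integration.integrable_diff) simp_all
      then show "integrable lebesgue (\<lambda>x. indicator K x *\<^sub>R ((g x - g' x) \<bullet> b))"
        by (simp flip: scaleR_diff_right)
    qed
  next
    fix \<phi> assume \<phi>: "test_function \<Omega> \<phi>"
    have i: "integrable lebesgue (\<lambda>x. (g x \<bullet> b) * \<phi> x)" "integrable lebesgue (\<lambda>x. (g' x \<bullet> b) * \<phi> x)"
      using integrable_inner_left[OF test_function_integrable(1)[OF li(1) \<phi>], of b]
        integrable_inner_left[OF test_function_integrable(1)[OF li(2) \<phi>], of b]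
      by (simp_all add: mult.commute)
    have "(LINT x|lebesgue. (g x \<bullet> b) * \<phi> x) = (LINT x|lebesgue. (g' x \<bullet> b) * \<phi> x)"
      using has_weak_gradientD[OF g \<phi> b] has_weak_gradientD[OF g' \<phi> b] by simp
    moreover have "(LINT x:\<Omega>|lebesgue. ((g x - g' x) \<bullet> b) * \<phi> x) =
        (LINT x|lebesgue. ((g x - g' x) \<bullet> b) * \<phi> x)"
      by (rule set_integral_eq_integral) (simp add: test_function_eq_0[OF \<phi>])
    ultimately show "(LINT x:\<Omega>|lebesgue. ((g x - g' x) \<bullet> b) * \<phi> x) = 0"
      using i by (simp add: inner_diff_left left_diff_distrib)
  qed
  then have "AE x in lebesgue. \<forall>b\<in>Basis. x \<in> \<Omega> \<longrightarrow> (g x - g' x) \<bullet> b = 0"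
    by (subst AE_ball_countable) (auto intro: countable_finite)
  then show ?thesis
    by eventually_elim (auto simp: inner_diff_left euclidean_eq_iff[of "g _"])
qed

section \<open>Weak gradients of locally Lipschitz functions\<close>

lemma locally_integrable_of_bounded:
  fixes f :: "'a::euclidean_space \<Rightarrow> 'b::euclidean_space"
  assumes m: "f \<in> borel_measurable lebesgue" and b: "\<And>S. bounded S \<Longrightarrow> bounded (f ` S)"
  shows "locally_integrable \<Omega> f"
  unfolding locally_integrable_def set_integrable_def
proof (intro allI impI)
  fix K :: "'a set" assume K: "compact K \<and> K \<subseteq> \<Omega>"
  then obtain B where B: "\<And>x. x \<in> K \<Longrightarrow> norm (f x) \<le> B"
    using b[OF compact_imp_bounded, of K] by (auto simp: bounded_iff)
  have "emeasure lborel K < \<infinity>" using K by (intro emeasure_bounded_finite compact_imp_bounded) simp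
  moreover have "K \<in> sets borel" using K by (simp add: compact_imp_closed)
  ultimately have "emeasure lebesgue K < \<infinity>" "K \<in> sets lebesgue" by simp_all
  then show "integrable lebesgue (\<lambda>x. indicator K x *\<^sub>R f x)"
    by (intro integrableI_bounded_set_indicator[where B = B]) (use m B in auto)
qed

lemma bounded_image_continuous:
  fixes f :: "'a::euclidean_space \<Rightarrow> 'b::real_normed_vector"
  assumes "continuous_on UNIV f" "bounded S"
  shows "bounded (f ` S)"
proof (rule bounded_subset)
  show "bounded (f ` closure S)"
    by (intro compact_imp_bounded compact_continuous_image continuous_on_subset[OF assms(1)])
       (use assms(2) in \<open>simp_all add: compact_closure\<close>)
  show "f ` S \<subseteq> f ` closure S" by (intro image_mono closure_subset)
qed

lemma C1_imp_lipschitz: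
  fixes f :: "'a::euclidean_space \<Rightarrow> real"
  assumes f: "\<And>x. (f has_derivative (\<lambda>v. g x \<bullet> v)) (at x)" and g: "continuous_on UNIV g" and S: "bounded S"
  shows "\<exists>L. L-lipschitz_on S f"
proof -
  obtain R where "\<forall>x\<in>S. norm x \<le> R" using S unfolding bounded_iff by blast
  then have R: "S \<subseteq> cball 0 R" by auto
  have "bounded (g ` cball 0 R)" by (rule bounded_image_continuous[OF g]) simp
  then obtain L where L: "L > 0" "\<And>x. x \<in> cball 0 R \<Longrightarrow> norm (g x) \<le> L"
    by (auto simp: bounded_pos)
  have on: "onorm (\<lambda>v. g x \<bullet> v) \<le> L" if x: "x \<in> cball 0 R" for x
  proof (rule onorm_le)
    fix v
    have "norm (g x \<bullet> v) \<le> norm (g x) * norm v" using Cauchy_Schwarz_ineq2[of "g x" v] by simp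
    also have "\<dots> \<le> L * norm v" using L(2)[OF x] by (intro mult_right_mono) auto
    finally show "norm (g x \<bullet> v) \<le> L * norm v" .
  qed
  have "norm (f x - f y) \<le> L * norm (x - y)" if "x \<in> cball 0 R" "y \<in> cball 0 R" for x y
    by (rule differentiable_bound[of "cball 0 R" f "\<lambda>x v. g x \<bullet> v" L x y])
       (use f on that in \<open>auto intro: has_derivative_at_withinI\<close>)
  then have "L-lipschitz_on S f"
    using L(1) R by (intro lipschitz_onI) (auto simp: dist_norm subset_eq)
  then show ?thesis by blast
qed

lemma directional_difference_quotient:
  fixes F :: "'a::real_normed_vector \<Rightarrow> real"
  assumes F: "(F has_derivative F') (at x)"
  shows "(\<lambda>n. (F (x + (1 / real (Suc n)) *\<^sub>R b) - F x) * real (Suc n)) \<longlonglongrightarrow> F' b"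
proof -
  have d: "((\<lambda>t. x + t *\<^sub>R b) has_derivative (\<lambda>t. t *\<^sub>R b)) (at (0::real))"
    by (auto intro!: derivative_eq_intros)
  have "((\<lambda>t. F (x + t *\<^sub>R b)) has_derivative (\<lambda>t. F' (t *\<^sub>R b))) (at (0::real))"
    by (rule has_derivative_compose[OF d]) (use F in simp)
  moreover have "F' (t *\<^sub>R b) = F' b * t" for t
    using linear_cmul[OF has_derivative_linear[OF F], of t b] by simp
  ultimately have "((\<lambda>t. F (x + t *\<^sub>R b)) has_real_derivative F' b) (at 0)"
    by (simp add: has_field_derivative_def)
  then have lim: "((\<lambda>h. (F (x + h *\<^sub>R b) - F x) / h) \<longlongrightarrow> F' b) (at 0)"
    by (simp add: DERIV_def)
  have "filterlim (\<lambda>n. 1 / real (Suc n)) (at 0) sequentially"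
    by (rule filterlim_atI[OF LIMSEQ_Suc[OF lim_1_over_n]]) simp
  from filterlim_compose[OF lim this] show ?thesis by simp
qed

text \<open>Translation invariance of the Lebesgue integral; in the limit of vanishing shifts it
  plays the part of integration by parts.\<close>

lemma integral_difference_quotient_eq_0:
  fixes F :: "'a::euclidean_space \<Rightarrow> real"
  assumes F: "continuous_on UNIV F" and K: "compact K" "\<And>x. x \<notin> K \<Longrightarrow> F x = 0"
  shows "(LINT x|lebesgue. (F (x + h) - F x) * c) = 0"
proof -
  have m: "F \<in> borel_measurable borel" by (rule borel_measurable_continuous_onI[OF F])
  have "integrable lborel (\<lambda>x. indicator K x *\<^sub>R F x)"
    by (rule borel_integrable_compact[OF K(1) continuous_on_subset[OF F]]) simp
  also have "(\<lambda>x. indicator K x *\<^sub>R F x) = F" using K(2) by (auto simp: indicator_def fun_eq_iff)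
  finally have i: "integrable lborel F" .
  have e: "(LINT x|lborel. F (h + x)) = (LINT x|lborel. F x)"
    using integral_distr[of "(+) h" lborel borel F] m by (simp add: lborel_distr_plus)
  have i': "integrable lborel (\<lambda>x. F (h + x))"
    using integrable_distr_eq[of "(+) h" lborel borel F] m i by (simp add: lborel_distr_plus)
  have "continuous_on UNIV (\<lambda>x. F (x + h))"
    by (intro continuous_on_compose2[OF F] continuous_intros) simp
  then have m': "(\<lambda>x. F (x + h)) \<in> borel_measurable borel" by (rule borel_measurable_continuous_onI)
  have "(LINT x|lebesgue. (F (x + h) - F x) * c) = (LINT x|lborel. (F (x + h) - F x) * c)"
    using m m' by (intro integral_completion) simp
  also have "\<dots> = 0" using i i' e by (simp add: add.commute)
  finally show ?thesis .
qed

text \<open>The difference quotients of \<open>u * \<phi>\<close> have integral zero, are dominated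
  by a Lipschitz constant on a fixed ball, and converge almost everywhere to the product rule.
  Covering Lipschitz functions matters because the parabolic profile has kinks at its contact
  points.\<close>

lemma has_weak_gradient_of_lipschitz:
  fixes u :: "'a::euclidean_space \<Rightarrow> real"
  assumes lip: "\<And>S. bounded S \<Longrightarrow> \<exists>L. L-lipschitz_on S u"
    and g: "g \<in> borel_measurable lebesgue" "\<And>S. bounded S \<Longrightarrow> bounded (g ` S)"
    and ae: "AE x in lebesgue. (u has_derivative (\<lambda>v. g x \<bullet> v)) (at x)"
  shows "has_weak_gradient \<Omega> u g"
proof -
  have cont: "continuous_on UNIV u"
  proof -
    have "isCont u x" for x
    proof -
      obtain L where "L-lipschitz_on (ball x 1) u" using lip[of "ball x 1"] by auto
      then have "continuous_on (ball x 1) u" by (rule lipschitz_on_continuous_on)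
      then show ?thesis by (simp add: continuous_on_eq_continuous_at)
    qed
    then show ?thesis by (simp add: continuous_on_eq_continuous_at)
  qed
  have li: "locally_integrable \<Omega> u"
    by (rule locally_integrable_of_bounded[OF borel_measurable_lebesgue_continuous(1)[OF cont]
          bounded_image_continuous[OF cont]])
  have lg: "locally_integrable \<Omega> g" by (rule locally_integrable_of_bounded[OF g])
  have main: "(LINT x|lebesgue. u x * frechet_derivative \<phi> (at x) b) = - (LINT x|lebesgue. (g x \<bullet> b) * \<phi> x)"
    if tf: "test_function \<Omega> \<phi>" and b: "b \<in> Basis" for \<phi> b
  proof -
    obtain K where K: "compact K" "K \<subseteq> \<Omega>" "\<forall>x. x \<notin> K \<longrightarrow> \<phi> x = 0" "smooth \<phi>"
      "\<forall>x v. x \<notin> K \<longrightarrow> frechet_derivative \<phi> (at x) v = 0"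
      by (rule test_functionE[OF tf])
    define F where "F x = u x * \<phi> x" for x
    define D where "D x = (\<Sum>c\<in>Basis. frechet_derivative \<phi> (at x) c *\<^sub>R c)" for x
    have D: "(\<phi> has_derivative (\<lambda>v. D x \<bullet> v)) (at x)" for x
    proof -
      have lin: "linear (frechet_derivative \<phi> (at x))"
        by (rule has_derivative_linear[OF smooth_frechet(1)[OF K(4)]])
      have "frechet_derivative \<phi> (at x) v = D x \<bullet> v" for v
      proof -
        have "frechet_derivative \<phi> (at x) v = frechet_derivative \<phi> (at x) (\<Sum>c\<in>Basis. (v \<bullet> c) *\<^sub>R c)"
          by (simp add: euclidean_representation)
        also have "\<dots> = (\<Sum>c\<in>Basis. (v \<bullet> c) * frechet_derivative \<phi> (at x) c)"
          using lin by (simp add: linear_sum linear_cmul)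
        also have "\<dots> = D x \<bullet> v"
          by (simp add: D_def inner_sum_left) (simp add: inner_commute mult.commute)
        finally show ?thesis .
      qed
      then have "frechet_derivative \<phi> (at x) = (\<lambda>v. D x \<bullet> v)" by auto
      with smooth_frechet(1)[OF K(4), of x] show ?thesis by simp
    qed
    have Db: "D x \<bullet> b = frechet_derivative \<phi> (at x) b" for x
      using frechet_derivative_eqI[OF D[of x], of b] by simp
    have contD: "continuous_on UNIV D"
      unfolding D_def
      by (intro continuous_on_sum continuous_on_scaleR continuous_on_const smooth_continuous[OF smooth_frechet(2)[OF K(4)]])
    have cont\<phi>: "continuous_on UNIV \<phi>" by (rule smooth_continuous[OF K(4)])
    obtain R where R: "R > 0" "\<And>x. x \<in> K \<Longrightarrow> norm x \<le> R"
      using compact_imp_bounded[OF K(1)] by (auto simp: bounded_pos)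
    \<comment> \<open>The quotients use shifts of norm at most 1 and vanish outside radius R + 1, so
      radius R + 2 contains every point at which the Lipschitz bounds are invoked.\<close>
    define S where "S = cball (0::'a) (R + 2)"
    have bS: "bounded S" by (simp add: S_def)
    obtain L1 where L1: "L1-lipschitz_on S u" using lip[OF bS] by blast
    obtain L2 where L2: "L2-lipschitz_on S \<phi>" using C1_imp_lipschitz[OF D contD bS] by blast
    obtain M1 where M1: "M1 > 0" "\<And>x. x \<in> S \<Longrightarrow> \<bar>u x\<bar> \<le> M1"
      using bounded_image_continuous[OF cont bS] by (auto simp: bounded_pos)
    obtain M2 where M2: "M2 > 0" "\<And>x. x \<in> S \<Longrightarrow> \<bar>\<phi> x\<bar> \<le> M2"
      using bounded_image_continuous[OF cont\<phi> bS] by (auto simp: bounded_pos)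
    define C where "C = M1 * L2 + L1 * M2"
    have C0: "C \<ge> 0"
      unfolding C_def using M1(1) M2(1) lipschitz_on_nonneg[OF L1] lipschitz_on_nonneg[OF L2] by simp
    have lipF: "\<bar>F x - F y\<bar> \<le> C * dist x y" if xy: "x \<in> S" "y \<in> S" for x y
    proof -
      have "F x - F y = u x * (\<phi> x - \<phi> y) + (u x - u y) * \<phi> y" by (simp add: F_def algebra_simps)
      then have "\<bar>F x - F y\<bar> \<le> \<bar>u x\<bar> * \<bar>\<phi> x - \<phi> y\<bar> + \<bar>u x - u y\<bar> * \<bar>\<phi> y\<bar>"
        using abs_triangle_ineq[of "u x * (\<phi> x - \<phi> y)" "(u x - u y) * \<phi> y"] by (simp add: abs_mult)
      also have "\<dots> \<le> M1 * (L2 * dist x y) + (L1 * dist x y) * M2"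
        using M1 M2 lipschitz_onD[OF L1 xy] lipschitz_onD[OF L2 xy] xy lipschitz_on_nonneg[OF L1]
        by (intro add_mono mult_mono) (auto simp: dist_real_def)
      also have "\<dots> = C * dist x y" by (simp add: C_def algebra_simps)
      finally show ?thesis .
    qed
    define q where "q n x = (F (x + (1 / real (Suc n)) *\<^sub>R b) - F x) * real (Suc n)" for n x
    have contF: "continuous_on UNIV F"
      unfolding F_def by (intro continuous_on_mult cont cont\<phi>)
    have F0: "F x = 0" if "x \<notin> K" for x using that K(3) by (simp add: F_def)
    have q0: "(LINT x|lebesgue. q n x) = 0" for n
      unfolding q_def by (rule integral_difference_quotient_eq_0[OF contF K(1) F0])
    have contq: "continuous_on UNIV (q n)" for n
      unfolding q_def by (intro continuous_on_mult continuous_on_diff continuous_on_compose2[OF contF]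
          continuous_on_add continuous_on_const continuous_on_id contF) simp_all
    have qbound: "norm (q n x) \<le> C * indicator (cball 0 (R + 1)) x" for n x
    proof -
      define h where "h = (1 / real (Suc n)) *\<^sub>R b"
      have nb: "norm h \<le> 1" "norm h * real (Suc n) = 1"
        using b by (simp_all add: h_def divide_simps)
      have qh: "q n x = (F (x + h) - F x) * real (Suc n)" by (simp add: q_def h_def)
      show ?thesis
      proof (cases "x \<in> cball 0 (R + 1)")
        case True
        then have "x \<in> S" "x + h \<in> S"
          using norm_triangle_ineq[of x h] nb(1) by (auto simp: S_def)
        from lipF[OF this(2,1)] have "\<bar>F (x + h) - F x\<bar> \<le> C * norm h" by (simp add: dist_norm)
        then have "\<bar>F (x + h) - F x\<bar> * real (Suc n) \<le> C * norm h * real (Suc n)"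
          by (intro mult_right_mono) simp_all
        also have "\<dots> = C" using nb(2) by (simp only: mult.assoc mult_1_right)
        finally show ?thesis using True unfolding qh by (simp only: real_norm_def abs_mult abs_of_nat) simp
      next
        case False
        then have n: "norm x > R + 1" by simp
        then have "x \<notin> K" using R(2)[of x] by auto
        moreover have "norm (x + h) > R"
          using norm_triangle_ineq4[of "x + h" h] nb(1) n by simp
        then have "x + h \<notin> K" using R(2)[of "x + h"] by auto
        ultimately show ?thesis using False by (simp add: qh F0)
      qed
    qed
    define l where "l x = u x * frechet_derivative \<phi> (at x) b + (g x \<bullet> b) * \<phi> x" for x
    have i1: "integrable lebesgue (\<lambda>x. u x * frechet_derivative \<phi> (at x) b)"
      using test_function_integrable(2)[OF li tf b] by (simp add: mult.commute)
    have i2: "integrable lebesgue (\<lambda>x. (g x \<bullet> b) * \<phi> x)"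
      using integrable_inner_left[OF test_function_integrable(1)[OF lg tf], of b] by (simp add: mult.commute)
    have "(\<lambda>n. LINT x|lebesgue. q n x) \<longlonglongrightarrow> (LINT x|lebesgue. l x)"
    proof (rule integral_dominated_convergence[where w = "\<lambda>x. C * indicator (cball 0 (R + 1)) x"])
      show "l \<in> borel_measurable lebesgue"
        unfolding l_def using i1 i2 by (intro borel_measurable_add borel_measurable_integrable)
      show "q n \<in> borel_measurable lebesgue" for n
        by (rule borel_measurable_lebesgue_continuous(1)[OF contq])
      have "emeasure lborel (cball (0::'a) (R + 1)) < \<infinity>" by (intro emeasure_bounded_finite) simp
      then show "integrable lebesgue (\<lambda>x::'a. C * indicator (cball 0 (R + 1)) x)"
        by (intro integrable_mult_right integrable_real_indicator) simp_all
      show "AE x in lebesgue. norm (q n x) \<le> C * indicator (cball 0 (R + 1)) x" for n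
        by (rule AE_I2) (rule qbound)
      show "AE x in lebesgue. (\<lambda>n. q n x) \<longlonglongrightarrow> l x"
        using ae
      proof eventually_elim
        case (elim x)
        have "(F has_derivative (\<lambda>v. u x * (D x \<bullet> v) + (g x \<bullet> v) * \<phi> x)) (at x)"
          unfolding F_def by (rule has_derivative_mult[OF elim D])
        from directional_difference_quotient[OF this, of b] show ?case by (simp add: q_def l_def Db)
      qed
    qed
    then have "(\<lambda>n. 0) \<longlonglongrightarrow> (LINT x|lebesgue. l x)" by (simp add: q0)
    from LIMSEQ_unique[OF this tendsto_const] have "(LINT x|lebesgue. l x) = 0" .
    then show ?thesis using i1 i2 by (simp add: l_def)
  qed
  show ?thesis unfolding has_weak_gradient_iff using li lg main by blast
qed

lemma has_weak_gradient_of_C1: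
  fixes u :: "'a::euclidean_space \<Rightarrow> real"
  assumes "\<And>x. (u has_derivative (\<lambda>v. g x \<bullet> v)) (at x)" "continuous_on UNIV g"
  shows "has_weak_gradient \<Omega> u g"
  by (rule has_weak_gradient_of_lipschitz[OF C1_imp_lipschitz[OF assms]
        borel_measurable_lebesgue_continuous(1)[OF assms(2)] bounded_image_continuous[OF assms(2)]])
     (use assms(1) in auto)

lemma weak_gradient_eq:
  assumes "open \<Omega>" "has_weak_gradient \<Omega> u g"
  shows "has_weak_gradient \<Omega> u (weak_gradient \<Omega> u)"
    and "AE x in lebesgue. x \<in> \<Omega> \<longrightarrow> weak_gradient \<Omega> u x = g x"
proof -
  show *: "has_weak_gradient \<Omega> u (weak_gradient \<Omega> u)"
    unfolding weak_gradient_def by (rule someI[of "has_weak_gradient \<Omega> u", OF assms(2)])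
  show "AE x in lebesgue. x \<in> \<Omega> \<longrightarrow> weak_gradient \<Omega> u x = g x"
    by (rule weak_gradient_unique[OF assms(1) * assms(2)])
qed

subsection \<open>Approximate identities\<close>

lemma integral_deriv_sstep:
  "integrable lborel (deriv sstep)" "(LINT t|lborel. deriv sstep t) = 1"
proof -
  have hi: "(deriv sstep has_integral sstep 1 - sstep 0) {0..1}"
    by (rule fundamental_theorem_of_calculus)
       (auto simp flip: has_real_derivative_iff_has_vector_derivative intro: has_field_derivative_at_within sstep_deriv)
  have eq: "(\<lambda>t. indicator {0..1} t *\<^sub>R deriv sstep t) = deriv sstep"
  proof
    fix t
    show "indicator {0..1} t *\<^sub>R deriv sstep t = deriv sstep t"
      using deriv_sstep_eq_0[of t] by (cases "0 \<le> t"; cases "t \<le> 1") (simp_all add: indicator_def)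
  qed
  have s: "set_integrable lborel {0..1} (deriv sstep)"
    unfolding set_integrable_def
    by (rule borel_integrable_compact[OF _ smooth_continuous[OF smooth_deriv_sstep]]) simp
  then show "integrable lborel (deriv sstep)" unfolding set_integrable_def eq .
  from set_borel_integral_eq_integral(2)[OF s] integral_unique[OF hi]
  have "(LINT t:{0..1}|lborel. deriv sstep t) = 1" by (simp add: sstep(3,4))
  then show "(LINT t|lborel. deriv sstep t) = 1"
    unfolding set_lebesgue_integral_def eq .
qed

text \<open>The derivative of the step \<open>sstep (Suc j * t - 1)\<close>: a mollifier of total
  mass 1 living strictly to the right of 0, between 1/(j+1) and 2/(j+1).\<close>

definition spike :: "nat \<Rightarrow> real \<Rightarrow> real" where
  "spike j t = real (Suc j) * deriv sstep (real (Suc j) * t - 1)"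

lemma sstep_affine_deriv:
  "((\<lambda>t. sstep (real (Suc j) * (t - x) - 1)) has_real_derivative spike j (t - x)) (at t)"
  unfolding spike_def
  by (rule DERIV_cong, rule DERIV_chain'[OF _ sstep_deriv]) (auto intro!: derivative_eq_intros simp: algebra_simps)

lemma spike_nonneg: "0 \<le> spike j t"
  by (simp add: spike_def deriv_sstep_nonneg)

lemma spike_eq_0: "t \<notin> {1 / Suc j..2 / Suc j} \<Longrightarrow> spike j t = 0"
proof -
  assume "t \<notin> {1 / Suc j..2 / Suc j}"
  then have "real (Suc j) * t \<le> 1 \<or> 2 \<le> real (Suc j) * t"
    by (auto simp: field_simps not_le simp del: of_nat_Suc)
  then have "deriv sstep (real (Suc j) * t - 1) = 0" by (intro deriv_sstep_eq_0) auto
  then show "spike j t = 0" by (simp add: spike_def)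
qed

lemma spike_affine:
  "spike j ((x + 1 / real (Suc j)) + (1 / real (Suc j)) * s - x) = real (Suc j) * deriv sstep s"
proof -
  have "real (Suc j) * ((x + 1 / real (Suc j)) + (1 / real (Suc j)) * s - x) - 1 = s"
    by (simp add: distrib_left del: of_nat_Suc)
  then show ?thesis unfolding spike_def by simp
qed

lemma continuous_spike: "continuous_on S (spike j)"
proof -
  have "continuous_on S (\<lambda>t. real (Suc j) * deriv sstep (real (Suc j) * t - 1))"
    by (intro continuous_on_mult continuous_on_const continuous_on_compose2[OF smooth_continuous[OF smooth_deriv_sstep, of UNIV]]
        continuous_on_diff continuous_on_id) simp_all
  then show ?thesis by (simp add: spike_def[abs_def])
qed

lemma integral_spike: "integrable lborel (\<lambda>t. spike j (t - x))" "(LINT t|lborel. spike j (t - x)) = 1"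
proof -
  have c: "1 / real (Suc j) \<noteq> 0" by simp
  note * = spike_affine
  show "(LINT t|lborel. spike j (t - x)) = 1"
    by (subst lborel_integral_real_affine[OF c, of _ "x + 1 / real (Suc j)"]) (unfold *, simp add: integral_deriv_sstep)
  have "integrable lborel (\<lambda>s. spike j ((x + 1 / real (Suc j)) + (1 / real (Suc j)) * s - x))"
    unfolding * using integral_deriv_sstep(1) by simp
  then show "integrable lborel (\<lambda>t. spike j (t - x))"
    by (subst (asm) lborel_integrable_real_affine_iff[OF c, of "\<lambda>t. spike j (t - x)" "x + 1 / real (Suc j)"])
qed

text \<open>Rescaling to the unit interval turns this into dominated convergence against the fixed
  density \<open>deriv sstep\<close>. As the spikes sit strictly to the right of x, only the
  right-hand limit enters, which suits traces reached from y > 0.\<close>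

lemma spike_tendsto:
  fixes f :: "real \<Rightarrow> real"
  assumes m: "f \<in> borel_measurable borel" and B: "\<And>t. x < t \<Longrightarrow> t \<le> x + 2 \<Longrightarrow> \<bar>f t\<bar> \<le> B"
    and lim: "(f \<longlongrightarrow> l) (at_right x)"
  shows "(\<lambda>j. LINT t|lborel. f t * spike j (t - x)) \<longlonglongrightarrow> l"
proof -
  define p where "p j s = (x + 1 / real (Suc j)) + (1 / real (Suc j)) * s" for j s
  have c: "1 / real (Suc j) \<noteq> 0" for j by simp
  have *: "spike j (p j s - x) = real (Suc j) * deriv sstep s" for j s
    unfolding p_def by (rule spike_affine)
  have eq: "(LINT t|lborel. f t * spike j (t - x)) = (LINT s|lborel. f (p j s) * deriv sstep s)" for j
  proof -
    have "(LINT t|lborel. f t * spike j (t - x)) =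
        \<bar>1 / real (Suc j)\<bar> *\<^sub>R (LINT s|lborel. f (p j s) * spike j (p j s - x))"
      unfolding p_def by (rule lborel_integral_real_affine[OF c])
    also have "\<dots> = (LINT s|lborel. f (p j s) * deriv sstep s)"
      unfolding * by (simp add: mult.left_commute flip: integral_mult_right_zero)
    finally show ?thesis .
  qed
  have mp[measurable]: "(\<lambda>s. f (p j s)) \<in> borel_measurable borel" for j
    by (rule measurable_compose[OF _ m]) (simp add: p_def)
  have ms[measurable]: "deriv sstep \<in> borel_measurable borel"
    by (rule borel_measurable_continuous_onI) (rule smooth_continuous[OF smooth_deriv_sstep])
  have pb: "x < p j s" "p j s \<le> x + 2" if "0 < s" "s < 1" for j s
  proof -
    define e where "e = 1 / real (Suc j)"
    have e: "0 < e" "e \<le> 1" by (simp_all add: e_def)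
    have "e * s \<le> 1" "0 < e * s" using e that mult_le_one[of e s] by simp_all
    moreover have "p j s = x + e + e * s" by (simp only: p_def e_def)
    ultimately show "x < p j s" "p j s \<le> x + 2" using e by linarith+
  qed
  have "(\<lambda>j. LINT s|lborel. f (p j s) * deriv sstep s) \<longlonglongrightarrow> (LINT s|lborel. l * deriv sstep s)"
  proof (rule integral_dominated_convergence[where w = "\<lambda>s. B * deriv sstep s"])
    show "integrable lborel (\<lambda>s. B * deriv sstep s)" using integral_deriv_sstep(1) by simp
    show "AE s in lborel. norm (f (p j s) * deriv sstep s) \<le> B * deriv sstep s" for j
    proof (rule AE_I2)
      fix s
      show "norm (f (p j s) * deriv sstep s) \<le> B * deriv sstep s"
      proof (cases "0 < s \<and> s < 1")
        case True
        then have "\<bar>f (p j s)\<bar> \<le> B" by (intro B pb) auto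
        then show ?thesis by (simp add: abs_mult deriv_sstep_nonneg mult_right_mono)
      next
        case False
        then show ?thesis using deriv_sstep_eq_0[of s] by auto
      qed
    qed
    show "AE s in lborel. (\<lambda>j. f (p j s) * deriv sstep s) \<longlonglongrightarrow> l * deriv sstep s"
    proof (rule AE_I2)
      fix s
      show "(\<lambda>j. f (p j s) * deriv sstep s) \<longlonglongrightarrow> l * deriv sstep s"
      proof (cases "0 < s \<and> s < 1")
        case True
        have "(\<lambda>j. p j s) \<longlonglongrightarrow> (x + 0) + 0 * s"
          unfolding p_def by (intro tendsto_intros LIMSEQ_Suc[OF lim_1_over_n])
        then have "filterlim (\<lambda>j. p j s) (at_right x) sequentially"
          using True pb(1) unfolding filterlim_at by (auto intro!: always_eventually simp: less_imp_neq[symmetric])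
        from filterlim_compose[OF lim this] show ?thesis by (intro tendsto_mult tendsto_const)
      next
        case False
        then show ?thesis using deriv_sstep_eq_0[of s] by auto
      qed
    qed
  qed simp_all
  then show ?thesis unfolding eq by (simp add: integral_deriv_sstep)
qed

lemma integrable_mult_spike:
  fixes f :: "real \<Rightarrow> real"
  assumes "continuous_on UNIV f"
  shows "integrable lborel (\<lambda>t. f t * spike j (t - x))"
proof -
  have "integrable lborel (\<lambda>t. indicator {x..x + 2} t *\<^sub>R (f t * spike j (t - x)))"
    by (intro borel_integrable_compact continuous_on_mult continuous_on_subset[OF assms]
        continuous_on_compose2[OF continuous_spike[of UNIV]] continuous_on_diff continuous_on_id continuous_on_const) simp_all
  also have "(\<lambda>t. indicator {x..x + 2} t *\<^sub>R (f t * spike j (t - x))) = (\<lambda>t. f t * spike j (t - x))"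
  proof
    fix t
    have "1 / real (Suc j) \<ge> 0" "2 / real (Suc j) \<le> 2" by (simp_all add: field_simps)
    then have "t \<notin> {x..x + 2} \<Longrightarrow> t - x \<notin> {1 / Suc j..2 / Suc j}" by auto
    then show "indicator {x..x + 2} t *\<^sub>R (f t * spike j (t - x)) = f t * spike j (t - x)"
      using spike_eq_0[of "t - x" j] by (cases "t \<in> {x..x + 2}") auto
  qed
  finally show ?thesis .
qed

lemma sstep_tendsto: "(\<lambda>j. sstep (real (Suc j) * d - 1)) \<longlonglongrightarrow> (if d > 0 then 1 else 0)"
proof (cases "d > 0")
  case True
  then have "\<forall>\<^sub>F j in sequentially. 1 \<le> real (Suc j) * d - 1" by real_asymp
  then have "\<forall>\<^sub>F j in sequentially. sstep (real (Suc j) * d - 1) = 1" by eventually_elim (rule sstep(4))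
  then show ?thesis using True by (simp add: tendsto_eventually)
next
  case False
  have "real (Suc j) * d - 1 \<le> 0" for j
    using False mult_nonneg_nonpos[of "real (Suc j)" d] by simp
  then show ?thesis using False by (simp add: sstep(3))
qed

text \<open>The test function is a difference of two smooth steps, approximating the indicator of
  (x, y]; its derivative is a difference of two spikes, which evaluate the continuous function at x
  and y.\<close>

lemma weak_derivative_FTC:
  fixes h g :: "real \<Rightarrow> real"
  assumes cont: "continuous_on UNIV h" and g: "has_weak_gradient UNIV h g" and xy: "x \<le> y"
  shows "(LINT t:{x..y}|lebesgue. g t) = h y - h x"
proof -
  define \<phi> where "\<phi> j t = sstep (real (Suc j) * (t - x) - 1) - sstep (real (Suc j) * (t - y) - 1)" for j t
  have sm: "smooth (\<phi> j)" for j
  proof -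
    have "\<phi> j = (\<lambda>t. sstep (real (Suc j) * t + (- real (Suc j) * x - 1)) - sstep (real (Suc j) * t + (- real (Suc j) * y - 1)))"
      by (auto simp: \<phi>_def fun_eq_iff algebra_simps)
    then show ?thesis using smooth_diff[OF smooth_sstep_affine smooth_sstep_affine] by metis
  qed
  have deriv: "(\<phi> j has_real_derivative (spike j (t - x) - spike j (t - y))) (at t)" for j t
    unfolding \<phi>_def by (intro DERIV_diff sstep_affine_deriv)
  have z: "\<phi> j t = 0" if "t \<notin> {x..y + 2}" for j t
  proof (cases "t < x")
    case True
    then have "real (Suc j) * (t - x) \<le> 0" "real (Suc j) * (t - y) \<le> 0"
      using xy by (auto intro!: mult_nonneg_nonpos)
    then show ?thesis by (simp add: \<phi>_def sstep(3))
  next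
    case False
    then have "2 \<le> t - x" "2 \<le> t - y" using that xy by auto
    then have "1 * 2 \<le> real (Suc j) * (t - x)" "1 * 2 \<le> real (Suc j) * (t - y)"
      by (intro mult_mono; simp)+
    then show ?thesis by (simp add: \<phi>_def sstep(4))
  qed
  have tf: "test_function UNIV (\<phi> j)" for j
    by (rule test_functionI[OF sm compact_Icc subset_UNIV z])
  have lhs: "(LINT t|lebesgue. h t * frechet_derivative (\<phi> j) (at t) 1) =
      (LINT t|lborel. h t * spike j (t - x)) - (LINT t|lborel. h t * spike j (t - y))" for j
  proof -
    have fd: "frechet_derivative (\<phi> j) (at t) 1 = spike j (t - x) - spike j (t - y)" for t
      using frechet_derivative_eqI[OF deriv[of j t, unfolded has_field_derivative_def], of 1] by simp
    have "(LINT t|lebesgue. h t * (spike j (t - x) - spike j (t - y))) =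
        (LINT t|lborel. h t * spike j (t - x) - h t * spike j (t - y))"
      unfolding right_diff_distrib
      by (intro integral_completion borel_measurable_diff borel_measurable_integrable integrable_mult_spike[OF cont])
    also have "\<dots> = (LINT t|lborel. h t * spike j (t - x)) - (LINT t|lborel. h t * spike j (t - y))"
      by (intro Bochner_Integration.integral_diff integrable_mult_spike[OF cont])
    finally show ?thesis unfolding fd .
  qed
  have lim1: "(\<lambda>j. LINT t|lborel. h t * spike j (t - z)) \<longlonglongrightarrow> h z" for z
  proof -
    have "bounded (h ` {z..z + 2})" by (rule bounded_image_continuous[OF cont]) simp
    then obtain B where "\<forall>t\<in>{z..z + 2}. \<bar>h t\<bar> \<le> B" unfolding bounded_iff by auto
    moreover have "(h \<longlongrightarrow> h z) (at_right z)"
      using cont by (auto simp: continuous_on_def intro: filterlim_mono[OF _ order_refl at_le])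
    ultimately show ?thesis
      by (intro spike_tendsto[where B = B] borel_measurable_continuous_onI[OF cont]) auto
  qed
  have lg: "locally_integrable UNIV g" using g unfolding has_weak_gradient_def by blast
  have ig: "integrable lebesgue (\<lambda>t. indicator {x..y + 2} t *\<^sub>R g t)"
    by (rule locally_integrableD[OF lg]) simp_all
  have ig': "integrable lebesgue (\<lambda>t. indicator {x..y} t *\<^sub>R g t)"
    by (rule locally_integrableD[OF lg]) simp_all
  have "(\<lambda>j. LINT t|lebesgue. (g t \<bullet> 1) * \<phi> j t) \<longlonglongrightarrow> (LINT t|lebesgue. indicator {x..y} t *\<^sub>R g t)"
  proof (rule integral_dominated_convergence[where w = "\<lambda>t. norm (indicator {x..y + 2} t *\<^sub>R g t)"])
    show "(\<lambda>t. indicator {x..y} t *\<^sub>R g t) \<in> borel_measurable lebesgue"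
      by (rule borel_measurable_integrable[OF ig'])
    show "(\<lambda>t. (g t \<bullet> 1) * \<phi> j t) \<in> borel_measurable lebesgue" for j
      using borel_measurable_integrable[OF test_function_integrable(1)[OF lg tf[of j]]] by (simp add: mult.commute)
    show "integrable lebesgue (\<lambda>t. norm (indicator {x..y + 2} t *\<^sub>R g t))" by (rule integrable_norm[OF ig])
    show "AE t in lebesgue. norm ((g t \<bullet> 1) * \<phi> j t) \<le> norm (indicator {x..y + 2} t *\<^sub>R g t)" for j
    proof (rule AE_I2)
      fix t
      have "\<bar>\<phi> j t\<bar> \<le> 1"
        using sstep_bounds[of "real (Suc j) * (t - x) - 1"] sstep_bounds[of "real (Suc j) * (t - y) - 1"]
        unfolding \<phi>_def by linarith
      then have "\<bar>g t\<bar> * \<bar>\<phi> j t\<bar> \<le> \<bar>g t\<bar> * 1" by (intro mult_left_mono) auto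
      then show "norm ((g t \<bullet> 1) * \<phi> j t) \<le> norm (indicator {x..y + 2} t *\<^sub>R g t)"
        using z[of t j] by (cases "t \<in> {x..y + 2}") (auto simp: abs_mult)
    qed
    \<comment> \<open>At t = x both steps tend to 0 while the indicator of the closed interval may
      be 1, so this point has to be excluded.\<close>
    have "AE t in lebesgue. t \<noteq> x" by (rule AE_completion[OF AE_lborel_singleton])
    then show "AE t in lebesgue. (\<lambda>j. (g t \<bullet> 1) * \<phi> j t) \<longlonglongrightarrow> indicator {x..y} t *\<^sub>R g t"
    proof eventually_elim
      case (elim t)
      have "(\<lambda>j. \<phi> j t) \<longlonglongrightarrow> (if t - x > 0 then 1 else 0) - (if t - y > 0 then 1 else 0)"
        unfolding \<phi>_def by (intro tendsto_diff sstep_tendsto)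
      also have "(if t - x > 0 then 1 else 0) - (if t - y > 0 then 1 else 0) = (indicator {x..y} t :: real)"
        using elim xy by (auto simp: indicator_def)
      finally have "(\<lambda>j. g t * \<phi> j t) \<longlonglongrightarrow> g t * indicator {x..y} t" by (intro tendsto_mult tendsto_const)
      then show ?case by (simp add: mult.commute)
    qed
  qed
  then have "(\<lambda>j. LINT t|lebesgue. (g t \<bullet> 1) * \<phi> j t) \<longlonglongrightarrow> (LINT t:{x..y}|lebesgue. g t)"
    unfolding set_lebesgue_integral_def .
  moreover have "(LINT t|lebesgue. (g t \<bullet> 1) * \<phi> j t) =
      (LINT t|lborel. h t * spike j (t - y)) - (LINT t|lborel. h t * spike j (t - x))" for j
    using has_weak_gradientD[OF g tf, of 1 j] lhs[of j] by simp
  ultimately have "(\<lambda>j. (LINT t|lborel. h t * spike j (t - y)) - (LINT t|lborel. h t * spike j (t - x)))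
      \<longlonglongrightarrow> (LINT t:{x..y}|lebesgue. g t)" by simp
  from LIMSEQ_unique[OF this tendsto_diff[OF lim1 lim1]] show ?thesis .
qed

subsection \<open>Trigonometric sums\<close>

text \<open>The constant of the half-strip problem is the energy of the harmonic extension
  \<open>\<Sum>k odd. 4 / (pi\<^sup>2 k\<^sup>2) cos (k pi x) exp (- k pi y)\<close> of \<open>1/2 - x\<close>.\<close>

definition C_W :: real where
  "C_W = (\<Sum>k. if odd k then 8 / (pi ^ 3 * real k ^ 3) else 0)"

definition C_N :: "nat \<Rightarrow> real" where
  "C_N n = (\<Sum>k<n. if odd k then 8 / (pi ^ 3 * real k ^ 3) else 0)"

lemma C_N_tendsto: "C_N \<longlonglongrightarrow> C_W" and C_N_le: "C_N n \<le> C_W" and C_W_pos: "0 < C_W"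
proof -
  let ?f = "\<lambda>k. if odd k then 8 / (pi ^ 3 * real k ^ 3) else (0::real)"
  have nn: "0 \<le> ?f k" for k by simp
  have sm: "summable ?f"
  proof (rule summable_comparison_test)
    have "norm (?f k) \<le> 8 / pi ^ 3 * inverse (real k ^ 3)" for k
      by (cases "odd k") (simp_all add: divide_inverse abs_mult)
    then show "\<exists>N. \<forall>k\<ge>N. norm (?f k) \<le> 8 / pi ^ 3 * inverse (real k ^ 3)" by blast
    show "summable (\<lambda>k. 8 / pi ^ 3 * inverse (real k ^ 3))"
      by (intro summable_mult inverse_power_summable) simp
  qed
  show "C_N \<longlonglongrightarrow> C_W"
    unfolding C_W_def C_N_def[abs_def] by (rule summable_LIMSEQ[OF sm])
  show "C_N n \<le> C_W" for n
    unfolding C_W_def C_N_def by (rule sum_le_suminf[OF sm]) (use nn in auto)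
  have "0 < C_N 2" by (simp add: C_N_def eval_nat_numeral)
  with \<open>C_N 2 \<le> C_W\<close> show "0 < C_W" by simp
qed

lemma integral_cos_multiple:
  fixes k :: int
  shows "integral {0..1} (\<lambda>x. cos (of_int k * pi * x)) = (if k = 0 then 1 else 0)"
proof (cases "k = 0")
  case False
  have "((\<lambda>x. cos (of_int k * pi * x)) has_integral
      sin (of_int k * pi * 1) / (of_int k * pi) - sin (of_int k * pi * 0) / (of_int k * pi)) {0..1}"
    using False
    by (intro fundamental_theorem_of_calculus)
       (auto intro!: derivative_eq_intros simp flip: has_real_derivative_iff_has_vector_derivative)
  moreover have "sin (of_int k * pi) = 0" by (simp add: sin_zero_iff_int2)
  ultimately show ?thesis using False by (simp add: integral_unique)
qed simp

lemma integral_sin_sin: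
  assumes "0 < j" "0 < k"
  shows "integral {0..1} (\<lambda>x. sin (real j * pi * x) * sin (real k * pi * x)) = (if j = k then 1 / 2 else 0)"
    and "integral {0..1} (\<lambda>x. cos (real j * pi * x) * cos (real k * pi * x)) = (if j = k then 1 / 2 else 0)"
proof -
  let ?c = "\<lambda>m x. cos (of_int m * pi * x) :: real"
  let ?m = "int j - int k" and ?p = "int j + int k"
  have i: "?c m integrable_on {0..1}" for m
    by (intro integrable_continuous_real continuous_intros)
  have "(\<lambda>x. sin (real j * pi * x) * sin (real k * pi * x)) = (\<lambda>x. (?c ?m x - ?c ?p x) / 2)"
    by (simp add: sin_times_sin left_diff_distrib distrib_right)
  then have "integral {0..1} (\<lambda>x. sin (real j * pi * x) * sin (real k * pi * x)) =
      (integral {0..1} (?c ?m) - integral {0..1} (?c ?p)) / 2"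
    using integral_diff[OF i i, of ?m ?p] by simp
  then show "integral {0..1} (\<lambda>x. sin (real j * pi * x) * sin (real k * pi * x)) = (if j = k then 1 / 2 else 0)"
    unfolding integral_cos_multiple using assms by auto
  have "(\<lambda>x. cos (real j * pi * x) * cos (real k * pi * x)) = (\<lambda>x. (?c ?m x + ?c ?p x) / 2)"
    by (simp add: cos_times_cos left_diff_distrib distrib_right)
  then have "integral {0..1} (\<lambda>x. cos (real j * pi * x) * cos (real k * pi * x)) =
      (integral {0..1} (?c ?m) + integral {0..1} (?c ?p)) / 2"
    using integral_add[OF i i, of ?m ?p] by simp
  then show "integral {0..1} (\<lambda>x. cos (real j * pi * x) * cos (real k * pi * x)) = (if j = k then 1 / 2 else 0)"
    unfolding integral_cos_multiple using assms by auto
qed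

lemma has_integral_sq_sum:
  fixes f :: "nat \<Rightarrow> real \<Rightarrow> real"
  assumes cont: "\<And>k. continuous_on {0..1} (f k)"
    and orth: "\<And>j k. j \<in> I \<Longrightarrow> k \<in> I \<Longrightarrow> integral {0..1} (\<lambda>x. f j x * f k x) = (if j = k then 1 / 2 else 0)"
    and I: "finite I"
  shows "((\<lambda>x. (\<Sum>k\<in>I. a k * f k x)\<^sup>2) has_integral (\<Sum>k\<in>I. (a k)\<^sup>2 / 2)) {0..1}"
proof -
  have hi: "((\<lambda>x. f j x * f k x) has_integral (if j = k then 1 / 2 else 0)) {0..1}" if "j \<in> I" "k \<in> I" for j k
    using integrable_integral[of "\<lambda>x. f j x * f k x" "{0..1}"] orth[OF that]
    by (simp add: integrable_continuous_real continuous_on_mult cont)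
  have "((\<lambda>x. \<Sum>j\<in>I. \<Sum>k\<in>I. (a j * a k) * (f j x * f k x)) has_integral
      (\<Sum>j\<in>I. \<Sum>k\<in>I. (a j * a k) * (if j = k then 1 / 2 else 0))) {0..1}"
    by (intro has_integral_sum I has_integral_mult_right hi)
  moreover have "(\<Sum>j\<in>I. \<Sum>k\<in>I. (a j * a k) * (f j x * f k x)) = (\<Sum>k\<in>I. a k * f k x)\<^sup>2" for x
    by (simp add: power2_eq_square sum_product mult_ac)
  moreover have "(\<Sum>j\<in>I. \<Sum>k\<in>I. (a j * a k) * (if j = k then 1 / 2 else 0)) = (\<Sum>k\<in>I. (a k)\<^sup>2 / 2)"
    using I by (simp add: if_distrib[of "\<lambda>u. _ * u"] sum.delta power2_eq_square cong: if_cong)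
  ultimately show ?thesis by simp
qed

lemma has_integral_sin_sum_sq:
  assumes I: "finite I" "0 \<notin> I"
  shows "((\<lambda>x. (\<Sum>k\<in>I. a k * sin (real k * pi * x))\<^sup>2) has_integral (\<Sum>k\<in>I. (a k)\<^sup>2 / 2)) {0..1}"
    and "((\<lambda>x. (\<Sum>k\<in>I. a k * cos (real k * pi * x))\<^sup>2) has_integral (\<Sum>k\<in>I. (a k)\<^sup>2 / 2)) {0..1}"
proof -
  have pos: "0 < k" if "k \<in> I" for k using that I(2) by (cases k) auto
  show "((\<lambda>x. (\<Sum>k\<in>I. a k * sin (real k * pi * x))\<^sup>2) has_integral (\<Sum>k\<in>I. (a k)\<^sup>2 / 2)) {0..1}"
    by (rule has_integral_sq_sum[OF _ _ I(1)]) (intro continuous_intros, intro integral_sin_sin pos)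
  show "((\<lambda>x. (\<Sum>k\<in>I. a k * cos (real k * pi * x))\<^sup>2) has_integral (\<Sum>k\<in>I. (a k)\<^sup>2 / 2)) {0..1}"
    by (rule has_integral_sq_sum[OF _ _ I(1)]) (intro continuous_intros, intro integral_sin_sin pos)
qed

definition odds :: "nat \<Rightarrow> nat set" where
  "odds n = {k. k < n \<and> odd k}"

lemma finite_odds [simp]: "finite (odds n)" and zero_notin_odds [simp]: "0 \<notin> odds n"
  by (auto simp: odds_def)

lemma odds_pos: "k \<in> odds n \<Longrightarrow> 0 < k"
  by (auto simp: odds_def intro: odd_pos)

lemma C_N_eq: "C_N n = (\<Sum>k\<in>odds n. 8 / (pi ^ 3 * real k ^ 3))"
proof -
  have "odds n = {k \<in> {..<n}. odd k}" by (auto simp: odds_def)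
  then show ?thesis
    unfolding C_N_def
    using sum.inter_filter[of "{..<n}" "\<lambda>k. 8 / (pi ^ 3 * real k ^ 3)" odd] by (simp only: finite_lessThan)
qed

text \<open>The even terms make up a quarter of the Basel sum, leaving
  \<open>3/4 * pi^2/6 = pi^2/8\<close> for the odd ones. The splitting is exact at even cut-offs;
  monotonicity carries the limit to all n. It will show that the truncated cosine series exhausts
  the boundary energy.\<close>

lemma basel_odd: "(\<lambda>n. \<Sum>k\<in>odds n. 8 / (pi\<^sup>2 * (real k)\<^sup>2)) \<longlonglongrightarrow> 1"
proof -
  have s: "(\<lambda>n. 1 / (real (Suc n))\<^sup>2) sums (pi\<^sup>2 / 6)"
    using inverse_squares_sums by (simp add: add.commute)
  have all: "(\<lambda>n. \<Sum>k<n. 1 / (real k)\<^sup>2) \<longlonglongrightarrow> pi\<^sup>2 / 6"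
  proof -
    \<comment> \<open>Division by zero gives 0, so the term at n = 0 vanishes and the index may be
      shifted freely.\<close>
    have "(\<lambda>n. 1 / (real n)\<^sup>2) sums (pi\<^sup>2 / 6)"
      using s sums_Suc_iff[of "\<lambda>n. 1 / (real n)\<^sup>2" "pi\<^sup>2 / 6"] by simp
    then show ?thesis by (simp add: sums_def)
  qed
  have split: "(\<Sum>k\<in>odds (2 * n). 8 / (pi\<^sup>2 * (real k)\<^sup>2)) =
      8 / pi\<^sup>2 * ((\<Sum>k<2 * n. 1 / (real k)\<^sup>2) - (1 / 4) * (\<Sum>k<n. 1 / (real k)\<^sup>2))" for n
  proof (induction n)
    case (Suc n)
    have "odds (2 * Suc n) = insert (2 * n + 1) (odds (2 * n))"
      by (auto simp: odds_def less_Suc_eq)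
    moreover have "2 * n + 1 \<notin> odds (2 * n)" by (simp add: odds_def)
    ultimately have "(\<Sum>k\<in>odds (2 * Suc n). 8 / (pi\<^sup>2 * (real k)\<^sup>2)) =
        8 / (pi\<^sup>2 * (real (2 * n + 1))\<^sup>2) + (\<Sum>k\<in>odds (2 * n). 8 / (pi\<^sup>2 * (real k)\<^sup>2))" by simp
    moreover have "(\<Sum>k<2 * Suc n. 1 / (real k)\<^sup>2) =
        (\<Sum>k<2 * n. 1 / (real k)\<^sup>2) + 1 / (real (2 * n))\<^sup>2 + 1 / (real (2 * n + 1))\<^sup>2" by simp
    moreover have "1 / (real (2 * n))\<^sup>2 = 1 / 4 * (1 / (real n)\<^sup>2)" by (simp add: power_mult_distrib)
    moreover have "8 / (pi\<^sup>2 * r) = 8 / pi\<^sup>2 * (1 / r)" for r by simp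
    moreover have "P * X + P * (A - 1 / 4 * B) = P * (A + 1 / 4 * c + X - 1 / 4 * (B + c))" for P A B c X :: real
      by (simp add: algebra_simps)
    ultimately show ?case unfolding Suc.IH by (simp only: sum.lessThan_Suc)
  qed (simp add: odds_def)
  have dbl: "filterlim (\<lambda>n::nat. 2 * n) at_top sequentially"
    by (rule filterlim_subseq) (simp add: strict_mono_def)
  have "(\<lambda>n. 8 / pi\<^sup>2 * ((\<Sum>k<2 * n. 1 / (real k)\<^sup>2) - (1 / 4) * (\<Sum>k<n. 1 / (real k)\<^sup>2)))
      \<longlonglongrightarrow> 8 / pi\<^sup>2 * (pi\<^sup>2 / 6 - (1 / 4) * (pi\<^sup>2 / 6))"
    by (intro tendsto_mult tendsto_diff tendsto_const all filterlim_compose[OF all dbl])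
  then have l: "(\<lambda>n. \<Sum>k\<in>odds (2 * n). 8 / (pi\<^sup>2 * (real k)\<^sup>2)) \<longlonglongrightarrow> 1"
    unfolding split by (simp add: field_simps)
  have inc: "incseq (\<lambda>n. \<Sum>k\<in>odds n. 8 / (pi\<^sup>2 * (real k)\<^sup>2))"
    by (intro incseq_SucI sum_mono2) (auto simp: odds_def)
  have ub: "(\<Sum>k\<in>odds n. 8 / (pi\<^sup>2 * (real k)\<^sup>2)) \<le> 1" for n
  proof -
    have "incseq (\<lambda>n. \<Sum>k\<in>odds (2 * n). 8 / (pi\<^sup>2 * (real k)\<^sup>2))"
      using inc by (auto simp: incseq_def)
    from incseq_le[OF this l] have "(\<Sum>k\<in>odds (2 * n). 8 / (pi\<^sup>2 * (real k)\<^sup>2)) \<le> 1" .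
    moreover have "(\<Sum>k\<in>odds n. 8 / (pi\<^sup>2 * (real k)\<^sup>2)) \<le> (\<Sum>k\<in>odds (2 * n). 8 / (pi\<^sup>2 * (real k)\<^sup>2))"
      using inc by (auto simp: incseq_def)
    ultimately show ?thesis by simp
  qed
  obtain L where L: "(\<lambda>n. \<Sum>k\<in>odds n. 8 / (pi\<^sup>2 * (real k)\<^sup>2)) \<longlonglongrightarrow> L"
    using incseq_convergent[OF inc] ub by blast
  from filterlim_compose[OF this dbl] l have "L = 1" by (intro LIMSEQ_unique)
  with L show ?thesis by simp
qed

subsection \<open>The flux identity\<close>

text \<open>Local integrability speaks of compact subsets only; finite unions of closed boxes
  exhaust \<Omega> and exhibit the restricted function as a pointwise limit of measurable
  ones.\<close>

lemma locally_integrable_measurable: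
  fixes f :: "'a::euclidean_space \<Rightarrow> 'b::euclidean_space"
  assumes \<Omega>: "open \<Omega>" and f: "locally_integrable \<Omega> f"
  shows "(\<lambda>x. indicator \<Omega> x *\<^sub>R f x) \<in> borel_measurable lebesgue"
proof (cases "\<Omega> = {}")
  case False
  obtain \<D> where D: "countable \<D>" "\<D> \<subseteq> Pow \<Omega>" "\<And>X. X \<in> \<D> \<Longrightarrow> \<exists>a b. X = cbox a b" "\<Union>\<D> = \<Omega>"
    using open_countable_Union_open_cbox[OF \<Omega>] by blast
  then have ne: "\<D> \<noteq> {}" using False by blast
  define K where "K n = (\<Union>i<n. from_nat_into \<D> i)" for n
  have inD: "from_nat_into \<D> i \<in> \<D>" for i by (rule from_nat_into[OF ne])
  have c: "compact (K n)" for n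
  proof -
    have "compact (from_nat_into \<D> i)" for i
    proof -
      obtain a b where "from_nat_into \<D> i = cbox a b" using D(3)[OF inD[of i]] by blast
      then show ?thesis by simp
    qed
    then show ?thesis unfolding K_def by (intro compact_UN ballI finite_lessThan)
  qed
  have s: "K n \<subseteq> \<Omega>" for n unfolding K_def using inD D(2) by blast
  show ?thesis
  proof (rule borel_measurable_LIMSEQ_metric)
    show "(\<lambda>x. indicator (K n) x *\<^sub>R f x) \<in> borel_measurable lebesgue" for n
      by (rule borel_measurable_integrable[OF locally_integrableD[OF f c s]])
    fix x
    show "(\<lambda>n. indicator (K n) x *\<^sub>R f x) \<longlonglongrightarrow> indicator \<Omega> x *\<^sub>R f x"
    proof (cases "x \<in> \<Omega>")
      case True
      then obtain X where X: "X \<in> \<D>" "x \<in> X" using D(4) by blast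
      then obtain i where i: "X = from_nat_into \<D> i" using from_nat_into_surj[OF D(1)] by metis
      have "\<forall>\<^sub>F n in sequentially. indicator (K n) x *\<^sub>R f x = indicator \<Omega> x *\<^sub>R f x"
        using eventually_gt_at_top[of i] by eventually_elim (use X i True in \<open>auto simp: K_def indicator_def\<close>)
      then show ?thesis by (rule tendsto_eventually)
    next
      case False
      then have "x \<notin> K n" for n using s by blast
      then show ?thesis using False by simp
    qed
  qed
qed simp

lemma compact_abs_bound:
  fixes F :: "'a::topological_space \<Rightarrow> real"
  assumes "compact S" "continuous_on S F"
  obtains B where "B > 0" "\<forall>x\<in>S. \<bar>F x\<bar> \<le> B"
proof -
  have "bounded (F ` S)" by (intro compact_imp_bounded compact_continuous_image assms)
  then show ?thesis using that unfolding bounded_pos by auto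
qed

lemma product_test_function:
  fixes F E :: "real \<Rightarrow> real"
  assumes sm: "smooth F" "smooth E"
    and F0: "\<And>x. x \<notin> {a..b} \<Longrightarrow> F x = 0" and E0: "\<And>y. y \<notin> {c..d} \<Longrightarrow> E y = 0"
    and sub: "{a..b} \<times> {c..d} \<subseteq> \<Omega>"
  shows "test_function \<Omega> (\<lambda>z. F (fst z) * E (snd z))"
proof (rule test_functionI[OF _ _ sub])
  show "smooth (\<lambda>z::real \<times> real. F (fst z) * E (snd z))"
    by (rule smooth_mult[OF smooth_fst[OF sm(1)] smooth_snd[OF sm(2)]])
  show "compact ({a..b} \<times> {c..d})" by (intro compact_Times compact_Icc)
  show "F (fst z) * E (snd z) = 0" if "z \<notin> {a..b} \<times> {c..d}" for z
    using that F0[of "fst z"] E0[of "snd z"] by (cases z) auto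
qed

lemma product_frechet:
  fixes F E :: "real \<Rightarrow> real"
  assumes "\<And>x. (F has_real_derivative F' x) (at x)" "\<And>y. (E has_real_derivative E' y) (at y)"
  shows "frechet_derivative (\<lambda>z. F (fst z) * E (snd z)) (at z) (1, 0) = F' (fst z) * E (snd z)"
    and "frechet_derivative (\<lambda>z. F (fst z) * E (snd z)) (at z) (0, 1) = F (fst z) * E' (snd z)"
proof -
  have "((\<lambda>z. F (fst z)) has_derivative (\<lambda>v. F' (fst z) * fst v)) (at z)"
    by (rule has_derivative_compose[OF has_derivative_fst[OF has_derivative_ident]])
       (use assms(1)[of "fst z"] in \<open>simp add: has_field_derivative_def\<close>)
  moreover have "((\<lambda>z. E (snd z)) has_derivative (\<lambda>v. E' (snd z) * snd v)) (at z)"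
    by (rule has_derivative_compose[OF has_derivative_snd[OF has_derivative_ident]])
       (use assms(2)[of "snd z"] in \<open>simp add: has_field_derivative_def\<close>)
  ultimately have "((\<lambda>z. F (fst z) * E (snd z)) has_derivative
      (\<lambda>v. F (fst z) * (E' (snd z) * snd v) + F' (fst z) * fst v * E (snd z))) (at z)"
    by (rule has_derivative_mult)
  from frechet_derivative_eqI[OF this]
  show "frechet_derivative (\<lambda>z. F (fst z) * E (snd z)) (at z) (1, 0) = F' (fst z) * E (snd z)"
    "frechet_derivative (\<lambda>z. F (fst z) * E (snd z)) (at z) (0, 1) = F (fst z) * E' (snd z)" by simp_all
qed

lemma Basis_real_prod: "(Basis :: (real \<times> real) set) = {(1, 0), (0, 1)}"
  by (auto simp: Basis_prod_def)

lemma has_weak_gradient_diff: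
  assumes "has_weak_gradient \<Omega> u g" "has_weak_gradient \<Omega> v g'"
  shows "has_weak_gradient \<Omega> (\<lambda>z. u z - v z) (\<lambda>z. g z - g' z)"
proof -
  have li: "locally_integrable \<Omega> u" "locally_integrable \<Omega> v" "locally_integrable \<Omega> g" "locally_integrable \<Omega> g'"
    using assms unfolding has_weak_gradient_def by simp_all
  have d: "locally_integrable \<Omega> (\<lambda>z. p z - q z)" if "locally_integrable \<Omega> p" "locally_integrable \<Omega> q"
    for p q :: "'a \<Rightarrow> 'c::euclidean_space"
    using that unfolding locally_integrable_def by (auto intro: set_integral_diff(1))
  have "(LINT x|lebesgue. (u x - v x) * frechet_derivative \<phi> (at x) b) = - (LINT x|lebesgue. ((g x - g' x) \<bullet> b) * \<phi> x)"
    if tf: "test_function \<Omega> \<phi>" and b: "b \<in> Basis" for \<phi> b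
  proof -
    have i: "integrable lebesgue (\<lambda>x. u x * frechet_derivative \<phi> (at x) b)"
      "integrable lebesgue (\<lambda>x. v x * frechet_derivative \<phi> (at x) b)"
      using test_function_integrable(2)[OF li(1) tf b] test_function_integrable(2)[OF li(2) tf b]
      by (simp_all add: mult.commute)
    have i': "integrable lebesgue (\<lambda>x. (g x \<bullet> b) * \<phi> x)" "integrable lebesgue (\<lambda>x. (g' x \<bullet> b) * \<phi> x)"
      using integrable_inner_left[OF test_function_integrable(1)[OF li(3) tf], of b]
        integrable_inner_left[OF test_function_integrable(1)[OF li(4) tf], of b]
      by (simp_all add: mult.commute)
    show ?thesis
      using i i' has_weak_gradientD[OF assms(1) tf b] has_weak_gradientD[OF assms(2) tf b]
      by (simp add: left_diff_distrib inner_diff_left)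
  qed
  then show ?thesis unfolding has_weak_gradient_iff using d[OF li(1,2)] d[OF li(3,4)] by blast
qed

text \<open>The field \<open>(- f e', f' e)\<close> is the rotated gradient of the product
  \<open>f e\<close>, hence divergence free. It vanishes near the two lateral sides and near the
  top, so its pairing with a gradient sees only the trace on the base. The primed bounds keep the
  support away from those three sides; only the base needs a cut-off.\<close>

locale rectangle_profile =
  fixes a b r :: real and f f' e e' :: "real \<Rightarrow> real" and a' b' r' :: real
  assumes ab: "a < b" and r: "0 < r"
    and df: "\<And>x. (f has_real_derivative f' x) (at x)" and de: "\<And>y. (e has_real_derivative e' y) (at y)"
    and smf: "smooth f" "smooth f'" and sme: "smooth e" "smooth e'"
    and sub: "a < a'" "b' < b" "r' < r"
    and f0: "\<And>x. x \<notin> {a'..b'} \<Longrightarrow> f x = 0" "\<And>x. x \<notin> {a'..b'} \<Longrightarrow> f' x = 0"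
    and e0: "\<And>y. y > r' \<Longrightarrow> e y = 0" "\<And>y. y > r' \<Longrightarrow> e' y = 0"
begin

definition "Q = {a<..<b} \<times> {0<..<r}"

text \<open>Test functions must vanish near the base y = 0. This factor provides that, and its
  derivative is a one-sided mollifier in y.\<close>

definition \<eta> :: "nat \<Rightarrow> real \<Rightarrow> real" where "\<eta> j y = sstep (real (Suc j) * y - 1)"

lemma \<eta>_deriv: "(\<eta> j has_real_derivative spike j y) (at y)"
  using sstep_affine_deriv[of j 0 y] by (simp add: \<eta>_def[abs_def])

lemma smooth_\<eta>: "smooth (\<eta> j)"
  unfolding \<eta>_def[abs_def] using smooth_sstep_affine[of "real (Suc j)" "- 1"] by simp

lemma \<eta>_bounds: "0 \<le> \<eta> j y" "\<eta> j y \<le> 1" "y < 1 / real (Suc j) \<Longrightarrow> \<eta> j y = 0"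
  by (auto simp: \<eta>_def sstep_bounds field_simps simp del: of_nat_Suc intro!: sstep(3))

lemma smooth_spike: "smooth (spike j)"
proof -
  obtain s where s: "\<And>x. (\<eta> j has_real_derivative s x) (at x)" "smooth s"
    using smooth_derivE[OF smooth_\<eta>] by blast
  have eq: "spike j = s" by (rule ext) (rule DERIV_unique[OF \<eta>_deriv s(1)])
  show ?thesis unfolding eq by (rule s(2))
qed

lemma test_functions:
  shows "test_function Q (\<lambda>z. f (fst z) * (e' (snd z) * \<eta> j (snd z)))"
    and "test_function Q (\<lambda>z. f' (fst z) * (e (snd z) * \<eta> j (snd z)))"
    and "test_function Q (\<lambda>z. f' (fst z) * (e' (snd z) * \<eta> j (snd z)))"
    and "test_function Q (\<lambda>z. f' (fst z) * (e (snd z) * spike j (snd z)))"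
proof -
  have pos: "0 < 1 / real (Suc j)" by simp
  have s: "{a'..b'} \<times> {1 / real (Suc j)..r'} \<subseteq> Q"
    using sub by (auto simp: Q_def simp del: of_nat_Suc intro: less_le_trans[OF pos])
  have z1: "e y * \<eta> j y = 0" and z2: "e' y * \<eta> j y = 0" and z3: "e y * spike j y = 0"
    if "y \<notin> {1 / real (Suc j)..r'}" for y
    using that \<eta>_bounds(3)[of y j] e0[of y] spike_eq_0[of y j] by (cases "y > r'"; auto)+
  show "test_function Q (\<lambda>z. f (fst z) * (e' (snd z) * \<eta> j (snd z)))"
    by (rule product_test_function[OF smf(1) smooth_mult[OF sme(2) smooth_\<eta>] f0(1) z2 s])
  show "test_function Q (\<lambda>z. f' (fst z) * (e (snd z) * \<eta> j (snd z)))"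
    by (rule product_test_function[OF smf(2) smooth_mult[OF sme(1) smooth_\<eta>] f0(2) z1 s])
  show "test_function Q (\<lambda>z. f' (fst z) * (e' (snd z) * \<eta> j (snd z)))"
    by (rule product_test_function[OF smf(2) smooth_mult[OF sme(2) smooth_\<eta>] f0(2) z2 s])
  show "test_function Q (\<lambda>z. f' (fst z) * (e (snd z) * spike j (snd z)))"
    by (rule product_test_function[OF smf(2) smooth_mult[OF sme(1) smooth_spike] f0(2) z3 s])
qed

text \<open>The boundary layer term, in which the vertical derivative falls on the cut-off. As j
  grows it concentrates on the base.\<close>

definition A :: "(real \<times> real \<Rightarrow> real) \<Rightarrow> nat \<Rightarrow> real" where
  "A w j = (LINT z|lebesgue. w z * (f' (fst z) * (e (snd z) * spike j (snd z))))"

text \<open>Trades the unbounded spike for the bounded cut-off at the cost of a derivative of w.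
  This gives bounds on the layer term that are uniform in j.\<close>

lemma vertical_parts:
  assumes w: "has_weak_gradient Q w g"
  shows "A w j = - (LINT z|lebesgue. (g z \<bullet> (0, 1)) * (f' (fst z) * (e (snd z) * \<eta> j (snd z))))
      - (LINT z|lebesgue. w z * (f' (fst z) * (e' (snd z) * \<eta> j (snd z))))"
proof -
  have lw: "locally_integrable Q w" using w unfolding has_weak_gradient_def by simp
  have d: "((\<lambda>y. e y * \<eta> j y) has_real_derivative (e' y * \<eta> j y + e y * spike j y)) (at y)" for y
    using DERIV_mult[OF de[of y] \<eta>_deriv[of j y]] by (simp add: algebra_simps)
  obtain f'' where f'': "\<And>x. (f' has_real_derivative f'' x) (at x)" "smooth f''"
    using smooth_derivE[OF smf(2)] by blast
  have fd: "frechet_derivative (\<lambda>z. f' (fst z) * (e (snd z) * \<eta> j (snd z))) (at z) (0, 1) =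
      f' (fst z) * (e' (snd z) * \<eta> j (snd z) + e (snd z) * spike j (snd z))" for z
    by (rule product_frechet(2)[OF f''(1) d])
  have i: "integrable lebesgue (\<lambda>z. w z * (f' (fst z) * (e' (snd z) * \<eta> j (snd z))))"
    "integrable lebesgue (\<lambda>z. w z * (f' (fst z) * (e (snd z) * spike j (snd z))))"
    using test_function_integrable(1)[OF lw test_functions(3)[of j]]
      test_function_integrable(1)[OF lw test_functions(4)[of j]]
    unfolding real_scaleR_def by (simp_all only: mult.commute[of "w _"])
  have "(LINT z|lebesgue. w z * (f' (fst z) * (e' (snd z) * \<eta> j (snd z) + e (snd z) * spike j (snd z)))) =
      - (LINT z|lebesgue. (g z \<bullet> (0, 1)) * (f' (fst z) * (e (snd z) * \<eta> j (snd z))))"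
    using has_weak_gradientD[OF w test_functions(2), of "(0, 1)" j] unfolding fd by (simp add: Basis_real_prod)
  moreover have "(LINT z|lebesgue. w z * (f' (fst z) * (e' (snd z) * \<eta> j (snd z) + e (snd z) * spike j (snd z)))) =
      (LINT z|lebesgue. w z * (f' (fst z) * (e' (snd z) * \<eta> j (snd z)))) + A w j"
    unfolding A_def distrib_left by (rule Bochner_Integration.integral_add[OF i])
  ultimately show ?thesis by linarith
qed

text \<open>The horizontal derivative is tested against \<open>f e' \<eta>\<close> and the vertical
  one against \<open>f' e \<eta>\<close>. The two integrals of \<open>w f' e' \<eta>\<close> cancel
  because the field is divergence free, and only the boundary layer remains.\<close>

lemma flux_approx:
  assumes w: "has_weak_gradient Q w g"
  shows "(LINT z|lebesgue. (g z \<bullet> (- (f (fst z) * e' (snd z)), f' (fst z) * e (snd z))) * \<eta> j (snd z)) = - A w j"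
proof -
  have lg: "locally_integrable Q g" using w unfolding has_weak_gradient_def by simp
  obtain E' where d: "\<And>y. ((\<lambda>y. e' y * \<eta> j y) has_real_derivative E' y) (at y)"
    using smooth_derivE[OF smooth_mult[OF sme(2) smooth_\<eta>]] by blast
  have fd: "frechet_derivative (\<lambda>z. f (fst z) * (e' (snd z) * \<eta> j (snd z))) (at z) (1, 0) =
      f' (fst z) * (e' (snd z) * \<eta> j (snd z))" for z
    by (rule product_frechet(1)[OF df d])
  have 1: "(LINT z|lebesgue. w z * (f' (fst z) * (e' (snd z) * \<eta> j (snd z)))) =
      - (LINT z|lebesgue. (g z \<bullet> (1, 0)) * (f (fst z) * (e' (snd z) * \<eta> j (snd z))))"
    using has_weak_gradientD[OF w test_functions(1), of "(1, 0)" j] unfolding fd by (simp add: Basis_real_prod)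
  have i: "integrable lebesgue (\<lambda>z. (g z \<bullet> (1, 0)) * (f (fst z) * (e' (snd z) * \<eta> j (snd z))))"
    "integrable lebesgue (\<lambda>z. (g z \<bullet> (0, 1)) * (f' (fst z) * (e (snd z) * \<eta> j (snd z))))"
    using integrable_inner_left[OF test_function_integrable(1)[OF lg test_functions(1)[of j]], of "(1, 0)"]
      integrable_inner_left[OF test_function_integrable(1)[OF lg test_functions(2)[of j]], of "(0, 1)"]
    by (simp_all add: mult.commute)
  have "(LINT z|lebesgue. (g z \<bullet> (- (f (fst z) * e' (snd z)), f' (fst z) * e (snd z))) * \<eta> j (snd z)) =
      (LINT z|lebesgue. (g z \<bullet> (0, 1)) * (f' (fst z) * (e (snd z) * \<eta> j (snd z))) -
        (g z \<bullet> (1, 0)) * (f (fst z) * (e' (snd z) * \<eta> j (snd z))))"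
    by (rule Bochner_Integration.integral_cong) (auto simp: inner_prod_def algebra_simps)
  also have "\<dots> = (LINT z|lebesgue. (g z \<bullet> (0, 1)) * (f' (fst z) * (e (snd z) * \<eta> j (snd z)))) -
      (LINT z|lebesgue. (g z \<bullet> (1, 0)) * (f (fst z) * (e' (snd z) * \<eta> j (snd z))))"
    using i by simp
  finally show ?thesis using vertical_parts[OF w, of j] 1 by simp
qed

lemma closure_Q: "closure Q = {a..b} \<times> {0..r}"
  unfolding Q_def closure_Times using ab r by simp

text \<open>For functions continuous up to the boundary, Fubini reduces the layer term to spikes on
  vertical lines, which pick out the value on the base.\<close>

lemma A_tendsto:
  assumes v: "continuous_on (closure Q) v"
  shows "A v \<longlonglongrightarrow> (LINT x|lborel. v (x, 0) * (f' x * e 0))"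
proof -
  define V where "V z = indicator (closure Q) z *\<^sub>R (v z * (f' (fst z) * e (snd z)))" for z
  have comp: "compact (closure Q)" unfolding closure_Q by (intro compact_Times compact_Icc)
  have cf: "continuous_on S f'" "continuous_on S e" for S
    by (rule smooth_continuous[OF smf(2)], rule smooth_continuous[OF sme(1)])
  have contV: "continuous_on (closure Q) (\<lambda>z. v z * (f' (fst z) * e (snd z)))"
    by (intro continuous_on_mult v continuous_on_compose2[OF cf(1)[of UNIV]] continuous_on_compose2[OF cf(2)[of UNIV]]
        continuous_on_fst continuous_on_snd continuous_on_id) simp_all
  have mV: "V \<in> borel_measurable borel"
    unfolding V_def by (rule borel_measurable_continuous_on_indicator[OF _ contV]) simp
  obtain B where B: "B > 0" "\<forall>z\<in>closure Q. \<bar>v z * (f' (fst z) * e (snd z))\<bar> \<le> B"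
    by (rule compact_abs_bound[OF comp contV])
  have VB: "\<bar>V z\<bar> \<le> B * indicator {a..b} (fst z)" for z
    using B by (cases "z \<in> closure Q") (auto simp: V_def closure_Q)
  have eq: "v z * (f' (fst z) * (e (snd z) * spike j (snd z))) = V z * spike j (snd z)" for z j
  proof (cases "z \<in> closure Q")
    case False
    then have "fst z \<notin> {a..b} \<or> snd z < 0 \<or> snd z > r" by (cases z) (auto simp: closure_Q)
    moreover have "f' (fst z) = 0" if "fst z \<notin> {a..b}" using that f0(2)[of "fst z"] sub by auto
    moreover have "spike j (snd z) = 0" if "snd z < 0"
    proof (rule spike_eq_0)
      have "0 < 1 / real (Suc j)" by simp
      then show "snd z \<notin> {1 / real (Suc j)..2 / real (Suc j)}" using that unfolding atLeastAtMost_iff by linarith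
    qed
    moreover have "e (snd z) = 0" if "snd z > r" using that e0(1)[of "snd z"] sub by auto
    ultimately show ?thesis using False by (auto simp: V_def)
  qed (simp add: V_def)
  have intV: "integrable (lborel \<Otimes>\<^sub>M lborel) (\<lambda>z. V z * spike j (snd z))" for j
  proof -
    have "integrable lborel (\<lambda>z. indicator (closure Q) z *\<^sub>R (v z * (f' (fst z) * e (snd z)) * spike j (snd z)))"
      by (intro borel_integrable_compact comp continuous_on_mult[OF contV]
          continuous_on_compose2[OF continuous_spike[of UNIV]] continuous_on_snd continuous_on_id) simp_all
    then show ?thesis by (simp add: V_def lborel_prod mult.assoc)
  qed
  have AV: "A v j = (LINT x|lborel. LINT y|lborel. V (x, y) * spike j y)" for j
  proof -
    have "A v j = (LINT z|lborel. V z * spike j (snd z))"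
      unfolding A_def eq
      by (rule integral_completion) (use borel_measurable_integrable[OF intV[of j]] in \<open>simp add: lborel_prod\<close>)
    also have "\<dots> = (LINT x|lborel. LINT y|lborel. V (x, y) * spike j y)"
      using lborel_pair.integral_fst'[OF intV[of j]] by (simp add: lborel_prod)
    finally show ?thesis .
  qed
  have Vx: "(\<lambda>y. V (x, y)) \<in> borel_measurable borel" for x
    by (rule measurable_compose[OF _ mV]) (simp add: borel_prod[symmetric])
  have inner: "(\<lambda>j. LINT y|lborel. V (x, y) * spike j (y - 0)) \<longlonglongrightarrow> V (x, 0)" for x
  proof (rule spike_tendsto[OF Vx, where B = B])
    show "\<bar>V (x, t)\<bar> \<le> B" for t
      using VB[of "(x, t)"] B(1) by (cases "x \<in> {a..b}") auto
    show "((\<lambda>y. V (x, y)) \<longlongrightarrow> V (x, 0)) (at_right 0)"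
    proof (cases "x \<in> {a..b}")
      case True
      have "continuous_on {0..r} (\<lambda>y. v (x, y) * (f' (fst (x, y)) * e (snd (x, y))))"
        by (rule continuous_on_compose2[OF contV]) (use True in \<open>auto simp: closure_Q intro!: continuous_intros\<close>)
      then have "((\<lambda>y. v (x, y) * (f' x * e y)) \<longlongrightarrow> v (x, 0) * (f' x * e 0)) (at 0 within {0..r})"
        using r by (auto simp: continuous_on_def)
      then have t: "((\<lambda>y. v (x, y) * (f' x * e y)) \<longlongrightarrow> v (x, 0) * (f' x * e 0)) (at_right 0)"
        using r by (simp add: at_within_Icc_at_right)
      have ev: "\<forall>\<^sub>F y in at_right 0. v (x, y) * (f' x * e y) = V (x, y)"
        unfolding eventually_at_right_field using r True by (auto simp: V_def closure_Q intro!: exI[of _ r])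
      have "v (x, 0) * (f' x * e 0) = V (x, 0)" using True r by (simp add: V_def closure_Q)
      with Lim_transform_eventually[OF t ev] show ?thesis by simp
    next
      case False
      then have "V (x, y) = 0" for y by (auto simp: V_def closure_Q)
      then show ?thesis by simp
    qed
  qed
  have "(\<lambda>j. LINT x|lborel. LINT y|lborel. V (x, y) * spike j y) \<longlonglongrightarrow> (LINT x|lborel. V (x, 0))"
  proof (rule integral_dominated_convergence[where w = "\<lambda>x. B * indicator {a..b} x"])
    show "(\<lambda>x. V (x, 0)) \<in> borel_measurable lborel"
      using measurable_compose[OF _ mV, of "\<lambda>x. (x, 0)" lborel] by (simp add: borel_prod[symmetric])
    show "(\<lambda>x. LINT y|lborel. V (x, y) * spike j y) \<in> borel_measurable lborel" for j
      using borel_measurable_integrable[OF lborel_pair.integrable_fst'[OF intV[of j]]] by simp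
    show "integrable lborel (\<lambda>x. B * indicator {a..b} x)"
      by (intro integrable_mult_right integrable_real_indicator) (use ab in simp_all)
    show "AE x in lborel. (\<lambda>j. LINT y|lborel. V (x, y) * spike j y) \<longlonglongrightarrow> V (x, 0)"
      using inner by (intro AE_I2) simp
    show "AE x in lborel. norm (LINT y|lborel. V (x, y) * spike j y) \<le> B * indicator {a..b} x" for j
    proof (rule AE_I2)
      fix x
      have sp: "integrable lborel (\<lambda>y. spike j y)" "(LINT y|lborel. spike j y) = 1"
        using integral_spike[of j 0] by simp_all
      have "integrable lborel (\<lambda>y. (B * indicator {a..b} x) * spike j y)" using sp(1) by simp
      moreover have "norm (V (x, y) * spike j y) \<le> (B * indicator {a..b} x) * spike j y" for y
        using mult_right_mono[OF VB[of "(x, y)"] spike_nonneg[of j y]] by (simp add: abs_mult spike_nonneg)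
      moreover have "integrable lborel (\<lambda>y. V (x, y) * spike j y)"
        by (rule Bochner_Integration.integrable_bound[OF calculation(1)])
           (use calculation(2) borel_measurable_times[OF Vx borel_measurable_continuous_onI[OF continuous_spike]]
             in \<open>auto intro!: order_trans[OF _ abs_ge_self] AE_I2\<close>)
      ultimately have "norm (LINT y|lborel. V (x, y) * spike j y) \<le> (LINT y|lborel. (B * indicator {a..b} x) * spike j y)"
        by (intro order_trans[OF integral_norm_bound] integral_mono integrable_norm)
      then show "norm (LINT y|lborel. V (x, y) * spike j y) \<le> B * indicator {a..b} x"
        using sp by simp
    qed
  qed
  then have "A v \<longlonglongrightarrow> (LINT x|lborel. V (x, 0))" unfolding AV[abs_def, symmetric] by (simp add: AV)
  also have "(LINT x|lborel. V (x, 0)) = (LINT x|lborel. v (x, 0) * (f' x * e 0))"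
  proof (rule Bochner_Integration.integral_cong)
    fix x
    show "V (x, 0) = v (x, 0) * (f' x * e 0)"
      using f0(2)[of x] sub r by (cases "x \<in> {a..b}") (auto simp: V_def closure_Q)
  qed simp
  finally show ?thesis .
qed

lemma integral_x_f': "(LINT x|lborel. x * (f' x * e 0)) = - (LINT x|lborel. f x * e 0)"
proof -
  have supp: "set_integrable lborel {a..b} F" "(LINT x|lborel. F x) = integral {a..b} F"
    if "continuous_on UNIV F" "\<And>x. x \<notin> {a'..b'} \<Longrightarrow> F x = 0" for F :: "real \<Rightarrow> real"
  proof -
    show i: "set_integrable lborel {a..b} F"
      unfolding set_integrable_def
      by (intro borel_integrable_compact continuous_on_subset[OF that(1)] compact_Icc subset_UNIV)
    have "(LINT x|lborel. F x) = (LINT x:{a..b}|lborel. F x)"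
      by (rule set_integral_eq_integral[symmetric]) (use that(2) sub in auto)
    then show "(LINT x|lborel. F x) = integral {a..b} F"
      using set_borel_integral_eq_integral(2)[OF i] by simp
  qed
  have c: "continuous_on UNIV f" "continuous_on UNIV f'"
    by (rule smooth_continuous[OF smf(1)], rule smooth_continuous[OF smf(2)])
  have 1: "(LINT x|lborel. f x) = integral {a..b} f" by (rule supp(2)[OF c(1) f0(1)])
  have 2: "(LINT x|lborel. x * f' x) = integral {a..b} (\<lambda>x. x * f' x)"
    by (rule supp(2)) (use f0(2) in \<open>auto intro!: continuous_on_mult continuous_on_id c\<close>)
  have "((\<lambda>x. f x + x * f' x) has_integral (b * f b - a * f a)) {a..b}"
  proof (rule fundamental_theorem_of_calculus)
    fix x
    have "((\<lambda>x. x * f x) has_real_derivative (f x + x * f' x)) (at x)"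
      using DERIV_mult[OF DERIV_ident df[of x]] by (simp only: mult_1 mult.commute)
    then show "((\<lambda>x. x * f x) has_vector_derivative (f x + x * f' x)) (at x within {a..b})"
      unfolding has_real_derivative_iff_has_vector_derivative by (rule has_vector_derivative_at_within)
  qed (use ab in simp)
  moreover have "f a = 0" "f b = 0" using f0(1)[of a] f0(1)[of b] sub by auto
  ultimately have "integral {a..b} (\<lambda>x. f x + x * f' x) = 0" by (simp add: integral_unique)
  moreover have "integral {a..b} (\<lambda>x. f x + x * f' x) = integral {a..b} f + integral {a..b} (\<lambda>x. x * f' x)"
    by (intro integral_add integrable_continuous_real continuous_on_mult continuous_on_id
        continuous_on_subset[OF c(1)] continuous_on_subset[OF c(2)] subset_UNIV)
  ultimately have "(LINT x|lborel. x * f' x) = - (LINT x|lborel. f x)" using 1 2 by simp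
  moreover have "(LINT x|lborel. x * (f' x * e 0)) = (LINT x|lborel. x * f' x) * e 0"
    by (subst mult.assoc[symmetric]) (rule integral_mult_left_zero)
  ultimately show ?thesis by simp
qed

text \<open>An approximation by functions continuous up to the boundary: the layer term is bounded
  by the \<open>W11_norm\<close> uniformly in j, so the approximations from the definition of the
  trace can be exchanged for u before j tends to infinity. Integration by parts on the base turns
  \<open>x f'\<close> into \<open>- f\<close>.\<close>

lemma A_tendsto_trace:
  assumes tr: "has_trace_rect a b r u (\<lambda>x. x)"
  shows "A u \<longlonglongrightarrow> - (LINT x|lborel. f x * e 0)"
proof -
  obtain v :: "nat \<Rightarrow> real \<times> real \<Rightarrow> real" where u: "u \<in> sobolev 1 Q"
    and v: "\<And>k. v k \<in> sobolev 1 Q" "\<And>k. continuous_on (closure Q) (v k)"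
    and W: "(\<lambda>k. W11_norm Q (\<lambda>z. v k z - u z)) \<longlonglongrightarrow> 0"
    and T: "(\<lambda>k. \<integral>\<^sup>+x\<in>{a<..<b}. ennreal \<bar>v k (x, 0) - x\<bar> \<partial>lebesgue) \<longlonglongrightarrow> 0"
    using tr unfolding has_trace_rect_def Let_def Q_def[symmetric] by blast
  define L where "L k = (LINT x|lborel. v k (x, 0) * (f' x * e 0))" for k
  have lim0: "A (v k) \<longlonglongrightarrow> L k" for k unfolding L_def by (rule A_tendsto[OF v(2)])
  have wg: "has_weak_gradient Q w (weak_gradient Q w)" if "w \<in> sobolev 1 Q" for w
    using that someI_ex[of "has_weak_gradient Q w"] unfolding sobolev_def weakly_differentiable_def weak_gradient_def
    by blast
  have comp: "compact (closure Q)" unfolding closure_Q by (intro compact_Times compact_Icc)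
  have cf: "continuous_on S f'" "continuous_on S e" "continuous_on S e'" for S
    by (rule smooth_continuous[OF smf(2)], rule smooth_continuous[OF sme(1)], rule smooth_continuous[OF sme(2)])
  obtain B1 where B1: "B1 > 0" "\<forall>x\<in>{a..b}. \<bar>f' x\<bar> \<le> B1" by (rule compact_abs_bound[OF compact_Icc cf(1)])
  obtain B2 where B2: "B2 > 0" "\<forall>x\<in>{0..r}. \<bar>e x\<bar> \<le> B2" by (rule compact_abs_bound[OF compact_Icc cf(2)])
  obtain B3 where B3: "B3 > 0" "\<forall>x\<in>{0..r}. \<bar>e' x\<bar> \<le> B3" by (rule compact_abs_bound[OF compact_Icc cf(3)])
  note B = B1(1) B2(1) B3(1) B1(2) B2(2) B3(2)
  define M where "M = B1 * (B2 + B3)"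
  have M: "\<bar>f' (fst z) * (e (snd z) * \<eta> j (snd z))\<bar> \<le> M * indicator Q z"
    "\<bar>f' (fst z) * (e' (snd z) * \<eta> j (snd z))\<bar> \<le> M * indicator Q z" for z j
  proof -
    have *: "\<bar>f' (fst z) * (E * \<eta> j (snd z))\<bar> \<le> M" if "z \<in> Q" "\<bar>E\<bar> \<le> B2 + B3" for E
    proof -
      have "\<bar>f' (fst z)\<bar> \<le> B1" using that(1) B by (auto simp: Q_def)
      moreover have "\<bar>E * \<eta> j (snd z)\<bar> \<le> (B2 + B3) * 1"
        unfolding abs_mult using that(2) \<eta>_bounds(1,2)[of _ "snd z"] B by (intro mult_mono) auto
      ultimately show ?thesis unfolding M_def abs_mult[of "f' (fst z)"] using B by (intro mult_mono) auto
    qed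
    have "\<bar>e (snd z)\<bar> \<le> B2 + B3" "\<bar>e' (snd z)\<bar> \<le> B2 + B3" if "z \<in> Q"
      using that B(2,3) B(5)[rule_format, of "snd z"] B(6)[rule_format, of "snd z"] by (auto simp: Q_def)
    then show "\<bar>f' (fst z) * (e (snd z) * \<eta> j (snd z))\<bar> \<le> M * indicator Q z"
      "\<bar>f' (fst z) * (e' (snd z) * \<eta> j (snd z))\<bar> \<le> M * indicator Q z"
      using * test_function_eq_0[OF test_functions(2), of z j] test_function_eq_0[OF test_functions(3), of z j]
      by (cases "z \<in> Q"; simp)+
  qed
  have M0: "M \<ge> 0" unfolding M_def using B by simp
  \<comment> \<open>The bound does not depend on j: after \<open>vertical_parts\<close> only the
    cut-off, never its derivative, appears.\<close>
  have bound: "ennreal \<bar>A w j\<bar> \<le> ennreal M * W11_norm Q w"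
    if g: "has_weak_gradient Q w (weak_gradient Q w)" for w j
  proof -
    have lw: "locally_integrable Q w" "locally_integrable Q (weak_gradient Q w)"
      using g unfolding has_weak_gradient_def by simp_all
    define G1 where "G1 z = (weak_gradient Q w z \<bullet> (0, 1)) * (f' (fst z) * (e (snd z) * \<eta> j (snd z)))" for z
    define G2 where "G2 z = w z * (f' (fst z) * (e' (snd z) * \<eta> j (snd z)))" for z
    have iG1: "integrable lebesgue G1"
      using integrable_inner_left[OF test_function_integrable(1)[OF lw(2) test_functions(2)[of j]], of "(0, 1)"]
      unfolding G1_def by (simp add: mult.commute)
    have iG2: "integrable lebesgue G2"
      using test_function_integrable(1)[OF lw(1) test_functions(3)[of j]] unfolding G2_def by (simp add: mult.commute)
    have nn: "(\<integral>\<^sup>+z. ennreal (norm (G z)) \<partial>lebesgue) \<le> ennreal M * (\<integral>\<^sup>+z\<in>Q. ennreal (norm (q z)) \<partial>lebesgue)"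
      if G: "\<And>z. norm (G z) \<le> norm (q z) * (M * indicator Q z)" and q: "locally_integrable Q q"
      for G :: "real \<times> real \<Rightarrow> real" and q :: "real \<times> real \<Rightarrow> 'z::euclidean_space"
    proof -
      have "open Q" unfolding Q_def by (intro open_Times open_greaterThanLessThan)
      note m = locally_integrable_measurable[OF this q]
      have "(\<integral>\<^sup>+z. ennreal (norm (G z)) \<partial>lebesgue) \<le> (\<integral>\<^sup>+z. ennreal M * ennreal (norm (indicator Q z *\<^sub>R q z)) \<partial>lebesgue)"
      proof (rule nn_integral_mono)
        fix z
        have "norm (G z) \<le> M * norm (indicator Q z *\<^sub>R q z)"
          using G[of z] by (cases "z \<in> Q") (auto simp: mult.commute)
        then show "ennreal (norm (G z)) \<le> ennreal M * ennreal (norm (indicator Q z *\<^sub>R q z))"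
          unfolding ennreal_mult'[OF M0, symmetric] by (rule ennreal_leI)
      qed
      also have "\<dots> = ennreal M * (\<integral>\<^sup>+z. ennreal (norm (indicator Q z *\<^sub>R q z)) \<partial>lebesgue)"
        by (rule nn_integral_cmult) (use m in measurable)
      also have "(\<integral>\<^sup>+z. ennreal (norm (indicator Q z *\<^sub>R q z)) \<partial>lebesgue) = (\<integral>\<^sup>+z\<in>Q. ennreal (norm (q z)) \<partial>lebesgue)"
        by (rule nn_integral_cong) (auto simp: indicator_def)
      finally show ?thesis .
    qed
    have n1: "norm (G1 z) \<le> norm (weak_gradient Q w z) * (M * indicator Q z)" for z
    proof -
      have "\<bar>weak_gradient Q w z \<bullet> (0, 1)\<bar> \<le> norm (weak_gradient Q w z)"
        using Cauchy_Schwarz_ineq2[of "weak_gradient Q w z" "(0, 1)"] by simp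
      then show ?thesis unfolding G1_def real_norm_def abs_mult[of "weak_gradient Q w z \<bullet> (0, 1)"]
        by (intro mult_mono M) auto
    qed
    have n2: "norm (G2 z) \<le> norm (w z) * (M * indicator Q z)" for z
      unfolding G2_def real_norm_def abs_mult[of "w z"] by (intro mult_left_mono M) auto
    have "ennreal \<bar>A w j\<bar> \<le> ennreal (\<bar>integral\<^sup>L lebesgue G1\<bar> + \<bar>integral\<^sup>L lebesgue G2\<bar>)"
      unfolding vertical_parts[OF g] G1_def[symmetric] G2_def[symmetric] by (intro ennreal_leI) linarith
    also have "\<dots> = ennreal (norm (integral\<^sup>L lebesgue G1)) + ennreal (norm (integral\<^sup>L lebesgue G2))"
      by (simp add: ennreal_plus)
    also have "\<dots> \<le> ennreal M * (\<integral>\<^sup>+z\<in>Q. ennreal (norm (weak_gradient Q w z)) \<partial>lebesgue) +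
        ennreal M * (\<integral>\<^sup>+z\<in>Q. ennreal (norm (w z)) \<partial>lebesgue)"
      by (intro add_mono order_trans[OF integral_norm_bound_ennreal[OF iG1] nn[OF n1 lw(2)]]
          order_trans[OF integral_norm_bound_ennreal[OF iG2] nn[OF n2 lw(1)]])
    also have "\<dots> = ennreal M * W11_norm Q w"
      unfolding W11_norm_def by (simp add: distrib_left add.commute)
    finally show ?thesis .
  qed
  define L0 where "L0 = (LINT x|lborel. x * (f' x * e 0))"
  have Lbound: "ennreal \<bar>L k - L0\<bar> \<le> ennreal M * (\<integral>\<^sup>+x\<in>{a<..<b}. ennreal \<bar>v k (x, 0) - x\<bar> \<partial>lebesgue)" for k
  proof -
    have int: "integrable lborel (\<lambda>x. F x * (f' x * e 0))" and
      meas: "(\<lambda>x. indicator {a..b} x *\<^sub>R F x) \<in> borel_measurable lborel"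
      if "continuous_on {a..b} F" for F :: "real \<Rightarrow> real"
    proof -
      have "integrable lborel (\<lambda>x. indicator {a..b} x *\<^sub>R (F x * (f' x * e 0)))"
        by (intro borel_integrable_compact compact_Icc continuous_on_mult that cf continuous_on_const)
      also have "(\<lambda>x. indicator {a..b} x *\<^sub>R (F x * (f' x * e 0))) = (\<lambda>x. F x * (f' x * e 0))"
      proof
        fix x
        show "indicator {a..b} x *\<^sub>R (F x * (f' x * e 0)) = F x * (f' x * e 0)"
          using f0(2)[of x] sub by (cases "x \<in> {a..b}") auto
      qed
      finally show "integrable lborel (\<lambda>x. F x * (f' x * e 0))" .
      show "(\<lambda>x. indicator {a..b} x *\<^sub>R F x) \<in> borel_measurable lborel"
        using borel_integrable_compact[OF compact_Icc that] by simp
    qed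
    have cv: "continuous_on {a..b} (\<lambda>x. v k (x, 0))"
      by (rule continuous_on_compose2[OF v(2)]) (use r in \<open>auto simp: closure_Q intro!: continuous_intros\<close>)
    define D where "D x = (v k (x, 0) - x) * (f' x * e 0)" for x
    have cD: "continuous_on {a..b} (\<lambda>x. v k (x, 0) - x)" by (intro continuous_on_diff cv continuous_on_id)
    have iD: "integrable lborel D" unfolding D_def by (rule int[OF cD])
    have "L k - L0 = integral\<^sup>L lborel D"
      unfolding L_def L0_def D_def left_diff_distrib
      using int[OF cv] int[OF continuous_on_id] by simp
    then have "ennreal \<bar>L k - L0\<bar> \<le> (\<integral>\<^sup>+x. ennreal (norm (D x)) \<partial>lborel)"
      using integral_norm_bound_ennreal[OF iD] by simp
    also have "\<dots> \<le> (\<integral>\<^sup>+x. ennreal M * ennreal (norm (indicator {a..b} x *\<^sub>R (v k (x, 0) - x)) * indicator {a<..<b} x) \<partial>lborel)"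
    proof (rule nn_integral_mono)
      fix x
      have "norm (D x) \<le> M * (norm (indicator {a..b} x *\<^sub>R (v k (x, 0) - x)) * indicator {a<..<b} x)"
      proof (cases "x \<in> {a<..<b}")
        case True
        have "\<bar>e 0\<bar> \<le> B2 + B3" using bspec[OF B(5), of 0] B(3) r by auto
        moreover have "\<bar>f' x\<bar> \<le> B1" using bspec[OF B(4), of x] True by auto
        ultimately have "\<bar>f' x * e 0\<bar> \<le> B1 * (B2 + B3)"
          unfolding abs_mult using B(1) by (intro mult_mono) auto
        then have "\<bar>v k (x, 0) - x\<bar> * \<bar>f' x * e 0\<bar> \<le> \<bar>v k (x, 0) - x\<bar> * M"
          unfolding M_def by (intro mult_left_mono) auto
        then show ?thesis using True unfolding D_def abs_mult[of "v k (x, 0) - x"] real_norm_def by (simp add: mult.commute)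
      next
        case False
        then have "f' x = 0" using f0(2)[of x] sub by auto
        then show ?thesis using False by (simp add: D_def)
      qed
      then show "ennreal (norm (D x)) \<le> ennreal M * ennreal (norm (indicator {a..b} x *\<^sub>R (v k (x, 0) - x)) * indicator {a<..<b} x)"
        unfolding ennreal_mult'[OF M0, symmetric] by (rule ennreal_leI)
    qed
    also have "\<dots> = ennreal M * (\<integral>\<^sup>+x. ennreal (norm (indicator {a..b} x *\<^sub>R (v k (x, 0) - x)) * indicator {a<..<b} x) \<partial>lborel)"
    proof -
      have "(\<lambda>x. norm (indicator {a..b} x *\<^sub>R (v k (x, 0) - x)) * indicator {a<..<b} x) \<in> borel_measurable lborel"
        by (rule borel_measurable_times[OF measurable_compose[OF meas[OF cD] borel_measurable_norm] borel_measurable_indicator]) simp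
      from nn_integral_cmult[OF measurable_compose[OF this measurable_ennreal]] show ?thesis .
    qed
    also have "(\<integral>\<^sup>+x. ennreal (norm (indicator {a..b} x *\<^sub>R (v k (x, 0) - x)) * indicator {a<..<b} x) \<partial>lborel) =
        (\<integral>\<^sup>+x\<in>{a<..<b}. ennreal \<bar>v k (x, 0) - x\<bar> \<partial>lebesgue)"
      unfolding nn_integral_completion by (rule nn_integral_cong) (auto simp: indicator_def)
    finally show ?thesis .
  qed
  have small: "\<forall>\<^sub>F k in sequentially. ennreal M * X k < ennreal \<epsilon>" if "X \<longlonglongrightarrow> 0" "0 < \<epsilon>" for X \<epsilon>
  proof -
    have "(\<lambda>k. ennreal M * X k) \<longlonglongrightarrow> ennreal M * 0"
      by (rule ennreal_tendsto_cmult[OF _ that(1)]) simp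
    then show ?thesis by (rule order_tendstoD) (use that(2) in simp)
  qed
  have "A u \<longlonglongrightarrow> L0"
  proof (rule tendstoI)
    fix \<epsilon> :: real assume "0 < \<epsilon>"
    then have \<epsilon>: "0 < \<epsilon> / 3" by simp
    obtain k where k: "ennreal M * W11_norm Q (\<lambda>z. v k z - u z) < ennreal (\<epsilon> / 3)"
      "ennreal M * (\<integral>\<^sup>+x\<in>{a<..<b}. ennreal \<bar>v k (x, 0) - x\<bar> \<partial>lebesgue) < ennreal (\<epsilon> / 3)"
      using eventually_happens'[OF _ eventually_conj[OF small[OF W \<epsilon>] small[OF T \<epsilon>]]] by auto
    \<comment> \<open>\<open>W11_norm\<close> is computed with the chosen gradient of the
      difference, which need not be the difference of the chosen gradients; the bound must be
      applied to that choice.\<close>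
    have wd: "has_weak_gradient Q (\<lambda>z. v k z - u z) (weak_gradient Q (\<lambda>z. v k z - u z))"
      unfolding weak_gradient_def
      by (rule someI[of "has_weak_gradient Q (\<lambda>z. v k z - u z)", OF has_weak_gradient_diff[OF wg[OF v(1)] wg[OF u]]])
    have Ad: "A (\<lambda>z. v k z - u z) j = A (v k) j - A u j" for j
    proof -
      have lw: "locally_integrable Q (v k)" "locally_integrable Q u"
        using wg[OF v(1)[of k]] wg[OF u] unfolding has_weak_gradient_def by simp_all
      show ?thesis
        using test_function_integrable(1)[OF lw(1) test_functions(4)[of j]]
          test_function_integrable(1)[OF lw(2) test_functions(4)[of j]]
        unfolding A_def left_diff_distrib by (simp add: mult.commute)
    qed
    have e1: "\<bar>A (v k) j - A u j\<bar> < \<epsilon> / 3" for j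
      using order_le_less_trans[OF bound[OF wd, of j] k(1)] \<epsilon> by (simp add: Ad ennreal_less_iff)
    have e2: "\<bar>L k - L0\<bar> < \<epsilon> / 3"
      using order_le_less_trans[OF Lbound[of k] k(2)] \<epsilon> by (simp add: ennreal_less_iff)
    have "\<forall>\<^sub>F j in sequentially. dist (A (v k) j) (L k) < \<epsilon> / 3" using tendstoD[OF lim0 \<epsilon>] .
    then show "\<forall>\<^sub>F j in sequentially. dist (A u j) L0 < \<epsilon>"
    proof eventually_elim
      case (elim j)
      then show ?case using e1[of j] e2 unfolding dist_real_def by linarith
    qed
  qed
  then show ?thesis unfolding L0_def integral_x_f' .
qed

text \<open>Removing the cut-off by dominated convergence. The pairing depends on u only through its
  boundary value x, so it can be evaluated without knowing u.\<close>

theorem flux: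
  assumes tr: "has_trace_rect a b r u (\<lambda>x. x)" and w: "has_weak_gradient Q u g"
    and ig: "integrable lebesgue (\<lambda>z. indicator Q z *\<^sub>R g z)"
  shows "(LINT z:Q|lebesgue. g z \<bullet> (- (f (fst z) * e' (snd z)), f' (fst z) * e (snd z))) = (LINT x|lborel. f x * e 0)"
proof -
  define p where "p z = (- (f (fst z) * e' (snd z)), f' (fst z) * e (snd z))" for z
  have cp: "continuous_on S p" for S
    unfolding p_def
    by (intro continuous_on_Pair continuous_on_minus continuous_on_mult
        continuous_on_compose2[OF smooth_continuous[OF smf(1), of UNIV]] continuous_on_compose2[OF smooth_continuous[OF smf(2), of UNIV]]
        continuous_on_compose2[OF smooth_continuous[OF sme(1), of UNIV]] continuous_on_compose2[OF smooth_continuous[OF sme(2), of UNIV]]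
        continuous_on_fst continuous_on_snd continuous_on_id) simp_all
  have comp: "compact (closure Q)" unfolding closure_Q by (intro compact_Times compact_Icc)
  have "continuous_on (closure Q) (\<lambda>z. norm (p z))" by (intro continuous_on_norm cp)
  then obtain B where B: "B > 0" "\<forall>z\<in>closure Q. \<bar>norm (p z)\<bar> \<le> B" by (rule compact_abs_bound[OF comp])
  have m: "(\<lambda>z. indicator Q z *\<^sub>R (g z \<bullet> p z)) \<in> borel_measurable lebesgue"
  proof -
    have "(\<lambda>z. (indicator Q z *\<^sub>R g z) \<bullet> p z) \<in> borel_measurable lebesgue"
      by (intro borel_measurable_inner borel_measurable_integrable[OF ig] borel_measurable_lebesgue_continuous(1) cp)
    then show ?thesis by simp
  qed
  have "(\<lambda>j. LINT z|lebesgue. indicator Q z *\<^sub>R (g z \<bullet> p z) * \<eta> j (snd z)) \<longlonglongrightarrow>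
      (LINT z|lebesgue. indicator Q z *\<^sub>R (g z \<bullet> p z))"
  proof (rule integral_dominated_convergence[where w = "\<lambda>z. B * norm (indicator Q z *\<^sub>R g z)"])
    show "integrable lebesgue (\<lambda>z. B * norm (indicator Q z *\<^sub>R g z))"
      by (intro integrable_mult_right integrable_norm ig)
    show "(\<lambda>z. indicator Q z *\<^sub>R (g z \<bullet> p z) * \<eta> j (snd z)) \<in> borel_measurable lebesgue" for j
      by (intro borel_measurable_times m borel_measurable_lebesgue_continuous(1)
          continuous_on_compose2[OF smooth_continuous[OF smooth_\<eta>, of UNIV]] continuous_on_snd continuous_on_id) simp
    show "AE z in lebesgue. norm (indicator Q z *\<^sub>R (g z \<bullet> p z) * \<eta> j (snd z)) \<le> B * norm (indicator Q z *\<^sub>R g z)" for j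
    proof (rule AE_I2)
      fix z
      show "norm (indicator Q z *\<^sub>R (g z \<bullet> p z) * \<eta> j (snd z)) \<le> B * norm (indicator Q z *\<^sub>R g z)"
      proof (cases "z \<in> Q")
        case True
        then have "norm (p z) \<le> B" using B(2) closure_subset[of Q] by auto
        then have "\<bar>g z \<bullet> p z\<bar> \<le> norm (g z) * B"
          by (intro order_trans[OF Cauchy_Schwarz_ineq2] mult_left_mono) auto
        then have "\<bar>g z \<bullet> p z\<bar> * \<bar>\<eta> j (snd z)\<bar> \<le> norm (g z) * B * 1"
          using \<eta>_bounds(1,2)[of _ "snd z"] B(1) by (intro mult_mono) auto
        then show ?thesis using True by (simp add: abs_mult mult.commute)
      qed simp
    qed
    show "AE z in lebesgue. (\<lambda>j. indicator Q z *\<^sub>R (g z \<bullet> p z) * \<eta> j (snd z)) \<longlonglongrightarrow> indicator Q z *\<^sub>R (g z \<bullet> p z)"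
    proof (rule AE_I2)
      fix z
      show "(\<lambda>j. indicator Q z *\<^sub>R (g z \<bullet> p z) * \<eta> j (snd z)) \<longlonglongrightarrow> indicator Q z *\<^sub>R (g z \<bullet> p z)"
      proof (cases "z \<in> Q")
        case True
        then have "(\<lambda>j. \<eta> j (snd z)) \<longlonglongrightarrow> 1"
          using sstep_tendsto[of "snd z"] unfolding \<eta>_def by (auto simp: Q_def)
        from tendsto_mult[OF tendsto_const this] show ?thesis by simp
      qed simp
    qed
  qed (rule m)
  moreover have "(LINT z|lebesgue. indicator Q z *\<^sub>R (g z \<bullet> p z) * \<eta> j (snd z)) = - A u j" for j
  proof -
    have "indicator Q z *\<^sub>R (g z \<bullet> p z) * \<eta> j (snd z) = (g z \<bullet> p z) * \<eta> j (snd z)" for z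
    proof (cases "z \<in> Q")
      case False
      then have "f (fst z) * (e' (snd z) * \<eta> j (snd z)) = 0" "f' (fst z) * (e (snd z) * \<eta> j (snd z)) = 0"
        using test_function_eq_0[OF test_functions(1), of z j] test_function_eq_0[OF test_functions(2), of z j] by simp_all
      then have eq0: "\<eta> j (snd z) *\<^sub>R p z = 0" by (auto simp: p_def zero_prod_def)
      have "g z \<bullet> (\<eta> j (snd z) *\<^sub>R p z) = 0" unfolding eq0 by (rule inner_zero_right)
      then have "(g z \<bullet> p z) * \<eta> j (snd z) = 0" by (simp only: inner_scaleR_right mult.commute)
      then show ?thesis using False by simp
    qed simp
    then show ?thesis using flux_approx[OF w, of j] by (simp only: p_def)
  qed
  ultimately have "(\<lambda>j. - A u j) \<longlonglongrightarrow> (LINT z|lebesgue. indicator Q z *\<^sub>R (g z \<bullet> p z))" by simp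
  from LIMSEQ_unique[OF this tendsto_minus[OF A_tendsto_trace[OF tr]]]
  show ?thesis unfolding set_lebesgue_integral_def p_def by simp
qed

end

section \<open>Divergence-free fields that vanish only on the three free sides\<close>

lemma smooth_deriv_of:
  fixes f :: "real \<Rightarrow> real"
  assumes "smooth f" and df: "\<And>x. (f has_real_derivative f' x) (at x)"
  shows "smooth f'"
proof -
  obtain s where s: "\<And>x. (f has_real_derivative s x) (at x)" "smooth s"
    using smooth_derivE[OF assms(1)] by blast
  have eq: "f' = s" by (rule ext) (rule DERIV_unique[OF df s(1)])
  show ?thesis unfolding eq by (rule s(2))
qed

lemma smooth_bounds_Icc:
  fixes f :: "real \<Rightarrow> real"
  assumes sm: "smooth f" and df: "\<And>x. (f has_real_derivative f' x) (at x)"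
  obtains \<Lambda> where "\<Lambda> > 0" "\<forall>x\<in>{a..b}. \<bar>f x\<bar> \<le> \<Lambda>" "\<forall>x\<in>{a..b}. \<bar>f' x\<bar> \<le> \<Lambda>"
    "\<forall>x\<in>{a..b}. \<forall>y\<in>{a..b}. \<bar>f x - f y\<bar> \<le> \<Lambda> * \<bar>x - y\<bar>"
proof -
  obtain B1 where B1: "B1 > 0" "\<forall>x\<in>{a..b}. \<bar>f x\<bar> \<le> B1"
    by (rule compact_abs_bound[OF compact_Icc smooth_continuous[OF sm]])
  obtain B2 where B2: "B2 > 0" "\<forall>x\<in>{a..b}. \<bar>f' x\<bar> \<le> B2"
    by (rule compact_abs_bound[OF compact_Icc smooth_continuous[OF smooth_deriv_of[OF sm df]]])
  have L: "\<bar>f x - f y\<bar> \<le> (B1 + B2) * \<bar>x - y\<bar>" if "x \<in> {a..b}" "y \<in> {a..b}" for x y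
  proof -
    have "norm (f x - f y) \<le> (B1 + B2) * norm (x - y)"
    proof (rule field_differentiable_bound[of "{a..b}" f f'])
      show "(f has_field_derivative f' z) (at z within {a..b})" for z
        by (rule has_field_derivative_at_within[OF df])
      show "norm (f' z) \<le> B1 + B2" if "z \<in> {a..b}" for z
        using bspec[OF B2(2) that] B1(1) by simp
    qed (use that in simp_all)
    then show ?thesis by simp
  qed
  show ?thesis
    by (rule that[of "B1 + B2"]) (use B1 B2 L in \<open>auto intro: order_trans\<close>)
qed

text \<open>A spike has height of order j at distance of order 1/j, so its product with anything
  vanishing linearly at that end stays bounded uniformly in j.\<close>

lemma spike_mult_bound:
  obtains B where "B > 0" "\<forall>j t. spike j t * \<bar>t\<bar> \<le> B"
proof -
  obtain B where B: "B > 0" "\<forall>x. deriv sstep x \<le> B" by (rule deriv_sstep_bounded)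
  have "spike j t * \<bar>t\<bar> \<le> 2 * B" for j t
  proof (cases "t \<in> {1 / Suc j..2 / Suc j}")
    case True
    then have "t > 0" by (auto intro: less_le_trans[of 0 "1 / real (Suc j)"] simp del: of_nat_Suc)
    moreover have "real (Suc j) * t \<le> 2" using True by (simp add: field_simps del: of_nat_Suc)
    ultimately have "(real (Suc j) * t) * deriv sstep (real (Suc j) * t - 1) \<le> 2 * B"
      using B deriv_sstep_nonneg by (intro mult_mono) auto
    then show ?thesis using \<open>t > 0\<close> by (simp add: spike_def mult_ac)
  next
    case False
    then show ?thesis using spike_eq_0[OF False] B(1) by simp
  qed
  then show ?thesis using that[of "2 * B"] B(1) by simp
qed

lemma sstep_reflect_deriv:
  "((\<lambda>t. sstep (real (Suc j) * (b - t) - 1)) has_real_derivative - spike j (b - t)) (at t)"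
proof -
  have "((\<lambda>t. b - t) has_real_derivative - 1) (at t)" by (auto intro!: derivative_eq_intros)
  from DERIV_chain2[where f = "\<lambda>t. sstep (real (Suc j) * (t - 0) - 1)" and g = "\<lambda>t. b - t", OF sstep_affine_deriv this]
  show ?thesis by simp
qed

lemma spike_tendsto_0: "0 < d \<Longrightarrow> (\<lambda>j. spike j d) \<longlonglongrightarrow> 0"
proof (rule tendsto_eventually)
  assume "0 < d"
  then have "\<forall>\<^sub>F j in sequentially. 2 / real (Suc j) < d" by real_asymp
  then show "\<forall>\<^sub>F j in sequentially. spike j d = 0"
    by eventually_elim (rule spike_eq_0, simp)
qed

text \<open>Relaxes compact support: the factors merely vanish on the sides and on the top. They are
  multiplied by cut-offs there; the spikes produced by differentiating hit factors that vanish at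
  the same end, so dominated convergence removes the cut-offs again.\<close>

lemma flux_boundary_zero:
  fixes s s' E E' :: "real \<Rightarrow> real" and a b r :: real
  defines "Q \<equiv> {a<..<b} \<times> {0<..<r}"
  assumes ab: "a < b" and r: "0 < r"
    and ds: "\<And>x. (s has_real_derivative s' x) (at x)" and dE: "\<And>y. (E has_real_derivative E' y) (at y)"
    and sms: "smooth s" and smE: "smooth E" and s0: "s a = 0" "s b = 0" and Er: "E r = 0"
    and tr: "has_trace_rect a b r u (\<lambda>x. x)" and w: "has_weak_gradient Q u g"
    and ig: "integrable lebesgue (\<lambda>z. indicator Q z *\<^sub>R g z)"
  shows "(LINT z:Q|lebesgue. g z \<bullet> (- (s (fst z) * E' (snd z)), s' (fst z) * E (snd z))) = integral {a..b} s * E 0"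
proof -
  obtain \<Lambda> where \<Lambda>: "\<Lambda> > 0" "\<forall>x\<in>{a..b}. \<bar>s x\<bar> \<le> \<Lambda>" "\<forall>x\<in>{a..b}. \<bar>s' x\<bar> \<le> \<Lambda>"
    "\<forall>x\<in>{a..b}. \<forall>y\<in>{a..b}. \<bar>s x - s y\<bar> \<le> \<Lambda> * \<bar>x - y\<bar>" by (rule smooth_bounds_Icc[OF sms ds])
  obtain M where M: "M > 0" "\<forall>y\<in>{0..r}. \<bar>E y\<bar> \<le> M" "\<forall>y\<in>{0..r}. \<bar>E' y\<bar> \<le> M"
    "\<forall>x\<in>{0..r}. \<forall>y\<in>{0..r}. \<bar>E x - E y\<bar> \<le> M * \<bar>x - y\<bar>" by (rule smooth_bounds_Icc[OF smE dE])
  obtain B where B: "B > 0" "\<forall>j t. spike j t * \<bar>t\<bar> \<le> B" by (rule spike_mult_bound)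
  define Y where "Y c j t = sstep (real (Suc j) * (c - t) - 1)" for c j t
  define Z where "Z j t = sstep (real (Suc j) * (t - a) - 1)" for j t
  define f where "f j x = Z j x * Y b j x * s x" for j x
  define f' where "f' j x = (spike j (x - a) * Y b j x - Z j x * spike j (b - x)) * s x + Z j x * Y b j x * s' x" for j x
  define e where "e j y = Y r j y * E y" for j y
  define e' where "e' j y = - spike j (r - y) * E y + Y r j y * E' y" for j y
  have Yd: "(Y c j has_real_derivative - spike j (c - t)) (at t)" for c j t
    unfolding Y_def by (rule sstep_reflect_deriv)
  have Zd: "(Z j has_real_derivative spike j (t - a)) (at t)" for j t
    unfolding Z_def by (rule sstep_affine_deriv)
  have df: "(f j has_real_derivative f' j x) (at x)" for j x
    using DERIV_mult[OF DERIV_mult[OF Zd[of j x] Yd[of b j x]] ds[of x]]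
    unfolding f_def f'_def by (simp add: algebra_simps)
  have de: "(e j has_real_derivative e' j y) (at y)" for j y
    using DERIV_mult[OF Yd[of r j y] dE[of y]] unfolding e_def e'_def by (simp add: algebra_simps)
  have smY: "smooth (Y c j)" for c j
  proof -
    have eq: "Y c j = (\<lambda>t. sstep ((- real (Suc j)) * t + (real (Suc j) * c - 1)))"
      by (auto simp: Y_def fun_eq_iff algebra_simps)
    show ?thesis unfolding eq by (rule smooth_sstep_affine)
  qed
  have smZ: "smooth (Z j)" for j
  proof -
    have eq: "Z j = (\<lambda>t. sstep (real (Suc j) * t + (- real (Suc j) * a - 1)))"
      by (auto simp: Z_def fun_eq_iff algebra_simps)
    show ?thesis unfolding eq by (rule smooth_sstep_affine)
  qed
  have smf: "smooth (f j)" for j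
    unfolding f_def by (rule smooth_mult[OF smooth_mult[OF smZ smY] sms])
  have sme: "smooth (e j)" for j
    unfolding e_def by (rule smooth_mult[OF smY smE])
  have YZ: "0 \<le> Y c j t" "Y c j t \<le> 1" "0 \<le> Z j t" "Z j t \<le> 1" for c j t
    by (auto simp: Y_def Z_def sstep_bounds)
  have Yz: "Y c j t = 0" "spike j (c - t) = 0" if "c - 1 / real (Suc j) < t" for c j t
  proof -
    have lt: "c - t < 1 / real (Suc j)" using that by simp
    then have "real (Suc j) * (c - t) < 1" by (simp add: field_simps del: of_nat_Suc)
    then show "Y c j t = 0" unfolding Y_def by (intro sstep(3)) simp
    show "spike j (c - t) = 0" by (rule spike_eq_0) (use lt in auto)
  qed
  have Zz: "Z j t = 0" "spike j (t - a) = 0" if "t < a + 1 / real (Suc j)" for j t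
  proof -
    have lt: "t - a < 1 / real (Suc j)" using that by simp
    then have "real (Suc j) * (t - a) < 1" by (simp add: field_simps del: of_nat_Suc)
    then show "Z j t = 0" unfolding Z_def by (intro sstep(3)) simp
    show "spike j (t - a) = 0" by (rule spike_eq_0) (use lt in auto)
  qed
  define p where "p j z = (- (f j (fst z) * e' j (snd z)), f' j (fst z) * e j (snd z))" for j z
  define q where "q z = (- (s (fst z) * E' (snd z)), s' (fst z) * E (snd z))" for z
  have flux: "(LINT z:Q|lebesgue. g z \<bullet> p j z) = (LINT x|lborel. f j x * e j 0)" for j
  proof -
    interpret rp: rectangle_profile a b r "f j" "f' j" "e j" "e' j" "a + 1 / real (Suc j)" "b - 1 / real (Suc j)" "r - 1 / real (Suc j)"
    proof
      have pos: "0 < 1 / real (Suc j)" by simp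
      then show "a < a + 1 / real (Suc j)" "b - 1 / real (Suc j) < b" "r - 1 / real (Suc j) < r" by linarith+
      show "smooth (f' j)" by (rule smooth_deriv_of[OF smf df])
      show "smooth (e' j)" by (rule smooth_deriv_of[OF sme de])
      show "f j x = 0" "f' j x = 0" if "x \<notin> {a + 1 / real (Suc j)..b - 1 / real (Suc j)}" for x
      proof -
        have "x < a + 1 / real (Suc j) \<or> b - 1 / real (Suc j) < x" using that by auto
        then show "f j x = 0" "f' j x = 0"
          using Zz[of x j] Yz[of b j x] unfolding f_def f'_def by auto
      qed
      show "e j y = 0" "e' j y = 0" if "r - 1 / real (Suc j) < y" for y
        using Yz[OF that] unfolding e_def e'_def by simp_all
    qed (use ab r df de smf sme in auto)
    have Q: "rp.Q = Q" unfolding rp.Q_def Q_def ..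
    show ?thesis using rp.flux[OF tr] w ig unfolding Q p_def by simp
  qed
  \<comment> \<open>Each lateral cut-off costs one spike, bounded by \<open>B * \<Lambda>\<close>
    since s vanishes at that end; together with the undifferentiated cut-offs times
    \<open>s'\<close> this gives the factor 2 B + 1.\<close>
  have bounds: "\<bar>f j x\<bar> \<le> \<Lambda>" "\<bar>f' j x\<bar> \<le> (2 * B + 1) * \<Lambda>" if x: "x \<in> {a..b}" for j x
  proof -
    have YZ1: "\<bar>Z j x * Y b j x\<bar> \<le> 1" using YZ by (simp add: abs_mult mult_le_one)
    have "\<bar>Z j x * Y b j x\<bar> * \<bar>s x\<bar> \<le> 1 * \<Lambda>" using YZ1 \<Lambda> x by (intro mult_mono) auto
    then show "\<bar>f j x\<bar> \<le> \<Lambda>" by (simp add: f_def abs_mult)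
    have sa: "\<bar>s x\<bar> \<le> \<Lambda> * \<bar>x - a\<bar>" "\<bar>s x\<bar> \<le> \<Lambda> * \<bar>b - x\<bar>"
      using \<Lambda>(4)[rule_format, of x a] \<Lambda>(4)[rule_format, of x b] x ab s0 by (auto simp: abs_minus_commute)
    have one: "\<bar>spike j d * c * s x\<bar> \<le> B * \<Lambda>" if "0 \<le> c" "c \<le> 1" "\<bar>s x\<bar> \<le> \<Lambda> * \<bar>d\<bar>" for c d
    proof -
      have "\<bar>spike j d * c * s x\<bar> = (spike j d * \<bar>s x\<bar>) * c" using that by (simp add: abs_mult spike_nonneg)
      also have "\<dots> \<le> (spike j d * (\<Lambda> * \<bar>d\<bar>)) * 1"
        using that spike_nonneg[of j d] \<Lambda>(1) by (intro mult_mono mult_nonneg_nonneg) auto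
      also have "\<dots> = (spike j d * \<bar>d\<bar>) * \<Lambda>" by simp
      also have "\<dots> \<le> B * \<Lambda>" using B \<Lambda>(1) by (intro mult_right_mono) auto
      finally show ?thesis .
    qed
    have "f' j x = spike j (x - a) * Y b j x * s x - spike j (b - x) * Z j x * s x + Z j x * Y b j x * s' x"
      by (simp add: f'_def algebra_simps)
    moreover have "\<bar>Z j x * Y b j x * s' x\<bar> \<le> 1 * \<Lambda>"
      unfolding abs_mult[of "Z j x * Y b j x"] using YZ1 \<Lambda> x by (intro mult_mono) auto
    moreover note one[of "Y b j x" "x - a"] one[of "Z j x" "b - x"]
    ultimately have "\<bar>f' j x\<bar> \<le> B * \<Lambda> + B * \<Lambda> + 1 * \<Lambda>" using YZ sa by (smt (verit))
    also have "\<dots> = (2 * B + 1) * \<Lambda>" by (simp add: algebra_simps)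
    finally show "\<bar>f' j x\<bar> \<le> (2 * B + 1) * \<Lambda>" .
  qed
  have ebounds: "\<bar>e j y\<bar> \<le> M" "\<bar>e' j y\<bar> \<le> (B + 1) * M" if y: "y \<in> {0..r}" for j y
  proof -
    have "\<bar>Y r j y\<bar> * \<bar>E y\<bar> \<le> 1 * M" using YZ M y by (intro mult_mono) auto
    then show "\<bar>e j y\<bar> \<le> M" by (simp add: e_def abs_mult)
    have Ey: "\<bar>E y\<bar> \<le> M * \<bar>r - y\<bar>" using M(4)[rule_format, of y r] y r Er by (auto simp: abs_minus_commute)
    have "\<bar>spike j (r - y) * E y\<bar> = spike j (r - y) * \<bar>E y\<bar>" by (simp add: abs_mult spike_nonneg)
    also have "\<dots> \<le> spike j (r - y) * (M * \<bar>r - y\<bar>)" using Ey by (intro mult_left_mono spike_nonneg)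
    also have "\<dots> = (spike j (r - y) * \<bar>r - y\<bar>) * M" by simp
    also have "\<dots> \<le> B * M" using B M(1) by (intro mult_right_mono) auto
    finally have 1: "\<bar>spike j (r - y) * E y\<bar> \<le> B * M" .
    have 2: "\<bar>Y r j y * E' y\<bar> \<le> 1 * M" unfolding abs_mult using YZ M y by (intro mult_mono) auto
    have "\<bar>e' j y\<bar> \<le> B * M + 1 * M" using 1 2 unfolding e'_def by linarith
    then show "\<bar>e' j y\<bar> \<le> (B + 1) * M" by (simp add: algebra_simps)
  qed
  have lims: "(\<lambda>j. f j x) \<longlonglongrightarrow> s x" "(\<lambda>j. f' j x) \<longlonglongrightarrow> s' x" if "a < x" "x < b" for x
  proof -
    have l: "(\<lambda>j. Z j x) \<longlonglongrightarrow> 1" "(\<lambda>j. Y b j x) \<longlonglongrightarrow> 1"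
      using sstep_tendsto[of "x - a"] sstep_tendsto[of "b - x"] that unfolding Z_def Y_def by simp_all
    have l': "(\<lambda>j. spike j (x - a)) \<longlonglongrightarrow> 0" "(\<lambda>j. spike j (b - x)) \<longlonglongrightarrow> 0"
      using that by (simp_all add: spike_tendsto_0)
    have "(\<lambda>j. f j x) \<longlonglongrightarrow> 1 * 1 * s x"
      unfolding f_def by (intro tendsto_mult tendsto_const l)
    moreover have "(\<lambda>j. f' j x) \<longlonglongrightarrow> (0 * 1 - 1 * 0) * s x + 1 * 1 * s' x"
      unfolding f'_def by (intro tendsto_mult tendsto_add tendsto_diff tendsto_const l l')
    ultimately show "(\<lambda>j. f j x) \<longlonglongrightarrow> s x" "(\<lambda>j. f' j x) \<longlonglongrightarrow> s' x" by simp_all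
  qed
  have elims: "(\<lambda>j. e j y) \<longlonglongrightarrow> E y" "(\<lambda>j. e' j y) \<longlonglongrightarrow> E' y" if "y < r" for y
  proof -
    have l: "(\<lambda>j. Y r j y) \<longlonglongrightarrow> 1" "(\<lambda>j. spike j (r - y)) \<longlonglongrightarrow> 0"
      using sstep_tendsto[of "r - y"] that unfolding Y_def by (simp_all add: spike_tendsto_0)
    have "(\<lambda>j. e j y) \<longlonglongrightarrow> 1 * E y"
      unfolding e_def by (intro tendsto_mult tendsto_const l)
    moreover have "(\<lambda>j. e' j y) \<longlonglongrightarrow> - 0 * E y + 1 * E' y"
      unfolding e'_def by (intro tendsto_mult tendsto_add tendsto_minus tendsto_const l)
    ultimately show "(\<lambda>j. e j y) \<longlonglongrightarrow> E y" "(\<lambda>j. e' j y) \<longlonglongrightarrow> E' y" by simp_all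
  qed
  have cp: "continuous_on UNIV (p j)" for j
    unfolding p_def
    by (intro continuous_on_Pair continuous_on_minus continuous_on_mult
        continuous_on_compose2[OF smooth_continuous[OF smf, of UNIV]] continuous_on_compose2[OF smooth_continuous[OF smooth_deriv_of[OF smf df], of UNIV]]
        continuous_on_compose2[OF smooth_continuous[OF sme, of UNIV]] continuous_on_compose2[OF smooth_continuous[OF smooth_deriv_of[OF sme de], of UNIV]]
        continuous_on_fst continuous_on_snd continuous_on_id) simp_all
  have cq: "continuous_on UNIV q"
    unfolding q_def
    by (intro continuous_on_Pair continuous_on_minus continuous_on_mult
        continuous_on_compose2[OF smooth_continuous[OF sms, of UNIV]] continuous_on_compose2[OF smooth_continuous[OF smooth_deriv_of[OF sms ds], of UNIV]]
        continuous_on_compose2[OF smooth_continuous[OF smE, of UNIV]] continuous_on_compose2[OF smooth_continuous[OF smooth_deriv_of[OF smE dE], of UNIV]]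
        continuous_on_fst continuous_on_snd continuous_on_id) simp_all
  have meas: "(\<lambda>z. indicator Q z *\<^sub>R (g z \<bullet> P z)) \<in> borel_measurable lebesgue" if "continuous_on UNIV P" for P
  proof -
    have "(\<lambda>z. (indicator Q z *\<^sub>R g z) \<bullet> P z) \<in> borel_measurable lebesgue"
      by (intro borel_measurable_inner borel_measurable_integrable[OF ig] borel_measurable_lebesgue_continuous(1) that)
    then show ?thesis by simp
  qed
  define C where "C = \<Lambda> * ((B + 1) * M) + ((2 * B + 1) * \<Lambda>) * M"
  have pC: "norm (p j z) \<le> C" if "z \<in> Q" for j z
  proof -
    have z: "fst z \<in> {a..b}" "snd z \<in> {0..r}" using that by (auto simp: Q_def)
    have "norm (p j z) \<le> \<bar>f j (fst z) * e' j (snd z)\<bar> + \<bar>f' j (fst z) * e j (snd z)\<bar>"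
      unfolding p_def by (rule order_trans[OF norm_Pair_le]) simp
    also have "\<dots> \<le> C"
      unfolding C_def abs_mult using bounds[OF z(1), of j] ebounds[OF z(2), of j] \<Lambda>(1) B(1) M(1)
      by (intro add_mono mult_mono) auto
    finally show ?thesis .
  qed
  have "(\<lambda>j. LINT z|lebesgue. indicator Q z *\<^sub>R (g z \<bullet> p j z)) \<longlonglongrightarrow> (LINT z|lebesgue. indicator Q z *\<^sub>R (g z \<bullet> q z))"
  proof (rule integral_dominated_convergence[where w = "\<lambda>z. C * norm (indicator Q z *\<^sub>R g z)"])
    show "integrable lebesgue (\<lambda>z. C * norm (indicator Q z *\<^sub>R g z))"
      by (intro integrable_mult_right integrable_norm ig)
    show "AE z in lebesgue. norm (indicator Q z *\<^sub>R (g z \<bullet> p j z)) \<le> C * norm (indicator Q z *\<^sub>R g z)" for j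
    proof (rule AE_I2)
      fix z
      show "norm (indicator Q z *\<^sub>R (g z \<bullet> p j z)) \<le> C * norm (indicator Q z *\<^sub>R g z)"
      proof (cases "z \<in> Q")
        case True
        have "\<bar>g z \<bullet> p j z\<bar> \<le> norm (g z) * C"
          by (intro order_trans[OF Cauchy_Schwarz_ineq2] mult_left_mono pC True) auto
        then show ?thesis using True by (simp add: mult.commute)
      qed simp
    qed
    show "AE z in lebesgue. (\<lambda>j. indicator Q z *\<^sub>R (g z \<bullet> p j z)) \<longlonglongrightarrow> indicator Q z *\<^sub>R (g z \<bullet> q z)"
    proof (rule AE_I2)
      fix z
      show "(\<lambda>j. indicator Q z *\<^sub>R (g z \<bullet> p j z)) \<longlonglongrightarrow> indicator Q z *\<^sub>R (g z \<bullet> q z)"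
      proof (cases "z \<in> Q")
        case True
        then have "(\<lambda>j. p j z) \<longlonglongrightarrow> q z"
          unfolding p_def q_def by (intro tendsto_Pair tendsto_minus tendsto_mult lims elims) (auto simp: Q_def)
        then show ?thesis by (intro tendsto_scaleR tendsto_inner tendsto_const)
      qed simp
    qed
  qed (rule meas[OF cq], rule meas[OF cp])
  moreover have "(\<lambda>j. LINT x|lborel. f j x * e j 0) \<longlonglongrightarrow> (LINT x|lborel. indicator {a<..<b} x *\<^sub>R (s x * E 0))"
  proof (rule integral_dominated_convergence[where w = "\<lambda>x. \<Lambda> * M * indicator {a..b} x"])
    show "integrable lborel (\<lambda>x. \<Lambda> * M * indicator {a..b} x)"
      by (intro integrable_mult_right integrable_real_indicator) (use ab in simp_all)
    show "(\<lambda>x. indicator {a<..<b} x *\<^sub>R (s x * E 0)) \<in> borel_measurable lborel"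
      using borel_measurable_continuous_onI[OF smooth_continuous[OF sms]] by measurable
    show "(\<lambda>x. f j x * e j 0) \<in> borel_measurable lborel" for j
      using borel_measurable_continuous_onI[OF smooth_continuous[OF smf[of j]]] by measurable
    have out: "f j x = 0" if "x \<notin> {a<..<b}" for j x
    proof -
      have "0 < 1 / real (Suc j)" by simp
      then have "x < a + 1 / real (Suc j) \<or> b - 1 / real (Suc j) < x" using that unfolding greaterThanLessThan_iff by linarith
      then show ?thesis using Zz[of x j] Yz[of b j x] unfolding f_def by auto
    qed
    show "AE x in lborel. norm (f j x * e j 0) \<le> \<Lambda> * M * indicator {a..b} x" for j
    proof (rule AE_I2)
      fix x
      show "norm (f j x * e j 0) \<le> \<Lambda> * M * indicator {a..b} x"
        using out[of x j] bounds(1)[of x j] ebounds(1)[of 0 j] r \<Lambda>(1) M(1)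
        by (cases "x \<in> {a..b}") (auto simp: abs_mult intro!: mult_mono)
    qed
    show "AE x in lborel. (\<lambda>j. f j x * e j 0) \<longlonglongrightarrow> indicator {a<..<b} x *\<^sub>R (s x * E 0)"
    proof (rule AE_I2)
      fix x
      show "(\<lambda>j. f j x * e j 0) \<longlonglongrightarrow> indicator {a<..<b} x *\<^sub>R (s x * E 0)"
      proof (cases "x \<in> {a<..<b}")
        case True
        then have "(\<lambda>j. f j x * e j 0) \<longlonglongrightarrow> s x * E 0" using r by (intro tendsto_mult lims elims) auto
        then show ?thesis using True by simp
      qed (simp add: out)
    qed
  qed
  ultimately have "(LINT z|lebesgue. indicator Q z *\<^sub>R (g z \<bullet> q z)) = (LINT x|lborel. indicator {a<..<b} x *\<^sub>R (s x * E 0))"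
    using flux unfolding set_lebesgue_integral_def by (intro LIMSEQ_unique) auto
  also have "\<dots> = (LINT x:{a<..<b}|lborel. s x * E 0)" unfolding set_lebesgue_integral_def ..
  also have "\<dots> = integral {a<..<b} (\<lambda>x. s x * E 0)"
  proof (rule set_borel_integral_eq_integral(2))
    have "set_integrable lborel {a..b} (\<lambda>x. s x * E 0)"
      unfolding set_integrable_def
      by (intro borel_integrable_compact continuous_on_mult smooth_continuous[OF sms] continuous_on_const compact_Icc)
    then show "set_integrable lborel {a<..<b} (\<lambda>x. s x * E 0)" by (rule set_integrable_subset) auto
  qed
  also have "\<dots> = integral {a..b} s * E 0"
    by (simp flip: integral_open_interval_real)
  finally show ?thesis unfolding set_lebesgue_integral_def q_def .
qed

lemma locally_integrable_subset: "locally_integrable \<Omega> f \<Longrightarrow> \<Omega>' \<subseteq> \<Omega> \<Longrightarrow> locally_integrable \<Omega>' f"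
  unfolding locally_integrable_def by blast

lemma has_weak_gradient_subset:
  assumes "has_weak_gradient \<Omega> u g" "\<Omega>' \<subseteq> \<Omega>"
  shows "has_weak_gradient \<Omega>' u g"
  unfolding has_weak_gradient_iff
proof (intro conjI allI impI ballI)
  show "locally_integrable \<Omega>' u" "locally_integrable \<Omega>' g"
    using assms locally_integrable_subset unfolding has_weak_gradient_def by blast+
  show "(LINT x|lebesgue. u x * frechet_derivative \<phi> (at x) b) = - (LINT x|lebesgue. (g x \<bullet> b) * \<phi> x)"
    if "test_function \<Omega>' \<phi>" "b \<in> Basis" for \<phi> b
    by (rule has_weak_gradientD[OF assms(1) test_function_mono[OF that(1) assms(2)] that(2)])
qed

subsection \<open>The lower bound on a rectangle\<close>

lemma integral_affine_Icc:
  fixes F :: "real \<Rightarrow> real"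
  assumes "(F has_integral I) {0..1}" and ab: "a < b"
  shows "((\<lambda>x. F ((x - a) / (b - a))) has_integral (b - a) * I) {a..b}"
proof -
  have m: "0 < 1 / (b - a)" using ab by simp
  from has_integral_affinity'[OF _ m, of F I 0 1 "- a / (b - a)"] assms
  have "((\<lambda>x. F ((1 / (b - a)) *\<^sub>R x + - a / (b - a))) has_integral (I /\<^sub>R (1 / (b - a)) ^ DIM(real)))
      (cbox ((0 - - a / (b - a)) /\<^sub>R (1 / (b - a))) ((1 - - a / (b - a)) /\<^sub>R (1 / (b - a))))" by simp
  also have "(\<lambda>x. F ((1 / (b - a)) *\<^sub>R x + - a / (b - a))) = (\<lambda>x. F ((x - a) / (b - a)))"
    by (simp add: diff_divide_distrib)
  also have "(0 - - a / (b - a)) /\<^sub>R (1 / (b - a)) = a" using ab by (simp add: field_simps)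
  also have "(1 - - a / (b - a)) /\<^sub>R (1 / (b - a)) = b" using ab by (simp add: field_simps)
  finally show ?thesis using ab by (simp add: field_simps)
qed

lemma set_lebesgue_integral_box:
  fixes F :: "real \<times> real \<Rightarrow> real"
  assumes "continuous_on UNIV F"
  shows "set_integrable lebesgue ({a<..<b} \<times> {c<..<d}) F"
    and "(LINT z:{a<..<b} \<times> {c<..<d}|lebesgue. F z) = integral {c..d} (\<lambda>y. integral {a..b} (\<lambda>x. F (x, y)))"
proof -
  have sub: "{a<..<b} \<times> {c<..<d} \<subseteq> cbox (a, c) (b, d)" by (auto simp: cbox_Pair_eq)
  have i0: "integrable lborel (\<lambda>z. indicator (cbox (a, c) (b, d)) z *\<^sub>R F z)"
    by (intro borel_integrable_compact compact_cbox continuous_on_subset[OF assms]) simp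
  then have "set_integrable lebesgue (cbox (a, c) (b, d)) F"
    unfolding set_integrable_def using integrable_completion[OF borel_measurable_integrable[OF i0]] by simp
  then show i: "set_integrable lebesgue ({a<..<b} \<times> {c<..<d}) F"
    by (rule set_integrable_subset[OF _ _ sub]) (simp add: borel_open open_Times)
  have box: "{a<..<b} \<times> {c<..<d} = box (a, c) (b, d)"
    by (auto simp: box_def Basis_real_prod)
  have "(LINT z:{a<..<b} \<times> {c<..<d}|lebesgue. F z) = integral (box (a, c) (b, d)) F"
    using set_lebesgue_integral_eq_integral(2)[OF i] unfolding box .
  also have "\<dots> = integral (cbox (a, c) (b, d)) F" by (rule integral_open_interval)
  also have "\<dots> = integral (cbox a b) (\<lambda>x. integral (cbox c d) (\<lambda>y. F (x, y)))"
    by (rule integral_prod_continuous[OF continuous_on_subset[OF assms subset_UNIV]])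
  also have "\<dots> = integral (cbox c d) (\<lambda>y. integral (cbox a b) (\<lambda>x. F (x, y)))"
    by (rule integral_swap_continuous) (simp add: continuous_on_subset[OF assms subset_UNIV])
  finally show "(LINT z:{a<..<b} \<times> {c<..<d}|lebesgue. F z) = integral {c..d} (\<lambda>y. integral {a..b} (\<lambda>x. F (x, y)))"
    by simp
qed

section \<open>Harmonic modes of the rectangle\<close>

context
  fixes a b r :: real
  assumes ab: "a < b" and r: "0 < r"
begin

text \<open>The products \<open>mode_s * mode_E\<close> are harmonic, vanish on the sides and on the
  top, and equal \<open>mode_s\<close> on the base. Their rotated gradients are therefore also curl
  free, as the gradient of an optimal displacement with free sides and free top must be.\<close>

definition "\<kappa> k = real k * pi / (b - a)"
definition "mode_s k x = sin (\<kappa> k * (x - a))"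
definition "mode_c k x = \<kappa> k * cos (\<kappa> k * (x - a))"
definition "mode_E k y = sinh (\<kappa> k * (r - y)) / sinh (\<kappa> k * r)"
definition "mode_E' k y = - \<kappa> k * cosh (\<kappa> k * (r - y)) / sinh (\<kappa> k * r)"

lemma kappa_pos: "0 < k \<Longrightarrow> 0 < \<kappa> k"
  using ab by (simp add: \<kappa>_def)

lemma mode_derivs:
  "(mode_s k has_real_derivative mode_c k x) (at x)"
  "(mode_E k has_real_derivative mode_E' k y) (at y)"
  "(mode_E' k has_real_derivative (\<kappa> k)\<^sup>2 * mode_E k y) (at y)"
proof -
  show "(mode_s k has_real_derivative mode_c k x) (at x)"
    unfolding mode_s_def[abs_def] mode_c_def by (auto intro!: derivative_eq_intros)
  have "((\<lambda>y. sinh (\<kappa> k * (r - y))) has_real_derivative (- \<kappa> k * cosh (\<kappa> k * (r - y)))) (at y)"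
    by (auto intro!: derivative_eq_intros)
  then show "(mode_E k has_real_derivative mode_E' k y) (at y)"
    unfolding mode_E_def[abs_def] mode_E'_def by (rule DERIV_cdivide)
  have "((\<lambda>y. - \<kappa> k * cosh (\<kappa> k * (r - y))) has_real_derivative ((\<kappa> k)\<^sup>2 * sinh (\<kappa> k * (r - y)))) (at y)"
    by (auto intro!: derivative_eq_intros simp: power2_eq_square)
  from DERIV_cdivide[OF this] show "(mode_E' k has_real_derivative (\<kappa> k)\<^sup>2 * mode_E k y) (at y)"
    unfolding mode_E_def mode_E'_def[abs_def] by simp
qed

lemma smooth_modes: "smooth (mode_s k)" "smooth (mode_E k)"
proof -
  have eq: "mode_s k = (\<lambda>x. sin (\<kappa> k * x + (- \<kappa> k * a)))" by (auto simp: mode_s_def fun_eq_iff algebra_simps)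
  show "smooth (mode_s k)"
    unfolding eq by (rule smooth_compose_affine[OF smooth_sin_cos(1)])
  define S where "S = sinh (\<kappa> k * r)"
  have eq: "mode_E k = (\<lambda>y. (exp ((- \<kappa> k) * y + \<kappa> k * r) - exp (\<kappa> k * y + (- \<kappa> k * r))) / (2 * S))"
    unfolding mode_E_def S_def[symmetric] by (auto simp: sinh_field_def fun_eq_iff algebra_simps)
  show "smooth (mode_E k)"
    unfolding eq
    by (rule smooth_divide_const[OF smooth_diff[OF smooth_compose_affine[OF smooth_exp] smooth_compose_affine[OF smooth_exp]]])
qed

lemma mode_boundary: "mode_s k a = 0" "mode_s k b = 0" "mode_E k r = 0" "0 < k \<Longrightarrow> mode_E k 0 = 1"
  using ab r kappa_pos[of k] by (simp_all add: mode_s_def mode_E_def \<kappa>_def)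

lemma integral_mode_s: "odd k \<Longrightarrow> integral {a..b} (mode_s k) = 2 / \<kappa> k"
proof -
  assume k: "odd k"
  then have "0 < \<kappa> k" by (intro kappa_pos) (auto intro: Nat.gr0I)
  then have "(mode_s k has_integral (- cos (\<kappa> k * (b - a)) / \<kappa> k - - cos (\<kappa> k * (a - a)) / \<kappa> k)) {a..b}"
    using ab
    by (intro fundamental_theorem_of_calculus)
       (auto intro!: derivative_eq_intros simp: mode_s_def simp flip: has_real_derivative_iff_has_vector_derivative)
  moreover have "cos (\<kappa> k * (b - a)) = - 1" using k ab by (simp add: \<kappa>_def cos_npi)
  ultimately show ?thesis by (simp add: integral_unique)
qed

lemma energy_density_integral:
  assumes I: "finite I" "0 \<notin> I"
  shows "integral {a..b} (\<lambda>x. (\<Sum>k\<in>I. \<gamma> k * (mode_s k x * mode_E' k y))\<^sup>2 + (\<Sum>k\<in>I. \<gamma> k * (mode_c k x * mode_E k y))\<^sup>2) =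
    (b - a) / 2 * (\<Sum>k\<in>I. (\<gamma> k)\<^sup>2 * ((mode_E' k y)\<^sup>2 + (\<kappa> k)\<^sup>2 * (mode_E k y)\<^sup>2))"
proof -
  have arg: "\<kappa> k * (x - a) = real k * pi * ((x - a) / (b - a))" for k x by (simp add: \<kappa>_def)
  have "((\<lambda>x. (\<Sum>k\<in>I. (\<gamma> k * mode_E' k y) * sin (real k * pi * ((x - a) / (b - a))))\<^sup>2) has_integral
      (b - a) * (\<Sum>k\<in>I. (\<gamma> k * mode_E' k y)\<^sup>2 / 2)) {a..b}"
    by (rule integral_affine_Icc[OF has_integral_sin_sum_sq(1)[OF I] ab])
  moreover have "((\<lambda>x. (\<Sum>k\<in>I. (\<gamma> k * \<kappa> k * mode_E k y) * cos (real k * pi * ((x - a) / (b - a))))\<^sup>2) has_integral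
      (b - a) * (\<Sum>k\<in>I. (\<gamma> k * \<kappa> k * mode_E k y)\<^sup>2 / 2)) {a..b}"
    by (rule integral_affine_Icc[OF has_integral_sin_sum_sq(2)[OF I] ab])
  ultimately have "((\<lambda>x. (\<Sum>k\<in>I. \<gamma> k * (mode_s k x * mode_E' k y))\<^sup>2 + (\<Sum>k\<in>I. \<gamma> k * (mode_c k x * mode_E k y))\<^sup>2) has_integral
      (b - a) * (\<Sum>k\<in>I. (\<gamma> k * mode_E' k y)\<^sup>2 / 2) + (b - a) * (\<Sum>k\<in>I. (\<gamma> k * \<kappa> k * mode_E k y)\<^sup>2 / 2)) {a..b}"
    unfolding mode_s_def mode_c_def arg by (intro has_integral_add) (simp_all add: mult_ac)
  from integral_unique[OF this] show ?thesis
    by (simp add: sum_divide_distrib[symmetric] sum.distrib power_mult_distrib distrib_left mult_ac)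
qed

text \<open>Since \<open>mode_E\<close> satisfies E'' = \<kappa>^2 E, the integrand is the
  derivative of E E', and only the base contributes.\<close>

lemma mode_energy:
  assumes "0 < k"
  shows "((\<lambda>y. (mode_E' k y)\<^sup>2 + (\<kappa> k)\<^sup>2 * (mode_E k y)\<^sup>2) has_integral \<kappa> k / tanh (\<kappa> k * r)) {0..r}"
proof -
  have "((\<lambda>y. (mode_E' k y)\<^sup>2 + (\<kappa> k)\<^sup>2 * (mode_E k y)\<^sup>2) has_integral
      mode_E k r * mode_E' k r - mode_E k 0 * mode_E' k 0) {0..r}"
  proof (rule fundamental_theorem_of_calculus)
    fix y
    have "((\<lambda>y. mode_E k y * mode_E' k y) has_real_derivative (mode_E' k y)\<^sup>2 + (\<kappa> k)\<^sup>2 * (mode_E k y)\<^sup>2) (at y)"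
      using DERIV_mult[OF mode_derivs(2)[of k y] mode_derivs(3)[of k y]] by (simp add: power2_eq_square algebra_simps)
    then show "((\<lambda>y. mode_E k y * mode_E' k y) has_vector_derivative (mode_E' k y)\<^sup>2 + (\<kappa> k)\<^sup>2 * (mode_E k y)\<^sup>2) (at y within {0..r})"
      unfolding has_real_derivative_iff_has_vector_derivative by (rule has_vector_derivative_at_within)
  qed (use r in simp)
  moreover have "- mode_E' k 0 = \<kappa> k / tanh (\<kappa> k * r)" by (simp add: mode_E'_def tanh_def)
  ultimately show ?thesis using mode_boundary(3,4)[of k] assms by simp
qed

end

text \<open>Duality: for any admissible gradient g and the fixed field P,
  \<open>2 T g \<bullet> P - T^2 |P|^2 \<le> |g|^2\<close>. The flux identity evaluates the first
  integral to \<open>l^2 * C_N n\<close> whatever g is, and the energy of P is at most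
  \<open>l^2 * C_N n / T\<close>, so the multiplier T leaves \<open>T * l^2 * C_N n\<close>. Letting
  n grow gives \<open>C_W\<close>.\<close>

lemma rectangle_lower_bound:
  fixes a b r :: real
  defines "Q \<equiv> {a<..<b} \<times> {0<..<r}"
  assumes ab: "a < b" and r: "0 < r"
    and tr: "has_trace_rect a b r u (\<lambda>x. x)" and w: "has_weak_gradient Q u g"
  shows "ennreal (C_W * (b - a)\<^sup>2 * tanh (pi * r / (b - a))) \<le> (\<integral>\<^sup>+z\<in>Q. ennreal ((norm (g z))\<^sup>2) \<partial>lebesgue)"
proof -
  define l where "l = b - a"
  have l: "l > 0" using ab by (simp add: l_def)
  define T where "T = tanh (pi * r / l)"
  have T: "0 < T" using r l by (simp add: T_def)
  have oQ: "open Q" unfolding Q_def by (intro open_Times open_greaterThanLessThan)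
  have lg: "locally_integrable Q g" using w unfolding has_weak_gradient_def by simp
  have mg: "(\<lambda>z. indicator Q z *\<^sub>R g z) \<in> borel_measurable lebesgue" by (rule locally_integrable_measurable[OF oQ lg])
  have eqN: "(\<integral>\<^sup>+z\<in>Q. ennreal ((norm (g z))\<^sup>2) \<partial>lebesgue) = (\<integral>\<^sup>+z. ennreal ((norm (indicator Q z *\<^sub>R g z))\<^sup>2) \<partial>lebesgue)"
    by (rule nn_integral_cong) (auto simp: indicator_def)
  show ?thesis
  proof (cases "(\<integral>\<^sup>+z\<in>Q. ennreal ((norm (g z))\<^sup>2) \<partial>lebesgue) = \<infinity>")
    case False
    have msq: "(\<lambda>z. (norm (indicator Q z *\<^sub>R g z))\<^sup>2) \<in> borel_measurable lebesgue"
      by (intro borel_measurable_power measurable_compose[OF mg borel_measurable_norm])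
    have i2: "integrable lebesgue (\<lambda>z. (norm (indicator Q z *\<^sub>R g z))\<^sup>2)"
      using False unfolding eqN by (intro integrableI_nonneg msq) (auto simp: top.not_eq_extremum)
    have i1: "integrable lebesgue (\<lambda>z. indicator Q z * (1::real))"
      using set_lebesgue_integral_box(1)[of "\<lambda>_. 1" a b 0 r] unfolding set_integrable_def Q_def by simp
    have ig: "integrable lebesgue (\<lambda>z. indicator Q z *\<^sub>R g z)"
    proof (rule Bochner_Integration.integrable_bound[OF Bochner_Integration.integrable_add[OF i1 i2] mg], rule AE_I2)
      fix z
      have "2 * norm (g z) \<le> (norm (g z))\<^sup>2 + 1" using zero_le_power2[of "norm (g z) - 1"] by (simp add: power2_diff)
      then have "norm (g z) \<le> 1 + (norm (g z))\<^sup>2" using norm_ge_zero[of "g z"] by linarith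
      then show "norm (indicator Q z *\<^sub>R g z) \<le> norm (indicator Q z * 1 + (norm (indicator Q z *\<^sub>R g z))\<^sup>2)"
        by (cases "z \<in> Q") auto
    qed
    have key: "T * l\<^sup>2 * C_N n \<le> (LINT z|lebesgue. (norm (indicator Q z *\<^sub>R g z))\<^sup>2)" for n
    proof -
      let ?s = "mode_s a b" and ?c = "mode_c a b" and ?E = "mode_E a b r" and ?E' = "mode_E' a b r"
      \<comment> \<open>The coefficients of the half-strip problem: at infinite height the flux and
        the energy of mode k would both equal \<open>8 l^2 / (pi^3 k^3)\<close>, the terms of
        \<open>C_W\<close>.\<close>
      define \<gamma> where "\<gamma> k = 4 * l / (pi\<^sup>2 * (real k)\<^sup>2)" for k
      define P where "P z = (\<Sum>k\<in>odds n. \<gamma> k *\<^sub>R (- (?s k (fst z) * ?E' k (snd z)), ?c k (fst z) * ?E k (snd z)))" for z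
      have cm: "continuous_on S (?s k)" "continuous_on S (?c k)" "continuous_on S (?E k)" "continuous_on S (?E' k)" for S k
        using smooth_continuous[OF smooth_modes(1)[OF ab r]] smooth_continuous[OF smooth_modes(2)[OF ab r]]
          smooth_continuous[OF smooth_deriv_of[OF smooth_modes(1)[OF ab r] mode_derivs(1)[OF ab r]]]
          smooth_continuous[OF smooth_deriv_of[OF smooth_modes(2)[OF ab r] mode_derivs(2)[OF ab r]]] by blast+
      have cP: "continuous_on UNIV P"
        unfolding P_def
        by (intro continuous_on_sum continuous_on_scaleR continuous_on_const continuous_on_Pair continuous_on_minus continuous_on_mult
            continuous_on_compose2[OF cm(1)[of UNIV]] continuous_on_compose2[OF cm(2)[of UNIV]]
            continuous_on_compose2[OF cm(3)[of UNIV]] continuous_on_compose2[OF cm(4)[of UNIV]]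
            continuous_on_fst continuous_on_snd continuous_on_id) simp_all
      have one: "(LINT z:Q|lebesgue. g z \<bullet> (- (?s k (fst z) * ?E' k (snd z)), ?c k (fst z) * ?E k (snd z))) = 2 * l / (real k * pi)"
        if "k \<in> odds n" for k
        using flux_boundary_zero[OF ab r mode_derivs(1)[OF ab r] mode_derivs(2)[OF ab r] smooth_modes[OF ab r]
            mode_boundary(1-3)[OF ab r] tr, folded Q_def, OF w ig, of k k] that
          mode_boundary(4)[OF ab r odds_pos[OF that]] integral_mode_s[OF ab r, of k]
        by (simp add: odds_def \<kappa>_def[OF ab r] l_def)
      have intk: "integrable lebesgue (\<lambda>z. indicator Q z *\<^sub>R (g z \<bullet> F z))" if F: "continuous_on UNIV F" for F
      proof -
        obtain B where B: "B > 0" "\<forall>z\<in>cbox (a, 0) (b, r). \<bar>norm (F z)\<bar> \<le> B"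
          by (rule compact_abs_bound[OF compact_cbox continuous_on_norm[OF continuous_on_subset[OF F subset_UNIV]]])
        show ?thesis
        proof (rule Bochner_Integration.integrable_bound[OF integrable_mult_right[OF integrable_norm[OF ig], of B]], goal_cases)
          case 1
          have "(\<lambda>z. (indicator Q z *\<^sub>R g z) \<bullet> F z) \<in> borel_measurable lebesgue"
            by (intro borel_measurable_inner mg borel_measurable_lebesgue_continuous(1) F)
          then show ?case by simp
        next
          case 2
          show ?case
          proof (rule AE_I2)
            fix z
            show "norm (indicator Q z *\<^sub>R (g z \<bullet> F z)) \<le> norm (B * norm (indicator Q z *\<^sub>R g z))"
            proof (cases "z \<in> Q")
              case True
              then have "norm (F z) \<le> B" using bspec[OF B(2), of z] by (cases z) (auto simp: Q_def)
              then have "\<bar>g z \<bullet> F z\<bar> \<le> norm (g z) * B"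
                by (intro order_trans[OF Cauchy_Schwarz_ineq2] mult_left_mono) auto
              then show ?thesis using True B(1) by (simp add: mult.commute abs_mult)
            qed simp
          qed
        qed
      qed
      have flux: "(LINT z:Q|lebesgue. g z \<bullet> P z) = l\<^sup>2 * C_N n"
      proof -
        let ?p = "\<lambda>k z. (- (?s k (fst z) * ?E' k (snd z)), ?c k (fst z) * ?E k (snd z))"
        have cp: "continuous_on UNIV (?p k)" for k
          by (intro continuous_on_Pair continuous_on_minus continuous_on_mult
              continuous_on_compose2[OF cm(1)[of UNIV]] continuous_on_compose2[OF cm(2)[of UNIV]]
              continuous_on_compose2[OF cm(3)[of UNIV]] continuous_on_compose2[OF cm(4)[of UNIV]]
              continuous_on_fst continuous_on_snd continuous_on_id) simp_all
        have lin: "i * (v \<bullet> (\<Sum>k\<in>K. \<gamma> k *\<^sub>R w k)) = (\<Sum>k\<in>K. \<gamma> k * (i * (v \<bullet> w k)))"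
          for i and v :: "real \<times> real" and w K
          by (simp add: inner_sum_right sum_distrib_left mult.left_commute)
        have "(LINT z:Q|lebesgue. g z \<bullet> P z) = (LINT z|lebesgue. (\<Sum>k\<in>odds n. \<gamma> k * (indicator Q z *\<^sub>R (g z \<bullet> ?p k z))))"
          unfolding set_lebesgue_integral_def P_def
          unfolding real_scaleR_def lin ..
        also have "\<dots> = (\<Sum>k\<in>odds n. \<gamma> k * (LINT z|lebesgue. indicator Q z *\<^sub>R (g z \<bullet> ?p k z)))"
          by (subst Bochner_Integration.integral_sum) (intro integrable_mult_right intk cp, simp)
        also have "\<dots> = (\<Sum>k\<in>odds n. \<gamma> k * (2 * l / (real k * pi)))"
          by (rule sum.cong) (use one in \<open>auto simp: set_lebesgue_integral_def\<close>)
        also have "\<dots> = l\<^sup>2 * C_N n"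
          unfolding C_N_eq sum_distrib_left
          by (rule sum.cong) (auto simp: \<gamma>_def power2_eq_square power3_eq_cube mult_ac)
        finally show ?thesis .
      qed
      have cP2: "continuous_on UNIV (\<lambda>z. (norm (P z))\<^sup>2)" by (intro continuous_on_power continuous_on_norm cP)
      have iP: "integrable lebesgue (\<lambda>z. indicator Q z *\<^sub>R (norm (P z))\<^sup>2)"
        using set_lebesgue_integral_box(1)[OF cP2, of a b 0 r] unfolding set_integrable_def Q_def .
      have P2: "(LINT z:Q|lebesgue. (norm (P z))\<^sup>2) \<le> l\<^sup>2 * C_N n / T"
      proof -
        have nP: "(norm (P (x, y)))\<^sup>2 = (\<Sum>k\<in>odds n. \<gamma> k * (?s k x * ?E' k y))\<^sup>2 + (\<Sum>k\<in>odds n. \<gamma> k * (?c k x * ?E k y))\<^sup>2" for x y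
          unfolding P_def power2_norm_eq_inner inner_prod_def
          by (simp add: fst_sum snd_sum power2_eq_square sum_negf)
        have "(LINT z:Q|lebesgue. (norm (P z))\<^sup>2) = integral {0..r} (\<lambda>y. integral {a..b} (\<lambda>x. (norm (P (x, y)))\<^sup>2))"
          unfolding Q_def by (rule set_lebesgue_integral_box(2)[OF cP2])
        also have "\<dots> = integral {0..r} (\<lambda>y. l / 2 * (\<Sum>k\<in>odds n. (\<gamma> k)\<^sup>2 * ((?E' k y)\<^sup>2 + (\<kappa> a b k)\<^sup>2 * (?E k y)\<^sup>2)))"
          unfolding nP energy_density_integral[OF ab r finite_odds zero_notin_odds] l_def ..
        also have "\<dots> = l / 2 * (\<Sum>k\<in>odds n. (\<gamma> k)\<^sup>2 * (\<kappa> a b k / tanh (\<kappa> a b k * r)))"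
          by (intro integral_unique has_integral_mult_right has_integral_sum finite_odds mode_energy[OF ab r] odds_pos)
        \<comment> \<open>The finite height costs mode k a factor 1/tanh, which is worst for k = 1;
          that value serves for all modes.\<close>
        also have "\<dots> \<le> l / 2 * (\<Sum>k\<in>odds n. (\<gamma> k)\<^sup>2 * (\<kappa> a b k / T))"
        proof (intro mult_left_mono sum_mono)
          fix k assume k: "k \<in> odds n"
          have "\<kappa> a b k = real k * (pi / l)" by (simp add: \<kappa>_def[OF ab r] l_def)
          moreover have "1 * (pi / l) \<le> real k * (pi / l)" using odds_pos[OF k] l by (intro mult_right_mono) auto
          ultimately have "pi / l * r \<le> \<kappa> a b k * r" using r by (intro mult_right_mono) auto
          then have "T \<le> tanh (\<kappa> a b k * r)" by (simp add: T_def)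
          then show "\<kappa> a b k / tanh (\<kappa> a b k * r) \<le> \<kappa> a b k / T"
            using T kappa_pos[OF ab r odds_pos[OF k]] r by (intro divide_left_mono mult_pos_pos) auto
        qed (use l in auto)
        also have "\<dots> = l\<^sup>2 * C_N n / T"
          unfolding C_N_eq sum_distrib_left sum_divide_distrib
        proof (rule sum.cong[OF refl])
          fix k assume "k \<in> odds n"
          then have "real k > 0" using odds_pos by simp
          then show "l / 2 * ((\<gamma> k)\<^sup>2 * (\<kappa> a b k / T)) = l\<^sup>2 * (8 / (pi ^ 3 * real k ^ 3)) / T"
            using l T unfolding \<gamma>_def \<kappa>_def[OF ab r] l_def[symmetric]
            by (simp add: field_simps power2_eq_square power3_eq_cube)
        qed
        finally show ?thesis .
      qed
      \<comment> \<open>Integrates the nonnegativity of \<open>|g - T P|^2\<close>.\<close>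
      have "(LINT z|lebesgue. 2 * T * (indicator Q z *\<^sub>R (g z \<bullet> P z)) - T\<^sup>2 * (indicator Q z *\<^sub>R (norm (P z))\<^sup>2))
          \<le> (LINT z|lebesgue. (norm (indicator Q z *\<^sub>R g z))\<^sup>2)"
      proof (rule integral_mono[OF _ i2])
        show "integrable lebesgue (\<lambda>z. 2 * T * (indicator Q z *\<^sub>R (g z \<bullet> P z)) - T\<^sup>2 * (indicator Q z *\<^sub>R (norm (P z))\<^sup>2))"
          by (intro Bochner_Integration.integrable_diff integrable_mult_right intk[OF cP] iP)
        fix z
        have "0 \<le> (norm (g z - T *\<^sub>R P z))\<^sup>2" by simp
        also have "\<dots> = (norm (g z))\<^sup>2 - 2 * T * (g z \<bullet> P z) + T\<^sup>2 * (norm (P z))\<^sup>2"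
          unfolding power2_norm_eq_inner by (simp add: inner_diff_left inner_diff_right inner_commute power2_eq_square algebra_simps)
        finally show "2 * T * (indicator Q z *\<^sub>R (g z \<bullet> P z)) - T\<^sup>2 * (indicator Q z *\<^sub>R (norm (P z))\<^sup>2) \<le> (norm (indicator Q z *\<^sub>R g z))\<^sup>2"
          by (cases "z \<in> Q") auto
      qed
      also have "(LINT z|lebesgue. 2 * T * (indicator Q z *\<^sub>R (g z \<bullet> P z)) - T\<^sup>2 * (indicator Q z *\<^sub>R (norm (P z))\<^sup>2)) =
          2 * T * (LINT z:Q|lebesgue. g z \<bullet> P z) - T\<^sup>2 * (LINT z:Q|lebesgue. (norm (P z))\<^sup>2)"
        unfolding set_lebesgue_integral_def
        by (subst Bochner_Integration.integral_diff) (intro integrable_mult_right intk[OF cP] iP | simp)+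
      finally have "2 * T * (l\<^sup>2 * C_N n) - T\<^sup>2 * (LINT z:Q|lebesgue. (norm (P z))\<^sup>2) \<le> (LINT z|lebesgue. (norm (indicator Q z *\<^sub>R g z))\<^sup>2)"
        unfolding flux .
      moreover have "T\<^sup>2 * (LINT z:Q|lebesgue. (norm (P z))\<^sup>2) \<le> T\<^sup>2 * (l\<^sup>2 * C_N n / T)"
        by (intro mult_left_mono P2) simp
      moreover have "T\<^sup>2 * (l\<^sup>2 * C_N n / T) = T * l\<^sup>2 * C_N n" using T by (simp add: power2_eq_square)
      ultimately show ?thesis by (simp add: algebra_simps)
    qed
    have "(\<lambda>n. T * l\<^sup>2 * C_N n) \<longlonglongrightarrow> T * l\<^sup>2 * C_W" by (intro tendsto_mult tendsto_const C_N_tendsto)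
    then have "T * l\<^sup>2 * C_W \<le> (LINT z|lebesgue. (norm (indicator Q z *\<^sub>R g z))\<^sup>2)"
      by (rule LIMSEQ_le_const2) (use key in blast)
    then have "ennreal (T * l\<^sup>2 * C_W) \<le> (\<integral>\<^sup>+z. ennreal ((norm (indicator Q z *\<^sub>R g z))\<^sup>2) \<partial>lebesgue)"
      by (subst nn_integral_eq_integral[OF i2]) (auto intro: ennreal_leI)
    then show ?thesis unfolding eqN by (simp add: T_def l_def mult_ac)
  qed simp
qed

subsection \<open>The optimal profile\<close>

text \<open>\<open>L_opt\<close> is the stationary width of \<open>C_W l^2 + 12 / l^3\<close>, and
  \<open>m_opt\<close> the value there. \<open>bump l M\<close> is the parabola of width l and mass
  M, which has the least surface energy \<open>12 M^2 / l^3\<close> for that width and mass.\<close>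

definition L_opt :: real where "L_opt = root 5 (18 / C_W)"
definition m_opt :: real where "m_opt = 5 / 3 * C_W * L_opt\<^sup>2"
definition bump :: "real \<Rightarrow> real \<Rightarrow> real \<Rightarrow> real" where
  "bump l M t = max 0 (3 * M / (2 * l) - 6 * M * t\<^sup>2 / l ^ 3)"

lemma L_opt: "0 < L_opt" "C_W * L_opt ^ 5 = 18"
  using C_W_pos by (simp_all add: L_opt_def field_simps)

lemma m_opt_pos: "0 < m_opt"
  using C_W_pos L_opt(1) by (simp add: m_opt_def)

text \<open>The polynomial \<open>3 l^5 - 5 l^3 y^2 + 2 y^5\<close> has a double root at l = y; the
  cofactor is at least \<open>3 l^3\<close>, which leaves a quadratic gap instead of mere
  nonnegativity.\<close>

lemma quintic_gap:
  fixes l y :: real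
  assumes "0 < l" "0 \<le> y"
  shows "(l - y)\<^sup>2 \<le> l\<^sup>2 + 2 / 3 * y ^ 5 / l ^ 3 - 5 / 3 * y\<^sup>2"
proof -
  have "(l - y)\<^sup>2 * (3 * l ^ 3) \<le> (l - y)\<^sup>2 * (3 * l ^ 3 + 6 * l\<^sup>2 * y + 4 * l * y\<^sup>2 + 2 * y ^ 3)"
    using assms by (intro mult_left_mono) auto
  also have "\<dots> = 3 * l ^ 5 - 5 * l ^ 3 * y\<^sup>2 + 2 * y ^ 5"
    by (simp add: power2_eq_square power3_eq_cube eval_nat_numeral algebra_simps)
  finally have "(l - y)\<^sup>2 \<le> (3 * l ^ 5 - 5 * l ^ 3 * y\<^sup>2 + 2 * y ^ 5) / (3 * l ^ 3)"
    using assms(1) by (simp add: pos_le_divide_eq)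
  also have "\<dots> = l\<^sup>2 + 2 / 3 * y ^ 5 / l ^ 3 - 5 / 3 * y\<^sup>2"
    using assms(1) by (simp add: field_simps eval_nat_numeral)
  finally show ?thesis .
qed

text \<open>The case y = \<open>L_opt\<close>. It bounds the distance to the optimal width by the
  energy excess, which is what yields convergence of widths.\<close>

lemma energy_gap:
  assumes "0 < l"
  shows "m_opt + C_W * (l - L_opt)\<^sup>2 \<le> C_W * l\<^sup>2 + 12 / l ^ 3"
proof -
  have "C_W * (l - L_opt)\<^sup>2 \<le> C_W * (l\<^sup>2 + 2 / 3 * L_opt ^ 5 / l ^ 3 - 5 / 3 * L_opt\<^sup>2)"
    using quintic_gap[OF assms, of L_opt] L_opt(1) C_W_pos by (intro mult_left_mono) auto
  also have "\<dots> = C_W * l\<^sup>2 + 2 / 3 * (C_W * L_opt ^ 5) / l ^ 3 - m_opt"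
    by (simp add: m_opt_def algebra_simps)
  finally show ?thesis by (simp add: L_opt(2))
qed

lemma energy_opt: "C_W * L_opt\<^sup>2 + 12 / L_opt ^ 3 = m_opt"
proof -
  have "2 / 3 * C_W * L_opt\<^sup>2 * L_opt ^ 3 = 12" using L_opt(2) by (simp add: mult.assoc power_add[symmetric])
  then have "12 / L_opt ^ 3 = 2 / 3 * C_W * L_opt\<^sup>2"
    using L_opt(1) by (simp add: divide_eq_eq)
  then show ?thesis by (simp add: m_opt_def)
qed

text \<open>With t = \<open>M powr (2/5)\<close>, both terms pick up the same factor t^2 when widths
  are multiplied by t, so the gap is used at y = \<open>L_opt * t\<close> and its square
  discarded.\<close>

lemma energy_scaled:
  assumes "0 < l" "0 < M"
  shows "m_opt * M powr (4 / 5) \<le> C_W * l\<^sup>2 + 12 * M\<^sup>2 / l ^ 3"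
proof -
  define t where "t = M powr (2 / 5)"
  have t: "t > 0" using assms(2) by (simp add: t_def)
  have t5: "t ^ 5 = M\<^sup>2" "t\<^sup>2 = M powr (4 / 5)"
    using assms(2) by (simp_all add: t_def powr_powr flip: powr_realpow powr_numeral)
  have "0 \<le> C_W * (l\<^sup>2 + 2 / 3 * (L_opt * t) ^ 5 / l ^ 3 - 5 / 3 * (L_opt * t)\<^sup>2)"
    using order_trans[OF zero_le_power2 quintic_gap[OF assms(1), of "L_opt * t"]] L_opt(1) t C_W_pos
    by (intro mult_nonneg_nonneg) auto
  also have "\<dots> = C_W * l\<^sup>2 + 2 / 3 * (C_W * L_opt ^ 5) * t ^ 5 / l ^ 3 - m_opt * t\<^sup>2"
    by (simp add: m_opt_def power_mult_distrib algebra_simps)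
  finally show ?thesis by (simp add: L_opt(2) t5)
qed

subsection \<open>Profiles with a local elastic energy density\<close>

text \<open>The elastic cost of a square of side \<open>\<theta> / 2\<close>, divided by
  \<open>\<theta>^2\<close>.\<close>

definition c0 :: real where "c0 = C_W * tanh pi / 4"

lemma c0_pos: "0 < c0" using C_W_pos by (simp add: c0_def)

text \<open>A Cauchy-Schwarz estimate in linear form with a free parameter \<tau>. The energy is
  measured on a larger set S, so that one number bounds the increments over all its
  subintervals.\<close>

lemma set_integral_young:
  fixes d :: "real \<Rightarrow> real"
  assumes xy: "x \<le> y" and \<tau>: "0 < \<tau>" and d: "set_integrable lborel {x..y} d"
    and d2: "set_integrable lborel S (\<lambda>t. (d t)\<^sup>2)" and S: "{x..y} \<subseteq> S"
  shows "\<bar>LINT t:{x..y}|lborel. d t\<bar> \<le> \<tau> * (y - x) + (LINT t:S|lborel. (d t)\<^sup>2) / (4 * \<tau>)"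
proof -
  have iS: "integrable lborel (\<lambda>t. indicator S t * (d t)\<^sup>2)" using d2 by (simp add: set_integrable_def)
  have young: "\<bar>d t\<bar> \<le> \<tau> + (d t)\<^sup>2 / (4 * \<tau>)" for t
  proof -
    have "0 \<le> (2 * \<tau> - \<bar>d t\<bar>)\<^sup>2" by simp
    then have "4 * \<tau> * \<bar>d t\<bar> \<le> 4 * \<tau>\<^sup>2 + (d t)\<^sup>2" by (simp add: power2_diff power_mult_distrib)
    then show ?thesis using \<tau> by (simp add: field_simps power2_eq_square)
  qed
  have "\<bar>LINT t:{x..y}|lborel. d t\<bar> = norm (LINT t|lborel. indicator {x..y} t *\<^sub>R d t)"
    by (simp add: set_lebesgue_integral_def)
  also have "\<dots> \<le> (LINT t|lborel. norm (indicator {x..y} t *\<^sub>R d t))" by (rule integral_norm_bound)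
  also have "\<dots> \<le> (LINT t|lborel. \<tau> * indicator {x..y} t + indicator S t * (d t)\<^sup>2 / (4 * \<tau>))"
  proof (rule integral_mono)
    show "integrable lborel (\<lambda>t. norm (indicator {x..y} t *\<^sub>R d t))"
      using d unfolding set_integrable_def by (rule integrable_norm)
    show "integrable lborel (\<lambda>t. \<tau> * indicator {x..y} t + indicator S t * (d t)\<^sup>2 / (4 * \<tau>))"
      by (intro Bochner_Integration.integrable_add integrable_mult_right integrable_divide iS integrable_real_indicator) (use xy in simp_all)
    show "norm (indicator {x..y} t *\<^sub>R d t) \<le> \<tau> * indicator {x..y} t + indicator S t * (d t)\<^sup>2 / (4 * \<tau>)" for t
      using young[of t] \<tau> S by (cases "t \<in> {x..y}") (auto simp: indicator_def)
  qed
  also have "\<dots> = \<tau> * (y - x) + (LINT t:S|lborel. (d t)\<^sup>2) / (4 * \<tau>)"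
  proof (subst Bochner_Integration.integral_add)
    show "integrable lborel (\<lambda>t. \<tau> * indicator {x..y} t)"
      by (intro integrable_mult_right integrable_real_indicator) (use xy in simp_all)
    show "integrable lborel (\<lambda>t. indicator S t * (d t)\<^sup>2 / (4 * \<tau>))" by (intro integrable_divide iS)
    show "(LINT t|lborel. \<tau> * indicator {x..y} t) + (LINT t|lborel. indicator S t * (d t)\<^sup>2 / (4 * \<tau>)) =
        \<tau> * (y - x) + (LINT t:S|lborel. (d t)\<^sup>2) / (4 * \<tau>)"
      using xy by (simp add: set_lebesgue_integral_def)
  qed
  finally show ?thesis .
qed

text \<open>Here \<open>\<mu>\<close> is the ratio of the vertical to the horizontal scale: \<open>V\<^bsup>1/5\<^esup>\<close> for a rescaled profile,
  and arbitrary for a competitor of \<open>G\<close>, whose half-strips have infinite height.\<close>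

locale profile_energy =
  fixes H g :: "real \<Rightarrow> real" and e :: "real \<Rightarrow> ennreal" and \<mu> tot :: real
  assumes contH: "continuous_on UNIV H" and H_nonneg: "\<And>x. 0 \<le> H x"
    and intH: "integrable lborel H" and H1: "(LINT x|lborel. H x) = 1"
    and g_meas: "g \<in> borel_measurable borel" and e_meas: "e \<in> borel_measurable borel"
    and ftc: "\<And>x y. x \<le> y \<Longrightarrow> set_integrable lborel {x..y} g"
      "\<And>x y. x \<le> y \<Longrightarrow> (LINT t:{x..y}|lborel. g t) = H y - H x"
    and mu: "0 < \<mu>" and tot: "0 \<le> tot"
    and elastic: "\<And>a b r. a < b \<Longrightarrow> 0 < r \<Longrightarrow> (\<And>x. x \<in> {a..b} \<Longrightarrow> r < \<mu> * H x) \<Longrightarrow>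
      ennreal (C_W * (b - a)\<^sup>2 * tanh (pi * r / (b - a))) \<le> (\<integral>\<^sup>+x\<in>{a..b}. e x \<partial>lborel)"
    and total: "(\<integral>\<^sup>+x. e x \<partial>lborel) + (\<integral>\<^sup>+x. ennreal ((g x)\<^sup>2) \<partial>lborel) \<le> ennreal tot"
begin

section \<open>Increments of the profile and the mass of its thin part\<close>

lemma g2: "(\<integral>\<^sup>+x. ennreal ((g x)\<^sup>2) \<partial>lborel) \<le> ennreal tot"
  by (rule order_trans[OF _ total]) simp

lemma e_total: "(\<integral>\<^sup>+x. e x \<partial>lborel) \<le> ennreal tot"
  by (rule order_trans[OF _ total]) simp

lemma g2_int: "integrable lborel (\<lambda>x. (g x)\<^sup>2)" "(LINT x|lborel. (g x)\<^sup>2) \<le> tot"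
proof -
  have m: "(\<lambda>x. (g x)\<^sup>2) \<in> borel_measurable lborel" using g_meas by simp
  show i: "integrable lborel (\<lambda>x. (g x)\<^sup>2)"
    by (rule integrableI_nonneg[OF m]) (use order_le_less_trans[OF g2 ennreal_less_top] in simp_all)
  have "ennreal (LINT x|lborel. (g x)\<^sup>2) \<le> ennreal tot"
    using g2 nn_integral_eq_integral[OF i] by simp
  then show "(LINT x|lborel. (g x)\<^sup>2) \<le> tot" using tot by simp
qed

lemma g2_set_int: "S \<in> sets borel \<Longrightarrow> set_integrable lborel S (\<lambda>t. (g t)\<^sup>2)"
  unfolding set_integrable_def by (rule integrable_mult_indicator[OF _ g2_int(1)]) simp

lemma increment_bound:
  assumes "x \<le> y" "0 < \<tau>" "S \<in> sets borel" "{x..y} \<subseteq> S"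
  shows "\<bar>H y - H x\<bar> \<le> \<tau> * (y - x) + (LINT t:S|lborel. (g t)\<^sup>2) / (4 * \<tau>)"
  using set_integral_young[OF assms(1,2) ftc(1)[OF assms(1)] g2_set_int[OF assms(3)] assms(4)] ftc(2)[OF assms(1)]
  by simp

text \<open>The largest 1-Lipschitz minorant of \<open>\<mu> * H\<close>. It is a local thickness
  that does not vary on its own scale, so near x a square of side comparable to
  \<open>\<theta> x\<close> fits under the film.\<close>

definition \<theta> :: "real \<Rightarrow> real" where "\<theta> x = (INF z. \<mu> * H z + \<bar>x - z\<bar>)"

lemma theta_le: "\<theta> x \<le> \<mu> * H z + \<bar>x - z\<bar>"
  unfolding \<theta>_def by (rule cINF_lower) (use mu H_nonneg in \<open>auto intro!: bdd_belowI[of _ 0]\<close>)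

lemma theta_nonneg: "0 \<le> \<theta> x"
  unfolding \<theta>_def by (rule cINF_greatest) (use mu H_nonneg in auto)

lemma theta_attain: "\<theta> x < t \<Longrightarrow> \<exists>z. \<mu> * H z + \<bar>x - z\<bar> < t"
proof (rule ccontr)
  assume lt: "\<theta> x < t" and "\<nexists>z. \<mu> * H z + \<bar>x - z\<bar> < t"
  then have "t \<le> \<theta> x" unfolding \<theta>_def by (intro cINF_greatest) (auto simp: not_less)
  with lt show False by simp
qed

lemma theta_lipschitz: "\<theta> x \<le> \<theta> y + \<bar>x - y\<bar>"
proof -
  have "\<theta> x - \<bar>x - y\<bar> \<le> \<theta> y"
    unfolding \<theta>_def[of y]
  proof (rule cINF_greatest)
    show "\<theta> x - \<bar>x - y\<bar> \<le> \<mu> * H z + \<bar>y - z\<bar>" for z using theta_le[of x z] by linarith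
  qed simp
  then show ?thesis by simp
qed

lemma theta_meas [measurable]: "\<theta> \<in> borel_measurable borel"
proof (rule borel_measurable_continuous_onI)
  have "1-lipschitz_on UNIV \<theta>"
  proof (rule lipschitz_onI)
    show "dist (\<theta> x) (\<theta> y) \<le> 1 * dist x y" for x y
      using theta_lipschitz[of x y] theta_lipschitz[of y x] by (simp add: dist_real_def)
  qed simp
  then show "continuous_on UNIV \<theta>" by (rule lipschitz_on_continuous_on)
qed

lemma theta_pos: "0 < H x \<Longrightarrow> 0 < \<theta> x"
proof -
  assume Hx: "0 < H x"
  have "isCont H x" using contH by (simp add: continuous_on_eq_continuous_at)
  then obtain d where d: "d > 0" "\<And>z. \<bar>z - x\<bar> < d \<Longrightarrow> \<bar>H z - H x\<bar> < H x / 2"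
    using Hx unfolding continuous_at_eps_delta dist_real_def by (metis half_gt_zero)
  have "min (\<mu> * (H x / 2)) d \<le> \<theta> x"
    unfolding \<theta>_def
  proof (rule cINF_greatest)
    fix z
    show "min (\<mu> * (H x / 2)) d \<le> \<mu> * H z + \<bar>x - z\<bar>"
    proof (cases "\<bar>z - x\<bar> < d")
      case True
      then have "H x / 2 \<le> H z" using d(2)[OF True] by linarith
      then have "\<mu> * (H x / 2) \<le> \<mu> * H z" using mu by (intro mult_left_mono) auto
      then show ?thesis by linarith
    next
      case False
      then show ?thesis using mult_nonneg_nonneg[of \<mu> "H z"] mu H_nonneg[of z] by linarith
    qed
  qed simp
  moreover have "0 < min (\<mu> * (H x / 2)) d" using d(1) mu Hx by simp
  ultimately show ?thesis by linarith
qed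

text \<open>Within distance \<open>\<theta> x / 4\<close> of x the thickness
  \<open>\<mu> * H\<close> is at least \<open>3/4 * \<theta> x\<close>, so a rectangle of width and
  height \<open>\<theta> x / 2\<close> fits.\<close>

lemma theta_local:
  assumes "0 < \<theta> x"
  shows "ennreal (c0 * (\<theta> x)\<^sup>2) \<le> (\<integral>\<^sup>+z\<in>{x - \<theta> x / 4..x + \<theta> x / 4}. e z \<partial>lborel)"
proof -
  define s where "s = \<theta> x / 4"
  have s: "s > 0" using assms by (simp add: s_def)
  have "ennreal (C_W * ((x + s) - (x - s))\<^sup>2 * tanh (pi * (2 * s) / ((x + s) - (x - s)))) \<le> (\<integral>\<^sup>+z\<in>{x - s..x + s}. e z \<partial>lborel)"
  proof (rule elastic)
    fix z assume "z \<in> {x - s..x + s}"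
    then have "\<bar>x - z\<bar> \<le> s" by auto
    then show "2 * s < \<mu> * H z" using theta_le[of x z] s unfolding s_def by linarith
  qed (use s in auto)
  moreover have "C_W * ((x + s) - (x - s))\<^sup>2 * tanh (pi * (2 * s) / ((x + s) - (x - s))) = c0 * (\<theta> x)\<^sup>2"
    using s by (simp add: c0_def s_def power2_eq_square field_simps)
  ultimately show ?thesis by (simp add: s_def)
qed

text \<open>Divide the local bound by \<open>\<theta> x\<close> and integrate, exchanging the order.
  The points x whose square covers z have \<open>\<theta> x\<close> at least
  \<open>4/5 * \<theta> z\<close> and lie within \<open>\<theta> z / 3\<close> of z, so z is counted
  with weight at most 5/4 * 2/3 = 5/6. The Lipschitz property replaces a covering lemma.\<close>

lemma theta_integral: "(\<integral>\<^sup>+x. ennreal (\<theta> x) \<partial>lborel) \<le> ennreal (tot / c0)"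
proof -
  note e_meas [measurable]
  define k where "k x z = (if 0 < \<theta> x \<and> x - \<theta> x / 4 \<le> z \<and> z \<le> x + \<theta> x / 4 then ennreal (1 / \<theta> x) else 0)" for x z
  have km[measurable]: "(\<lambda>(x, z). e z * k x z) \<in> borel_measurable (lborel \<Otimes>\<^sub>M lborel)"
    unfolding k_def by measurable
  have 1: "ennreal (c0 * \<theta> x) \<le> (\<integral>\<^sup>+z. e z * k x z \<partial>lborel)" for x
  proof (cases "0 < \<theta> x")
    case True
    have "ennreal (c0 * \<theta> x) = ennreal (c0 * (\<theta> x)\<^sup>2) * ennreal (1 / \<theta> x)"
      using True c0_pos by (simp add: ennreal_mult'[symmetric] power2_eq_square)
    also have "\<dots> \<le> (\<integral>\<^sup>+z\<in>{x - \<theta> x / 4..x + \<theta> x / 4}. e z \<partial>lborel) * ennreal (1 / \<theta> x)"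
      by (intro mult_right_mono theta_local True) simp
    also have "\<dots> = (\<integral>\<^sup>+z. e z * indicator {x - \<theta> x / 4..x + \<theta> x / 4} z * ennreal (1 / \<theta> x) \<partial>lborel)"
      by (rule nn_integral_multc[symmetric]) measurable
    also have "\<dots> = (\<integral>\<^sup>+z. e z * k x z \<partial>lborel)"
      by (rule nn_integral_cong) (use True in \<open>auto simp: k_def indicator_def\<close>)
    finally show ?thesis .
  next
    case False
    then have "\<theta> x = 0" using theta_nonneg[of x] by simp
    then show ?thesis by simp
  qed
  have inner: "(\<integral>\<^sup>+x. k x z \<partial>lborel) \<le> 1" for z
  proof -
    have "(\<integral>\<^sup>+x. k x z \<partial>lborel) \<le> (\<integral>\<^sup>+x. ennreal (5 / (4 * \<theta> z)) * indicator {z - \<theta> z / 3..z + \<theta> z / 3} x \<partial>lborel)"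
    proof (rule nn_integral_mono)
      fix x
      show "k x z \<le> ennreal (5 / (4 * \<theta> z)) * indicator {z - \<theta> z / 3..z + \<theta> z / 3} x"
      proof (cases "0 < \<theta> x \<and> x - \<theta> x / 4 \<le> z \<and> z \<le> x + \<theta> x / 4")
        case True
        have "\<theta> z \<le> \<theta> x + \<bar>z - x\<bar>" "\<theta> x \<le> \<theta> z + \<bar>x - z\<bar>" by (rule theta_lipschitz)+
        then have b: "4 / 5 * \<theta> z \<le> \<theta> x" "\<theta> x \<le> 4 / 3 * \<theta> z" "0 < \<theta> z" "\<bar>z - x\<bar> \<le> \<theta> z / 3"
          using True by linarith+
        have "1 / \<theta> x \<le> 1 / (4 / 5 * \<theta> z)" using b True by (intro divide_left_mono) auto
        then have "ennreal (1 / \<theta> x) \<le> ennreal (5 / (4 * \<theta> z))" by (intro ennreal_leI) simp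
        moreover have "x \<in> {z - \<theta> z / 3..z + \<theta> z / 3}" using b(4) unfolding atLeastAtMost_iff by linarith
        ultimately show ?thesis using True by (simp add: k_def)
      next
        case False
        then show ?thesis unfolding k_def by (simp only: if_False) simp
      qed
    qed
    also have "\<dots> = ennreal (5 / (4 * \<theta> z)) * emeasure lborel {z - \<theta> z / 3..z + \<theta> z / 3}"
      by (rule nn_integral_cmult_indicator) simp
    also have "\<dots> = ennreal (5 / (4 * \<theta> z) * (2 / 3 * \<theta> z))"
      using theta_nonneg[of z] by (simp add: ennreal_mult'[symmetric])
    also have "\<dots> \<le> 1"
      using theta_nonneg[of z] by (cases "\<theta> z = 0") auto
    finally show ?thesis .
  qed
  have "(\<integral>\<^sup>+x. ennreal (c0 * \<theta> x) \<partial>lborel) \<le> (\<integral>\<^sup>+x. \<integral>\<^sup>+z. e z * k x z \<partial>lborel \<partial>lborel)"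
    by (rule nn_integral_mono) (rule 1)
  also have "\<dots> = (\<integral>\<^sup>+z. \<integral>\<^sup>+x. e z * k x z \<partial>lborel \<partial>lborel)"
    using lborel_pair.Fubini'[OF km] by simp
  also have "\<dots> = (\<integral>\<^sup>+z. e z * (\<integral>\<^sup>+x. k x z \<partial>lborel) \<partial>lborel)"
  proof (rule nn_integral_cong)
    fix z
    have "(\<lambda>x. k x z) \<in> borel_measurable lborel" unfolding k_def by measurable
    then show "(\<integral>\<^sup>+x. e z * k x z \<partial>lborel) = e z * (\<integral>\<^sup>+x. k x z \<partial>lborel)" by (rule nn_integral_cmult)
  qed
  also have "\<dots> \<le> (\<integral>\<^sup>+z. e z * 1 \<partial>lborel)" by (intro nn_integral_mono mult_left_mono inner) simp
  also have "\<dots> \<le> ennreal tot" using e_total by simp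
  finally have "ennreal c0 * (\<integral>\<^sup>+x. ennreal (\<theta> x) \<partial>lborel) \<le> ennreal tot"
    using c0_pos by (simp add: ennreal_mult' nn_integral_cmult)
  then have "ennreal (1 / c0) * (ennreal c0 * (\<integral>\<^sup>+x. ennreal (\<theta> x) \<partial>lborel)) \<le> ennreal (1 / c0) * ennreal tot"
    by (intro mult_left_mono) simp_all
  then show ?thesis
    using c0_pos tot by (simp add: mult.assoc[symmetric] ennreal_mult'[symmetric])
qed

text \<open>If \<open>\<theta> x\<close> is at least T, the truncation level \<delta> is at most
  \<open>\<delta> / T * \<theta> x\<close>. Otherwise some z within \<open>2 * \<theta> x\<close> of
  x has small height, and H grows little between z and x by the surface energy.\<close>

lemma film_pointwise:
  assumes T: "0 < T" and \<delta>: "0 < \<delta>"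
  shows "min (H x) \<delta> \<le> (2 / \<mu> + 2 * sqrt T + \<delta> / T) * \<theta> x + (LINT t:{x - 2 * T..x + 2 * T}|lborel. (g t)\<^sup>2) / (4 * sqrt T)"
proof -
  let ?\<Gamma> = "LINT t:{x - 2 * T..x + 2 * T}|lborel. (g t)\<^sup>2"
  have G0: "0 \<le> ?\<Gamma> / (4 * sqrt T)"
    using T unfolding set_lebesgue_integral_def by (intro divide_nonneg_nonneg Bochner_Integration.integral_nonneg) auto
  have pos: "0 \<le> 2 / \<mu> * \<theta> x" "0 \<le> 2 * sqrt T * \<theta> x" "0 \<le> \<delta> / T * \<theta> x"
    using mu T \<delta> theta_nonneg[of x] by simp_all
  show ?thesis
  proof (cases "H x = 0 \<or> T \<le> \<theta> x")
    case True
    then have "min (H x) \<delta> \<le> \<delta> / T * \<theta> x"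
    proof
      assume "T \<le> \<theta> x"
      then have "\<delta> / T * T \<le> \<delta> / T * \<theta> x" using T \<delta> by (intro mult_left_mono) auto
      then show ?thesis using T by simp
    qed (use pos(3) \<delta> in simp)
    then show ?thesis using G0 pos by (simp add: distrib_right)
  next
    case False
    then have \<theta>: "0 < \<theta> x" "\<theta> x < T" using theta_pos[of x] H_nonneg[of x] by auto
    \<comment> \<open>A point within a factor two of the infimum suffices; the factor reappears in
      \<open>2 / \<mu>\<close> and \<open>2 * sqrt T\<close>.\<close>
    then obtain z where z: "\<mu> * H z + \<bar>x - z\<bar> < 2 * \<theta> x" using theta_attain[of x "2 * \<theta> x"] by auto
    have Hz: "H z \<le> 2 / \<mu> * \<theta> x"
      using z mu H_nonneg[of z] by (simp add: field_simps)
    have xz: "\<bar>x - z\<bar> \<le> 2 * \<theta> x" using z mult_nonneg_nonneg[of \<mu> "H z"] mu H_nonneg[of z] by linarith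
    have sub: "{min x z..max x z} \<subseteq> {x - 2 * T..x + 2 * T}" using xz \<theta> by auto
    \<comment> \<open>The parameter \<open>sqrt T\<close> balances two errors: the length term is at
      most \<open>2 * sqrt T * \<theta> x\<close>, and integrating the slope term over windows of
      length 4 T yields \<open>sqrt T * tot\<close>.\<close>
    have "\<bar>H (max x z) - H (min x z)\<bar> \<le> sqrt T * (max x z - min x z) + ?\<Gamma> / (4 * sqrt T)"
      by (rule increment_bound) (use T sub in auto)
    moreover have "\<bar>H (max x z) - H (min x z)\<bar> = \<bar>H x - H z\<bar>" by (auto simp: max_def min_def)
    moreover have "sqrt T * (max x z - min x z) \<le> sqrt T * (2 * \<theta> x)"
      using xz T by (intro mult_left_mono) auto
    ultimately have "H x \<le> 2 / \<mu> * \<theta> x + 2 * sqrt T * \<theta> x + ?\<Gamma> / (4 * sqrt T)" using Hz by linarith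
    then show ?thesis using pos(3) by (simp add: distrib_right)
  qed
qed

text \<open>The bound becomes small by choosing first T small, then \<delta> small compared with T,
  then the ratio \<mu> large. The slope windows are integrated by exchanging the order: every t
  belongs to windows of total length 4 T.\<close>

lemma film_integral:
  assumes T: "0 < T" and \<delta>: "0 < \<delta>"
  shows "(LINT x|lborel. min (H x) \<delta>) \<le> (2 / \<mu> + 2 * sqrt T + \<delta> / T) * (tot / c0) + sqrt T * tot"
proof -
  note g_meas [measurable]
  define K where "K = 2 / \<mu> + 2 * sqrt T + \<delta> / T"
  have K: "0 \<le> K" using mu T \<delta> by (simp add: K_def)
  define \<Gamma> where "\<Gamma> x = (\<integral>\<^sup>+t. ennreal ((g t)\<^sup>2) * indicator {x - 2 * T..x + 2 * T} t \<partial>lborel)" for x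
  have mm: "(\<lambda>(x, t). ennreal ((g t)\<^sup>2) * indicator {x - 2 * T..x + 2 * T} t) \<in> borel_measurable (lborel \<Otimes>\<^sub>M lborel)"
  proof -
    have "(\<lambda>(x, t). ennreal ((g t)\<^sup>2) * (if x - 2 * T \<le> t \<and> t \<le> x + 2 * T then 1 else 0)) \<in> borel_measurable (lborel \<Otimes>\<^sub>M lborel)"
      by measurable
    also have "(\<lambda>(x, t). ennreal ((g t)\<^sup>2) * (if x - 2 * T \<le> t \<and> t \<le> x + 2 * T then 1 else 0)) =
        (\<lambda>(x, t). ennreal ((g t)\<^sup>2) * indicator {x - 2 * T..x + 2 * T} t)"
      by (auto simp: fun_eq_iff indicator_def)
    finally show ?thesis .
  qed
  have \<Gamma>m: "\<Gamma> \<in> borel_measurable lborel"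
    unfolding \<Gamma>_def using lborel.borel_measurable_nn_integral_fst[OF mm] by simp
  have \<Gamma>: "ennreal (LINT t:{x - 2 * T..x + 2 * T}|lborel. (g t)\<^sup>2) = \<Gamma> x" for x
  proof -
    have "integrable lborel (\<lambda>t. indicator {x - 2 * T..x + 2 * T} t * (g t)\<^sup>2)"
      using integrable_mult_indicator[OF _ g2_int(1), of "{x - 2 * T..x + 2 * T}"] by simp
    from nn_integral_eq_integral[OF this]
    have "ennreal (LINT t:{x - 2 * T..x + 2 * T}|lborel. (g t)\<^sup>2) =
        (\<integral>\<^sup>+t. ennreal (indicator {x - 2 * T..x + 2 * T} t * (g t)\<^sup>2) \<partial>lborel)"
      by (simp add: set_lebesgue_integral_def)
    also have "\<dots> = \<Gamma> x" unfolding \<Gamma>_def by (rule nn_integral_cong) (auto simp: indicator_def)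
    finally show ?thesis .
  qed
  have i\<Gamma>: "(\<integral>\<^sup>+x. \<Gamma> x \<partial>lborel) \<le> ennreal (4 * T * tot)"
  proof -
    have "(\<integral>\<^sup>+x. \<Gamma> x \<partial>lborel) = (\<integral>\<^sup>+t. \<integral>\<^sup>+x. ennreal ((g t)\<^sup>2) * indicator {x - 2 * T..x + 2 * T} t \<partial>lborel \<partial>lborel)"
      unfolding \<Gamma>_def using lborel_pair.Fubini'[OF mm] by simp
    also have "\<dots> = (\<integral>\<^sup>+t. ennreal ((g t)\<^sup>2) * ennreal (4 * T) \<partial>lborel)"
    proof (rule nn_integral_cong)
      fix t
      have "(\<integral>\<^sup>+x. ennreal ((g t)\<^sup>2) * indicator {x - 2 * T..x + 2 * T} t \<partial>lborel) =
          (\<integral>\<^sup>+x. ennreal ((g t)\<^sup>2) * indicator {t - 2 * T..t + 2 * T} x \<partial>lborel)"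
        by (rule nn_integral_cong) (auto simp: indicator_def)
      also have "\<dots> = ennreal ((g t)\<^sup>2) * ennreal (4 * T)"
        using T by (simp add: nn_integral_cmult_indicator)
      finally show "(\<integral>\<^sup>+x. ennreal ((g t)\<^sup>2) * indicator {x - 2 * T..x + 2 * T} t \<partial>lborel) = ennreal ((g t)\<^sup>2) * ennreal (4 * T)" .
    qed
    also have "\<dots> = (\<integral>\<^sup>+t. ennreal ((g t)\<^sup>2) \<partial>lborel) * ennreal (4 * T)" by (rule nn_integral_multc) measurable
    also have "\<dots> \<le> ennreal tot * ennreal (4 * T)" by (intro mult_right_mono g2) simp
    finally show ?thesis using T tot by (simp add: ennreal_mult'[symmetric] mult.commute)
  qed
  have Hm[measurable]: "H \<in> borel_measurable borel" by (rule borel_measurable_continuous_onI[OF contH])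
  have imin: "integrable lborel (\<lambda>x. min (H x) \<delta>)"
    by (rule Bochner_Integration.integrable_bound[OF intH]) (use H_nonneg \<delta> in auto)
  have "ennreal (LINT x|lborel. min (H x) \<delta>) = (\<integral>\<^sup>+x. ennreal (min (H x) \<delta>) \<partial>lborel)"
    by (rule nn_integral_eq_integral[symmetric, OF imin]) (use H_nonneg \<delta> in auto)
  also have "\<dots> \<le> (\<integral>\<^sup>+x. ennreal K * ennreal (\<theta> x) + ennreal (1 / (4 * sqrt T)) * \<Gamma> x \<partial>lborel)"
  proof (rule nn_integral_mono)
    fix x
    let ?I = "LINT t:{x - 2 * T..x + 2 * T}|lborel. (g t)\<^sup>2"
    have I0: "0 \<le> ?I" unfolding set_lebesgue_integral_def by (rule Bochner_Integration.integral_nonneg) simp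
    have "ennreal (min (H x) \<delta>) \<le> ennreal (K * \<theta> x + 1 / (4 * sqrt T) * ?I)"
      using film_pointwise[OF T \<delta>, of x] unfolding K_def[symmetric] by (intro ennreal_leI) simp
    also have "\<dots> = ennreal (K * \<theta> x) + ennreal (1 / (4 * sqrt T) * ?I)"
      using K theta_nonneg[of x] I0 T by (intro ennreal_plus) simp_all
    also have "\<dots> = ennreal K * ennreal (\<theta> x) + ennreal (1 / (4 * sqrt T)) * \<Gamma> x"
    proof -
      have "0 \<le> 1 / (4 * sqrt T)" using T by simp
      then show ?thesis unfolding \<Gamma>[symmetric] using ennreal_mult'[OF K] ennreal_mult' by metis
    qed
    finally show "ennreal (min (H x) \<delta>) \<le> ennreal K * ennreal (\<theta> x) + ennreal (1 / (4 * sqrt T)) * \<Gamma> x" .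
  qed
  also have "\<dots> = ennreal K * (\<integral>\<^sup>+x. ennreal (\<theta> x) \<partial>lborel) + ennreal (1 / (4 * sqrt T)) * (\<integral>\<^sup>+x. \<Gamma> x \<partial>lborel)"
    using \<Gamma>m by (simp add: nn_integral_add nn_integral_cmult)
  also have "\<dots> \<le> ennreal K * ennreal (tot / c0) + ennreal (1 / (4 * sqrt T)) * ennreal (4 * T * tot)"
    by (intro add_mono mult_left_mono theta_integral i\<Gamma>) simp_all
  also have "\<dots> = ennreal (K * (tot / c0) + 1 / (4 * sqrt T) * (4 * T * tot))"
    using K T tot c0_pos by (simp add: ennreal_mult'[symmetric] ennreal_plus[symmetric] del: ennreal_plus)
  also have "1 / (4 * sqrt T) * (4 * T * tot) = sqrt T * tot"
    using T real_div_sqrt[of T] by (simp add: field_simps)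
  finally show ?thesis
    using K tot c0_pos T unfolding K_def[symmetric] by (subst (asm) ennreal_le_iff) auto
qed

end

section \<open>Components of superlevel sets\<close>

lemma open_connected_bounded_real:
  fixes K :: "real set"
  assumes "open K" "connected K" "bounded K" "K \<noteq> {}"
  obtains \<alpha> \<beta> where "\<alpha> < \<beta>" "K = {\<alpha><..<\<beta>}"
proof -
  have bdd: "bdd_below K" "bdd_above K" using bounded_imp_bdd_below[OF assms(3)] bounded_imp_bdd_above[OF assms(3)] .
  have eq: "K = {Inf K<..<Sup K}"
  proof (intro equalityI subsetI)
    fix x assume x: "x \<in> K"
    then obtain d where d: "d > 0" "ball x d \<subseteq> K" using assms(1) openE by blast
    then have "x - d / 2 \<in> K" "x + d / 2 \<in> K" by (auto simp: dist_real_def subset_eq)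
    then have "Inf K \<le> x - d / 2" "x + d / 2 \<le> Sup K" by (auto intro: cInf_lower cSup_upper bdd)
    then show "x \<in> {Inf K<..<Sup K}" using d(1) by auto
  next
    fix x assume "x \<in> {Inf K<..<Sup K}"
    then obtain y z where "y \<in> K" "y < x" "z \<in> K" "x < z"
      using cInf_less_iff[OF assms(4) bdd(1)] less_cSup_iff[OF assms(4) bdd(2)] by auto
    then show "x \<in> K" using connected_contains_Icc[OF assms(2), of y z] by auto
  qed
  then have "Inf K < Sup K" using assms(4) by (metis greaterThanLessThan_empty_iff not_less)
  with eq that show ?thesis by blast
qed

lemma set_nn_integral_Ioo_Icc:
  fixes f :: "real \<Rightarrow> ennreal"
  shows "(\<integral>\<^sup>+x\<in>{\<alpha><..<\<beta>}. f x \<partial>lborel) = (\<integral>\<^sup>+x\<in>{\<alpha>..\<beta>}. f x \<partial>lborel)"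
proof (rule nn_integral_cong_AE)
  show "AE x in lborel. f x * indicator {\<alpha><..<\<beta>} x = f x * indicator {\<alpha>..\<beta>} x"
    using AE_lborel_singleton[of \<alpha>] AE_lborel_singleton[of \<beta>]
    by eventually_elim (auto simp: indicator_def)
qed

lemma set_integral_Ioo_Icc:
  fixes f :: "real \<Rightarrow> real"
  assumes "f \<in> borel_measurable borel"
  shows "(LINT x:{\<alpha><..<\<beta>}|lborel. f x) = (LINT x:{\<alpha>..\<beta>}|lborel. f x)"
  unfolding set_lebesgue_integral_def
proof (rule integral_cong_AE)
  show "AE x in lborel. indicator {\<alpha><..<\<beta>} x *\<^sub>R f x = indicator {\<alpha>..\<beta>} x *\<^sub>R f x"
    using AE_lborel_singleton[of \<alpha>] AE_lborel_singleton[of \<beta>]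
    by eventually_elim (auto simp: indicator_def)
qed (use assms in simp_all)

context profile_energy
begin

lemma H_meas [measurable]: "H \<in> borel_measurable borel"
  by (rule borel_measurable_continuous_onI[OF contH])

lemma mass_le_1: "S \<in> sets borel \<Longrightarrow> (LINT x:S|lborel. H x) \<le> 1"
proof -
  assume S: "S \<in> sets borel"
  have "(LINT x:S|lborel. H x) \<le> (LINT x|lborel. H x)"
    unfolding set_lebesgue_integral_def
    by (rule integral_mono[OF integrable_mult_indicator[OF _ intH] intH])
       (use S H_nonneg in \<open>auto simp: indicator_def\<close>)
  then show ?thesis by (simp add: H1)
qed

text \<open>A component carries mass at least \<delta> times its length, so its length is at most
  1/\<delta>. At its ends the height equals \<delta>: not less by continuity, not more because the
  component is maximal.\<close>

lemma component_interval:
  assumes \<delta>: "0 < \<delta>" and K: "K \<in> components {x. \<delta> < H x}"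
  obtains \<alpha> \<beta> where "\<alpha> < \<beta>" "K = {\<alpha><..<\<beta>}" "H \<alpha> = \<delta>" "H \<beta> = \<delta>" "\<forall>x\<in>{\<alpha>..\<beta>}. \<delta> \<le> H x"
proof -
  let ?S = "{x. \<delta> < H x}"
  have oS: "open ?S" by (intro open_Collect_less continuous_on_const contH)
  have oK: "open K" using open_components[OF oS K] .
  have cK: "connected K" using in_components_connected[OF K] .
  have nK: "K \<noteq> {}" using in_components_nonempty[OF K] .
  have sK: "K \<subseteq> ?S" using in_components_subset[OF K] .
  have diam: "y - x \<le> 1 / \<delta>" if "x \<in> K" "y \<in> K" "x \<le> y" for x y
  proof -
    have "{x..y} \<subseteq> ?S" using connected_contains_Icc[OF cK that(1,2)] sK by blast
    then have sub: "\<And>t. t \<in> {x..y} \<Longrightarrow> \<delta> \<le> H t" by auto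
    have "\<delta> * (y - x) = (LINT t:{x..y}|lborel. \<delta>)" using that(3) by (simp add: set_lebesgue_integral_def)
    also have "\<dots> \<le> (LINT t:{x..y}|lborel. H t)"
    proof (rule set_integral_mono[OF _ _ sub])
      show "set_integrable lborel {x..y} (\<lambda>_. \<delta>)"
        unfolding set_integrable_def by (intro borel_integrable_compact continuous_on_const compact_Icc)
      show "set_integrable lborel {x..y} H"
        unfolding set_integrable_def by (rule integrable_mult_indicator[OF _ intH]) simp
    qed
    also have "\<dots> \<le> 1" by (rule mass_le_1) simp
    finally show ?thesis using \<delta> by (simp add: field_simps)
  qed
  obtain x0 where x0: "x0 \<in> K" using nK by blast
  have "dist x0 y \<le> 1 / \<delta>" if "y \<in> K" for y
    using diam[OF x0 that] diam[OF that x0] by (cases "x0 \<le> y") (auto simp: dist_real_def)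
  then have bK: "bounded K" unfolding bounded_def by blast
  obtain \<alpha> \<beta> where ab: "\<alpha> < \<beta>" "K = {\<alpha><..<\<beta>}" by (rule open_connected_bounded_real[OF oK cK bK nK])
  have "closed {x. \<delta> \<le> H x}" by (intro closed_Collect_le continuous_on_const contH)
  moreover have "K \<subseteq> {x. \<delta> \<le> H x}" using sK by auto
  ultimately have "closure K \<subseteq> {x. \<delta> \<le> H x}" by (rule closure_minimal[rotated])
  then have ge: "\<forall>x\<in>{\<alpha>..\<beta>}. \<delta> \<le> H x" using ab by (auto simp: subset_eq)
  have le: "H x \<le> \<delta>" if x: "x = \<alpha> \<or> x = \<beta>" for x
  proof (rule ccontr)
    assume "\<not> H x \<le> \<delta>"
    then obtain d where d: "d > 0" "ball x d \<subseteq> ?S" using oS openE[of ?S x] by auto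
    have "K \<inter> ball x d \<noteq> {}"
    proof -
      define t where "t = min (d / 2) ((\<beta> - \<alpha>) / 2)"
      have ts: "t \<le> d / 2" "t \<le> (\<beta> - \<alpha>) / 2" unfolding t_def by (rule min.cobounded1, rule min.cobounded2)
      have t: "0 < t" "t < d" "t < \<beta> - \<alpha>"
      proof -
        show "0 < t" using d(1) ab(1) by (simp add: t_def)
        show "t < d" using ts(1) d(1) by linarith
        have "(\<beta> - \<alpha>) / 2 < \<beta> - \<alpha>" using ab(1) by simp
        then show "t < \<beta> - \<alpha>" using ts(2) by linarith
      qed
      show ?thesis
      proof (cases "x = \<alpha>")
        case True
        then have "\<alpha> + t \<in> K \<inter> ball x d" using t ab by (auto simp: dist_real_def)
        then show ?thesis by blast
      next
        case False
        then have "\<beta> - t \<in> K \<inter> ball x d" using t ab x by (auto simp: dist_real_def)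
        then show ?thesis by blast
      qed
    qed
    then have "ball x d \<subseteq> K" using components_maximal[OF K connected_ball d(2)] by blast
    then have "x \<in> K" using d(1) by auto
    then show False using x ab by auto
  qed
  show ?thesis
  proof (rule that[OF ab _ _ ge])
    show "H \<alpha> = \<delta>" using le[of \<alpha>] bspec[OF ge, of \<alpha>] ab(1) by simp
    show "H \<beta> = \<delta>" using le[of \<beta>] bspec[OF ge, of \<beta>] ab(1) by simp
  qed
qed

lemma g_set_int: "set_integrable lborel {\<alpha>..\<beta>} g"
  using ftc(1)[of \<alpha> \<beta>] by (cases "\<alpha> \<le> \<beta>") (simp_all add: set_integrable_def)

text \<open>Integration by parts for the absolutely continuous H, done by Fubini. Since H takes the
  same value at both ends, the integral of g is zero and the moment may be taken about the
  midpoint.\<close>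

lemma moment_identity:
  assumes ab: "\<alpha> < \<beta>" and eq: "H \<alpha> = \<delta>" "H \<beta> = \<delta>"
  shows "(LINT t:{\<alpha>..\<beta>}|lborel. g t * ((\<alpha> + \<beta>) / 2 - t)) = (LINT x:{\<alpha>..\<beta>}|lborel. H x - \<delta>)"
    and "set_integrable lborel {\<alpha>..\<beta>} (\<lambda>t. g t * ((\<alpha> + \<beta>) / 2 - t))"
proof -
  note g_meas [measurable]
  \<comment> \<open>The kernel of the triangle \<alpha> \<le> t \<le> x \<le> \<beta>: integrated in
    t it gives the height above \<delta>, integrated in x it gives the weight \<beta> - t.\<close>
  define f where "f x t = (if \<alpha> \<le> t \<and> t \<le> x \<and> x \<le> \<beta> then g t else 0)" for x t
  have fm[measurable]: "case_prod f \<in> borel_measurable (lborel \<Otimes>\<^sub>M lborel)"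
    unfolding f_def by measurable
  have fx: "f x t = indicator {\<alpha>..\<beta>} x * (indicator {\<alpha>..x} t *\<^sub>R g t)" for x t
    by (auto simp: f_def indicator_def)
  have ft: "f x t = indicator {\<alpha>..\<beta>} t *\<^sub>R g t * indicator {t..\<beta>} x" for x t
    by (auto simp: f_def indicator_def)
  have ix: "integrable lborel (\<lambda>t. f x t)" for x
    unfolding fx using g_set_int[of \<alpha> x] unfolding set_integrable_def by (rule integrable_mult_right)
  have nrm: "integrable lborel (\<lambda>t. norm (indicator {\<alpha>..\<beta>} t *\<^sub>R g t))"
    using g_set_int[of \<alpha> \<beta>] unfolding set_integrable_def by (rule integrable_norm)
  have "integrable lborel (\<lambda>x. LINT t|lborel. norm (f x t))"
  proof (rule Bochner_Integration.integrable_bound)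
    show "integrable lborel (\<lambda>x. (LINT t|lborel. norm (indicator {\<alpha>..\<beta>} t *\<^sub>R g t)) * indicator {\<alpha>..\<beta>} x)"
      by (intro integrable_mult_right integrable_real_indicator) (use ab in simp_all)
    show "(\<lambda>x. LINT t|lborel. norm (f x t)) \<in> borel_measurable lborel" by measurable
    show "AE x in lborel. norm (LINT t|lborel. norm (f x t)) \<le> norm ((LINT t|lborel. norm (indicator {\<alpha>..\<beta>} t *\<^sub>R g t)) * indicator {\<alpha>..\<beta>} x)"
    proof (rule AE_I2)
      fix x
      have "(LINT t|lborel. norm (f x t)) \<le> (LINT t|lborel. norm (indicator {\<alpha>..\<beta>} t *\<^sub>R g t) * indicator {\<alpha>..\<beta>} x)"
        by (rule integral_mono[OF integrable_norm[OF ix] integrable_mult_left[OF nrm]])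
           (auto simp: f_def indicator_def)
      then show "norm (LINT t|lborel. norm (f x t)) \<le> norm ((LINT t|lborel. norm (indicator {\<alpha>..\<beta>} t *\<^sub>R g t)) * indicator {\<alpha>..\<beta>} x)"
        by (simp add: abs_of_nonneg Bochner_Integration.integral_nonneg)
    qed
  qed
  then have int: "integrable (lborel \<Otimes>\<^sub>M lborel) (case_prod f)"
    by (intro lborel_pair.Fubini_integrable) (use ix in simp_all)
  have swap: "(LINT t|lborel. LINT x|lborel. f x t) = (LINT x|lborel. LINT t|lborel. f x t)"
    by (rule lborel_pair.Fubini_integral[OF int])
  have L: "(LINT x|lborel. LINT t|lborel. f x t) = (LINT x:{\<alpha>..\<beta>}|lborel. H x - \<delta>)"
    unfolding set_lebesgue_integral_def
  proof (rule Bochner_Integration.integral_cong[OF refl])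
    fix x
    show "(LINT t|lborel. f x t) = indicator {\<alpha>..\<beta>} x *\<^sub>R (H x - \<delta>)"
      unfolding fx using ftc(2)[of \<alpha> x] eq(1)
      by (cases "x \<in> {\<alpha>..\<beta>}") (simp_all add: set_lebesgue_integral_def)
  qed
  have R: "(LINT x|lborel. f x t) = indicator {\<alpha>..\<beta>} t *\<^sub>R (g t * (\<beta> - t))" for t
    unfolding ft by (cases "t \<in> {\<alpha>..\<beta>}") simp_all
  have bnd: "set_integrable lborel {\<alpha>..\<beta>} (\<lambda>t. g t * (c - t))" for c
    unfolding set_integrable_def
  proof (rule Bochner_Integration.integrable_bound)
    show "integrable lborel (\<lambda>t. (\<bar>c\<bar> + \<bar>\<alpha>\<bar> + \<bar>\<beta>\<bar>) * norm (indicator {\<alpha>..\<beta>} t *\<^sub>R g t))"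
      by (intro integrable_mult_right nrm)
    show "AE t in lborel. norm (indicator {\<alpha>..\<beta>} t *\<^sub>R (g t * (c - t))) \<le> norm ((\<bar>c\<bar> + \<bar>\<alpha>\<bar> + \<bar>\<beta>\<bar>) * norm (indicator {\<alpha>..\<beta>} t *\<^sub>R g t))"
    proof (rule AE_I2)
      fix t
      show "norm (indicator {\<alpha>..\<beta>} t *\<^sub>R (g t * (c - t))) \<le> norm ((\<bar>c\<bar> + \<bar>\<alpha>\<bar> + \<bar>\<beta>\<bar>) * norm (indicator {\<alpha>..\<beta>} t *\<^sub>R g t))"
      proof (cases "t \<in> {\<alpha>..\<beta>}")
        case True
        then have "\<bar>c - t\<bar> \<le> \<bar>c\<bar> + \<bar>\<alpha>\<bar> + \<bar>\<beta>\<bar>" by auto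
        then have "\<bar>g t\<bar> * \<bar>c - t\<bar> \<le> \<bar>g t\<bar> * (\<bar>c\<bar> + \<bar>\<alpha>\<bar> + \<bar>\<beta>\<bar>)" by (intro mult_left_mono) auto
        then show ?thesis using True by (simp add: abs_mult mult.commute)
      qed simp
    qed
  qed simp
  show "set_integrable lborel {\<alpha>..\<beta>} (\<lambda>t. g t * ((\<alpha> + \<beta>) / 2 - t))" by (rule bnd)
  have "(LINT x:{\<alpha>..\<beta>}|lborel. H x - \<delta>) = (LINT t:{\<alpha>..\<beta>}|lborel. g t * (\<beta> - t))"
    using swap unfolding L R by (simp add: set_lebesgue_integral_def)
  also have "\<dots> = (LINT t:{\<alpha>..\<beta>}|lborel. g t * ((\<alpha> + \<beta>) / 2 - t) + (\<beta> - \<alpha>) / 2 * g t)"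
  proof -
    have "g t * (\<beta> - t) = g t * ((\<alpha> + \<beta>) / 2 - t) + (\<beta> - \<alpha>) / 2 * g t" for t by (simp add: field_simps)
    then show ?thesis by (simp only:)
  qed
  also have "\<dots> = (LINT t:{\<alpha>..\<beta>}|lborel. g t * ((\<alpha> + \<beta>) / 2 - t)) + (\<beta> - \<alpha>) / 2 * (LINT t:{\<alpha>..\<beta>}|lborel. g t)"
    by (subst set_integral_add(2)[OF bnd]) (use g_set_int in auto)
  also have "(LINT t:{\<alpha>..\<beta>}|lborel. g t) = 0" using ftc(2)[of \<alpha> \<beta>] ab eq by simp
  finally show "(LINT t:{\<alpha>..\<beta>}|lborel. g t * ((\<alpha> + \<beta>) / 2 - t)) = (LINT x:{\<alpha>..\<beta>}|lborel. H x - \<delta>)" by simp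
qed

text \<open>Pythagoras: \<open>12 M / l^3 * (c - t)\<close> is the slope of the parabola of mass M,
  and by \<open>moment_identity\<close> it is the projection of g onto multiples of c - t. The
  remainder measures exactly the excess over the optimal surface energy.\<close>

lemma surface_identity:
  assumes ab: "\<alpha> < \<beta>" and eq: "H \<alpha> = \<delta>" "H \<beta> = \<delta>"
  defines "M \<equiv> LINT x:{\<alpha>..\<beta>}|lborel. H x - \<delta>" and "l \<equiv> \<beta> - \<alpha>" and "c \<equiv> (\<alpha> + \<beta>) / 2"
  shows "(LINT t:{\<alpha>..\<beta>}|lborel. (g t - 12 * M / l ^ 3 * (c - t))\<^sup>2) = (LINT t:{\<alpha>..\<beta>}|lborel. (g t)\<^sup>2) - 12 * M\<^sup>2 / l ^ 3"
    and "set_integrable lborel {\<alpha>..\<beta>} (\<lambda>t. (g t - 12 * M / l ^ 3 * (c - t))\<^sup>2)"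
proof -
  define k where "k = 12 * M / l ^ 3"
  have l: "l > 0" using ab by (simp add: l_def)
  have i1: "set_integrable lborel {\<alpha>..\<beta>} (\<lambda>t. (g t)\<^sup>2)" by (rule g2_set_int) simp
  have i2: "set_integrable lborel {\<alpha>..\<beta>} (\<lambda>t. 2 * k * (g t * (c - t)))"
    using moment_identity(2)[OF ab eq] unfolding c_def by simp
  have i3: "set_integrable lborel {\<alpha>..\<beta>} (\<lambda>t. k\<^sup>2 * (c - t)\<^sup>2)"
    unfolding set_integrable_def by (intro borel_integrable_compact compact_Icc continuous_intros)
  have ex: "(g t - k * (c - t))\<^sup>2 = (g t)\<^sup>2 - 2 * k * (g t * (c - t)) + k\<^sup>2 * (c - t)\<^sup>2" for t
    by (simp add: power2_eq_square algebra_simps)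
  show "set_integrable lborel {\<alpha>..\<beta>} (\<lambda>t. (g t - 12 * M / l ^ 3 * (c - t))\<^sup>2)"
    unfolding k_def[symmetric] ex by (intro set_integral_add(1) set_integral_diff(1) i1 i2 i3)
  have sq: "(LINT t:{\<alpha>..\<beta>}|lborel. (c - t)\<^sup>2) = l ^ 3 / 12"
  proof -
    have "((\<lambda>t. (c - t)\<^sup>2) has_integral (- ((c - \<beta>) ^ 3 / 3) - - ((c - \<alpha>) ^ 3 / 3))) {\<alpha>..\<beta>}"
      using ab by (intro fundamental_theorem_of_calculus)
        (auto intro!: derivative_eq_intros simp flip: has_real_derivative_iff_has_vector_derivative)
    moreover have "c - \<beta> = - (l / 2)" "c - \<alpha> = l / 2" by (simp_all add: c_def l_def field_simps)
    moreover have "set_integrable lborel {\<alpha>..\<beta>} (\<lambda>t. (c - t)\<^sup>2)"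
      unfolding set_integrable_def by (intro borel_integrable_compact compact_Icc continuous_intros)
    ultimately show ?thesis
      using set_borel_integral_eq_integral(2)[of "{\<alpha>..\<beta>}" "\<lambda>t. (c - t)\<^sup>2"] by (simp add: integral_unique power_divide)
  qed
  have "(LINT t:{\<alpha>..\<beta>}|lborel. (g t - k * (c - t))\<^sup>2) =
      (LINT t:{\<alpha>..\<beta>}|lborel. (g t)\<^sup>2) - 2 * k * (LINT t:{\<alpha>..\<beta>}|lborel. g t * (c - t)) + k\<^sup>2 * (LINT t:{\<alpha>..\<beta>}|lborel. (c - t)\<^sup>2)"
    unfolding ex using set_integral_add(2)[OF set_integral_diff(1)[OF i1 i2] i3] set_integral_diff(2)[OF i1 i2] by simp
  also have "(LINT t:{\<alpha>..\<beta>}|lborel. g t * (c - t)) = M"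
    unfolding M_def c_def by (rule moment_identity(1)[OF ab eq])
  also have "(LINT t:{\<alpha>..\<beta>}|lborel. (g t)\<^sup>2) - 2 * k * M + k\<^sup>2 * (LINT t:{\<alpha>..\<beta>}|lborel. (c - t)\<^sup>2) = (LINT t:{\<alpha>..\<beta>}|lborel. (g t)\<^sup>2) - 12 * M\<^sup>2 / l ^ 3"
    unfolding sq k_def using l by (simp add: field_simps power2_eq_square)
  finally show "(LINT t:{\<alpha>..\<beta>}|lborel. (g t - 12 * M / l ^ 3 * (c - t))\<^sup>2) = (LINT t:{\<alpha>..\<beta>}|lborel. (g t)\<^sup>2) - 12 * M\<^sup>2 / l ^ 3"
    unfolding k_def .
qed

context
  fixes \<Lambda> \<delta> :: real
  assumes \<Lambda>: "0 < \<Lambda>" "tot < C_W * \<Lambda>\<^sup>2 * tanh pi" and \<delta>: "0 < \<delta>" and thick: "2 * \<Lambda> \<le> \<mu> * \<delta>"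
begin

text \<open>The tanh factor of a rectangle of width \<Lambda> and height
  \<open>\<mu> * \<delta> / 2\<close>; narrower components do better. The height is halved because
  the rectangle has to stay strictly below the graph, whose lowest value over a component is
  \<delta>.\<close>

definition "\<rho> = tanh (pi * (\<mu> * \<delta> / 2) / \<Lambda>)"

lemma rho: "0 < \<rho>" "\<rho> < 1"
  unfolding \<rho>_def using \<Lambda>(1) \<delta> mu by (auto simp: tanh_real_lt_1)

text \<open>A longer interval would contain one of length exactly \<Lambda>. By thickness, the
  rectangle over it has height at least its width, and it would already cost more than
  \<open>tot\<close>.\<close>

lemma interval_length:
  assumes ab: "\<alpha> < \<beta>" and ge: "\<forall>x\<in>{\<alpha>..\<beta>}. \<delta> \<le> H x"
  shows "\<beta> - \<alpha> \<le> \<Lambda>"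
proof (rule ccontr)
  assume "\<not> \<beta> - \<alpha> \<le> \<Lambda>"
  then have sub: "{\<alpha>..\<alpha> + \<Lambda>} \<subseteq> {\<alpha>..\<beta>}" by auto
  have "ennreal (C_W * ((\<alpha> + \<Lambda>) - \<alpha>)\<^sup>2 * tanh (pi * (\<mu> * \<delta> / 2) / ((\<alpha> + \<Lambda>) - \<alpha>))) \<le> (\<integral>\<^sup>+x\<in>{\<alpha>..\<alpha> + \<Lambda>}. e x \<partial>lborel)"
  proof (rule elastic)
    fix x assume "x \<in> {\<alpha>..\<alpha> + \<Lambda>}"
    then have "\<mu> * \<delta> \<le> \<mu> * H x" using sub ge mu by (intro mult_left_mono) auto
    then show "\<mu> * \<delta> / 2 < \<mu> * H x" using mult_pos_pos[OF mu \<delta>] by linarith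
  qed (use \<Lambda> mu \<delta> in auto)
  also have "\<dots> \<le> (\<integral>\<^sup>+x. e x \<partial>lborel)" by (rule nn_integral_mono) (auto simp: indicator_def)
  also have "\<dots> \<le> ennreal tot" by (rule e_total)
  finally have "C_W * \<Lambda>\<^sup>2 * tanh (pi * (\<mu> * \<delta> / 2) / \<Lambda>) \<le> tot" using tot by (simp add: ennreal_le_iff)
  moreover have "tanh pi \<le> tanh (pi * (\<mu> * \<delta> / 2) / \<Lambda>)"
    using thick \<Lambda>(1) by (simp add: field_simps)
  then have "C_W * \<Lambda>\<^sup>2 * tanh pi \<le> C_W * \<Lambda>\<^sup>2 * tanh (pi * (\<mu> * \<delta> / 2) / \<Lambda>)"
    using C_W_pos by (intro mult_left_mono) auto
  ultimately show False using \<Lambda>(2) by linarith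
qed

lemma interval_elastic:
  assumes ab: "\<alpha> < \<beta>" and ge: "\<forall>x\<in>{\<alpha>..\<beta>}. \<delta> \<le> H x"
  shows "ennreal (\<rho> * C_W * (\<beta> - \<alpha>)\<^sup>2) \<le> (\<integral>\<^sup>+x\<in>{\<alpha><..<\<beta>}. e x \<partial>lborel)"
proof -
  have "ennreal (C_W * (\<beta> - \<alpha>)\<^sup>2 * tanh (pi * (\<mu> * \<delta> / 2) / (\<beta> - \<alpha>))) \<le> (\<integral>\<^sup>+x\<in>{\<alpha>..\<beta>}. e x \<partial>lborel)"
  proof (rule elastic[OF ab])
    fix x assume "x \<in> {\<alpha>..\<beta>}"
    then have "\<mu> * \<delta> \<le> \<mu> * H x" using ge mu by (intro mult_left_mono) auto
    then show "\<mu> * \<delta> / 2 < \<mu> * H x" using mult_pos_pos[OF mu \<delta>] by linarith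
  qed (use mu \<delta> in auto)
  note el = this
  have "\<rho> \<le> tanh (pi * (\<mu> * \<delta> / 2) / (\<beta> - \<alpha>))"
    unfolding \<rho>_def tanh_real_le_iff
    using interval_length[OF ab ge] ab mu \<delta> by (intro divide_left_mono) auto
  then have le: "(C_W * (\<beta> - \<alpha>)\<^sup>2) * \<rho> \<le> C_W * (\<beta> - \<alpha>)\<^sup>2 * tanh (pi * (\<mu> * \<delta> / 2) / (\<beta> - \<alpha>))"
    using C_W_pos by (intro mult_left_mono) auto
  have "(C_W * (\<beta> - \<alpha>)\<^sup>2) * \<rho> = \<rho> * C_W * (\<beta> - \<alpha>)\<^sup>2" by simp
  with order_trans[OF ennreal_leI[OF le] el] show ?thesis
    unfolding set_nn_integral_Ioo_Icc by (simp only:)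
qed

definition "mass K = (LINT x:K|lborel. H x - \<delta>)"

lemma set_nn_integral_g2:
  assumes "S \<in> sets borel"
  shows "(\<integral>\<^sup>+x\<in>S. ennreal ((g x)\<^sup>2) \<partial>lborel) = ennreal (LINT x:S|lborel. (g x)\<^sup>2)"
proof -
  have "(\<integral>\<^sup>+x\<in>S. ennreal ((g x)\<^sup>2) \<partial>lborel) = (\<integral>\<^sup>+x. ennreal (indicator S x *\<^sub>R (g x)\<^sup>2) \<partial>lborel)"
    by (rule nn_integral_cong) (auto simp: indicator_def)
  also have "\<dots> = ennreal (LINT x|lborel. indicator S x *\<^sub>R (g x)\<^sup>2)"
    using g2_set_int[OF assms] unfolding set_integrable_def by (intro nn_integral_eq_integral) auto
  finally show ?thesis unfolding set_lebesgue_integral_def .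
qed

lemma H_set_int: "set_integrable lborel {\<alpha>..\<beta>} (\<lambda>x. H x - \<delta>)"
  unfolding set_integrable_def
  by (intro borel_integrable_compact compact_Icc continuous_on_diff continuous_on_subset[OF contH] continuous_on_const subset_UNIV)

text \<open>Counting mass from level \<delta> gives zero boundary values, so the parabola bound
  holds on each component; together with the elastic bound this is the one-island problem with its
  scaling law.\<close>

lemma component_energy:
  assumes K: "K \<in> components {x. \<delta> < H x}"
  shows "0 < mass K"
    and "ennreal (\<rho> * m_opt * mass K powr (4 / 5)) \<le> (\<integral>\<^sup>+x\<in>K. e x + ennreal ((g x)\<^sup>2) \<partial>lborel)"
proof -
  obtain \<alpha> \<beta> where ab: "\<alpha> < \<beta>" and Keq: "K = {\<alpha><..<\<beta>}" and eq: "H \<alpha> = \<delta>" "H \<beta> = \<delta>" and ge: "\<forall>x\<in>{\<alpha>..\<beta>}. \<delta> \<le> H x"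
    by (rule component_interval[OF \<delta> K])
  have gt: "\<delta> < H x" if "x \<in> {\<alpha><..<\<beta>}" for x using that in_components_subset[OF K] Keq by auto
  have massK: "mass K = (LINT x:{\<alpha>..\<beta>}|lborel. H x - \<delta>)"
    unfolding mass_def Keq by (rule set_integral_Ioo_Icc) measurable
  show pos: "0 < mass K"
  proof -
    have "0 \<le> mass K"
      unfolding massK set_lebesgue_integral_def using ge by (intro Bochner_Integration.integral_nonneg) (auto simp: indicator_def)
    moreover have "mass K \<noteq> 0"
    proof
      assume "mass K = 0"
      moreover have "integrable lborel (\<lambda>x. indicator {\<alpha>..\<beta>} x *\<^sub>R (H x - \<delta>))"
        using H_set_int unfolding set_integrable_def .
      ultimately have "AE x in lborel. indicator {\<alpha>..\<beta>} x *\<^sub>R (H x - \<delta>) = 0"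
        unfolding massK set_lebesgue_integral_def using ge
        by (subst (asm) integral_nonneg_eq_0_iff_AE) (auto simp: indicator_def)
      then have "AE x in lborel. x \<notin> {\<alpha><..<\<beta>}"
        by eventually_elim (use gt in \<open>force simp: indicator_def\<close>)
      then have "emeasure lborel {\<alpha><..<\<beta>} = 0" by (subst (asm) AE_iff_measurable[of "{\<alpha><..<\<beta>}"]) auto
      then show False using ab by simp
    qed
    ultimately show ?thesis by simp
  qed
  let ?l = "\<beta> - \<alpha>"
  have l: "0 < ?l" using ab by simp
  have S: "12 * (mass K)\<^sup>2 / ?l ^ 3 \<le> (LINT t:{\<alpha>..\<beta>}|lborel. (g t)\<^sup>2)"
  proof -
    have "0 \<le> (LINT t:{\<alpha>..\<beta>}|lborel. (g t - 12 * (LINT x:{\<alpha>..\<beta>}|lborel. H x - \<delta>) / ?l ^ 3 * ((\<alpha> + \<beta>) / 2 - t))\<^sup>2)"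
      unfolding set_lebesgue_integral_def by (rule Bochner_Integration.integral_nonneg) simp
    then show ?thesis unfolding surface_identity(1)[OF ab eq] massK by simp
  qed
  \<comment> \<open>Only the elastic part really loses the factor \<rho>; charging the surface part
    as well gives a common factor to which the scaling inequality applies.\<close>
  have "\<rho> * m_opt * mass K powr (4 / 5) \<le> \<rho> * (C_W * ?l\<^sup>2 + 12 * (mass K)\<^sup>2 / ?l ^ 3)"
    using energy_scaled[OF l pos] rho by (simp add: mult.assoc)
  also have "\<dots> \<le> \<rho> * C_W * ?l\<^sup>2 + 12 * (mass K)\<^sup>2 / ?l ^ 3"
  proof -
    have "0 \<le> 12 * (mass K)\<^sup>2 / ?l ^ 3" using l by simp
    from mult_right_mono[OF less_imp_le[OF rho(2)] this] show ?thesis by (simp add: distrib_left)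
  qed
  also have "\<dots> \<le> \<rho> * C_W * ?l\<^sup>2 + (LINT t:{\<alpha>..\<beta>}|lborel. (g t)\<^sup>2)" using S by simp
  finally have "ennreal (\<rho> * m_opt * mass K powr (4 / 5)) \<le> ennreal (\<rho> * C_W * ?l\<^sup>2 + (LINT t:{\<alpha>..\<beta>}|lborel. (g t)\<^sup>2))"
    by (rule ennreal_leI)
  also have "\<dots> = ennreal (\<rho> * C_W * ?l\<^sup>2) + ennreal (LINT t:{\<alpha>..\<beta>}|lborel. (g t)\<^sup>2)"
    using rho C_W_pos unfolding set_lebesgue_integral_def
    by (intro ennreal_plus Bochner_Integration.integral_nonneg) simp_all
  also have "\<dots> \<le> (\<integral>\<^sup>+x\<in>K. e x \<partial>lborel) + (\<integral>\<^sup>+x\<in>K. ennreal ((g x)\<^sup>2) \<partial>lborel)"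
    unfolding Keq set_nn_integral_Ioo_Icc[of "\<lambda>x. ennreal ((g x)\<^sup>2)"]
    using interval_elastic[OF ab ge] set_nn_integral_g2[of "{\<alpha>..\<beta>}"] by (intro add_mono) simp_all
  also have "\<dots> = (\<integral>\<^sup>+x\<in>K. e x + ennreal ((g x)\<^sup>2) \<partial>lborel)"
  proof -
    note e_meas [measurable] g_meas [measurable]
    show ?thesis unfolding distrib_right Keq by (rule nn_integral_add[symmetric]) measurable
  qed
  finally show "ennreal (\<rho> * m_opt * mass K powr (4 / 5)) \<le> (\<integral>\<^sup>+x\<in>K. e x + ennreal ((g x)\<^sup>2) \<partial>lborel)" .
qed

lemma component_mass_le:
  assumes ab: "\<alpha> < \<beta>"
  shows "(LINT x:{\<alpha>..\<beta>}|lborel. H x - \<delta>) \<le> (LINT x:{\<alpha>..\<beta>}|lborel. H x)"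
    and "(LINT x:{\<alpha>..\<beta>}|lborel. H x) \<le> 1"
proof -
  have "set_integrable lborel {\<alpha>..\<beta>} H"
    unfolding set_integrable_def by (rule integrable_mult_indicator[OF _ intH]) simp
  then show "(LINT x:{\<alpha>..\<beta>}|lborel. H x - \<delta>) \<le> (LINT x:{\<alpha>..\<beta>}|lborel. H x)"
    by (intro set_integral_mono H_set_int) (use \<delta> in simp_all)
qed (simp add: mass_le_1)

lemma component_borel: "K \<in> components {x. \<delta> < H x} \<Longrightarrow> K \<in> sets borel"
  using open_components[OF open_Collect_less[OF continuous_on_const contH]] by (rule borel_open)

lemma sum_component_energy:
  assumes F: "finite F" "F \<subseteq> components {x. \<delta> < H x}"
  shows "\<rho> * m_opt * (\<Sum>K\<in>F. mass K powr (4 / 5)) \<le> tot"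
proof -
  note e_meas [measurable] g_meas [measurable]
  have disj: "disjoint_family_on (\<lambda>K. K) F"
    using pairwise_subset[OF pairwise_disjoint_components F(2)] unfolding disjoint_family_on_def pairwise_def by blast
  have bor: "K \<in> sets borel" if "K \<in> F" for K using component_borel that F(2) by blast
  have "ennreal (\<rho> * m_opt * (\<Sum>K\<in>F. mass K powr (4 / 5))) = (\<Sum>K\<in>F. ennreal (\<rho> * m_opt * mass K powr (4 / 5)))"
    unfolding sum_distrib_left using rho m_opt_pos by (intro sum_ennreal[symmetric]) simp
  also have "\<dots> \<le> (\<Sum>K\<in>F. \<integral>\<^sup>+x\<in>K. e x + ennreal ((g x)\<^sup>2) \<partial>lborel)"
    by (rule sum_mono) (use component_energy(2) F in blast)
  also have "\<dots> = (\<integral>\<^sup>+x. (\<Sum>K\<in>F. (e x + ennreal ((g x)\<^sup>2)) * indicator K x) \<partial>lborel)"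
    by (rule nn_integral_sum[symmetric]) (use bor in measurable)
  also have "\<dots> \<le> (\<integral>\<^sup>+x. e x + ennreal ((g x)\<^sup>2) \<partial>lborel)"
  proof (rule nn_integral_mono)
    fix x
    have "(\<Sum>K\<in>F. (e x + ennreal ((g x)\<^sup>2)) * indicator K x) = (e x + ennreal ((g x)\<^sup>2)) * indicator (\<Union>K\<in>F. K) x"
      unfolding indicator_UN_disjoint[OF F(1) disj] sum_distrib_left ..
    also have "\<dots> \<le> e x + ennreal ((g x)\<^sup>2)" by (auto simp: indicator_def)
    finally show "(\<Sum>K\<in>F. (e x + ennreal ((g x)\<^sup>2)) * indicator K x) \<le> e x + ennreal ((g x)\<^sup>2)" .
  qed
  also have "\<dots> = (\<integral>\<^sup>+x. e x \<partial>lborel) + (\<integral>\<^sup>+x. ennreal ((g x)\<^sup>2) \<partial>lborel)" by (rule nn_integral_add) measurable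
  also have "\<dots> \<le> ennreal tot" by (rule total)
  finally show ?thesis using tot by (simp add: ennreal_le_iff)
qed

lemma pos_part_int: "integrable lborel (\<lambda>x. max 0 (H x - \<delta>))"
  by (rule Bochner_Integration.integrable_bound[OF intH]) (use H_nonneg \<delta> in auto)

text \<open>Strict subadditivity in usable form: a component of mass m \<le> M has m =
  \<open>m powr (1/5) * m powr (4/5)\<close> \<le> \<open>M powr (1/5) * m powr (4/5)\<close>, and
  the second factors are summed by the energy. With \<open>tot\<close> close to
  \<open>m_opt\<close>, small components cannot carry almost all of the mass.\<close>

lemma mass_bound:
  assumes M: "0 \<le> M" "\<And>K. K \<in> components {x. \<delta> < H x} \<Longrightarrow> mass K \<le> M"
  shows "\<rho> * m_opt * (LINT x|lborel. max 0 (H x - \<delta>)) \<le> M powr (1 / 5) * tot"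
proof -
  let ?S = "{x. \<delta> < H x}"
  have oS: "open ?S" by (intro open_Collect_less continuous_on_const contH)
  have cS: "countable (components ?S)"
  proof (rule countable_disjoint_open_subsets)
    show "disjoint (components ?S)"
      using pairwise_disjoint_components[of ?S] unfolding pairwise_def disjnt_def .
  qed (rule open_components[OF oS])
  define P where "P x = max 0 (H x - \<delta>)" for x
  have fin: "\<rho> * m_opt * (LINT x:(\<Union>F)|lborel. P x) \<le> M powr (1 / 5) * tot" if F: "finite F" "F \<subseteq> components ?S" for F
  proof -
    have PK: "(LINT x:K|lborel. P x) = mass K" if "K \<in> F" for K
      unfolding mass_def set_lebesgue_integral_def
      by (rule Bochner_Integration.integral_cong) (use that F in_components_subset[of K ?S] in \<open>auto simp: P_def indicator_def subset_eq\<close>)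
    have bor: "K \<in> sets borel" if "K \<in> F" for K using component_borel that F(2) by blast
    have "(LINT x:(\<Union>K\<in>F. K)|lborel. P x) = (\<Sum>K\<in>F. LINT x:K|lborel. P x)"
    proof (rule set_integral_finite_Union[OF F(1)])
      show "disjoint_family_on (\<lambda>K. K) F"
        using pairwise_subset[OF pairwise_disjoint_components F(2)] unfolding disjoint_family_on_def pairwise_def by blast
      show "set_integrable lborel K P" if "K \<in> F" for K
        unfolding set_integrable_def P_def using bor[OF that] by (intro integrable_mult_indicator pos_part_int) simp
    qed (use bor in simp)
    also have "\<dots> = (\<Sum>K\<in>F. mass K)" by (rule sum.cong[OF refl PK])
    also have "\<dots> \<le> (\<Sum>K\<in>F. M powr (1 / 5) * mass K powr (4 / 5))"
    proof (rule sum_mono)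
      fix K assume "K \<in> F"
      then have K: "0 < mass K" "mass K \<le> M" using component_energy(1) M(2) F(2) by blast+
      have "mass K = mass K powr (1 / 5) * mass K powr (4 / 5)" using K(1) by (simp flip: powr_add)
      also have "\<dots> \<le> M powr (1 / 5) * mass K powr (4 / 5)" using K by (intro mult_right_mono powr_mono2) auto
      finally show "mass K \<le> M powr (1 / 5) * mass K powr (4 / 5)" .
    qed
    finally have "(LINT x:(\<Union>F)|lborel. P x) \<le> M powr (1 / 5) * (\<Sum>K\<in>F. mass K powr (4 / 5))"
      by (simp add: sum_distrib_left)
    then have "\<rho> * m_opt * (LINT x:(\<Union>F)|lborel. P x) \<le> \<rho> * m_opt * (M powr (1 / 5) * (\<Sum>K\<in>F. mass K powr (4 / 5)))"
      using rho m_opt_pos by (intro mult_left_mono) auto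
    also have "\<dots> = M powr (1 / 5) * (\<rho> * m_opt * (\<Sum>K\<in>F. mass K powr (4 / 5)))" by simp
    also have "\<dots> \<le> M powr (1 / 5) * tot" by (intro mult_left_mono sum_component_energy F) simp
    finally show ?thesis .
  qed
  show ?thesis
  proof (cases "components ?S = {}")
    case True
    then have "?S = {}" by (simp add: components_eq_empty)
    then have "H x \<le> \<delta>" for x by (auto simp: not_less)
    then have "max 0 (H x - \<delta>) = 0" for x by (simp add: max_absorb1)
    then show ?thesis using tot by simp
  next
    case False
    \<comment> \<open>The enumeration may repeat components; only the unions of its initial images
      matter.\<close>
    define c where "c n = from_nat_into (components ?S) n" for n
    have cin: "c n \<in> components ?S" for n unfolding c_def by (rule from_nat_into[OF False])
    have lim: "(\<lambda>n. LINT x|lborel. indicator (\<Union>(c ` {..<n})) x *\<^sub>R P x) \<longlonglongrightarrow> (LINT x|lborel. P x)"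
    proof (rule integral_dominated_convergence[where w = P])
      show "integrable lborel P" unfolding P_def by (rule pos_part_int)
      then show "P \<in> borel_measurable lborel" by simp
      show "(\<lambda>x. indicator (\<Union>(c ` {..<n})) x *\<^sub>R P x) \<in> borel_measurable lborel" for n
      proof -
        have "\<Union>(c ` {..<n}) \<in> sets borel" using component_borel[OF cin] by auto
        then show ?thesis unfolding P_def by measurable
      qed
      show "AE x in lborel. norm (indicator (\<Union>(c ` {..<n})) x *\<^sub>R P x) \<le> P x" for n
        by (rule AE_I2) (auto simp: P_def indicator_def)
      show "AE x in lborel. (\<lambda>n. indicator (\<Union>(c ` {..<n})) x *\<^sub>R P x) \<longlonglongrightarrow> P x"
      proof (rule AE_I2)
        fix x
        show "(\<lambda>n. indicator (\<Union>(c ` {..<n})) x *\<^sub>R P x) \<longlonglongrightarrow> P x"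
        proof (cases "x \<in> ?S")
          case True
          then obtain K where K: "K \<in> components ?S" "x \<in> K" using Union_components[of ?S] by blast
          then obtain i where i: "c i = K" unfolding c_def using from_nat_into_surj[OF cS] by blast
          have "\<forall>\<^sub>F n in sequentially. indicator (\<Union>(c ` {..<n})) x *\<^sub>R P x = P x"
            using eventually_gt_at_top[of i] by eventually_elim (use i K in \<open>auto simp: indicator_def\<close>)
          then show ?thesis by (rule tendsto_eventually)
        next
          case False
          then have "P x = 0" by (simp add: P_def)
          then show ?thesis by simp
        qed
      qed
    qed
    have "\<rho> * m_opt * (LINT x|lborel. indicator (\<Union>(c ` {..<n})) x *\<^sub>R P x) \<le> M powr (1 / 5) * tot" for n
      using fin[of "c ` {..<n}"] cin unfolding set_lebesgue_integral_def by auto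
    then have "\<rho> * m_opt * (LINT x|lborel. P x) \<le> M powr (1 / 5) * tot"
      by (intro LIMSEQ_le_const2[OF tendsto_mult[OF tendsto_const lim]]) blast
    then show ?thesis unfolding P_def .
  qed
qed

end

end

section \<open>Stability of near-minimizers\<close>

context profile_energy
begin

text \<open>One parameter q bounds the level \<delta>, the loss in the tanh factor and the mass of
  the thin part. A heavy component is found first; then the energy excess, at most
  \<open>m_opt * (1 - r)\<close>, controls its width, its deviation from the parabola and the slopes
  outside.\<close>

lemma stability:
  assumes tm: "tot \<le> m_opt" and \<Lambda>: "0 < \<Lambda>" "tot < C_W * \<Lambda>\<^sup>2 * tanh pi"
    and \<delta>: "0 < \<delta>" "\<delta> \<le> q" and thick: "2 * \<Lambda> \<le> \<mu> * \<delta>"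
    and q: "0 < q" "q < 1 / 4" and rq: "1 - q \<le> tanh (pi * (\<mu> * \<delta> / 2) / \<Lambda>)"
    and film: "(LINT x|lborel. min (H x) \<delta>) \<le> q"
  defines "r \<equiv> (1 - 2 * q) ^ 20"
  obtains c l M where "0 < l" "l \<le> \<Lambda>" "r \<le> M" "M \<le> 1" "r * C_W * (l - L_opt)\<^sup>2 \<le> m_opt * (1 - r)"
    "\<forall>t. \<bar>H (c + t) - bump l M t\<bar> \<le> q + (1 - r) + sqrt (1 - r) * (\<Lambda> + 1 + m_opt)"
proof -
  let ?S = "{x. \<delta> < H x}"
  define \<rho>' where "\<rho>' = \<rho> \<Lambda> \<delta>"
  have rho: "1 - q \<le> \<rho>'" "\<rho>' < 1" "0 < \<rho>'"
    using rq rho[OF \<Lambda> \<delta>(1) thick] unfolding \<rho>'_def \<rho>_def[OF \<Lambda> \<delta>(1) thick] by simp_all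
  have b: "0 < 1 - 2 * q" "1 - 2 * q < 1" using q by auto
  have r10: "r = ((1 - 2 * q) ^ 10)\<^sup>2" by (simp add: r_def flip: power_mult)
  have le10: "r \<le> (1 - 2 * q) ^ 10" unfolding r_def by (rule power_decreasing) (use b in auto)
  have le1: "r \<le> 1 - 2 * q" unfolding r_def using power_decreasing[of 1 20 "1 - 2 * q"] b by simp
  have r: "0 < r" "r < 1" using b le1 by (simp_all add: r_def)
  \<comment> \<open>The fifth root of the threshold is (1 - 2q)^2. If all components were lighter,
    \<open>mass_bound\<close> would give a product at most (1 - 2q)^2, while both its factors, the
    tanh factor and the mass above \<delta>, are at least 1 - q.\<close>
  have "\<exists>K\<in>components ?S. (1 - 2 * q) ^ 10 < mass \<delta> K"
  proof (rule ccontr)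
    assume "\<not> ?thesis"
    then have "mass \<delta> K \<le> (1 - 2 * q) ^ 10" if "K \<in> components ?S" for K using that by auto
    from mass_bound[OF \<Lambda> \<delta>(1) thick _ this] b
    have "\<rho>' * m_opt * (LINT x|lborel. max 0 (H x - \<delta>)) \<le> ((1 - 2 * q) ^ 10) powr (1 / 5) * tot"
      unfolding \<rho>'_def by simp
    also have "((1 - 2 * q) ^ 10) powr (1 / 5) = (1 - 2 * q)\<^sup>2"
      using b(1) by (simp add: powr_powr flip: powr_realpow powr_numeral)
    also have "(1 - 2 * q)\<^sup>2 * tot \<le> (1 - 2 * q)\<^sup>2 * m_opt" using tm by (intro mult_left_mono) auto
    finally have 1: "\<rho>' * (LINT x|lborel. max 0 (H x - \<delta>)) \<le> (1 - 2 * q)\<^sup>2" using m_opt_pos by (simp add: mult.commute mult.left_commute)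
    have imin: "integrable lborel (\<lambda>x. min (H x) \<delta>)"
      by (rule Bochner_Integration.integrable_bound[OF intH]) (use H_nonneg \<delta> in auto)
    have "(LINT x|lborel. max 0 (H x - \<delta>)) = (LINT x|lborel. H x - min (H x) \<delta>)"
      by (rule Bochner_Integration.integral_cong) (auto simp: max_def min_def)
    also have "\<dots> = 1 - (LINT x|lborel. min (H x) \<delta>)" using intH imin by (simp add: H1)
    finally have "1 - q \<le> (LINT x|lborel. max 0 (H x - \<delta>))" using film by simp
    then have "(1 - q) * (1 - q) \<le> \<rho>' * (LINT x|lborel. max 0 (H x - \<delta>))"
      using rho(1) q by (intro mult_mono) auto
    moreover have "(1 - 2 * q)\<^sup>2 < (1 - q) * (1 - q)"
      unfolding power2_eq_square using q by (intro mult_strict_mono) auto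
    ultimately show False using 1 by simp
  qed
  then obtain K where K: "K \<in> components ?S" and big: "(1 - 2 * q) ^ 10 < mass \<delta> K" by blast
  obtain \<alpha> \<beta> where ab: "\<alpha> < \<beta>" and Keq: "K = {\<alpha><..<\<beta>}" and eq: "H \<alpha> = \<delta>" "H \<beta> = \<delta>" and ge: "\<forall>x\<in>{\<alpha>..\<beta>}. \<delta> \<le> H x"
    by (rule component_interval[OF \<delta>(1) K])
  define l where "l = \<beta> - \<alpha>"
  define c where "c = (\<alpha> + \<beta>) / 2"
  define M where "M = (LINT x:{\<alpha>..\<beta>}|lborel. H x - \<delta>)"
  define k where "k = 12 * M / l ^ 3"
  have l: "0 < l" "l \<le> \<Lambda>" using ab interval_length[OF \<Lambda> \<delta>(1) thick ab ge] by (simp_all add: l_def)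
  have massK: "mass \<delta> K = M"
    unfolding mass_def[OF \<Lambda> \<delta>(1) thick] Keq M_def by (rule set_integral_Ioo_Icc) measurable
  have Mgt: "(1 - 2 * q) ^ 10 < M" using big massK by simp
  have inH: "M \<le> (LINT x:{\<alpha>..\<beta>}|lborel. H x)" "(LINT x:{\<alpha>..\<beta>}|lborel. H x) \<le> 1"
    unfolding M_def using component_mass_le[OF \<Lambda> \<delta>(1) thick ab] by blast+
  have M: "r \<le> M" "M \<le> 1" "r \<le> M\<^sup>2"
  proof -
    show "r \<le> M" using le10 Mgt by linarith
    show "M \<le> 1" using inH by linarith
    show "r \<le> M\<^sup>2" unfolding r10 by (rule power_mono) (use Mgt b in auto)
  qed
  define out where "out = - {\<alpha>..\<beta>}"
  have outb: "out \<in> sets borel" unfolding out_def by (rule borel_comp) simp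
  \<comment> \<open>\<open>W\<close> is the excess inside the heavy component, measured against the
    slope of the parabola; \<open>W'\<close> is all the surface energy outside it.\<close>
  define W where "W = (LINT t:{\<alpha>..\<beta>}|lborel. (g t - k * (c - t))\<^sup>2)"
  define W' where "W' = (LINT t:out|lborel. (g t)\<^sup>2)"
  have W0: "0 \<le> W" "0 \<le> W'"
    unfolding W_def W'_def set_lebesgue_integral_def by (simp_all add: Bochner_Integration.integral_nonneg)
  have Weq: "W = (LINT t:{\<alpha>..\<beta>}|lborel. (g t)\<^sup>2) - 12 * M\<^sup>2 / l ^ 3"
    and Wint: "set_integrable lborel {\<alpha>..\<beta>} (\<lambda>t. (g t - k * (c - t))\<^sup>2)"
    unfolding W_def k_def M_def l_def c_def using surface_identity[OF ab eq] by simp_all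
  have split: "(LINT t|lborel. (g t)\<^sup>2) = (LINT t:{\<alpha>..\<beta>}|lborel. (g t)\<^sup>2) + W'"
  proof -
    have "(LINT t:{\<alpha>..\<beta>} \<union> out|lborel. (g t)\<^sup>2) = (LINT t:{\<alpha>..\<beta>}|lborel. (g t)\<^sup>2) + (LINT t:out|lborel. (g t)\<^sup>2)"
      by (intro set_integral_Un g2_set_int outb) (auto simp: out_def)
    moreover have "{\<alpha>..\<beta>} \<union> out = UNIV" by (auto simp: out_def)
    ultimately show ?thesis by (simp add: W'_def set_lebesgue_integral_def)
  qed
  have "ennreal (\<rho>' * C_W * l\<^sup>2 + (LINT t|lborel. (g t)\<^sup>2)) = ennreal (\<rho>' * C_W * l\<^sup>2) + ennreal (LINT t|lborel. (g t)\<^sup>2)"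
    using rho C_W_pos by (intro ennreal_plus) simp_all
  also have "\<dots> \<le> (\<integral>\<^sup>+x. e x \<partial>lborel) + (\<integral>\<^sup>+x. ennreal ((g x)\<^sup>2) \<partial>lborel)"
  proof (rule add_mono)
    have "ennreal (\<rho>' * C_W * l\<^sup>2) \<le> (\<integral>\<^sup>+x\<in>{\<alpha><..<\<beta>}. e x \<partial>lborel)"
      unfolding \<rho>'_def l_def by (rule interval_elastic[OF \<Lambda> \<delta>(1) thick ab ge])
    also have "\<dots> \<le> (\<integral>\<^sup>+x. e x \<partial>lborel)" by (rule nn_integral_mono) (auto simp: indicator_def)
    finally show "ennreal (\<rho>' * C_W * l\<^sup>2) \<le> (\<integral>\<^sup>+x. e x \<partial>lborel)" .
    show "ennreal (LINT t|lborel. (g t)\<^sup>2) \<le> (\<integral>\<^sup>+x. ennreal ((g x)\<^sup>2) \<partial>lborel)"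
      using nn_integral_eq_integral[OF g2_int(1)] by simp
  qed
  also have "\<dots> \<le> ennreal tot" by (rule total)
  finally have en: "\<rho>' * C_W * l\<^sup>2 + (LINT t|lborel. (g t)\<^sup>2) \<le> m_opt" using tot tm by (simp add: ennreal_le_iff)
  \<comment> \<open>The exponent 20 makes r a lower bound both for \<open>\<rho>'\<close> and for
    \<open>M^2\<close>, the coefficients of the elastic and of the surface term, so the gap
    inequality applies to their sum.\<close>
  have "r * (m_opt + C_W * (l - L_opt)\<^sup>2) \<le> r * (C_W * l\<^sup>2 + 12 / l ^ 3)"
    using r energy_gap[OF l(1)] by (intro mult_left_mono) auto
  also have "\<dots> = r * (C_W * l\<^sup>2) + r * (12 / l ^ 3)" by (simp add: distrib_left)
  also have "\<dots> \<le> \<rho>' * (C_W * l\<^sup>2) + M\<^sup>2 * (12 / l ^ 3)"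
    using le1 rho(1) q M(3) C_W_pos l(1) by (intro add_mono mult_right_mono) auto
  finally have WW: "W + W' \<le> m_opt * (1 - r) - r * C_W * (l - L_opt)\<^sup>2"
    using en Weq split by (simp add: algebra_simps)
  have rC: "0 \<le> r * C_W * (l - L_opt)\<^sup>2" using r C_W_pos by simp
  \<comment> \<open>The excess is at most \<open>m_opt * s^2\<close>, so Young's inequality with
    parameter s gives pointwise errors of order s.\<close>
  define s where "s = sqrt (1 - r)"
  have s: "0 < s" "s * s = 1 - r" using r by (simp_all add: s_def)
  have Ws: "w / (4 * s) \<le> m_opt * s" if "0 \<le> w" "w \<le> W + W'" for w
  proof -
    have "w \<le> m_opt * (s * s)" using that WW rC s by simp
    also have "\<dots> \<le> 4 * (m_opt * (s * s))" using m_opt_pos s(1) by simp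
    finally show ?thesis using s(1) by (simp add: pos_divide_le_eq mult_ac)
  qed
  have cl: "c - \<alpha> = l / 2" "\<beta> - c = l / 2" by (simp_all add: c_def l_def field_simps)
  have main: "\<bar>H (c + t) - bump l M t\<bar> \<le> q + (1 - r) + s * (\<Lambda> + 1 + m_opt)" for t
  proof (cases "\<bar>t\<bar> \<le> l / 2")
    case True
    define x where "x = c + t"
    have x: "\<alpha> \<le> x" "x \<le> \<beta>" using True cl unfolding x_def by linarith+
    have "t\<^sup>2 \<le> (l / 2)\<^sup>2" using True abs_le_square_iff[of t "l / 2"] l(1) by simp
    then have t2: "4 * t\<^sup>2 \<le> l\<^sup>2" by (simp add: power_divide)
    have "0 \<le> 3 * M / (2 * l ^ 3) * (l\<^sup>2 - 4 * t\<^sup>2)"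
      using t2 M(1) r l(1) by (intro mult_nonneg_nonneg) auto
    also have "\<dots> = 3 * M / (2 * l) - 6 * M * t\<^sup>2 / l ^ 3"
      using l(1) by (simp add: field_simps power2_eq_square power3_eq_cube)
    finally have bm: "bump l M t = 3 * M / (2 * l) - 6 * M * t\<^sup>2 / l ^ 3" by (simp add: bump_def)
    have P: "((\<lambda>u. k * (c - u)) has_integral (3 * M / (2 * l) - 6 * M * t\<^sup>2 / l ^ 3)) {\<alpha>..x}"
    proof -
      have "((\<lambda>u. k * (c - u)) has_integral (- k * (c - x)\<^sup>2 / 2 - - k * (c - \<alpha>)\<^sup>2 / 2)) {\<alpha>..x}"
        using x(1) by (intro fundamental_theorem_of_calculus)
          (auto intro!: derivative_eq_intros simp: field_simps simp flip: has_real_derivative_iff_has_vector_derivative)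
      moreover have "- k * (c - x)\<^sup>2 / 2 - - k * (c - \<alpha>)\<^sup>2 / 2 = 3 * M / (2 * l) - 6 * M * t\<^sup>2 / l ^ 3"
        unfolding cl x_def k_def using l(1) by (simp add: field_simps power2_eq_square power3_eq_cube)
      ultimately show ?thesis by simp
    qed
    have ip: "set_integrable lborel {\<alpha>..x} (\<lambda>u. k * (c - u))"
      unfolding set_integrable_def by (intro borel_integrable_compact compact_Icc continuous_intros)
    have "(LINT u:{\<alpha>..x}|lborel. g u - k * (c - u)) = (H x - H \<alpha>) - bump l M t"
      by (simp only: set_integral_diff(2)[OF ftc(1)[OF x(1)] ip] ftc(2)[OF x(1)]
          set_borel_integral_eq_integral(2)[OF ip] integral_unique[OF P] bm)
    moreover have "\<bar>LINT u:{\<alpha>..x}|lborel. g u - k * (c - u)\<bar> \<le> s * (x - \<alpha>) + W / (4 * s)"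
      unfolding W_def
      by (rule set_integral_young[OF x(1) s(1) set_integral_diff(1)[OF ftc(1)[OF x(1)] ip] Wint]) (use x in auto)
    moreover have "s * (x - \<alpha>) \<le> s * \<Lambda>" using s(1) x l(2) unfolding l_def by (intro mult_left_mono) auto
    moreover have "W / (4 * s) \<le> m_opt * s" using W0 by (intro Ws) auto
    ultimately have "\<bar>H x - bump l M t\<bar> \<le> \<delta> + s * \<Lambda> + m_opt * s" using eq(1) \<delta>(1) by linarith
    also have "\<dots> \<le> q + (1 - r) + s * (\<Lambda> + 1 + m_opt)" using \<delta>(2) r s(1) by (simp add: algebra_simps)
    finally show ?thesis by (simp add: x_def)
  next
    case False
    define x where "x = c + t"
    have x: "x < \<alpha> \<or> \<beta> < x" using False cl unfolding x_def by linarith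
    have "(l / 2)\<^sup>2 \<le> t\<^sup>2" using False abs_le_square_iff[of "l / 2" t] l(1) by simp
    then have t2: "l\<^sup>2 \<le> 4 * t\<^sup>2" by (simp add: power_divide)
    have "0 \<le> 3 * M / (2 * l ^ 3) * (4 * t\<^sup>2 - l\<^sup>2)"
      using t2 M(1) r l(1) by (intro mult_nonneg_nonneg) auto
    also have "\<dots> = 6 * M * t\<^sup>2 / l ^ 3 - 3 * M / (2 * l)"
      using l(1) by (simp add: field_simps power2_eq_square power3_eq_cube)
    finally have bm: "bump l M t = 0" by (simp add: bump_def)
    \<comment> \<open>A unit interval starting at x and pointing away from the component. A large
      value at x would persist on it, since slopes outside are small, and would carry more than the
      mass 1 - r left there.\<close>
    define I where "I = (if \<beta> < x then {x..x + 1} else {x - 1..x})"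
    have I: "I \<subseteq> out" "I \<in> sets borel" "emeasure lborel I = 1" "measure lborel I = 1"
      using x ab by (auto simp: I_def out_def)
    have inc: "H x - (s + m_opt * s) \<le> H z" if z: "z \<in> I" for z
    proof -
      have zx: "\<bar>z - x\<bar> \<le> 1" and sub: "{min x z..max x z} \<subseteq> out"
        using z x ab by (auto simp: I_def out_def split: if_splits)
      have "\<bar>H (max x z) - H (min x z)\<bar> \<le> s * (max x z - min x z) + W' / (4 * s)"
        unfolding W'_def by (rule increment_bound[OF _ s(1) outb sub]) simp
      moreover have "\<bar>H (max x z) - H (min x z)\<bar> = \<bar>H x - H z\<bar>" by (auto simp: max_def min_def)
      moreover have "s * (max x z - min x z) \<le> s * 1" using zx s(1) by (intro mult_left_mono) auto
      moreover have "W' / (4 * s) \<le> m_opt * s" using W0 by (intro Ws) auto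
      ultimately show ?thesis by linarith
    qed
    have iH: "set_integrable lborel S H" if "S \<in> sets borel" for S
      unfolding set_integrable_def by (rule integrable_mult_indicator[OF _ intH]) (use that in simp)
    have "H x - (s + m_opt * s) = (LINT z:I|lborel. H x - (s + m_opt * s))"
      using I by (simp add: set_lebesgue_integral_def)
    also have "\<dots> \<le> (LINT z:I|lborel. H z)"
    proof (rule set_integral_mono[OF _ iH[OF I(2)] inc])
      show "set_integrable lborel I (\<lambda>z. H x - (s + m_opt * s))"
        unfolding set_integrable_def using I by (intro integrable_scaleR_left integrable_real_indicator) simp_all
    qed
    also have "\<dots> \<le> (LINT z:out|lborel. H z)"
      unfolding set_lebesgue_integral_def
      by (rule integral_mono[OF iH[OF I(2), unfolded set_integrable_def] iH[OF outb, unfolded set_integrable_def]])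
         (use I(1) H_nonneg in \<open>auto simp: indicator_def\<close>)
    also have "\<dots> = 1 - (LINT z:{\<alpha>..\<beta>}|lborel. H z)"
    proof -
      have "(LINT t:{\<alpha>..\<beta>} \<union> out|lborel. H t) = (LINT t:{\<alpha>..\<beta>}|lborel. H t) + (LINT t:out|lborel. H t)"
        by (intro set_integral_Un iH outb) (auto simp: out_def)
      moreover have "{\<alpha>..\<beta>} \<union> out = UNIV" by (auto simp: out_def)
      ultimately show ?thesis using H1 by (simp add: set_lebesgue_integral_def)
    qed
    also have "\<dots> \<le> 1 - r" using inH M by simp
    finally have "\<bar>H x - bump l M t\<bar> \<le> (1 - r) + s + m_opt * s" using bm H_nonneg[of x] by simp
    also have "\<dots> \<le> q + (1 - r) + s * (\<Lambda> + 1 + m_opt)" using q(1) mult_pos_pos[OF s(1) \<Lambda>(1)] by (simp add: algebra_simps)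
    finally show ?thesis by (simp add: x_def)
  qed
  have gap: "r * C_W * (l - L_opt)\<^sup>2 \<le> m_opt * (1 - r)" using WW W0 by simp
  show ?thesis
    by (rule that[of l M c]) (use l M gap main in \<open>auto simp: s_def\<close>)
qed

end

section \<open>The sharp lower bound and the choice of parameters\<close>

lemma thickness_exists:
  assumes "0 \<le> tot"
  obtains \<Lambda> where "0 < \<Lambda>" "tot < C_W * \<Lambda>\<^sup>2 * tanh pi"
proof
  define a where "a = (tot + 1) / (C_W * tanh pi)"
  have a: "0 < a" using assms C_W_pos by (simp add: a_def)
  show "0 < sqrt a" using a by simp
  show "tot < C_W * (sqrt a)\<^sup>2 * tanh pi" using a C_W_pos by (simp add: a_def)
qed

lemma tanh_scaled_tendsto:
  fixes c :: real
  assumes "0 < c"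
  shows "((\<lambda>\<mu>. tanh (c * \<mu>)) \<longlongrightarrow> 1) at_top"
  by (rule filterlim_compose[OF tanh_real_at_top])
     (use assms in \<open>auto intro: filterlim_tendsto_pos_mult_at_top filterlim_ident\<close>)

text \<open>For half-strips every ratio \<mu> is available: letting \<mu> grow at fixed \<delta>
  sends the tanh factor to 1, and then \<delta> tends to 0 to recover the whole mass. The trivial
  bound 1 on component masses suffices in \<open>mass_bound\<close>.\<close>

lemma energy_lower_bound:
  assumes pe: "\<And>\<mu>. 0 < \<mu> \<Longrightarrow> profile_energy H g e \<mu> tot"
  shows "m_opt \<le> tot"
proof -
  interpret p1: profile_energy H g e 1 tot by (rule pe) simp
  obtain \<Lambda> where \<Lambda>: "0 < \<Lambda>" "tot < C_W * \<Lambda>\<^sup>2 * tanh pi" by (rule thickness_exists[OF p1.tot])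
  have 1: "m_opt * (LINT x|lborel. max 0 (H x - \<delta>)) \<le> tot" if \<delta>: "0 < \<delta>" for \<delta>
  proof -
    have *: "tanh ((pi * \<delta> / (2 * \<Lambda>)) * \<mu>) * m_opt * (LINT x|lborel. max 0 (H x - \<delta>)) \<le> tot"
      if \<mu>: "2 * \<Lambda> / \<delta> \<le> \<mu>" for \<mu>
    proof -
      have thick: "2 * \<Lambda> \<le> \<mu> * \<delta>" using \<mu> \<delta> by (simp add: field_simps)
      have "0 < \<mu>" using \<mu> \<Lambda>(1) \<delta> by (meson divide_pos_pos less_le_trans mult_pos_pos zero_less_numeral)
      then interpret p: profile_energy H g e \<mu> tot by (rule pe)
      have "p.mass \<delta> K \<le> 1" if K: "K \<in> components {x. \<delta> < H x}" for K
      proof -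
        obtain \<alpha> \<beta> where ab: "\<alpha> < \<beta>" "K = {\<alpha><..<\<beta>}" "H \<alpha> = \<delta>" "H \<beta> = \<delta>" "\<forall>x\<in>{\<alpha>..\<beta>}. \<delta> \<le> H x"
          by (rule p.component_interval[OF \<delta> K])
        have "p.mass \<delta> K = (LINT x:{\<alpha>..\<beta>}|lborel. H x - \<delta>)"
          unfolding p.mass_def[OF \<Lambda> \<delta> thick] ab(2) by (rule set_integral_Ioo_Icc) measurable
        then show ?thesis using p.component_mass_le[OF \<Lambda> \<delta> thick ab(1)] by simp
      qed
      from p.mass_bound[OF \<Lambda> \<delta> thick _ this] show ?thesis
        unfolding p.\<rho>_def[OF \<Lambda> \<delta> thick] by (simp add: mult_ac)
    qed
    have "((\<lambda>\<mu>. tanh ((pi * \<delta> / (2 * \<Lambda>)) * \<mu>) * m_opt * (LINT x|lborel. max 0 (H x - \<delta>))) \<longlongrightarrow>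
        1 * m_opt * (LINT x|lborel. max 0 (H x - \<delta>))) at_top"
      by (intro tendsto_mult tendsto_const tanh_scaled_tendsto) (use \<delta> \<Lambda> in simp)
    then have "1 * m_opt * (LINT x|lborel. max 0 (H x - \<delta>)) \<le> tot"
      by (rule tendsto_upperbound) (use * in \<open>auto simp: eventually_at_top_linorder\<close>)
    then show ?thesis by simp
  qed
  have lim: "(\<lambda>n. LINT x|lborel. max 0 (H x - 1 / real (Suc n))) \<longlonglongrightarrow> (LINT x|lborel. H x)"
  proof (rule integral_dominated_convergence[where w = H])
    show "AE x in lborel. (\<lambda>n. max 0 (H x - 1 / real (Suc n))) \<longlonglongrightarrow> H x"
    proof (rule AE_I2)
      fix x
      have "(\<lambda>n. max 0 (H x - 1 / real (Suc n))) \<longlonglongrightarrow> max 0 (H x - 0)"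
        by (intro tendsto_max tendsto_const tendsto_diff LIMSEQ_Suc[OF lim_1_over_n])
      then show "(\<lambda>n. max 0 (H x - 1 / real (Suc n))) \<longlonglongrightarrow> H x" using p1.H_nonneg by simp
    qed
    show "AE x in lborel. norm (max 0 (H x - 1 / real (Suc n))) \<le> H x" for n
      using p1.H_nonneg by (intro AE_I2) (simp add: max_def)
  qed (use p1.intH in simp_all)
  have "m_opt * (LINT x|lborel. H x) \<le> tot"
    by (rule LIMSEQ_le_const2[OF tendsto_mult[OF tendsto_const lim]]) (use 1 in auto)
  then show ?thesis by (simp add: p1.H1)
qed

text \<open>The error splits into three parts, each at most q/4: the terms in \<open>sqrt T\<close>
  fix T, then \<open>\<delta> / T\<close> fixes \<delta>, and \<open>2 / \<mu>\<close> together with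
  the tanh limit fixes \<open>\<mu>0\<close>. These choices depend on q and \<Lambda> but on no
  profile.\<close>

lemma film_parameters:
  assumes q: "0 < q" "q < 1" and \<Lambda>: "0 < \<Lambda>"
  obtains T \<delta> \<mu>0 where "0 < T" "0 < \<delta>" "\<delta> \<le> q" "0 < \<mu>0"
    "\<forall>\<mu>\<ge>\<mu>0. 2 * \<Lambda> \<le> \<mu> * \<delta> \<and> 1 - q \<le> tanh (pi * (\<mu> * \<delta> / 2) / \<Lambda>) \<and>
      (2 / \<mu> + 2 * sqrt T + \<delta> / T) * (m_opt / c0) + sqrt T * m_opt \<le> q"
proof -
  define A where "A = m_opt / c0"
  have A: "0 < A" using m_opt_pos c0_pos by (simp add: A_def)
  \<comment> \<open>The coefficient of \<open>sqrt T\<close> in the film bound; \<open>w\<close>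
    will be \<open>sqrt T\<close>.\<close>
  define B where "B = 2 * A + m_opt"
  have B: "0 < B" using A m_opt_pos by (simp add: B_def)
  define w where "w = q / (4 * B)"
  have w: "0 < w" using q B by (simp add: w_def)
  have w4: "B * w = q / 4" using B by (simp add: w_def)
  define T where "T = w\<^sup>2"
  have T: "0 < T" "sqrt T = w" using w by (simp_all add: T_def)
  define \<delta> where "\<delta> = min q (q * T / (4 * A))"
  have \<delta>: "0 < \<delta>" "\<delta> \<le> q" "\<delta> / T * A \<le> q / 4"
  proof -
    show "0 < \<delta>" "\<delta> \<le> q" using q T A by (simp_all add: \<delta>_def)
    have "\<delta> \<le> q * T / (4 * A)" unfolding \<delta>_def by (rule min.cobounded2)
    then show "\<delta> / T * A \<le> q / 4" using T A by (simp add: field_simps)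
  qed
  have lim: "((\<lambda>\<mu>. tanh ((pi * \<delta> / (2 * \<Lambda>)) * \<mu>)) \<longlongrightarrow> 1) at_top"
    by (rule tanh_scaled_tendsto) (use \<delta> \<Lambda> in simp)
  then have "\<forall>\<^sub>F \<mu> in at_top. 1 - q < tanh ((pi * \<delta> / (2 * \<Lambda>)) * \<mu>)" by (rule order_tendstoD) (use q in simp)
  then obtain \<mu>1 where \<mu>1: "\<And>\<mu>. \<mu>1 \<le> \<mu> \<Longrightarrow> 1 - q < tanh ((pi * \<delta> / (2 * \<Lambda>)) * \<mu>)"
    by (auto simp: eventually_at_top_linorder)
  define \<mu>0 where "\<mu>0 = max \<mu>1 (max (2 * \<Lambda> / \<delta>) (8 * A / q))"
  have "0 < 8 * A / q" using A q by simp
  then have \<mu>0: "0 < \<mu>0" unfolding \<mu>0_def by linarith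
  have "2 * \<Lambda> \<le> \<mu> * \<delta> \<and> 1 - q \<le> tanh (pi * (\<mu> * \<delta> / 2) / \<Lambda>) \<and>
      (2 / \<mu> + 2 * sqrt T + \<delta> / T) * (m_opt / c0) + sqrt T * m_opt \<le> q" if "\<mu>0 \<le> \<mu>" for \<mu>
  proof (intro conjI)
    have \<mu>: "\<mu>1 \<le> \<mu>" "2 * \<Lambda> / \<delta> \<le> \<mu>" "8 * A / q \<le> \<mu>" "0 < \<mu>" using that \<mu>0 unfolding \<mu>0_def by linarith+
    show "2 * \<Lambda> \<le> \<mu> * \<delta>" using \<mu>(2) \<delta>(1) by (simp add: field_simps)
    have "(pi * \<delta> / (2 * \<Lambda>)) * \<mu> = pi * (\<mu> * \<delta> / 2) / \<Lambda>" by simp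
    with \<mu>1[OF \<mu>(1)] show "1 - q \<le> tanh (pi * (\<mu> * \<delta> / 2) / \<Lambda>)" by (simp only: less_imp_le)
    have "2 / \<mu> * A \<le> q / 4" using \<mu>(3,4) q by (simp add: field_simps)
    moreover have "(2 / \<mu> + 2 * sqrt T + \<delta> / T) * A + sqrt T * m_opt = 2 / \<mu> * A + B * w + \<delta> / T * A"
      unfolding T(2) B_def by (simp add: algebra_simps)
    ultimately show "(2 / \<mu> + 2 * sqrt T + \<delta> / T) * (m_opt / c0) + sqrt T * m_opt \<le> q"
      using w4 \<delta>(3) q unfolding A_def[symmetric] by linarith
  qed
  then show ?thesis using that[OF T(1) \<delta>(1,2) \<mu>0] by blast
qed

text \<open>Beyond R both parabolas vanish; within R the positive part is 1-Lipschitz, so the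
  difference is controlled by the coefficients. Convergence of width and mass thus gives uniform
  convergence.\<close>

lemma bump_diff:
  assumes "0 < l" "l \<le> R" "0 < L" "L \<le> R" "0 \<le> M"
  shows "\<bar>bump l M t - bump L 1 t\<bar> \<le> \<bar>3 * M / (2 * l) - 3 / (2 * L)\<bar> + 6 * R\<^sup>2 * \<bar>M / l ^ 3 - 1 / L ^ 3\<bar>"
proof (cases "\<bar>t\<bar> \<le> R")
  case True
  then have t2: "t\<^sup>2 \<le> R\<^sup>2" using abs_le_square_iff[of t R] by simp
  have lip: "\<bar>max 0 x - max 0 y\<bar> \<le> \<bar>x - y\<bar>" for x y :: real by (simp add: max_def)
  have "\<bar>bump l M t - bump L 1 t\<bar> \<le> \<bar>(3 * M / (2 * l) - 6 * M * t\<^sup>2 / l ^ 3) - (3 * 1 / (2 * L) - 6 * 1 * t\<^sup>2 / L ^ 3)\<bar>"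
    unfolding bump_def by (rule lip)
  also have "\<dots> = \<bar>(3 * M / (2 * l) - 3 / (2 * L)) - 6 * t\<^sup>2 * (M / l ^ 3 - 1 / L ^ 3)\<bar>"
    by (simp add: algebra_simps)
  also have "\<dots> \<le> \<bar>3 * M / (2 * l) - 3 / (2 * L)\<bar> + 6 * t\<^sup>2 * \<bar>M / l ^ 3 - 1 / L ^ 3\<bar>"
    by (rule order_trans[OF abs_triangle_ineq4]) (simp add: abs_mult)
  also have "\<dots> \<le> \<bar>3 * M / (2 * l) - 3 / (2 * L)\<bar> + 6 * R\<^sup>2 * \<bar>M / l ^ 3 - 1 / L ^ 3\<bar>"
    using t2 by (intro add_left_mono mult_right_mono) auto
  finally show ?thesis .
next
  case False
  have z: "bump l' M' t = 0" if "0 < l'" "l' \<le> R" "0 \<le> M'" for l' M'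
  proof -
    have "l'\<^sup>2 \<le> t\<^sup>2" using abs_le_square_iff[of l' t] that False by simp
    then have "l'\<^sup>2 \<le> 4 * t\<^sup>2" using zero_le_power2[of t] by linarith
    then have "0 \<le> 3 * M' / (2 * l' ^ 3) * (4 * t\<^sup>2 - l'\<^sup>2)"
      using that by (intro mult_nonneg_nonneg) auto
    also have "\<dots> = 6 * M' * t\<^sup>2 / l' ^ 3 - 3 * M' / (2 * l')"
      using that(1) by (simp add: field_simps power2_eq_square power3_eq_cube)
    finally show ?thesis by (simp add: bump_def)
  qed
  show ?thesis using z[of l M] z[of L 1] assms by simp
qed

subsection \<open>Admissible competitors\<close>

lemma lebesgue_on_measurable_of_locally_integrable:
  assumes "open \<Omega>" "locally_integrable \<Omega> f"
  shows "f \<in> borel_measurable (lebesgue_on \<Omega>)"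
  by (subst borel_measurable_restrict_space_iff)
     (use assms locally_integrable_measurable[OF assms] in simp_all)

lemma set_nn_integral_weak_gradient:
  assumes "open \<Omega>" "has_weak_gradient \<Omega> u g"
  shows "(\<integral>\<^sup>+x\<in>\<Omega>. F (weak_gradient \<Omega> u x) \<partial>lebesgue) = (\<integral>\<^sup>+x\<in>\<Omega>. F (g x) \<partial>lebesgue)"
  by (rule nn_integral_cong_AE)
     (use weak_gradient_eq(2)[OF assms] in \<open>eventually_elim, auto simp: indicator_def\<close>)

lemma dirichlet_eq:
  assumes "open \<Omega>" "has_weak_gradient \<Omega> u g"
  shows "dirichlet \<Omega> u = (\<integral>\<^sup>+x\<in>\<Omega>. ennreal ((norm (g x))\<^sup>2) \<partial>lebesgue)"
  unfolding dirichlet_def by (rule set_nn_integral_weak_gradient[OF assms])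

text \<open>Membership in \<open>sobolev\<close> concerns the chosen \<open>weak_gradient\<close>;
  integrability reaches it from an explicit gradient through almost everywhere uniqueness.\<close>

lemma sobolevI:
  assumes \<Omega>: "open \<Omega>" and u: "u \<in> Lp p \<Omega>" and w: "has_weak_gradient \<Omega> u g" and g: "g \<in> Lp p \<Omega>"
  shows "u \<in> sobolev p \<Omega>"
proof -
  note wg = weak_gradient_eq(1)[OF \<Omega> w]
  have "weak_gradient \<Omega> u \<in> Lp p \<Omega>"
    using g set_nn_integral_weak_gradient[OF \<Omega> w, of "\<lambda>v. ennreal (norm v ^ p)"]
      lebesgue_on_measurable_of_locally_integrable[OF \<Omega>, of "weak_gradient \<Omega> u"] wg
    unfolding Lp_def has_weak_gradient_def by simp
  then show ?thesis using u w unfolding sobolev_def weakly_differentiable_def by blast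
qed

lemma Lp_bounded:
  fixes f :: "'a::euclidean_space \<Rightarrow> 'b::euclidean_space"
  assumes \<Omega>: "open \<Omega>" and f: "f \<in> borel_measurable lebesgue" and S: "S \<in> sets borel" "bounded S"
    and B: "\<And>x. x \<in> \<Omega> \<Longrightarrow> x \<in> S \<Longrightarrow> norm (f x) \<le> B" and z: "\<And>x. x \<in> \<Omega> \<Longrightarrow> x \<notin> S \<Longrightarrow> f x = 0" and p: "0 < p"
  shows "f \<in> Lp p \<Omega>"
proof -
  have "(\<integral>\<^sup>+x\<in>\<Omega>. ennreal (norm (f x) ^ p) \<partial>lebesgue) \<le> (\<integral>\<^sup>+x. ennreal (\<bar>B\<bar> ^ p) * indicator S x \<partial>lebesgue)"
  proof (rule nn_integral_mono)
    fix x
    show "ennreal (norm (f x) ^ p) * indicator \<Omega> x \<le> ennreal (\<bar>B\<bar> ^ p) * indicator S x"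
      using B[of x] z[of x] p by (cases "x \<in> \<Omega>"; cases "x \<in> S") (auto intro!: ennreal_leI power_mono simp: zero_power)
  qed
  also have "\<dots> = ennreal (\<bar>B\<bar> ^ p) * emeasure lborel S" using S by (simp add: nn_integral_cmult_indicator)
  also have "\<dots> < \<infinity>" using emeasure_bounded_finite[OF S(2)] by (simp add: ennreal_mult_less_top)
  finally have "(\<integral>\<^sup>+x\<in>\<Omega>. ennreal (norm (f x) ^ p) \<partial>lebesgue) < \<infinity>" .
  moreover have "f \<in> borel_measurable (lebesgue_on \<Omega>)" by (rule measurable_restrict_space1[OF f])
  ultimately show ?thesis by (simp add: Lp_def)
qed

lemma sobolev_of_C1:
  fixes u :: "'a::euclidean_space \<Rightarrow> real"
  assumes u: "\<And>x. (u has_derivative (\<lambda>v. g x \<bullet> v)) (at x)" and g: "continuous_on UNIV g"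
    and \<Omega>: "open \<Omega>" "bounded \<Omega>" and p: "0 < p"
  shows "u \<in> sobolev p \<Omega>"
proof -
  have cu: "continuous_on UNIV u"
    unfolding continuous_on_eq_continuous_at[OF open_UNIV] using has_derivative_continuous[OF u] by blast
  have Lp: "F \<in> Lp p \<Omega>" if F: "continuous_on UNIV F" for F :: "'a \<Rightarrow> 'c::euclidean_space"
  proof -
    obtain B where "\<forall>x\<in>\<Omega>. norm (F x) \<le> B" using bounded_image_continuous[OF F \<Omega>(2)] unfolding bounded_iff by auto
    then show ?thesis
      using \<Omega> by (intro Lp_bounded[OF \<Omega>(1) borel_measurable_lebesgue_continuous(1)[OF F], of \<Omega> B]) (simp_all add: p)
  qed
  show ?thesis by (rule sobolevI[OF \<Omega>(1) Lp[OF cu] has_weak_gradient_of_C1[OF u g] Lp[OF g]])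
qed

lemma has_weak_gradient_zero: "has_weak_gradient \<Omega> (\<lambda>_. 0) (\<lambda>_. 0)"
  by (rule has_weak_gradient_of_C1) (auto intro: continuous_on_const)

text \<open>Being continuous up to the boundary on every rectangle, u approximates itself: the
  constant sequence witnesses the trace.\<close>

lemma has_trace_of_C1:
  fixes u :: "real \<times> real \<Rightarrow> real"
  assumes u: "\<And>z. (u has_derivative (\<lambda>v. g z \<bullet> v)) (at z)" and g: "continuous_on UNIV g" and tr: "\<And>x. u (x, 0) = x"
  shows "has_trace \<Omega> u (\<lambda>x. x)"
  unfolding has_trace_def
proof (intro allI impI)
  fix a b r :: real assume "a < b \<and> 0 < r \<and> {a..b} \<times> {0<..r} \<subseteq> \<Omega>"
  define Q where "Q = {a<..<b} \<times> {0<..<r}"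
  have Q: "open Q" "bounded Q"
    unfolding Q_def by (intro open_Times open_greaterThanLessThan) (intro bounded_Times bounded_Ioo)
  have s: "u \<in> sobolev 1 Q" by (rule sobolev_of_C1[OF u g Q]) simp
  have cu: "continuous_on S u" for S
    using u has_derivative_continuous continuous_at_imp_continuous_on by blast
  \<comment> \<open>The chosen gradient of the zero function is known to vanish only almost
    everywhere, so the norm is computed through the explicit gradient.\<close>
  have "W11_norm Q (\<lambda>z. u z - u z) = 0"
    unfolding W11_norm_def
    using set_nn_integral_weak_gradient[OF Q(1) has_weak_gradient_zero, of "\<lambda>v. ennreal (norm v)"] by simp
  then have "(\<forall>k::nat. u \<in> sobolev 1 Q \<and> continuous_on (closure Q) u) \<and> (\<lambda>k::nat. W11_norm Q (\<lambda>z. u z - u z)) \<longlonglongrightarrow> 0 \<and>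
      (\<lambda>k::nat. \<integral>\<^sup>+x\<in>{a<..<b}. ennreal \<bar>u (x, 0) - x\<bar> \<partial>lebesgue) \<longlonglongrightarrow> 0"
    using s cu tr by simp
  note this[THEN exI[of "\<lambda>v. (\<forall>k::nat. v k \<in> sobolev 1 Q \<and> continuous_on (closure Q) (v k)) \<and>
      (\<lambda>k. W11_norm Q (\<lambda>z. v k z - u z)) \<longlonglongrightarrow> 0 \<and>
      (\<lambda>k. \<integral>\<^sup>+x\<in>{a<..<b}. ennreal \<bar>v k (x, 0) - x\<bar> \<partial>lebesgue) \<longlonglongrightarrow> 0" "\<lambda>_. u"]]
  then show "has_trace_rect a b r u (\<lambda>x. x)"
    unfolding has_trace_rect_def Let_def Q_def[symmetric] using s by (rule conjI[rotated])
qed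

subsection \<open>Parabolic profiles\<close>

context
  fixes l M :: real
  assumes l: "0 < l" and M: "0 < M"
begin

lemma bump_inside: "\<bar>t\<bar> \<le> l / 2 \<Longrightarrow> bump l M t = 3 * M / (2 * l) - 6 * M * t\<^sup>2 / l ^ 3"
  and bump_outside: "l / 2 \<le> \<bar>t\<bar> \<Longrightarrow> bump l M t = 0"
  and bump_pos_iff: "0 < bump l M t \<longleftrightarrow> \<bar>t\<bar> < l / 2"
proof -
  have eq: "3 * M / (2 * l) - 6 * M * t\<^sup>2 / l ^ 3 = 3 * M / (2 * l ^ 3) * (l\<^sup>2 - 4 * t\<^sup>2)"
    using l by (simp add: field_simps power2_eq_square power3_eq_cube)
  have c: "0 < 3 * M / (2 * l ^ 3)" using l M by simp
  have q: "l\<^sup>2 - 4 * t\<^sup>2 = 4 * ((l / 2)\<^sup>2 - t\<^sup>2)" by (simp add: power_divide)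
  show "bump l M t = 3 * M / (2 * l) - 6 * M * t\<^sup>2 / l ^ 3" if "\<bar>t\<bar> \<le> l / 2"
  proof -
    have "t\<^sup>2 \<le> (l / 2)\<^sup>2" using that abs_le_square_iff[of t "l / 2"] l by simp
    then have "0 \<le> 3 * M / (2 * l ^ 3) * (l\<^sup>2 - 4 * t\<^sup>2)" unfolding q using c by (intro mult_nonneg_nonneg) auto
    then show ?thesis unfolding bump_def eq by simp
  qed
  show out: "bump l M t = 0" if "l / 2 \<le> \<bar>t\<bar>"
  proof -
    have "(l / 2)\<^sup>2 \<le> t\<^sup>2" using that abs_le_square_iff[of "l / 2" t] l by simp
    then have "3 * M / (2 * l ^ 3) * (l\<^sup>2 - 4 * t\<^sup>2) \<le> 0" unfolding q using c by (intro mult_nonneg_nonpos) auto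
    then show ?thesis unfolding bump_def eq by simp
  qed
  show "0 < bump l M t \<longleftrightarrow> \<bar>t\<bar> < l / 2"
  proof
    show "0 < bump l M t \<Longrightarrow> \<bar>t\<bar> < l / 2" using out by (cases "\<bar>t\<bar> < l / 2") auto
    assume "\<bar>t\<bar> < l / 2"
    then have "t\<^sup>2 < (l / 2)\<^sup>2" using power_strict_mono[of "\<bar>t\<bar>" "l / 2" 2] by simp
    then have "0 < 3 * M / (2 * l ^ 3) * (l\<^sup>2 - 4 * t\<^sup>2)" unfolding q using c by (intro mult_pos_pos) auto
    then show "0 < bump l M t" unfolding bump_def eq by simp
  qed
qed

lemma continuous_bump: "continuous_on S (bump l M)"
  unfolding bump_def[abs_def] by (intro continuous_intros) (use l in simp_all)

definition "bump_deriv t = (if \<bar>t\<bar> < l / 2 then - 12 * M * t / l ^ 3 else 0)"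

text \<open>The bump is the positive part of a polynomial, hence locally Lipschitz, and is
  differentiable except at the two contact points.\<close>

lemma bump_has_weak_gradient: "has_weak_gradient UNIV (bump l M) bump_deriv"
proof (rule has_weak_gradient_of_lipschitz)
  define P where "P t = 3 * M / (2 * l) - 6 * M * t\<^sup>2 / l ^ 3" for t
  have dP: "(P has_derivative (\<lambda>v. (- 12 * M * t / l ^ 3) \<bullet> v)) (at t)" for t
  proof -
    have "((\<lambda>t. A - B * t\<^sup>2) has_derivative (\<lambda>v. (- 2 * B * t) * v)) (at t)" for A B :: real
      by (auto intro!: derivative_eq_intros)
    from this[of "3 * M / (2 * l)" "6 * M / l ^ 3"] show ?thesis unfolding P_def by simp
  qed
  have cP: "continuous_on UNIV (\<lambda>t. - 12 * M * t / l ^ 3)" by (intro continuous_intros) (use l in simp)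
  show "\<exists>L. L-lipschitz_on S (bump l M)" if S: "bounded S" for S
  proof -
    obtain L where L: "L-lipschitz_on S P" using C1_imp_lipschitz[OF dP cP S] by blast
    have "L-lipschitz_on S (bump l M)"
    proof (rule lipschitz_onI)
      fix x y assume "x \<in> S" "y \<in> S"
      then have "\<bar>P x - P y\<bar> \<le> L * dist x y" using lipschitz_onD[OF L] by (simp add: dist_real_def)
      moreover have "\<bar>bump l M x - bump l M y\<bar> \<le> \<bar>P x - P y\<bar>" unfolding bump_def P_def[symmetric] by (simp add: max_def)
      ultimately show "dist (bump l M x) (bump l M y) \<le> L * dist x y" by (simp add: dist_real_def)
    qed (rule lipschitz_on_nonneg[OF L])
    then show ?thesis by blast
  qed
  have "bump_deriv \<in> borel_measurable lborel" unfolding bump_deriv_def[abs_def] by measurable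
  then show "bump_deriv \<in> borel_measurable lebesgue" by (rule measurable_completion)
  show "bounded (bump_deriv ` S)" if S: "bounded S" for S
  proof -
    obtain B where B: "B > 0" "\<forall>t\<in>S. norm (- 12 * M * t / l ^ 3) \<le> B"
      using bounded_image_continuous[OF cP S] unfolding bounded_pos by auto
    then show ?thesis unfolding bounded_iff by (intro exI[of _ B]) (auto simp: bump_deriv_def)
  qed
  have "AE t in lborel. t \<noteq> l / 2 \<and> t \<noteq> - l / 2"
    using AE_lborel_singleton[of "l / 2"] AE_lborel_singleton[of "- l / 2"] by eventually_elim simp
  then show "AE t in lebesgue. (bump l M has_derivative (\<lambda>v. bump_deriv t \<bullet> v)) (at t)"
  proof (rule eventually_mono[OF AE_completion])
    fix t assume t: "t \<noteq> l / 2 \<and> t \<noteq> - l / 2"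
    show "(bump l M has_derivative (\<lambda>v. bump_deriv t \<bullet> v)) (at t)"
    proof (cases "\<bar>t\<bar> < l / 2")
      case True
      have "(bump l M has_derivative (\<lambda>v. (- 12 * M * t / l ^ 3) \<bullet> v)) (at t)"
        by (rule has_derivative_transform_within_open[OF dP, of "{- l / 2<..<l / 2}"])
           (use True in \<open>auto simp: bump_inside P_def abs_le_iff\<close>)
      then show ?thesis using True by (simp add: bump_deriv_def)
    next
      case False
      then have out: "l / 2 < \<bar>t\<bar>" using t by linarith
      have "(bump l M has_derivative (\<lambda>v. 0)) (at t)"
        by (rule has_derivative_transform_within_open[OF has_derivative_const, of "{t. l / 2 < \<bar>t\<bar>}"])
           (use out bump_outside in \<open>auto intro!: open_Collect_less continuous_intros\<close>)
      then show ?thesis using False by (simp add: bump_deriv_def)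
    qed
  qed
qed

lemma bump_mass: "has_bochner_integral lebesgue (bump l M) M"
proof -
  have "((\<lambda>t. 3 * M / (2 * l) - 6 * M * t\<^sup>2 / l ^ 3) has_integral
      ((3 * M / (2 * l) * (l / 2) - 2 * M * (l / 2) ^ 3 / l ^ 3) - (3 * M / (2 * l) * (- (l / 2)) - 2 * M * (- (l / 2)) ^ 3 / l ^ 3))) {- (l / 2)..l / 2}"
  proof (rule fundamental_theorem_of_calculus)
    have "((\<lambda>t. A * t - B * t ^ 3 / D) has_real_derivative A - 3 * B * t\<^sup>2 / D) (at t within S)" if "D \<noteq> 0" for A B D t :: real and S
      using that by (auto intro!: derivative_eq_intros simp: power2_eq_square)
    from this[of "l ^ 3" "3 * M / (2 * l)" "2 * M"] show "((\<lambda>t. 3 * M / (2 * l) * t - 2 * M * t ^ 3 / l ^ 3) has_vector_derivative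
        3 * M / (2 * l) - 6 * M * t\<^sup>2 / l ^ 3) (at t within {- (l / 2)..l / 2})" for t
      using l by (simp flip: has_real_derivative_iff_has_vector_derivative)
  qed (use l in simp)
  also have "(3 * M / (2 * l) * (l / 2) - 2 * M * (l / 2) ^ 3 / l ^ 3) - (3 * M / (2 * l) * (- (l / 2)) - 2 * M * (- (l / 2)) ^ 3 / l ^ 3) = M"
    using l by (simp add: field_simps power3_eq_cube)
  finally have "(bump l M has_integral M) {- (l / 2)..l / 2}"
    by (rule has_integral_eq[rotated]) (auto simp: bump_inside abs_le_iff)
  then have I: "integral {- (l / 2)..l / 2} (bump l M) = M" by (rule integral_unique)
  have i: "set_integrable lborel {- (l / 2)..l / 2} (bump l M)"
    unfolding set_integrable_def by (rule borel_integrable_compact[OF compact_Icc continuous_bump])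
  have eq: "(\<lambda>t. indicator {- (l / 2)..l / 2} t *\<^sub>R bump l M t) = bump l M"
    using bump_outside by (force simp: indicator_def fun_eq_iff)
  have i': "integrable lborel (bump l M)" using i unfolding set_integrable_def eq .
  have "(LINT t|lborel. bump l M t) = M"
    using set_borel_integral_eq_integral(2)[OF i] I unfolding set_lebesgue_integral_def eq by simp
  then show ?thesis
    using i' integrable_completion[OF borel_measurable_integrable[OF i']] integral_completion[OF borel_measurable_integrable[OF i']]
    by (simp add: has_bochner_integral_iff)
qed

lemma bump_profile: "profile M (bump l M)"
proof -
  have "bump l M \<in> sobolev 2 UNIV"
  proof (rule sobolevI[OF open_UNIV _ bump_has_weak_gradient])
    obtain B where B: "B > 0" "\<forall>t\<in>{- (l / 2)..l / 2}. \<bar>bump l M t\<bar> \<le> B" by (rule compact_abs_bound[OF compact_Icc continuous_bump])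
    show "bump l M \<in> Lp 2 UNIV"
      by (rule Lp_bounded[OF open_UNIV borel_measurable_lebesgue_continuous(1)[OF continuous_bump], of "{- (l / 2)..l / 2}" B])
         (use B bump_outside in auto)
    have "locally_integrable UNIV bump_deriv" using bump_has_weak_gradient unfolding has_weak_gradient_def by simp
    then have m: "bump_deriv \<in> borel_measurable lebesgue" using locally_integrable_measurable[OF open_UNIV] by fastforce
    have "norm (bump_deriv t) \<le> 6 * M / l\<^sup>2" for t
    proof (cases "\<bar>t\<bar> < l / 2")
      case True
      then have "12 * M * \<bar>t\<bar> / l ^ 3 \<le> 12 * M * (l / 2) / l ^ 3" using l M by (intro divide_right_mono mult_left_mono) auto
      also have "\<dots> = 6 * M / l\<^sup>2" using l by (simp add: power2_eq_square power3_eq_cube)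
      finally show ?thesis using True l M by (simp add: bump_deriv_def abs_mult)
    qed (use l M in \<open>simp add: bump_deriv_def\<close>)
    then show "bump_deriv \<in> Lp 2 UNIV"
      by (intro Lp_bounded[OF open_UNIV m, of "{- (l / 2)..l / 2}" "6 * M / l\<^sup>2"]) (auto simp: bump_deriv_def)
  qed
  then show ?thesis
    unfolding profile_def using continuous_bump bump_mass by (auto simp: bump_def)
qed

lemma bump_surface: "surface_energy (bump l M) = ennreal (12 * M\<^sup>2 / l ^ 3)"
proof -
  have "((\<lambda>t. (12 * M * t / l ^ 3)\<^sup>2) has_integral
      ((12 * M / l ^ 3)\<^sup>2 * (l / 2) ^ 3 / 3 - (12 * M / l ^ 3)\<^sup>2 * (- (l / 2)) ^ 3 / 3)) {- (l / 2)..l / 2}"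
  proof (rule fundamental_theorem_of_calculus)
    have "((\<lambda>t. D\<^sup>2 * t ^ 3 / 3) has_real_derivative (D * t)\<^sup>2) (at t within S)" for D t :: real and S
      by (auto intro!: derivative_eq_intros simp: power2_eq_square)
    from this[of "12 * M / l ^ 3"] show "((\<lambda>t. (12 * M / l ^ 3)\<^sup>2 * t ^ 3 / 3) has_vector_derivative
        (12 * M * t / l ^ 3)\<^sup>2) (at t within {- (l / 2)..l / 2})" for t
      by (simp flip: has_real_derivative_iff_has_vector_derivative)
  qed (use l in simp)
  also have "(12 * M / l ^ 3)\<^sup>2 * (l / 2) ^ 3 / 3 - (12 * M / l ^ 3)\<^sup>2 * (- (l / 2)) ^ 3 / 3 = 12 * M\<^sup>2 / l ^ 3"
    using l by (simp add: field_simps power2_eq_square power3_eq_cube)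
  finally have hi: "((\<lambda>t. (12 * M * t / l ^ 3)\<^sup>2) has_integral 12 * M\<^sup>2 / l ^ 3) {- (l / 2)..l / 2}" .
  have "surface_energy (bump l M) = (\<integral>\<^sup>+t. ennreal ((bump_deriv t)\<^sup>2) \<partial>lborel)"
    unfolding surface_energy_def dirichlet_eq[OF open_UNIV bump_has_weak_gradient] by (simp add: nn_integral_completion)
  also have "\<dots> = (\<integral>\<^sup>+t. ennreal ((12 * M * t / l ^ 3)\<^sup>2) * indicator {- (l / 2)..l / 2} t \<partial>lborel)"
  proof (rule nn_integral_cong_AE)
    show "AE t in lborel. ennreal ((bump_deriv t)\<^sup>2) = ennreal ((12 * M * t / l ^ 3)\<^sup>2) * indicator {- (l / 2)..l / 2} t"
      using AE_lborel_singleton[of "l / 2"] AE_lborel_singleton[of "- (l / 2)"]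
      by eventually_elim (auto simp: bump_deriv_def indicator_def abs_less_iff)
  qed
  also have "\<dots> = ennreal (12 * M\<^sup>2 / l ^ 3)" by (rule nn_integral_has_integral_lebesgue'[OF _ hi]) simp
  finally show ?thesis .
qed

end

subsection \<open>A near-optimal displacement over a strip\<close>

context
  fixes l :: real and n :: nat
  assumes l: "0 < l"
begin

text \<open>The truncated cosine series misses the boundary value \<open>x\<close> by \<open>rem\<close>; the term
  \<open>rem s * exp (- y)\<close> restores the trace exactly at an energy cost that vanishes as \<open>n\<close> grows.\<close>

definition "cf k = 4 / (pi\<^sup>2 * (real k)\<^sup>2)"
definition "cg k = 4 / (pi * real k)"
definition "rem s = s - 1 / 2 + (\<Sum>k\<in>odds n. cf k * cos (real k * pi * s))"
definition "rem' s = 1 - (\<Sum>k\<in>odds n. cg k * sin (real k * pi * s))"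
definition "disp z = l * (- (\<Sum>k\<in>odds n. cf k * (cos (real k * pi * (fst z / l + 1 / 2)) * exp (- (real k * pi) * (snd z / l))))
    + rem (fst z / l + 1 / 2) * exp (- (snd z / l)))"
definition "disp_x s y = (\<Sum>k\<in>odds n. cg k * (sin (real k * pi * s) * exp (- (real k * pi) * y))) + rem' s * exp (- y)"
definition "disp_y s y = (\<Sum>k\<in>odds n. cg k * (cos (real k * pi * s) * exp (- (real k * pi) * y))) - rem s * exp (- y)"
definition "disp_grad z = (disp_x (fst z / l + 1 / 2) (snd z / l), disp_y (fst z / l + 1 / 2) (snd z / l))"

lemma cf_cg: "k \<in> odds n \<Longrightarrow> cf k * (real k * pi) = cg k"
  using odds_pos[of k n] by (simp add: cf_def cg_def power2_eq_square)

lemma rem_deriv: "(rem has_real_derivative rem' s) (at s)"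
proof -
  have "(rem has_real_derivative 1 + (\<Sum>k\<in>odds n. cf k * (- sin (real k * pi * s) * (real k * pi)))) (at s)"
    unfolding rem_def[abs_def] by (auto intro!: derivative_eq_intros sum.cong simp: sum_negf[symmetric])
  also have "1 + (\<Sum>k\<in>odds n. cf k * (- sin (real k * pi * s) * (real k * pi))) = rem' s"
  proof -
    have "(\<Sum>k\<in>odds n. cf k * (- sin (real k * pi * s) * (real k * pi))) = (\<Sum>k\<in>odds n. - (cg k * sin (real k * pi * s)))"
      by (rule sum.cong) (simp_all flip: cf_cg)
    then show ?thesis by (simp add: rem'_def sum_negf)
  qed
  finally show ?thesis .
qed

lemma disp_trace: "disp (x, 0) = x"
  using l by (simp add: disp_def rem_def field_simps)

lemma disp_derivative: "(disp has_derivative (\<lambda>v. disp_grad z \<bullet> v)) (at z)"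
proof -
  define s y where "s = fst z / l + 1 / 2" and "y = snd z / l"
  have ds: "((\<lambda>z. fst z / l + 1 / 2) has_derivative (\<lambda>v. fst v / l)) (at z)"
    and dy: "((\<lambda>z. snd z / l) has_derivative (\<lambda>v. snd v / l)) (at z)"
    using l by (auto intro!: derivative_eq_intros)
  have r: "((\<lambda>z. rem (fst z / l + 1 / 2)) has_derivative (\<lambda>v. rem' s * (fst v / l))) (at z)"
    using has_derivative_compose[OF ds, of rem "\<lambda>v. rem' s * v"] rem_deriv[of s]
    by (simp add: has_field_derivative_def s_def)
  have ex: "((\<lambda>z. exp (- c * (snd z / l))) has_derivative (\<lambda>v. exp (- c * y) * (- c * (snd v / l)))) (at z)" for c
    unfolding y_def using l by (auto intro!: derivative_eq_intros)
  have co: "((\<lambda>z. cos (c * (fst z / l + 1 / 2))) has_derivative (\<lambda>v. - sin (c * s) * (c * (fst v / l)))) (at z)" for c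
    unfolding s_def using l by (auto intro!: derivative_eq_intros)
  have "(disp has_derivative (\<lambda>v. l * (- (\<Sum>k\<in>odds n. cf k * (cos (real k * pi * s) * (exp (- (real k * pi) * y) * (- (real k * pi) * (snd v / l)))
        + - sin (real k * pi * s) * (real k * pi * (fst v / l)) * exp (- (real k * pi) * y)))
      + (rem s * (exp (- 1 * y) * (- 1 * (snd v / l))) + rem' s * (fst v / l) * exp (- y))))) (at z)"
  proof -
    have e1: "((\<lambda>z. exp (- (snd z / l))) has_derivative (\<lambda>v. exp (- 1 * y) * (- 1 * (snd v / l)))) (at z)"
      using ex[of 1] by (simp only: mult_minus1)
    have t: "((\<lambda>z. cf k * (cos (real k * pi * (fst z / l + 1 / 2)) * exp (- (real k * pi) * (snd z / l)))) has_derivative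
      (\<lambda>v. cf k * (cos (real k * pi * s) * (exp (- (real k * pi) * y) * (- (real k * pi) * (snd v / l)))
        + - sin (real k * pi * s) * (real k * pi * (fst v / l)) * exp (- (real k * pi) * y)))) (at z)" for k
      using has_derivative_mult_right[OF has_derivative_mult[OF co[of "real k * pi"] ex[of "real k * pi"]], of "cf k"]
      unfolding s_def[symmetric] y_def[symmetric] .
    show ?thesis
      unfolding disp_def[abs_def]
      using has_derivative_mult_right[OF has_derivative_add[OF has_derivative_minus[OF has_derivative_sum[where I = "odds n", OF t]]
        has_derivative_mult[OF r e1]], of l]
      unfolding s_def[symmetric] y_def[symmetric] .
  qed
  moreover have "l * (- (\<Sum>k\<in>odds n. cf k * (cos (real k * pi * s) * (exp (- (real k * pi) * y) * (- (real k * pi) * (snd v / l)))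
        + - sin (real k * pi * s) * (real k * pi * (fst v / l)) * exp (- (real k * pi) * y)))
      + (rem s * (exp (- 1 * y) * (- 1 * (snd v / l))) + rem' s * (fst v / l) * exp (- y))) = disp_grad z \<bullet> v" for v
  proof -
    have "(\<Sum>k\<in>odds n. cf k * (cos (real k * pi * s) * (exp (- (real k * pi) * y) * (- (real k * pi) * (snd v / l)))
        + - sin (real k * pi * s) * (real k * pi * (fst v / l)) * exp (- (real k * pi) * y))) =
      (\<Sum>k\<in>odds n. - (snd v / l) * (cg k * (cos (real k * pi * s) * exp (- (real k * pi) * y)))
        - (fst v / l) * (cg k * (sin (real k * pi * s) * exp (- (real k * pi) * y))))"
      by (rule sum.cong) (simp_all add: algebra_simps flip: cf_cg)
    also have "\<dots> = - (snd v / l) * (\<Sum>k\<in>odds n. cg k * (cos (real k * pi * s) * exp (- (real k * pi) * y)))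
        - (fst v / l) * (\<Sum>k\<in>odds n. cg k * (sin (real k * pi * s) * exp (- (real k * pi) * y)))"
      by (simp add: sum_subtractf sum_distrib_left sum_negf)
    finally have S: "(\<Sum>k\<in>odds n. cf k * (cos (real k * pi * s) * (exp (- (real k * pi) * y) * (- (real k * pi) * (snd v / l)))
        + - sin (real k * pi * s) * (real k * pi * (fst v / l)) * exp (- (real k * pi) * y))) =
      - (snd v / l) * (disp_y s y + rem s * exp (- y)) - (fst v / l) * (disp_x s y - rem' s * exp (- y))"
      by (simp add: disp_x_def disp_y_def)
    have "disp_grad z \<bullet> v = disp_x s y * fst v + disp_y s y * snd v"
      by (simp add: disp_grad_def inner_prod_def s_def y_def)
    then show ?thesis unfolding S using l by (simp add: field_simps)
  qed
  ultimately show ?thesis by simp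
qed

lemma continuous_rem: "continuous_on S rem" "continuous_on S rem'"
  unfolding rem_def[abs_def] rem'_def[abs_def] by (intro continuous_intros)+

lemma continuous_disp_grad: "continuous_on UNIV disp_grad"
  unfolding disp_grad_def[abs_def] disp_x_def disp_y_def
  by (intro continuous_on_Pair continuous_on_add continuous_on_diff continuous_on_sum continuous_on_mult continuous_on_const
      continuous_on_compose2[OF continuous_rem(1)[of UNIV]] continuous_on_compose2[OF continuous_rem(2)[of UNIV]]
      continuous_on_sin continuous_on_cos continuous_on_exp continuous_on_divide continuous_on_fst continuous_on_snd continuous_on_id
      continuous_on_minus) (use l in simp_all)

text \<open>The squared norm of \<open>rem'\<close> on the unit interval; it tends to 0 by the odd
  Basel sum.\<close>

definition "defect = 1 - (\<Sum>k\<in>odds n. 8 / (pi\<^sup>2 * (real k)\<^sup>2))"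

lemma rem'_integral: "((\<lambda>s. (rem' s)\<^sup>2) has_integral defect) {0..1}"
proof -
  have sin1: "((\<lambda>s. sin (real k * pi * s)) has_integral 2 / (real k * pi)) {0..1}" if k: "k \<in> odds n" for k
  proof -
    have k0: "real k * pi \<noteq> 0" using odds_pos[OF k] by simp
    have "((\<lambda>s. sin (real k * pi * s)) has_integral
        - cos (real k * pi * 1) / (real k * pi) - - cos (real k * pi * 0) / (real k * pi)) {0..1}"
      using k0 by (intro fundamental_theorem_of_calculus)
        (auto intro!: derivative_eq_intros simp flip: has_real_derivative_iff_has_vector_derivative)
    moreover have "cos (real k * pi) = - 1" using k by (simp add: odds_def cos_npi)
    ultimately show ?thesis using k0 by (simp add: diff_divide_distrib[symmetric])
  qed
  have "((\<lambda>s. 1 - 2 * (\<Sum>k\<in>odds n. cg k * sin (real k * pi * s)) + (\<Sum>k\<in>odds n. cg k * sin (real k * pi * s))\<^sup>2) has_integral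
      1 - 2 * (\<Sum>k\<in>odds n. cg k * (2 / (real k * pi))) + (\<Sum>k\<in>odds n. (cg k)\<^sup>2 / 2)) {0..1}"
    by (intro has_integral_add has_integral_diff has_integral_mult_right has_integral_sum finite_odds sin1
        has_integral_sin_sum_sq(1) zero_notin_odds) (use has_integral_const_real[of "1::real" 0 1] in simp_all)
  moreover have "(\<Sum>k\<in>odds n. cg k * (2 / (real k * pi))) = (\<Sum>k\<in>odds n. 8 / (pi\<^sup>2 * (real k)\<^sup>2))"
    "(\<Sum>k\<in>odds n. (cg k)\<^sup>2 / 2) = (\<Sum>k\<in>odds n. 8 / (pi\<^sup>2 * (real k)\<^sup>2))"
    by (rule sum.cong; simp add: cg_def power2_eq_square mult_ac)+
  moreover have "(rem' s)\<^sup>2 = 1 - 2 * (\<Sum>k\<in>odds n. cg k * sin (real k * pi * s)) + (\<Sum>k\<in>odds n. cg k * sin (real k * pi * s))\<^sup>2" for s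
    by (simp add: rem'_def power2_diff)
  ultimately show ?thesis by (simp add: defect_def)
qed

lemma defect_nonneg: "0 \<le> defect"
  using has_integral_nonneg[OF rem'_integral] by simp

text \<open>The remainder vanishes at the midpoint, so it is controlled by its derivative.\<close>

lemma rem_bound:
  assumes s: "s \<in> {0..1}" shows "(rem s)\<^sup>2 \<le> defect"
proof -
  have mid: "rem (1 / 2) = 0"
  proof -
    have "cos (real k * pi * (1 / 2)) = 0" if "k \<in> odds n" for k
    proof -
      have "odd k" using that by (simp add: odds_def)
      then obtain j where "k = 2 * j + 1" by (rule oddE)
      then have "real k * pi * (1 / 2) = pi / 2 + real j * pi" by (simp add: field_simps)
      then show ?thesis by (simp only: cos_add sin_npi) simp
    qed
    then show ?thesis by (simp add: rem_def)
  qed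
  define a b where "a = min s (1 / 2)" and "b = max s (1 / 2)"
  have ab: "a \<le> b" "{a..b} \<subseteq> {0..1}" using s by (auto simp: a_def b_def)
  have i: "set_integrable lborel S rem'" "set_integrable lborel S (\<lambda>t. (rem' t)\<^sup>2)" if "compact S" for S
    unfolding set_integrable_def by (intro borel_integrable_compact continuous_on_power continuous_rem that)+
  have sq: "(LINT t:{0..1}|lborel. (rem' t)\<^sup>2) = defect"
    using set_borel_integral_eq_integral(2)[OF i(2)[of "{0..1}"]] integral_unique[OF rem'_integral] by simp
  have "(rem' has_integral (rem b - rem a)) {a..b}"
    by (rule fundamental_theorem_of_calculus[OF ab(1)])
       (use rem_deriv has_real_derivative_iff_has_vector_derivative has_vector_derivative_at_within in blast)
  then have eq: "(LINT t:{a..b}|lborel. rem' t) = rem b - rem a"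
    using set_borel_integral_eq_integral(2)[OF i(1)[OF compact_Icc]] by (simp add: integral_unique)
  have rs: "\<bar>rem b - rem a\<bar> = \<bar>rem s\<bar>" using mid by (auto simp: a_def b_def max_def min_def)
  have half: "b - a \<le> 1" using s by (auto simp: a_def b_def max_def min_def)
  have y: "\<bar>rem s\<bar> \<le> \<tau> + defect / (4 * \<tau>)" if \<tau>: "0 < \<tau>" for \<tau>
  proof -
    have "\<bar>LINT t:{a..b}|lborel. rem' t\<bar> \<le> \<tau> * (b - a) + (LINT t:{0..1}|lborel. (rem' t)\<^sup>2) / (4 * \<tau>)"
      by (rule set_integral_young[OF ab(1) \<tau> i(1)[OF compact_Icc] i(2)[OF compact_Icc] ab(2)])
    moreover have "\<tau> * (b - a) \<le> \<tau> * 1" using half \<tau> by (intro mult_left_mono) auto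
    ultimately show ?thesis unfolding eq sq rs by simp
  qed
  show ?thesis
  proof (cases "rem s = 0")
    case False
    \<comment> \<open>Taking half of the quantity being bounded as Young parameter lets it be
      absorbed and leaves its square at most \<open>defect\<close>.\<close>
    have "\<bar>rem s\<bar> \<le> \<bar>rem s\<bar> / 2 + defect / (4 * (\<bar>rem s\<bar> / 2))" using y[of "\<bar>rem s\<bar> / 2"] False by simp
    then have "\<bar>rem s\<bar> * \<bar>rem s\<bar> \<le> defect" using False by (simp add: field_simps)
    then show ?thesis by (simp add: power2_eq_square)
  qed (simp add: defect_nonneg)
qed

text \<open>Young's inequality separates the cosine series from the correction. The series is summed
  exactly by orthogonality in x and exponential decay in y and gives \<open>C_N n\<close>; the
  correction costs a multiple of \<open>defect\<close>, at the price of the factor 1 + 1/t.\<close>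

lemma disp_energy:
  assumes t: "0 < t"
  shows "(\<integral>\<^sup>+z\<in>{- (l / 2)<..<l / 2} \<times> {0<..}. ennreal ((norm (disp_grad z))\<^sup>2) \<partial>lebesgue)
    \<le> ennreal (l\<^sup>2 * ((1 + t) * C_W + (1 + 1 / t) * defect))"
proof -
  \<comment> \<open>Up to the factor l, a bound for the energy on the horizontal line at height y.
    The factor 2 in front of \<open>defect\<close> counts \<open>rem'\<close> in mean square and
    \<open>rem\<close> pointwise.\<close>
  define J where "J y = (1 + t) * (\<Sum>k\<in>odds n. (cg k)\<^sup>2 * exp (- (2 * real k * pi / l) * y)) + (1 + 1 / t) * (2 * defect * exp (- (2 / l) * y))" for y
  have J0: "0 \<le> J y" for y unfolding J_def using t defect_nonneg by (intro add_nonneg_nonneg mult_nonneg_nonneg sum_nonneg) auto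
  have young: "(p + q)\<^sup>2 \<le> (1 + t) * p\<^sup>2 + (1 + 1 / t) * q\<^sup>2" for p q :: real
  proof -
    have "0 \<le> (t * p - q)\<^sup>2 / t" using t by simp
    also have "\<dots> = t * p\<^sup>2 - 2 * p * q + q\<^sup>2 / t" using t by (simp add: power2_eq_square field_simps)
    finally show ?thesis by (simp add: power2_eq_square algebra_simps)
  qed
  have inner: "(\<integral>\<^sup>+x\<in>{- (l / 2)..l / 2}. ennreal ((norm (disp_grad (x, y)))\<^sup>2) \<partial>lborel) \<le> ennreal (l * J y)" for y
  proof -
    define Y where "Y = y / l"
    define \<gamma> where "\<gamma> k = cg k * exp (- (real k * pi) * Y)" for k
    define F where "F s = (1 + t) * ((\<Sum>k\<in>odds n. \<gamma> k * sin (real k * pi * s))\<^sup>2 + (\<Sum>k\<in>odds n. \<gamma> k * cos (real k * pi * s))\<^sup>2)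
        + (1 + 1 / t) * (((rem' s)\<^sup>2 + defect) * (exp (- Y))\<^sup>2)" for s
    have FI: "(F has_integral ((1 + t) * ((\<Sum>k\<in>odds n. (\<gamma> k)\<^sup>2 / 2) + (\<Sum>k\<in>odds n. (\<gamma> k)\<^sup>2 / 2))
        + (1 + 1 / t) * ((defect + defect) * (exp (- Y))\<^sup>2))) {0..1}"
      unfolding F_def
      by (intro has_integral_add has_integral_mult_right has_integral_mult_left has_integral_sin_sum_sq finite_odds zero_notin_odds
          rem'_integral) (use has_integral_const_real[of defect 0 1] in simp_all)
    have Jeq: "(1 + t) * ((\<Sum>k\<in>odds n. (\<gamma> k)\<^sup>2 / 2) + (\<Sum>k\<in>odds n. (\<gamma> k)\<^sup>2 / 2)) + (1 + 1 / t) * ((defect + defect) * (exp (- Y))\<^sup>2) = J y"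
    proof -
      have "(\<gamma> k)\<^sup>2 / 2 + (\<gamma> k)\<^sup>2 / 2 = (cg k)\<^sup>2 * exp (- (2 * real k * pi / l) * y)" for k
        by (simp add: \<gamma>_def Y_def power_mult_distrib exp_double[symmetric] mult_ac)
      moreover have "(exp (- Y))\<^sup>2 = exp (- (2 / l) * y)" by (simp add: Y_def exp_double[symmetric])
      ultimately show ?thesis unfolding J_def by (simp add: sum.distrib[symmetric])
    qed
    have "((\<lambda>x. F ((x - - (l / 2)) / (l / 2 - - (l / 2)))) has_integral (l / 2 - - (l / 2)) * J y) {- (l / 2)..l / 2}"
      using integral_affine_Icc[OF FI, of "- (l / 2)" "l / 2"] l unfolding Jeq by simp
    moreover have "(x - - (l / 2)) / (l / 2 - - (l / 2)) = x / l + 1 / 2" for x using l by (simp add: field_simps)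
    ultimately have FI': "((\<lambda>x. F (x / l + 1 / 2)) has_integral l * J y) {- (l / 2)..l / 2}" by simp
    have F0: "0 \<le> F s" for s unfolding F_def using t defect_nonneg by (intro add_nonneg_nonneg mult_nonneg_nonneg) auto
    have le: "(norm (disp_grad (x, y)))\<^sup>2 \<le> F (x / l + 1 / 2)" if x: "x \<in> {- (l / 2)..l / 2}" for x
    proof -
      define s where "s = x / l + 1 / 2"
      have s: "s \<in> {0..1}" using x l by (auto simp: s_def field_simps)
      have "(norm (disp_grad (x, y)))\<^sup>2 = ((\<Sum>k\<in>odds n. \<gamma> k * sin (real k * pi * s)) + rem' s * exp (- Y))\<^sup>2 +
          ((\<Sum>k\<in>odds n. \<gamma> k * cos (real k * pi * s)) + - rem s * exp (- Y))\<^sup>2"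
        unfolding power2_norm_eq_inner inner_prod_def
        by (simp add: disp_grad_def disp_x_def disp_y_def s_def Y_def \<gamma>_def power2_eq_square mult_ac)
      also have "\<dots> \<le> ((1 + t) * (\<Sum>k\<in>odds n. \<gamma> k * sin (real k * pi * s))\<^sup>2 + (1 + 1 / t) * (rem' s * exp (- Y))\<^sup>2) +
          ((1 + t) * (\<Sum>k\<in>odds n. \<gamma> k * cos (real k * pi * s))\<^sup>2 + (1 + 1 / t) * (- rem s * exp (- Y))\<^sup>2)"
        by (intro add_mono young)
      also have "\<dots> = (1 + t) * ((\<Sum>k\<in>odds n. \<gamma> k * sin (real k * pi * s))\<^sup>2 + (\<Sum>k\<in>odds n. \<gamma> k * cos (real k * pi * s))\<^sup>2)
          + (1 + 1 / t) * (((rem' s)\<^sup>2 + (rem s)\<^sup>2) * (exp (- Y))\<^sup>2)"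
        by (simp add: power_mult_distrib algebra_simps)
      also have "\<dots> \<le> F s"
        unfolding F_def using rem_bound[OF s] t by (intro add_left_mono mult_left_mono mult_right_mono) auto
      finally show ?thesis by (simp add: s_def)
    qed
    have "(\<integral>\<^sup>+x\<in>{- (l / 2)..l / 2}. ennreal ((norm (disp_grad (x, y)))\<^sup>2) \<partial>lborel)
        \<le> (\<integral>\<^sup>+x\<in>{- (l / 2)..l / 2}. ennreal (F (x / l + 1 / 2)) \<partial>lborel)"
      by (rule nn_integral_mono) (use le in \<open>auto simp: indicator_def intro!: ennreal_leI\<close>)
    also have "\<dots> = ennreal (l * J y)" by (rule nn_integral_has_integral_lebesgue'[OF F0 FI'])
    finally show ?thesis .
  qed
  have JI: "((\<lambda>y. l * J y) has_integral l * ((1 + t) * (\<Sum>k\<in>odds n. (cg k)\<^sup>2 * (l / (2 * real k * pi))) + (1 + 1 / t) * (2 * defect * (l / 2)))) {0..}"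
    unfolding J_def
  proof (intro has_integral_mult_right has_integral_add has_integral_sum finite_odds)
    fix k assume "k \<in> odds n"
    then have "0 < 2 * real k * pi / l" using odds_pos l by simp
    from has_integral_exp_minus_to_infinity[OF this, of 0]
    show "((\<lambda>y. exp (- (2 * real k * pi / l) * y)) has_integral l / (2 * real k * pi)) {0..}" by simp
  next
    have "0 < 2 / l" using l by simp
    from has_integral_exp_minus_to_infinity[OF this, of 0]
    show "((\<lambda>y. exp (- (2 / l) * y)) has_integral l / 2) {0..}" by simp
  qed
  have val: "l * ((1 + t) * (\<Sum>k\<in>odds n. (cg k)\<^sup>2 * (l / (2 * real k * pi))) + (1 + 1 / t) * (2 * defect * (l / 2)))
      = l\<^sup>2 * ((1 + t) * C_N n + (1 + 1 / t) * defect)"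
  proof -
    have "(\<Sum>k\<in>odds n. (cg k)\<^sup>2 * (l / (2 * real k * pi))) = (\<Sum>k\<in>odds n. l * (8 / (pi ^ 3 * real k ^ 3)))"
      by (rule sum.cong) (auto simp: cg_def power2_eq_square power3_eq_cube mult_ac)
    then show ?thesis unfolding C_N_eq by (simp add: power2_eq_square algebra_simps sum_distrib_left)
  qed
  define G where "G z = ennreal ((norm (disp_grad z))\<^sup>2) * indicator ({- (l / 2)..l / 2} \<times> {0..}) z" for z
  have mG: "G \<in> borel_measurable (lborel \<Otimes>\<^sub>M lborel)"
  proof -
    have "(\<lambda>z. (norm (disp_grad z))\<^sup>2) \<in> borel_measurable borel"
      by (intro borel_measurable_continuous_onI continuous_on_power continuous_on_norm continuous_disp_grad)
    then have "G \<in> borel_measurable borel"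
      unfolding G_def by (intro borel_measurable_times_ennreal measurable_compose[OF _ measurable_ennreal] borel_measurable_indicator)
        (auto intro!: borel_closed closed_Times)
    then show ?thesis by (simp add: lborel_prod)
  qed
  have "(\<integral>\<^sup>+z\<in>{- (l / 2)<..<l / 2} \<times> {0<..}. ennreal ((norm (disp_grad z))\<^sup>2) \<partial>lebesgue) \<le> (\<integral>\<^sup>+z. G z \<partial>lborel)"
    unfolding nn_integral_completion G_def by (rule nn_integral_mono) (auto simp: indicator_def)
  also have "\<dots> = (\<integral>\<^sup>+y. \<integral>\<^sup>+x. G (x, y) \<partial>lborel \<partial>lborel)"
    using lborel_pair.nn_integral_snd[OF mG] by (simp add: lborel_prod)
  also have "\<dots> \<le> (\<integral>\<^sup>+y. ennreal (l * J y) * indicator {0..} y \<partial>lborel)"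
  proof (rule nn_integral_mono)
    fix y
    have "(\<integral>\<^sup>+x. G (x, y) \<partial>lborel) = (\<integral>\<^sup>+x\<in>{- (l / 2)..l / 2}. ennreal ((norm (disp_grad (x, y)))\<^sup>2) \<partial>lborel)" if "0 \<le> y"
      using that by (intro nn_integral_cong) (auto simp: G_def indicator_def)
    moreover have "(\<integral>\<^sup>+x. G (x, y) \<partial>lborel) = 0" if "\<not> 0 \<le> y"
      using that by (simp add: G_def indicator_def)
    ultimately show "(\<integral>\<^sup>+x. G (x, y) \<partial>lborel) \<le> ennreal (l * J y) * indicator {0..} y"
      using inner[of y] by (cases "0 \<le> y") auto
  qed
  also have "\<dots> = ennreal (l\<^sup>2 * ((1 + t) * C_N n + (1 + 1 / t) * defect))"
    unfolding val[symmetric] by (rule nn_integral_has_integral_lebesgue'[OF _ JI]) (use J0 l in simp)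
  also have "\<dots> \<le> ennreal (l\<^sup>2 * ((1 + t) * C_W + (1 + 1 / t) * defect))"
    using C_N_le[of n] t by (intro ennreal_leI mult_left_mono add_right_mono) auto
  finally show ?thesis .
qed

end

subsection \<open>Upper bounds for the infima\<close>

lemma open_region: "continuous_on UNIV h \<Longrightarrow> open (region h)"
proof -
  assume h: "continuous_on UNIV h"
  have "region h = {z. 0 < snd z} \<inter> {z. snd z < h (fst z)}" by (auto simp: region_def)
  also have "open \<dots>"
    by (intro open_Int open_Collect_less continuous_intros continuous_on_compose2[OF h]) auto
  finally show ?thesis .
qed

lemma open_half_strips: "continuous_on UNIV h \<Longrightarrow> open (half_strips h)"
  unfolding half_strips_def by (intro open_Times open_Collect_less continuous_on_const open_greaterThan)

text \<open>The order of limits matters: n grows first, at fixed t, so that the factor 1 + 1/t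
  multiplies a vanishing defect; only then t tends to 0.\<close>

lemma energy_limit:
  assumes E: "\<And>t n. 0 < t \<Longrightarrow> E \<le> ennreal (l\<^sup>2 * ((1 + t) * C_W + (1 + 1 / t) * defect n) + b)"
  shows "E \<le> ennreal (C_W * l\<^sup>2 + b)"
proof -
  have d: "(\<lambda>n. defect n) \<longlonglongrightarrow> 1 - 1" unfolding defect_def[OF zero_less_one] by (intro tendsto_diff tendsto_const basel_odd)
  have "E \<le> ennreal (l\<^sup>2 * ((1 + t) * C_W + (1 + 1 / t) * (1 - 1)) + b)" if t: "0 < t" for t
  proof -
    have "(\<lambda>n. ennreal (l\<^sup>2 * ((1 + t) * C_W + (1 + 1 / t) * defect n) + b)) \<longlonglongrightarrow> ennreal (l\<^sup>2 * ((1 + t) * C_W + (1 + 1 / t) * (1 - 1)) + b)"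
      by (intro tendsto_ennrealI tendsto_intros d)
    from LIMSEQ_le_const[OF this] E[OF t] show ?thesis by blast
  qed
  then have "E \<le> ennreal (l\<^sup>2 * ((1 + inverse (real (Suc k))) * C_W + 0) + b)" for k by simp
  moreover have "(\<lambda>k. ennreal (l\<^sup>2 * ((1 + inverse (real (Suc k))) * C_W + 0) + b)) \<longlonglongrightarrow> ennreal (l\<^sup>2 * ((1 + 0) * C_W + 0) + b)"
    by (intro tendsto_ennrealI tendsto_intros LIMSEQ_inverse_real_of_nat)
  ultimately show ?thesis using LIMSEQ_le_const by (fastforce simp: mult.commute)
qed

text \<open>The positivity set of the parabola is one interval, so the half-strip over it is exactly
  the domain on which the displacement was estimated.\<close>

lemma G_bump_le: "G (bump L_opt 1) \<le> ennreal m_opt"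
proof -
  let ?h = "bump L_opt 1"
  note L = L_opt(1) zero_less_one[where 'a = real]
  have S: "half_strips ?h = {- (L_opt / 2)<..<L_opt / 2} \<times> {0<..}"
    unfolding half_strips_def bump_pos_iff[OF L] by (simp add: abs_less_iff set_eq_iff) linarith
  have "G ?h \<le> ennreal (L_opt\<^sup>2 * ((1 + t) * C_W + (1 + 1 / t) * defect n) + 12 / L_opt ^ 3)" if t: "0 < t" for t n
  proof -
    note D = disp_derivative[OF L(1), where n = n] continuous_disp_grad[OF L(1), where n = n]
    have w: "has_weak_gradient (half_strips ?h) (disp L_opt n) (disp_grad L_opt n)" by (rule has_weak_gradient_of_C1[OF D])
    have tr: "has_trace (half_strips ?h) (disp L_opt n) (\<lambda>x. x)" by (rule has_trace_of_C1[OF D disp_trace[OF L(1)]])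
    have "G ?h \<le> dirichlet (half_strips ?h) (disp L_opt n) + surface_energy ?h"
      unfolding G_def by (intro add_right_mono INF_lower) (use w tr in \<open>auto simp: weakly_differentiable_def\<close>)
    also have "\<dots> \<le> ennreal (L_opt\<^sup>2 * ((1 + t) * C_W + (1 + 1 / t) * defect n)) + ennreal (12 / L_opt ^ 3)"
      unfolding dirichlet_eq[OF open_half_strips[OF continuous_bump[OF L]] w] bump_surface[OF L] unfolding S
      using disp_energy[OF L(1) t] by (intro add_mono) auto
    also have "\<dots> = ennreal (L_opt\<^sup>2 * ((1 + t) * C_W + (1 + 1 / t) * defect n) + 12 / L_opt ^ 3)"
      using t C_W_pos defect_nonneg[OF L(1)] L by (intro ennreal_plus[symmetric] mult_nonneg_nonneg add_nonneg_nonneg) auto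
    finally show ?thesis .
  qed
  from energy_limit[OF this] show ?thesis by (simp add: energy_opt)
qed

lemma powr_fifth:
  fixes V :: real
  assumes "0 < V"
  shows "V powr (real k / 5) = (V powr (1 / 5)) ^ k"
  using assms by (simp add: powr_powr flip: powr_realpow)

text \<open>The competitor is the parabola of width \<open>L_opt * V powr (2/5)\<close> with the
  half-strip displacement restricted to its region; restriction only lowers the energy. The bound
  carries no error term, so rescaled minimizers have total energy at most
  \<open>m_opt\<close>.\<close>

lemma F_s_le:
  assumes V: "0 < V"
  shows "F_s V \<le> ennreal (V powr (4 / 5) * m_opt)"
proof -
  define v l where "v = V powr (1 / 5)" and "l = L_opt * v\<^sup>2"
  have v: "0 < v" "V = v ^ 5" "V powr (4 / 5) = v ^ 4" using V powr_fifth[of V 5] powr_fifth[of V 4] by (auto simp: v_def)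
  have l: "0 < l" using v L_opt(1) by (simp add: l_def)
  let ?h = "bump l V"
  note b = l V
  have prof: "profile V ?h" by (rule bump_profile[OF b])
  have op: "open (region ?h)" by (rule open_region[OF continuous_bump[OF b]])
  have sub: "region ?h \<subseteq> {- (l / 2)<..<l / 2} \<times> {0<..}"
  proof
    fix z assume "z \<in> region ?h"
    then have "0 < snd z" "0 < ?h (fst z)" by (auto simp: region_def)
    moreover from this have "\<bar>fst z\<bar> < l / 2" using bump_pos_iff[OF b] by blast
    then have "- (l / 2) < fst z" "fst z < l / 2" by linarith+
    ultimately show "z \<in> {- (l / 2)<..<l / 2} \<times> {0<..}" by (cases z) simp
  qed
  have "region ?h \<subseteq> {- (l / 2)..l / 2} \<times> {0..3 * V / (2 * l)}"
  proof -
    have le: "bump l V t \<le> 3 * V / (2 * l)" for t using b by (simp add: bump_def)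
    show ?thesis
    proof
      fix z assume z: "z \<in> region ?h"
      then have "0 < snd z" "snd z < ?h (fst z)" by (auto simp: region_def)
      moreover have "- (l / 2) < fst z" "fst z < l / 2" using subsetD[OF sub z] by (auto simp: mem_Times_iff)
      ultimately show "z \<in> {- (l / 2)..l / 2} \<times> {0..3 * V / (2 * l)}"
        using le[of "fst z"] by (simp only: mem_Times_iff atLeastAtMost_iff) linarith
    qed
  qed
  then have bd: "bounded (region ?h)" by (rule bounded_subset[rotated]) (intro bounded_Times bounded_closed_interval)
  have "F_s V \<le> ennreal (l\<^sup>2 * ((1 + t) * C_W + (1 + 1 / t) * defect n) + 12 * V\<^sup>2 / l ^ 3)" if t: "0 < t" for t n
  proof -
    note D = disp_derivative[OF l, where n = n] continuous_disp_grad[OF l, where n = n]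
    have "(disp l n, ?h) \<in> admissible V"
      unfolding admissible_def using prof sobolev_of_C1[OF D op bd, of 2] has_trace_of_C1[OF D disp_trace[OF l]] by simp
    then have "F_s V \<le> elastic_energy (disp l n) ?h + surface_energy ?h"
      unfolding F_s_def by (rule INF_lower2) simp
    also have "\<dots> \<le> (\<integral>\<^sup>+z\<in>{- (l / 2)<..<l / 2} \<times> {0<..}. ennreal ((norm (disp_grad l n z))\<^sup>2) \<partial>lebesgue) + ennreal (12 * V\<^sup>2 / l ^ 3)"
      unfolding elastic_energy_def dirichlet_eq[OF op has_weak_gradient_of_C1[OF D]] bump_surface[OF b]
      using sub by (intro add_right_mono nn_integral_mono) (auto simp: indicator_def)
    also have "\<dots> \<le> ennreal (l\<^sup>2 * ((1 + t) * C_W + (1 + 1 / t) * defect n)) + ennreal (12 * V\<^sup>2 / l ^ 3)"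
      by (intro add_right_mono disp_energy[OF l t])
    also have "\<dots> = ennreal (l\<^sup>2 * ((1 + t) * C_W + (1 + 1 / t) * defect n) + 12 * V\<^sup>2 / l ^ 3)"
      using t C_W_pos defect_nonneg[OF l] l by (intro ennreal_plus[symmetric] mult_nonneg_nonneg add_nonneg_nonneg) auto
    finally show ?thesis .
  qed
  then have "F_s V \<le> ennreal (C_W * l\<^sup>2 + 12 * V\<^sup>2 / l ^ 3)" by (rule energy_limit)
  also have "C_W * l\<^sup>2 + 12 * V\<^sup>2 / l ^ 3 = v ^ 4 * (C_W * L_opt\<^sup>2 + 12 / L_opt ^ 3)"
  proof -
    have "V\<^sup>2 / l ^ 3 = v ^ 4 / L_opt ^ 3"
      using v L_opt(1) unfolding v(2) l_def by (simp add: power_mult_distrib divide_simps flip: power_mult power_add)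
    then show ?thesis by (simp add: l_def power_mult_distrib algebra_simps flip: power_mult)
  qed
  finally show ?thesis by (simp add: energy_opt v(3))
qed

subsection \<open>Reduction to one dimension\<close>

text \<open>Integrating the energy density over vertical lines, the region enters only through the
  rectangles it contains.\<close>

lemma energy_density:
  fixes u :: "real \<times> real \<Rightarrow> real"
  assumes \<Omega>: "open \<Omega>" and w: "has_weak_gradient \<Omega> u g" and tr: "has_trace \<Omega> u (\<lambda>x. x)"
  shows "\<exists>e :: real \<Rightarrow> ennreal. e \<in> borel_measurable borel \<and>
    (\<integral>\<^sup>+x. e x \<partial>lborel) = (\<integral>\<^sup>+z\<in>\<Omega>. ennreal ((norm (g z))\<^sup>2) \<partial>lebesgue) \<and>
    (\<forall>a b r. a < b \<longrightarrow> 0 < r \<longrightarrow> {a..b} \<times> {0<..r} \<subseteq> \<Omega> \<longrightarrow>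
      ennreal (C_W * (b - a)\<^sup>2 * tanh (pi * r / (b - a))) \<le> (\<integral>\<^sup>+x\<in>{a..b}. e x \<partial>lborel))"
proof -
  define f where "f z = (norm (indicator \<Omega> z *\<^sub>R g z))\<^sup>2" for z
  have li: "locally_integrable \<Omega> g" using w unfolding has_weak_gradient_def by blast
  have m: "f \<in> borel_measurable lebesgue"
    unfolding f_def
    by (rule measurable_compose[OF locally_integrable_measurable[OF \<Omega> li]])
       (intro borel_measurable_continuous_onI continuous_intros)
  \<comment> \<open>The line density must be Borel and come from an iterated integral, so the energy
    density is replaced by a Borel representative.\<close>
  obtain f' where f': "f' \<in> borel_measurable lborel" "AE z in lborel. f z = f' z"
    using completion_ex_borel_measurable_real[OF m] by blast
  have mp: "(\<lambda>z. ennreal (f' z)) \<in> borel_measurable (lborel \<Otimes>\<^sub>M lborel)" using f'(1) by (simp add: lborel_prod)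
  define e where "e x = (\<integral>\<^sup>+y. ennreal (f' (x, y)) \<partial>lborel)" for x
  have me: "e \<in> borel_measurable lborel" unfolding e_def by (rule lborel.borel_measurable_nn_integral_fst[OF mp])
  have fe: "(\<integral>\<^sup>+z. ennreal (f z) * indicator (A \<times> UNIV) z \<partial>lebesgue) = (\<integral>\<^sup>+x\<in>A. e x \<partial>lborel)" if A: "A \<in> sets borel" for A
  proof -
    have mA: "(\<lambda>z. ennreal (f' z) * indicator (A \<times> UNIV) z) \<in> borel_measurable (lborel \<Otimes>\<^sub>M lborel)"
      using A by (intro borel_measurable_times_ennreal mp borel_measurable_indicator pair_measureI) auto
    have "(\<integral>\<^sup>+z. ennreal (f z) * indicator (A \<times> UNIV) z \<partial>lebesgue) = (\<integral>\<^sup>+z. ennreal (f' z) * indicator (A \<times> UNIV) z \<partial>lborel)"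
      unfolding nn_integral_completion by (rule nn_integral_cong_AE) (use f'(2) in \<open>eventually_elim, simp\<close>)
    also have "\<dots> = (\<integral>\<^sup>+x. \<integral>\<^sup>+y. ennreal (f' (x, y)) * indicator (A \<times> UNIV) (x, y) \<partial>lborel \<partial>lborel)"
      using lborel.nn_integral_fst[OF mA] by (simp add: lborel_prod)
    also have "\<dots> = (\<integral>\<^sup>+x\<in>A. e x \<partial>lborel)"
      by (rule nn_integral_cong) (simp add: e_def indicator_def)
    finally show ?thesis .
  qed
  show ?thesis
  proof (intro exI[of _ e] conjI allI impI)
    show "e \<in> borel_measurable borel" using me by simp
    have "(\<integral>\<^sup>+x. e x \<partial>lborel) = (\<integral>\<^sup>+z. ennreal (f z) \<partial>lebesgue)" using fe[of UNIV] by simp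
    also have "\<dots> = (\<integral>\<^sup>+z\<in>\<Omega>. ennreal ((norm (g z))\<^sup>2) \<partial>lebesgue)"
      by (rule nn_integral_cong) (simp add: f_def indicator_def)
    finally show "(\<integral>\<^sup>+x. e x \<partial>lborel) = (\<integral>\<^sup>+z\<in>\<Omega>. ennreal ((norm (g z))\<^sup>2) \<partial>lebesgue)" .
    fix a b r :: real assume ab: "a < b" and r: "0 < r" and sub: "{a..b} \<times> {0<..r} \<subseteq> \<Omega>"
    have subQ: "{a<..<b} \<times> {0<..<r} \<subseteq> \<Omega>" using sub by fastforce
    have "has_trace_rect a b r u (\<lambda>x. x)" using tr ab r sub unfolding has_trace_def by blast
    from rectangle_lower_bound[OF ab r this has_weak_gradient_subset[OF w subQ]]
    have "ennreal (C_W * (b - a)\<^sup>2 * tanh (pi * r / (b - a))) \<le> (\<integral>\<^sup>+z\<in>{a<..<b} \<times> {0<..<r}. ennreal ((norm (g z))\<^sup>2) \<partial>lebesgue)" .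
    also have "\<dots> \<le> (\<integral>\<^sup>+z. ennreal (f z) * indicator ({a..b} \<times> UNIV) z \<partial>lebesgue)"
      by (rule nn_integral_mono) (use subQ in \<open>auto simp: f_def indicator_def\<close>)
    also have "\<dots> = (\<integral>\<^sup>+x\<in>{a..b}. e x \<partial>lborel)" by (rule fe) simp
    finally show "ennreal (C_W * (b - a)\<^sup>2 * tanh (pi * r / (b - a))) \<le> (\<integral>\<^sup>+x\<in>{a..b}. e x \<partial>lborel)" .
  qed
qed

text \<open>Replaces the Lebesgue measurable weak derivative by a Borel representative, as the
  one-dimensional argument works with \<open>lborel\<close>.\<close>

lemma profile_derivative:
  assumes h: "profile V h"
  shows "\<exists>g. g \<in> borel_measurable borel \<and> (\<forall>x y. x \<le> y \<longrightarrow> set_integrable lborel {x..y} g) \<and>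
    (\<forall>x y. x \<le> y \<longrightarrow> (LINT t:{x..y}|lborel. g t) = h y - h x) \<and>
    surface_energy h = (\<integral>\<^sup>+x. ennreal ((g x)\<^sup>2) \<partial>lborel)"
proof -
  have c: "continuous_on UNIV h" using h unfolding profile_def by blast
  obtain g0 where w: "has_weak_gradient UNIV h g0"
    using h unfolding profile_def sobolev_def weakly_differentiable_def by blast
  have li: "locally_integrable UNIV g0" using w unfolding has_weak_gradient_def by blast
  have "g0 \<in> borel_measurable lebesgue" using locally_integrable_measurable[OF open_UNIV li] by simp
  then obtain g where g: "g \<in> borel_measurable lborel" "AE x in lborel. g0 x = g x"
    using completion_ex_borel_measurable_real by blast
  have AE: "AE t in lebesgue. g0 t = g t" by (rule AE_completion[OF g(2)])
  have meas: "(\<lambda>t. indicator {x..y} t *\<^sub>R g t) \<in> borel_measurable lborel" for x y :: real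
    using g(1) by (intro borel_measurable_scaleR) simp_all
  have ml: "(\<lambda>t. indicator {x..y} t *\<^sub>R g t) \<in> borel_measurable lebesgue" for x y :: real
    by (rule measurable_completion[OF meas])
  have AE2: "AE t in lebesgue. indicator {x..y} t *\<^sub>R g0 t = indicator {x..y} t *\<^sub>R g t" for x y :: real
    using AE by eventually_elim simp
  have i0: "integrable lebesgue (\<lambda>t. indicator {x..y} t *\<^sub>R g0 t)" for x y :: real
    using li compact_Icc unfolding locally_integrable_def set_integrable_def by blast
  show ?thesis
  proof (intro exI[of _ g] conjI allI impI)
    show "g \<in> borel_measurable borel" using g(1) unfolding measurable_lborel2 .
    fix x y :: real assume xy: "x \<le> y"
    show "set_integrable lborel {x..y} g"
      using integrable_cong_AE_imp[OF i0 ml AE2] integrable_completion[OF meas]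
      unfolding set_integrable_def by blast
    have "(LINT t:{x..y}|lborel. g t) = (LINT t:{x..y}|lebesgue. g t)"
      unfolding set_lebesgue_integral_def by (rule integral_completion[OF meas, symmetric])
    also have "\<dots> = (LINT t:{x..y}|lebesgue. g0 t)"
      unfolding set_lebesgue_integral_def by (rule integral_cong_AE[OF ml borel_measurable_integrable[OF i0]]) (use AE in \<open>eventually_elim, simp\<close>)
    also have "\<dots> = h y - h x" by (rule weak_derivative_FTC[OF c w xy])
    finally show "(LINT t:{x..y}|lborel. g t) = h y - h x" .
  next
    have "surface_energy h = (\<integral>\<^sup>+x. ennreal ((g0 x)\<^sup>2) \<partial>lborel)"
      unfolding surface_energy_def dirichlet_eq[OF open_UNIV w] by (simp add: nn_integral_completion)
    also have "\<dots> = (\<integral>\<^sup>+x. ennreal ((g x)\<^sup>2) \<partial>lborel)"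
      by (rule nn_integral_cong_AE) (use g(2) in \<open>eventually_elim, simp\<close>)
    finally show "surface_energy h = (\<integral>\<^sup>+x. ennreal ((g x)\<^sup>2) \<partial>lborel)" .
  qed
qed

text \<open>Lengths scale by v^2 and heights by v^3, so slopes scale by v, both energies by v^4, and
  the ratio of scales is multiplied by v. Minimizers use the case \<mu> = 1; competitors of
  \<open>G\<close> use V = 1 with \<mu> arbitrary.\<close>

lemma profile_energy_rescaled:
  assumes V: "0 < V" and h: "profile V h" and e: "e \<in> borel_measurable borel"
    and el: "\<And>a b r. a < b \<Longrightarrow> 0 < r \<Longrightarrow> (\<And>x. x \<in> {a..b} \<Longrightarrow> r < \<mu> * h x) \<Longrightarrow>
      ennreal (C_W * (b - a)\<^sup>2 * tanh (pi * r / (b - a))) \<le> (\<integral>\<^sup>+x\<in>{a..b}. e x \<partial>lborel)"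
    and total: "(\<integral>\<^sup>+x. e x \<partial>lborel) + surface_energy h \<le> ennreal (V powr (4 / 5) * tot)"
    and \<mu>: "0 < \<mu>" and tot: "0 \<le> tot"
    and g: "g \<in> borel_measurable borel" "\<And>x y. x \<le> y \<Longrightarrow> set_integrable lborel {x..y} g"
      "\<And>x y. x \<le> y \<Longrightarrow> (LINT t:{x..y}|lborel. g t) = h y - h x"
      "surface_energy h = (\<integral>\<^sup>+x. ennreal ((g x)\<^sup>2) \<partial>lborel)"
  defines "v \<equiv> V powr (1 / 5)"
  shows "profile_energy (rescaled V h) (\<lambda>x. g (v\<^sup>2 * x) / v) (\<lambda>x. ennreal (1 / v\<^sup>2) * e (v\<^sup>2 * x)) (\<mu> * v) tot"
proof
  have v: "0 < v" "V = v ^ 5" "V powr (4 / 5) = v ^ 4" "V powr (2 / 5) = v\<^sup>2" "V powr (3 / 5) = v ^ 3"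
    using V powr_fifth[of V 5] powr_fifth[of V 4] powr_fifth[of V 2] powr_fifth[of V 3] by (auto simp: v_def)
  have H: "rescaled V h = (\<lambda>x. h (v\<^sup>2 * x) / v ^ 3)"
    using v(4,5) by (simp add: rescaled_def fun_eq_iff powr_minus_divide)
  have ch: "continuous_on UNIV h" and h0: "\<And>x. 0 \<le> h x" and bi: "has_bochner_integral lebesgue h V"
    using h unfolding profile_def by auto
  have mh: "h \<in> borel_measurable lborel" using borel_measurable_continuous_onI[OF ch] by simp
  have ih: "integrable lborel h" "(LINT x|lborel. h x) = V"
    using bi integrable_completion[OF mh] integral_completion[OF mh] by (simp_all add: has_bochner_integral_iff)
  show "continuous_on UNIV (rescaled V h)"
    unfolding H by (intro continuous_intros continuous_on_compose2[OF ch]) (use v in auto)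
  show "0 \<le> rescaled V h x" for x unfolding H using h0 v by simp
  have v2: "v\<^sup>2 \<noteq> 0" using v by simp
  show "integrable lborel (rescaled V h)"
    unfolding H using lborel_integrable_real_affine[OF ih(1) v2, of 0] by simp
  have "V = v\<^sup>2 * (LINT x|lborel. h (v\<^sup>2 * x))"
    using lborel_integral_real_affine[OF v2, of h 0] ih(2) by simp
  then have "v\<^sup>2 * (LINT x|lborel. h (v\<^sup>2 * x)) = v\<^sup>2 * v ^ 3" using v(2) by (simp flip: power_add)
  then have "(LINT x|lborel. h (v\<^sup>2 * x)) = v ^ 3" using mult_left_cancel[OF v2] by blast
  then show "(LINT x|lborel. rescaled V h x) = 1" unfolding H using v(1) by simp
  have mg: "(\<lambda>x. g (v\<^sup>2 * x)) \<in> borel_measurable borel" by (rule measurable_compose[OF _ g(1)]) measurable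
  have me: "(\<lambda>x. e (v\<^sup>2 * x)) \<in> borel_measurable borel" by (rule measurable_compose[OF _ e]) measurable
  show "(\<lambda>x. g (v\<^sup>2 * x) / v) \<in> borel_measurable borel" "(\<lambda>x. ennreal (1 / v\<^sup>2) * e (v\<^sup>2 * x)) \<in> borel_measurable borel"
    by (intro borel_measurable_divide borel_measurable_times_ennreal borel_measurable_const mg me)+
  have ind: "indicator {v\<^sup>2 * x..v\<^sup>2 * y} (v\<^sup>2 * t) = indicator {x..y} t" for x y t using v by (simp add: indicator_def)
  {
    fix x y :: real assume xy: "x \<le> y"
    then have xy': "v\<^sup>2 * x \<le> v\<^sup>2 * y" using v by simp
    show "set_integrable lborel {x..y} (\<lambda>x. g (v\<^sup>2 * x) / v)"
      using lborel_integrable_real_affine[OF g(2)[OF xy', unfolded set_integrable_def] v2, of 0]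
      unfolding set_integrable_def by (simp add: ind)
    have "h (v\<^sup>2 * y) - h (v\<^sup>2 * x) = v\<^sup>2 * (LINT t|lborel. indicator {x..y} t * g (v\<^sup>2 * t))"
      using lborel_integral_real_affine[OF v2, of "\<lambda>t. indicator {v\<^sup>2 * x..v\<^sup>2 * y} t *\<^sub>R g t" 0] g(3)[OF xy']
      by (simp add: ind set_lebesgue_integral_def)
    then show "(LINT t:{x..y}|lborel. g (v\<^sup>2 * t) / v) = rescaled V h y - rescaled V h x"
      unfolding H set_lebesgue_integral_def using v by (simp add: diff_divide_distrib[symmetric] power3_eq_cube power2_eq_square)
  }
  show "0 < \<mu> * v" using \<mu> v by simp
  show "0 \<le> tot" by (rule tot)
  {
    fix a b r :: real assume ab: "a < b" and r: "0 < r" and *: "\<And>x. x \<in> {a..b} \<Longrightarrow> r < \<mu> * v * rescaled V h x"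
    have "v\<^sup>2 * r < \<mu> * h x" if x: "x \<in> {v\<^sup>2 * a..v\<^sup>2 * b}" for x
    proof -
      have "x / v\<^sup>2 \<in> {a..b}" using x v by (auto simp: field_simps)
      from *[OF this] show ?thesis unfolding H using v by (simp add: field_simps power2_eq_square power3_eq_cube)
    qed
    moreover have "v\<^sup>2 * a < v\<^sup>2 * b" "0 < v\<^sup>2 * r" using v ab r by auto
    ultimately have "ennreal (C_W * (v\<^sup>2 * b - v\<^sup>2 * a)\<^sup>2 * tanh (pi * (v\<^sup>2 * r) / (v\<^sup>2 * b - v\<^sup>2 * a)))
        \<le> (\<integral>\<^sup>+x\<in>{v\<^sup>2 * a..v\<^sup>2 * b}. e x \<partial>lborel)" by (intro el)
    also have "\<dots> = ennreal (v\<^sup>2) * (\<integral>\<^sup>+x\<in>{a..b}. e (v\<^sup>2 * x) \<partial>lborel)"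
      using nn_integral_real_affine[OF _ v2, of "\<lambda>x. e x * indicator {v\<^sup>2 * a..v\<^sup>2 * b} x" 0] e by (simp add: ind)
    also have "C_W * (v\<^sup>2 * b - v\<^sup>2 * a)\<^sup>2 * tanh (pi * (v\<^sup>2 * r) / (v\<^sup>2 * b - v\<^sup>2 * a)) = v ^ 4 * (C_W * (b - a)\<^sup>2 * tanh (pi * r / (b - a)))"
    proof -
      have "pi * (v\<^sup>2 * r) / (v\<^sup>2 * b - v\<^sup>2 * a) = (v\<^sup>2 * (pi * r)) / (v\<^sup>2 * (b - a))" by (simp only: right_diff_distrib mult.left_commute)
      also have "\<dots> = pi * r / (b - a)" using v2 by (rule mult_divide_mult_cancel_left)
      finally show ?thesis by (simp add: power_mult_distrib flip: right_diff_distrib power_mult)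
    qed
    finally have "ennreal (1 / v ^ 4) * ennreal (v ^ 4 * (C_W * (b - a)\<^sup>2 * tanh (pi * r / (b - a))))
        \<le> ennreal (1 / v ^ 4) * (ennreal (v\<^sup>2) * (\<integral>\<^sup>+x\<in>{a..b}. e (v\<^sup>2 * x) \<partial>lborel))" by (rule mult_left_mono) simp
    moreover have "ennreal (1 / v ^ 4) * ennreal (v ^ 4 * (C_W * (b - a)\<^sup>2 * tanh (pi * r / (b - a)))) =
        ennreal (C_W * (b - a)\<^sup>2 * tanh (pi * r / (b - a)))" using v by (simp flip: ennreal_mult')
    moreover have "ennreal (1 / v ^ 4) * (ennreal (v\<^sup>2) * (\<integral>\<^sup>+x\<in>{a..b}. e (v\<^sup>2 * x) \<partial>lborel)) =
        (\<integral>\<^sup>+x\<in>{a..b}. ennreal (1 / v\<^sup>2) * e (v\<^sup>2 * x) \<partial>lborel)"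
    proof -
      have c: "1 / v ^ 4 * v\<^sup>2 = 1 / v\<^sup>2" using v by (simp add: power2_eq_square power4_eq_xxxx)
      have "ennreal (1 / v ^ 4) * (ennreal (v\<^sup>2) * (\<integral>\<^sup>+x\<in>{a..b}. e (v\<^sup>2 * x) \<partial>lborel)) =
        ennreal (1 / v ^ 4 * v\<^sup>2) * (\<integral>\<^sup>+x\<in>{a..b}. e (v\<^sup>2 * x) \<partial>lborel)" 
        using ennreal_mult'[of "1 / v ^ 4" "v\<^sup>2"] v by (simp only: mult.assoc zero_le_divide_1_iff zero_le_power less_imp_le)
      also have "\<dots> = (\<integral>\<^sup>+x. ennreal (1 / v\<^sup>2) * (e (v\<^sup>2 * x) * indicator {a..b} x) \<partial>lborel)"
        unfolding c using me by (intro nn_integral_cmult[symmetric] borel_measurable_times_ennreal borel_measurable_indicator) simp_all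
      finally show ?thesis by (simp add: mult.assoc)
    qed
    ultimately show "ennreal (C_W * (b - a)\<^sup>2 * tanh (pi * r / (b - a))) \<le> (\<integral>\<^sup>+x\<in>{a..b}. ennreal (1 / v\<^sup>2) * e (v\<^sup>2 * x) \<partial>lborel)"
      by simp
  }
  have c: "ennreal (1 / v\<^sup>2) = ennreal (1 / v ^ 4) * ennreal (v\<^sup>2)"
    using v by (simp add: power2_eq_square power4_eq_xxxx flip: ennreal_mult')
  have "(\<integral>\<^sup>+x. ennreal (1 / v\<^sup>2) * e (v\<^sup>2 * x) \<partial>lborel) = ennreal (1 / v\<^sup>2) * (\<integral>\<^sup>+x. e (v\<^sup>2 * x) \<partial>lborel)"
    using me by (intro nn_integral_cmult) simp
  also have "\<dots> = ennreal (1 / v ^ 4) * (\<integral>\<^sup>+x. e x \<partial>lborel)"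
    unfolding c using nn_integral_real_affine[OF e v2, of 0] by (simp add: mult.assoc)
  finally have 1: "(\<integral>\<^sup>+x. ennreal (1 / v\<^sup>2) * e (v\<^sup>2 * x) \<partial>lborel) = ennreal (1 / v ^ 4) * (\<integral>\<^sup>+x. e x \<partial>lborel)" .
  have "(\<integral>\<^sup>+x. ennreal ((g (v\<^sup>2 * x) / v)\<^sup>2) \<partial>lborel) = (\<integral>\<^sup>+x. ennreal (1 / v\<^sup>2) * ennreal ((g (v\<^sup>2 * x))\<^sup>2) \<partial>lborel)"
    by (rule nn_integral_cong) (simp add: power_divide flip: ennreal_mult')
  also have "\<dots> = ennreal (1 / v\<^sup>2) * (\<integral>\<^sup>+x. ennreal ((g (v\<^sup>2 * x))\<^sup>2) \<partial>lborel)"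
    using mg by (intro nn_integral_cmult) measurable
  also have "\<dots> = ennreal (1 / v ^ 4) * (\<integral>\<^sup>+x. ennreal ((g x)\<^sup>2) \<partial>lborel)"
    unfolding c using nn_integral_real_affine[of "\<lambda>x. ennreal ((g x)\<^sup>2)", OF _ v2, of 0] g(1) by (simp add: mult.assoc)
  finally have 2: "(\<integral>\<^sup>+x. ennreal ((g (v\<^sup>2 * x) / v)\<^sup>2) \<partial>lborel) = ennreal (1 / v ^ 4) * surface_energy h" unfolding g(4) .
  have "ennreal (1 / v ^ 4) * ((\<integral>\<^sup>+x. e x \<partial>lborel) + surface_energy h) \<le> ennreal (1 / v ^ 4) * ennreal (v ^ 4 * tot)"
    using total unfolding v(3) by (rule mult_left_mono) simp
  also have "\<dots> = ennreal tot" using v by (simp flip: ennreal_mult')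
  finally show "(\<integral>\<^sup>+x. ennreal (1 / v\<^sup>2) * e (v\<^sup>2 * x) \<partial>lborel) + (\<integral>\<^sup>+x. ennreal ((g (v\<^sup>2 * x) / v)\<^sup>2) \<partial>lborel) \<le> ennreal tot"
    unfolding 1 2 by (simp add: distrib_left)
qed

text \<open>A half-strip over {k > 0} contains rectangles of every height, so its line density obeys
  the elastic inequality for all \<mu> at once, which is what \<open>energy_lower_bound\<close> asks
  for.\<close>

lemma G_lower:
  assumes k: "profile 1 k"
  shows "ennreal m_opt \<le> G k"
  unfolding G_def
proof -
  have ck: "continuous_on UNIV k" using k unfolding profile_def by blast
  have op: "open (half_strips k)" by (rule open_half_strips[OF ck])
  have *: "ennreal m_opt \<le> dirichlet (half_strips k) u + surface_energy k"
    if u: "weakly_differentiable (half_strips k) u" "has_trace (half_strips k) u (\<lambda>x. x)" for u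
  proof (cases "dirichlet (half_strips k) u + surface_energy k = \<infinity>")
    case False
    define tot where "tot = enn2real (dirichlet (half_strips k) u + surface_energy k)"
    have tot: "dirichlet (half_strips k) u + surface_energy k = ennreal tot" "0 \<le> tot"
      using False by (simp_all add: tot_def less_top)
    obtain gu where w: "has_weak_gradient (half_strips k) u gu" using u(1) unfolding weakly_differentiable_def by blast
    obtain e where e: "e \<in> borel_measurable borel"
      "(\<integral>\<^sup>+x. e x \<partial>lborel) = (\<integral>\<^sup>+z\<in>half_strips k. ennreal ((norm (gu z))\<^sup>2) \<partial>lebesgue)"
      "\<forall>a b r. a < b \<longrightarrow> 0 < r \<longrightarrow> {a..b} \<times> {0<..r} \<subseteq> half_strips k \<longrightarrow>
        ennreal (C_W * (b - a)\<^sup>2 * tanh (pi * r / (b - a))) \<le> (\<integral>\<^sup>+x\<in>{a..b}. e x \<partial>lborel)"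
      using energy_density[OF op w u(2)] by (elim exE conjE) (rule that)
    obtain g where g: "g \<in> borel_measurable borel" "\<forall>x y. x \<le> y \<longrightarrow> set_integrable lborel {x..y} g"
      "\<forall>x y. x \<le> y \<longrightarrow> (LINT t:{x..y}|lborel. g t) = k y - k x"
      "surface_energy k = (\<integral>\<^sup>+x. ennreal ((g x)\<^sup>2) \<partial>lborel)" using profile_derivative[OF k] by (elim exE conjE) (rule that)
    have "profile_energy k g e \<mu> tot" if \<mu>: "0 < \<mu>" for \<mu>
    proof -
      have el: "ennreal (C_W * (b - a)\<^sup>2 * tanh (pi * r / (b - a))) \<le> (\<integral>\<^sup>+x\<in>{a..b}. e x \<partial>lborel)"
        if ab: "a < b" and r: "0 < r" and pos: "\<And>x. x \<in> {a..b} \<Longrightarrow> r < \<mu> * k x" for a b r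
      proof (rule e(3)[rule_format, OF ab r])
        have "0 < k x" if "x \<in> {a..b}" for x
          using less_trans[OF r pos[OF that]] \<mu> by (rule zero_less_mult_pos)
        then show "{a..b} \<times> {0<..r} \<subseteq> half_strips k" unfolding half_strips_def by auto
      qed
      have "(\<integral>\<^sup>+x. e x \<partial>lborel) + surface_energy k \<le> ennreal (1 powr (4 / 5) * tot)"
        unfolding e(2) using tot by (simp add: dirichlet_eq[OF op w])
      then have "profile_energy (rescaled 1 k) (\<lambda>x. g ((1 powr (1 / 5))\<^sup>2 * x) / 1 powr (1 / 5))
          (\<lambda>x. ennreal (1 / (1 powr (1 / 5))\<^sup>2) * e ((1 powr (1 / 5))\<^sup>2 * x)) (\<mu> * 1 powr (1 / 5)) tot"
        by (intro profile_energy_rescaled[OF zero_less_one k e(1)] el \<mu> tot(2) g(1) g(2,3)[rule_format] g(4))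
      moreover have "rescaled 1 k = k" by (simp add: rescaled_def fun_eq_iff)
      ultimately show ?thesis by simp
    qed
    then have "m_opt \<le> tot" by (rule energy_lower_bound)
    then show ?thesis unfolding tot(1) by (rule ennreal_leI)
  next
    case True
    then show ?thesis by (simp only: infinity_ennreal_def top_greatest)
  qed
  show "ennreal m_opt \<le> (INF u\<in>{u. weakly_differentiable (half_strips k) u \<and> has_trace (half_strips k) u (\<lambda>x. x)}.
            dirichlet (half_strips k) u) + surface_energy k"
  proof (cases "surface_energy k = \<infinity>")
    case False
    \<comment> \<open>With finite surface energy the term can be moved to the other side, so that
      the bound passes through the infimum.\<close>
    have "ennreal m_opt - surface_energy k \<le> (INF u\<in>{u. weakly_differentiable (half_strips k) u \<and> has_trace (half_strips k) u (\<lambda>x. x)}.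
            dirichlet (half_strips k) u)"
      by (rule INF_greatest) (use * in \<open>simp add: ennreal_minus_le_iff add.commute[of "surface_energy k"]\<close>)
    then show ?thesis by (simp add: ennreal_minus_le_iff add.commute[of "surface_energy k"])
  qed simp
qed

lemma G_minimizer_bump: "G_minimizer (bump L_opt 1)"
  unfolding G_minimizer_def using bump_profile[OF L_opt(1) zero_less_one] order_trans[OF G_bump_le G_lower] by blast

text \<open>Minimality enters only here, through comparison with the parabolic competitor: the total
  becomes exactly \<open>m_opt\<close>, the value required by the stability estimate.\<close>

lemma F_s_minimizer_profile_energy:
  assumes V: "0 < V" and min: "F_s_minimizer V u h"
  shows "\<exists>g e. profile_energy (rescaled V h) g e (V powr (1 / 5)) m_opt"
proof -
  have h: "profile V h" and u: "u \<in> H1 (region h)" "has_trace (region h) u (\<lambda>x. x)"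
    and en: "elastic_energy u h + surface_energy h = F_s V"
    using min unfolding F_s_minimizer_def admissible_def by auto
  have op: "open (region h)" using h open_region unfolding profile_def by blast
  obtain gu where w: "has_weak_gradient (region h) u gu" using u(1) unfolding sobolev_def weakly_differentiable_def by blast
  obtain e where e: "e \<in> borel_measurable borel"
    "(\<integral>\<^sup>+x. e x \<partial>lborel) = (\<integral>\<^sup>+z\<in>region h. ennreal ((norm (gu z))\<^sup>2) \<partial>lebesgue)"
    "\<forall>a b r. a < b \<longrightarrow> 0 < r \<longrightarrow> {a..b} \<times> {0<..r} \<subseteq> region h \<longrightarrow>
      ennreal (C_W * (b - a)\<^sup>2 * tanh (pi * r / (b - a))) \<le> (\<integral>\<^sup>+x\<in>{a..b}. e x \<partial>lborel)"
    using energy_density[OF op w u(2)] by (elim exE conjE) (rule that)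
  obtain g where g: "g \<in> borel_measurable borel" "\<forall>x y. x \<le> y \<longrightarrow> set_integrable lborel {x..y} g"
    "\<forall>x y. x \<le> y \<longrightarrow> (LINT t:{x..y}|lborel. g t) = h y - h x"
    "surface_energy h = (\<integral>\<^sup>+x. ennreal ((g x)\<^sup>2) \<partial>lborel)" using profile_derivative[OF h] by (elim exE conjE) (rule that)
  have el: "ennreal (C_W * (b - a)\<^sup>2 * tanh (pi * r / (b - a))) \<le> (\<integral>\<^sup>+x\<in>{a..b}. e x \<partial>lborel)"
    if "a < b" "0 < r" "\<And>x. x \<in> {a..b} \<Longrightarrow> r < 1 * h x" for a b r
    by (rule e(3)[rule_format, OF that(1,2)]) (use that(3) in \<open>force simp: region_def\<close>)
  have "(\<integral>\<^sup>+x. e x \<partial>lborel) + surface_energy h \<le> ennreal (V powr (4 / 5) * m_opt)"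
    using F_s_le[OF V] unfolding e(2) en[symmetric] elastic_energy_def by (simp add: dirichlet_eq[OF op w])
  then have "profile_energy (rescaled V h) (\<lambda>x. g ((V powr (1 / 5))\<^sup>2 * x) / V powr (1 / 5))
      (\<lambda>x. ennreal (1 / (V powr (1 / 5))\<^sup>2) * e ((V powr (1 / 5))\<^sup>2 * x)) (1 * V powr (1 / 5)) m_opt"
    by (intro profile_energy_rescaled[OF V h e(1)] el zero_less_one less_imp_le[OF m_opt_pos] g(1) g(2,3)[rule_format] g(4))
  then show ?thesis unfolding mult_1 by blast
qed

subsection \<open>Convergence\<close>

text \<open>What counts is the order of quantifiers: the threshold for the ratio of scales is chosen
  before the profile, hence serves every minimizer of large volume.\<close>

lemma close_to_bump:
  assumes \<Lambda>: "0 < \<Lambda>" "m_opt < C_W * \<Lambda>\<^sup>2 * tanh pi" and q: "0 < q" "q < 1 / 4"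
  defines "r \<equiv> (1 - 2 * q) ^ 20"
  shows "\<exists>\<mu>0. \<forall>H g e \<mu>. \<mu>0 \<le> \<mu> \<longrightarrow> profile_energy H g e \<mu> m_opt \<longrightarrow>
    (\<exists>c l M. 0 < l \<and> l \<le> \<Lambda> \<and> r \<le> M \<and> M \<le> 1 \<and> r * C_W * (l - L_opt)\<^sup>2 \<le> m_opt * (1 - r) \<and>
      (\<forall>t. \<bar>H (c + t) - bump l M t\<bar> \<le> q + (1 - r) + sqrt (1 - r) * (\<Lambda> + 1 + m_opt)))"
proof -
  have "q < 1" using q by simp
  from film_parameters[OF q(1) this \<Lambda>(1)]
  obtain T \<delta> \<mu>0 where p: "0 < T" "0 < \<delta>" "\<delta> \<le> q" "0 < \<mu>0"
    "\<forall>\<mu>\<ge>\<mu>0. 2 * \<Lambda> \<le> \<mu> * \<delta> \<and> 1 - q \<le> tanh (pi * (\<mu> * \<delta> / 2) / \<Lambda>) \<and>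
      (2 / \<mu> + 2 * sqrt T + \<delta> / T) * (m_opt / c0) + sqrt T * m_opt \<le> q" by blast
  show ?thesis
  proof (rule exI[of _ \<mu>0], intro allI impI)
    fix H g e \<mu> assume \<mu>: "\<mu>0 \<le> \<mu>" and pe: "profile_energy H g e \<mu> m_opt"
    interpret profile_energy H g e \<mu> m_opt by (rule pe)
    have b: "2 * \<Lambda> \<le> \<mu> * \<delta>" "1 - q \<le> tanh (pi * (\<mu> * \<delta> / 2) / \<Lambda>)"
      "(LINT x|lborel. min (H x) \<delta>) \<le> q"
      using p(5)[rule_format, OF \<mu>] order_trans[OF film_integral[OF p(1,2)]] by auto
    show "\<exists>c l M. 0 < l \<and> l \<le> \<Lambda> \<and> r \<le> M \<and> M \<le> 1 \<and> r * C_W * (l - L_opt)\<^sup>2 \<le> m_opt * (1 - r) \<and>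
      (\<forall>t. \<bar>H (c + t) - bump l M t\<bar> \<le> q + (1 - r) + sqrt (1 - r) * (\<Lambda> + 1 + m_opt))"
      unfolding r_def by (rule stability[OF order_refl \<Lambda> p(2,3) b(1) q b(2,3)]) blast
  qed
qed

lemma diagonal_subsequence:
  assumes "\<And>k. eventually (P k) sequentially"
  shows "\<exists>\<sigma>::nat \<Rightarrow> nat. strict_mono \<sigma> \<and> (\<forall>k. P k (\<sigma> k))"
proof -
  have "\<exists>n>m. P k n" for k m
    using eventually_conj[OF assms[of k] eventually_gt_at_top[of m]] eventually_happens' sequentially_bot by blast
  then have "\<exists>\<sigma>. \<forall>k. P k (\<sigma> k) \<and> \<sigma> k < \<sigma> (Suc k)"
    by (intro dependent_nat_choice) blast+
  then show ?thesis unfolding strict_mono_Suc_iff by blast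
qed

lemma LIMSEQ_of_square_bound:
  fixes f :: "nat \<Rightarrow> real"
  assumes "\<And>n. (f n - a)\<^sup>2 \<le> b n" "b \<longlonglongrightarrow> 0"
  shows "f \<longlonglongrightarrow> a"
proof -
  have "(\<lambda>n. (f n - a)\<^sup>2) \<longlonglongrightarrow> 0"
    by (rule tendsto_sandwich[OF _ _ tendsto_const assms(2)]) (use assms(1) in auto)
  from tendsto_real_sqrt[OF this] have "(\<lambda>n. \<bar>f n - a\<bar>) \<longlonglongrightarrow> 0" by simp
  from LIM_zero_cancel[OF tendsto_rabs_zero_cancel[OF this]] show ?thesis .
qed

theorem theorem3p35:
  fixes V :: "nat \<Rightarrow> real"
    and u :: "nat \<Rightarrow> real \<times> real \<Rightarrow> real"
    and h :: "nat \<Rightarrow> real \<Rightarrow> real"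
  assumes "\<And>n. 0 < V n"
    and "filterlim V at_top sequentially"
    and "\<And>n. F_s_minimizer (V n) (u n) (h n)"
  shows "\<exists>(\<sigma>::nat \<Rightarrow> nat) (\<tau>::nat \<Rightarrow> real) (h\<^sub>0::real \<Rightarrow> real).
           strict_mono \<sigma> \<and>
           uniform_limit UNIV
             (\<lambda>n x. rescaled (V (\<sigma> n)) (h (\<sigma> n)) (x + \<tau> n)) h\<^sub>0 sequentially \<and>
           G_minimizer h\<^sub>0"
proof -
  obtain \<Lambda> where \<Lambda>: "0 < \<Lambda>" "m_opt < C_W * \<Lambda>\<^sup>2 * tanh pi"
    using thickness_exists[of m_opt] m_opt_pos by force
  \<comment> \<open>Accuracies tending to 0; dividing by 8 keeps them below the 1/4 required by the
    stability estimate.\<close>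
  define q where "q k = inverse (real (Suc k)) / 8" for k
  define r where "r k = (1 - 2 * q k) ^ 20" for k
  have q: "0 < q k" "q k < 1 / 4" for k
  proof -
    have "inverse (real (Suc k)) \<le> 1" by (simp add: inverse_le_1_iff)
    then show "q k < 1 / 4" unfolding q_def by linarith
  qed (simp add: q_def)
  have q0: "q \<longlonglongrightarrow> 0" unfolding q_def using tendsto_divide[OF LIMSEQ_inverse_real_of_nat tendsto_const, of 8] by simp
  have r1: "r \<longlonglongrightarrow> 1"
    using tendsto_power[OF tendsto_diff[OF tendsto_const[of 1] tendsto_mult_right[OF q0, of 2]], of 20] unfolding r_def by (simp add: mult.commute)
  have r: "0 < r k" "r k \<le> 1" for k using q[of k] unfolding r_def by (auto intro!: power_le_one)
  have "\<forall>k. \<exists>\<mu>0. \<forall>H g e \<mu>. \<mu>0 \<le> \<mu> \<longrightarrow> profile_energy H g e \<mu> m_opt \<longrightarrow>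
    (\<exists>c l M. 0 < l \<and> l \<le> \<Lambda> \<and> r k \<le> M \<and> M \<le> 1 \<and> r k * C_W * (l - L_opt)\<^sup>2 \<le> m_opt * (1 - r k) \<and>
      (\<forall>t. \<bar>H (c + t) - bump l M t\<bar> \<le> q k + (1 - r k) + sqrt (1 - r k) * (\<Lambda> + 1 + m_opt)))"
    unfolding r_def using close_to_bump[OF \<Lambda> q] by blast
  from choice[OF this] obtain \<mu>0 where \<mu>0: "\<forall>k H g e \<mu>. \<mu>0 k \<le> \<mu> \<longrightarrow> profile_energy H g e \<mu> m_opt \<longrightarrow>
    (\<exists>c l M. 0 < l \<and> l \<le> \<Lambda> \<and> r k \<le> M \<and> M \<le> 1 \<and> r k * C_W * (l - L_opt)\<^sup>2 \<le> m_opt * (1 - r k) \<and>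
      (\<forall>t. \<bar>H (c + t) - bump l M t\<bar> \<le> q k + (1 - r k) + sqrt (1 - r k) * (\<Lambda> + 1 + m_opt)))" by blast
  have "filterlim (\<lambda>n. V n powr (1 / 5)) at_top sequentially"
    by (rule filterlim_compose[OF _ assms(2)]) real_asymp
  then have "eventually (\<lambda>n. \<mu>0 k \<le> V n powr (1 / 5)) sequentially" for k
    unfolding filterlim_at_top by blast
  \<comment> \<open>The k-th selected volume is large enough for the k-th accuracy.\<close>
  from diagonal_subsequence[where P = "\<lambda>k n. \<mu>0 k \<le> V n powr (1 / 5)", OF this]
  obtain \<sigma> :: "nat \<Rightarrow> nat" where \<sigma>: "strict_mono \<sigma>" "\<And>k. \<mu>0 k \<le> V (\<sigma> k) powr (1 / 5)" by blast
  have "\<forall>k. \<exists>c l M. 0 < l \<and> l \<le> \<Lambda> \<and> r k \<le> M \<and> M \<le> 1 \<and> r k * C_W * (l - L_opt)\<^sup>2 \<le> m_opt * (1 - r k) \<and>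
      (\<forall>t. \<bar>rescaled (V (\<sigma> k)) (h (\<sigma> k)) (c + t) - bump l M t\<bar> \<le> q k + (1 - r k) + sqrt (1 - r k) * (\<Lambda> + 1 + m_opt))"
  proof
    fix k
    obtain g e where "profile_energy (rescaled (V (\<sigma> k)) (h (\<sigma> k))) g e (V (\<sigma> k) powr (1 / 5)) m_opt"
      using F_s_minimizer_profile_energy[OF assms(1) assms(3)] by blast
    from \<mu>0[rule_format, OF \<sigma>(2) this]
    show "\<exists>c l M. 0 < l \<and> l \<le> \<Lambda> \<and> r k \<le> M \<and> M \<le> 1 \<and> r k * C_W * (l - L_opt)\<^sup>2 \<le> m_opt * (1 - r k) \<and>
      (\<forall>t. \<bar>rescaled (V (\<sigma> k)) (h (\<sigma> k)) (c + t) - bump l M t\<bar> \<le> q k + (1 - r k) + sqrt (1 - r k) * (\<Lambda> + 1 + m_opt))" .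
  qed
  then obtain c l M where "\<forall>k. 0 < l k \<and> l k \<le> \<Lambda> \<and> r k \<le> M k \<and> M k \<le> 1 \<and> r k * C_W * (l k - L_opt)\<^sup>2 \<le> m_opt * (1 - r k) \<and>
      (\<forall>t. \<bar>rescaled (V (\<sigma> k)) (h (\<sigma> k)) (c k + t) - bump (l k) (M k) t\<bar> \<le> q k + (1 - r k) + sqrt (1 - r k) * (\<Lambda> + 1 + m_opt))"
    unfolding choice_iff by (elim exE) (rule that)
  then have l: "0 < l k" "l k \<le> \<Lambda>" and M: "r k \<le> M k" "M k \<le> 1"
    and ll: "r k * C_W * (l k - L_opt)\<^sup>2 \<le> m_opt * (1 - r k)"
    and close: "\<bar>rescaled (V (\<sigma> k)) (h (\<sigma> k)) (c k + t) - bump (l k) (M k) t\<bar> \<le> q k + (1 - r k) + sqrt (1 - r k) * (\<Lambda> + 1 + m_opt)" for k t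
    by auto
  have M1: "M \<longlonglongrightarrow> 1" by (rule tendsto_sandwich[OF _ _ r1 tendsto_const]) (use M in auto)
  have lL: "l \<longlonglongrightarrow> L_opt"
  proof (rule LIMSEQ_of_square_bound)
    show "(l k - L_opt)\<^sup>2 \<le> m_opt * (1 - r k) / (r k * C_W)" for k
      using ll[of k] r(1)[of k] C_W_pos by (simp add: pos_le_divide_eq mult.commute)
    have "(\<lambda>k. m_opt * (1 - r k) / (r k * C_W)) \<longlonglongrightarrow> m_opt * (1 - 1) / (1 * C_W)"
      by (intro tendsto_intros r1) (use C_W_pos in simp)
    then show "(\<lambda>k. m_opt * (1 - r k) / (r k * C_W)) \<longlonglongrightarrow> 0" by simp
  qed
  \<comment> \<open>Bounds all the widths \<open>l k\<close> together with \<open>L_opt\<close>, so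
    that one radius serves the comparison of parabolas.\<close>
  define R where "R = max \<Lambda> L_opt"
  define D where "D k = q k + (1 - r k) + sqrt (1 - r k) * (\<Lambda> + 1 + m_opt) +
    (\<bar>3 * M k / (2 * l k) - 3 / (2 * L_opt)\<bar> + 6 * R\<^sup>2 * \<bar>M k / l k ^ 3 - 1 / L_opt ^ 3\<bar>)" for k
  have "D \<longlonglongrightarrow> 0 + (1 - 1) + sqrt (1 - 1) * (\<Lambda> + 1 + m_opt) +
    (\<bar>3 * 1 / (2 * L_opt) - 3 / (2 * L_opt)\<bar> + 6 * R\<^sup>2 * \<bar>1 / L_opt ^ 3 - 1 / L_opt ^ 3\<bar>)"
    unfolding D_def by (intro tendsto_intros q0 r1 M1 lL) (use L_opt(1) in simp_all)
  then have D: "D \<longlonglongrightarrow> 0" by simp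
  have bound: "\<bar>rescaled (V (\<sigma> k)) (h (\<sigma> k)) (x + c k) - bump L_opt 1 x\<bar> \<le> D k" for k x
  proof -
    have "0 \<le> M k" using M[of k] r(1)[of k] by simp
    from bump_diff[OF l(1) _ L_opt(1) _ this, where R = R and t = x] l(2)[of k]
    have "\<bar>bump (l k) (M k) x - bump L_opt 1 x\<bar> \<le> \<bar>3 * M k / (2 * l k) - 3 / (2 * L_opt)\<bar> + 6 * R\<^sup>2 * \<bar>M k / l k ^ 3 - 1 / L_opt ^ 3\<bar>"
      by (simp add: R_def)
    then show ?thesis using close[of k x] unfolding D_def by (simp add: add.commute)
  qed
  have "uniform_limit UNIV (\<lambda>n x. rescaled (V (\<sigma> n)) (h (\<sigma> n)) (x + c n)) (bump L_opt 1) sequentially"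
  proof (rule uniform_limitI)
    fix \<epsilon> :: real assume "0 < \<epsilon>"
    then have "eventually (\<lambda>n. D n < \<epsilon>) sequentially" using D by (rule order_tendstoD(2)[rotated])
    then show "\<forall>\<^sub>F n in sequentially. \<forall>x\<in>UNIV. dist (rescaled (V (\<sigma> n)) (h (\<sigma> n)) (x + c n)) (bump L_opt 1 x) < \<epsilon>"
      by eventually_elim (use bound in \<open>auto simp: dist_real_def intro: le_less_trans\<close>)
  qed
  then show ?thesis using \<sigma>(1) G_minimizer_bump by blast
qed

end
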